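(* Let $f_0$ be a smooth function germ at the origin of $\mathbb{R}^2$ for which the surface $z=f_0(x,y)$ has a generic umbilic point at the origin, normalized as in the context. For every $n\geq 2$ and every $n$-parameter rank $2$ deformation $z=f(x,y;\tau)$, $\tau\in\mathbb{R}^n$, of the surface $z=f_0(x,y)$, the germ at the origin of the discriminant of the vertex sets of the family is diffeomorphic to the germ at the origin of an $(n-2)$-cylinder over the union of three pairwise transverse smooth curves through the origin of the plane $T\approx\mathbb{R}^2=\{\lambda,\mu\}$, tangent there respectively to the lines $\mu=0$, $\mu=\sqrt{3}\,\lambda$ and $\mu=-\sqrt{3}\,\lambda$.
   Context: Surface. $f_0:\mathbb{R}^2\to\mathbb{R}$ is smooth with $f_0(0,0)=0$ and zero linear part at the origin, so the plane $z=0$ is the tangent plane of the surface $z=f_0(x,y)$ at the origin. The origin is a generic umbilic: the quadratic part $q_0$ of $f_0$ at the origin is a nonzero multiple of $x^2+y^2$, and $q_0$ does not divide the cubic part of $f_0$. The coordinates are chosen so that the cubic part is $ax^3+bx^2y+axy^2+cy^3$; genericity then means $b\neq c$. Deformation. An $n$-parameter deformation is $f(x,y;\tau)=f_0(x,y)+R(x,y;\tau)$ with $R:\mathbb{R}^2\times\mathbb{R}^n\to\mathbb{R}$ smooth, $R(\cdot\,;0)\equiv 0$, and, for all $\tau$, $R(0,0;\tau)=0$ and the linear part of $R(\cdot\,;\tau)$ at $(x,y)=(0,0)$ is zero. Rank. Let $Q$ be the $3$-dimensional space of quadratic forms on $\mathbb{R}^2$, with basis $x^2+y^2$, $x^2-y^2$,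 $2xy$, and let $T=q_0+\langle x^2-y^2,\,2xy\rangle_{\mathbb{R}}\subset Q$, an affine plane with coordinates $(\lambda,\mu)$ corresponding to $q_0+\lambda(x^2-y^2)+2\mu xy$. Let $F:\mathbb{R}^n\to T\approx\mathbb{R}^2$ send $\tau$ to the natural projection on $T$ of the quadratic part of $f(\cdot\,;\tau)$ at the origin (projection along the line spanned by $x^2+y^2$, i.e. the coefficients $(\lambda,\mu)$ of $x^2-y^2$ and $2xy$). The rank of the deformation is the rank of the derivative of $F$ at $\tau=0$. Vertices. A vertex of a smooth plane curve is a point where the osculating circle has tangency of order at least $3$ with the curve; equivalently, a critical point of the curvature. It is non-degenerate if the tangency has order exactly $3$ (the critical point of the curvature is of type $A_1$), and degenerate otherwise. Bifurcation diagram and discriminant. The bifurcation diagram of the vertex sets of the family $z=f$ is the germ at the origin of the closure of the set of $(\tau,k)\in\mathbb{R}^n\times\mathbb{R}$ such that the level curve $f(\cdot\,;\tau)=k$ (near the origin of $\mathbb{R}^2$) has at least one degenerate vertex. The discriminant of the vertex sets is the image of the singular locus of the bifurcation diagram under the projection $(\tau,k)\mapsto\tau$. An $(n-2)$-cylinder over a set $S\subset\mathbb{R}^2$ is $S\times\mathbb{R}^{n-2}$. *)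

theory Defs
  imports "HOL-Analysis.Analysis"
begin

section \<open>Smooth maps and submanifolds\<close>

(* Meant for open S: all iterated directional derivatives exist and are continuous on S. *)
primrec Ck_on :: "nat \<Rightarrow> 'a set \<Rightarrow> ('a::real_normed_vector \<Rightarrow> 'b::real_normed_vector) \<Rightarrow> bool" where
  "Ck_on 0 S f \<longleftrightarrow> continuous_on S f"
| "Ck_on (Suc k) S f \<longleftrightarrow> (\<forall>x\<in>S. f differentiable (at x)) \<and>
     (\<forall>v. Ck_on k S (\<lambda>x. frechet_derivative f (at x) v))"

definition smooth_on :: "'a set \<Rightarrow> ('a::real_normed_vector \<Rightarrow> 'b::real_normed_vector) \<Rightarrow> bool" where
  "smooth_on S f \<longleftrightarrow> (\<forall>k. Ck_on k S f)"

definition diffeo ::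
  "'a set \<Rightarrow> 'b set \<Rightarrow> ('a::real_normed_vector \<Rightarrow> 'b::real_normed_vector) \<Rightarrow> ('b \<Rightarrow> 'a) \<Rightarrow> bool" where
  "diffeo N N' \<Phi> \<Psi> \<longleftrightarrow> open N \<and> open N' \<and> homeomorphism N N' \<Phi> \<Psi> \<and>
     smooth_on N \<Phi> \<and> smooth_on N' \<Psi>"

definition smooth_submanifold_at :: "nat \<Rightarrow> 'a::euclidean_space set \<Rightarrow> 'a \<Rightarrow> bool" where
  "smooth_submanifold_at d M p \<longleftrightarrow> p \<in> M \<and>
     (\<exists>N N' \<Phi> \<Psi> (L :: 'a set). p \<in> N \<and> diffeo N N' \<Phi> \<Psi> \<and> subspace L \<and> dim L = d \<and>
        \<Phi> ` (M \<inter> N) = N' \<inter> L)"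

definition tangent_space :: "'a::euclidean_space set \<Rightarrow> 'a \<Rightarrow> 'a set" where
  "tangent_space M p = {v. \<exists>(\<gamma> :: real \<Rightarrow> 'a) e. e > 0 \<and> smooth_on {-e<..<e} \<gamma> \<and>
     \<gamma> ` {-e<..<e} \<subseteq> M \<and> \<gamma> 0 = p \<and> (\<gamma> has_vector_derivative v) (at 0)}"

definition transverse_at :: "'a::euclidean_space set \<Rightarrow> 'a set \<Rightarrow> 'a \<Rightarrow> bool" where
  "transverse_at A B p \<longleftrightarrow> {u + v | u v. u \<in> tangent_space A p \<and> v \<in> tangent_space B p} = UNIV"

definition singular_locus :: "'a::euclidean_space set \<Rightarrow> 'a set" where
  "singular_locus B = {x \<in> B. \<not> smooth_submanifold_at (DIM('a) - 1) B x}"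

section \<open>Germs of sets\<close>

definition germ_eq_at :: "'a::topological_space \<Rightarrow> 'a set \<Rightarrow> 'a set \<Rightarrow> bool" where
  "germ_eq_at p A B \<longleftrightarrow> (\<forall>\<^sub>F x in nhds p. x \<in> A \<longleftrightarrow> x \<in> B)"

definition germ_diffeomorphic_at_0 ::
  "'a::real_normed_vector set \<Rightarrow> 'b::real_normed_vector set \<Rightarrow> bool" where
  "germ_diffeomorphic_at_0 A B \<longleftrightarrow> (\<exists>N N' \<Phi> \<Psi>. 0 \<in> N \<and> diffeo N N' \<Phi> \<Psi> \<and> \<Phi> 0 = 0 \<and>
     \<Phi> ` (A \<inter> N) = B \<inter> N')"

section \<open>Generic umbilics and their deformations\<close>

(* The degree k homogeneous Taylor part at 0, evaluated at v: (D_v)^k f (0) / k!. *)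
definition taylor_part :: "nat \<Rightarrow> ('a::real_normed_vector \<Rightarrow> real) \<Rightarrow> 'a \<Rightarrow> real" where
  "taylor_part k f v = ((\<lambda>g x. frechet_derivative g (at x) v) ^^ k) f 0 / fact k"

definition surface_germ :: "(real \<times> real \<Rightarrow> real) \<Rightarrow> bool" where
  "surface_germ f0 \<longleftrightarrow> (\<exists>U. open U \<and> 0 \<in> U \<and> smooth_on U f0) \<and> f0 0 = 0 \<and>
     (\<forall>v. taylor_part 1 f0 v = 0)"

(* The quotient of a cubic form by a quadratic form, if it is a polynomial, is a linear form. *)
definition quadratic_divides_cubic ::
  "(real \<times> real \<Rightarrow> real) \<Rightarrow> (real \<times> real \<Rightarrow> real) \<Rightarrow> bool" where
  "quadratic_divides_cubic q C \<longleftrightarrow>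
     (\<exists>r s. \<forall>x y. C (x, y) = q (x, y) * (r * x + s * y))"

definition generic_umbilic :: "(real \<times> real \<Rightarrow> real) \<Rightarrow> bool" where
  "generic_umbilic f0 \<longleftrightarrow>
     (\<exists>m. m \<noteq> 0 \<and> (\<forall>x y. taylor_part 2 f0 (x, y) = m * (x^2 + y^2))) \<and>
     \<not> quadratic_divides_cubic (taylor_part 2 f0) (taylor_part 3 f0)"

lemma normalized_umbilic_generic_iff:
  fixes m a b c :: real
  assumes "m \<noteq> 0"
    and q: "\<And>x y. q (x, y) = m * (x^2 + y^2)"
    and C: "\<And>x y. C (x, y) = a * x^3 + b * x^2 * y + a * x * y^2 + c * y^3"
  shows "\<not> quadratic_divides_cubic q C \<longleftrightarrow> b \<noteq> c"
proof -
  have "b = c" if rs: "\<And>x y. C (x, y) = q (x, y) * (r * x + s * y)" for r s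
    using rs[of 0 1] rs[of 1 0] rs[of 1 1] unfolding q C by (simp add: algebra_simps)
  moreover have "C (x, y) = q (x, y) * ((a / m) * x + (b / m) * y)" if "b = c" for x y
    unfolding q C using that \<open>m \<noteq> 0\<close>
    by (simp add: field_simps power2_eq_square power3_eq_cube)
  ultimately show ?thesis
    unfolding quadratic_divides_cubic_def by blast
qed

definition deformation_term ::
  "((real \<times> real) \<times> 'c::euclidean_space \<Rightarrow> real) \<Rightarrow> bool" where
  "deformation_term R \<longleftrightarrow> (\<exists>W. open W \<and> (0, 0) \<in> W \<and> smooth_on W R \<and>
     (\<forall>p. (p, 0) \<in> W \<longrightarrow> R (p, 0) = 0) \<and>
     (\<forall>\<tau>. (0, \<tau>) \<in> W \<longrightarrow> R (0, \<tau>) = 0 \<and> (\<forall>v. taylor_part 1 (\<lambda>p. R (p, \<tau>)) v = 0)))"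

definition deformed ::
  "(real \<times> real \<Rightarrow> real) \<Rightarrow> ((real \<times> real) \<times> 'c \<Rightarrow> real) \<Rightarrow> (real \<times> real) \<times> 'c \<Rightarrow> real" where
  "deformed f0 R = (\<lambda>(p, \<tau>). f0 p + R (p, \<tau>))"

(* Coefficients of x^2 - y^2 and 2xy of a quadratic form, in the basis
   x^2 + y^2, x^2 - y^2, 2xy; see the lemma below. *)
definition T_coords :: "(real \<times> real \<Rightarrow> real) \<Rightarrow> real \<times> real" where
  "T_coords q = ((q (1, 0) - q (0, 1)) / 2, (q (1, 1) - q (1, -1)) / 4)"

lemma T_coords_quadratic_form:
  "T_coords (\<lambda>(x, y). \<kappa> * (x^2 + y^2) + l * (x^2 - y^2) + m * (2 * x * y)) = (l, m)"
  by (simp add: T_coords_def)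

definition T_projection :: "((real \<times> real) \<times> 'c \<Rightarrow> real) \<Rightarrow> 'c \<Rightarrow> real \<times> real" where
  "T_projection f \<tau> = T_coords (taylor_part 2 (\<lambda>p. f (p, \<tau>)))"

definition deformation_rank ::
  "((real \<times> real) \<times> 'c::euclidean_space \<Rightarrow> real) \<Rightarrow> nat" where
  "deformation_rank f = dim (range (frechet_derivative (T_projection f) (at 0)))"

section \<open>Vertices of plane curves\<close>

definition regular_param ::
  "(real \<times> real) set \<Rightarrow> real \<times> real \<Rightarrow> (real \<Rightarrow> real \<times> real) \<Rightarrow> bool" where
  "regular_param M p \<gamma> \<longleftrightarrow> (\<exists>e>0. smooth_on {-e<..<e} \<gamma> \<and> \<gamma> ` {-e<..<e} \<subseteq> M) \<and>
     \<gamma> 0 = p \<and> vector_derivative \<gamma> (at 0) \<noteq> 0"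

(* Circles are given by equations; lines (A = 0) are included, as they are the
   osculating circles at inflections. Degenerate loci (points, the empty set) have
   no tangency of order 2 with a regular curve. *)
definition circle_equation :: "(real \<times> real \<Rightarrow> real) \<Rightarrow> bool" where
  "circle_equation g \<longleftrightarrow> (\<exists>A B c. (A, B) \<noteq> (0, 0) \<and> (\<forall>p. g p = A * (p \<bullet> p) + B \<bullet> p + c))"

(* Tangency of order m is (m+1)-fold contact: g vanishes along the curve to order m + 1. *)
definition tangency_at_least ::
  "nat \<Rightarrow> (real \<times> real) set \<Rightarrow> real \<times> real \<Rightarrow> (real \<times> real \<Rightarrow> real) \<Rightarrow> bool" where
  "tangency_at_least m M p g \<longleftrightarrow>
     (\<exists>\<gamma>. regular_param M p \<gamma> \<and> (\<forall>j\<le>m. (deriv ^^ j) (g \<circ> \<gamma>) 0 = 0))"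

definition osculating_circle ::
  "(real \<times> real) set \<Rightarrow> real \<times> real \<Rightarrow> (real \<times> real \<Rightarrow> real) \<Rightarrow> bool" where
  "osculating_circle M p g \<longleftrightarrow> circle_equation g \<and> tangency_at_least 2 M p g"

definition vertex :: "(real \<times> real) set \<Rightarrow> real \<times> real \<Rightarrow> bool" where
  "vertex M p \<longleftrightarrow> smooth_submanifold_at 1 M p \<and>
     (\<exists>g. osculating_circle M p g \<and> tangency_at_least 3 M p g)"

definition nondegenerate_vertex :: "(real \<times> real) set \<Rightarrow> real \<times> real \<Rightarrow> bool" where
  "nondegenerate_vertex M p \<longleftrightarrow> smooth_submanifold_at 1 M p \<and>
     (\<exists>g. osculating_circle M p g \<and> tangency_at_least 3 M p g \<and> \<not> tangency_at_least 4 M p g)"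

definition degenerate_vertex :: "(real \<times> real) set \<Rightarrow> real \<times> real \<Rightarrow> bool" where
  "degenerate_vertex M p \<longleftrightarrow> vertex M p \<and> \<not> nondegenerate_vertex M p"

section \<open>Bifurcation diagram and discriminant\<close>

definition level_curve ::
  "((real \<times> real) \<times> 'c \<Rightarrow> real) \<Rightarrow> real \<Rightarrow> 'c \<Rightarrow> real \<Rightarrow> (real \<times> real) set" where
  "level_curve f \<delta> \<tau> k = {p \<in> ball 0 \<delta>. f (p, \<tau>) = k}"

definition bifurcation_diagram ::
  "((real \<times> real) \<times> 'c::euclidean_space \<Rightarrow> real) \<Rightarrow> real \<Rightarrow> ('c \<times> real) set" where
  "bifurcation_diagram f \<delta> =
     closure {(\<tau>, k). \<exists>p. degenerate_vertex (level_curve f \<delta> \<tau> k) p}"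

(* D represents the germ at 0 of the projection of the germ at (0,0) of the singular locus:
   f is restricted to a small ball of radius \<delta> in the plane, the singular locus to a small
   ball of radius \<epsilon> in the (\<tau>, k)-space, and the germ must not depend on these choices. *)
definition discriminant_germ ::
  "((real \<times> real) \<times> 'c::euclidean_space \<Rightarrow> real) \<Rightarrow> 'c set \<Rightarrow> bool" where
  "discriminant_germ f D \<longleftrightarrow>
     (\<forall>\<^sub>F \<delta> in at_right 0. \<forall>\<^sub>F \<epsilon> in at_right 0.
        germ_eq_at 0 D (fst ` (singular_locus (bifurcation_diagram f \<delta>) \<inter> ball (0, 0) \<epsilon>)))"

(* The product of S with R^(n-2): S in the i-th and j-th coordinates, the others free. *)
definition cylinder :: "'n \<Rightarrow> 'n \<Rightarrow> (real \<times> real) set \<Rightarrow> (real ^ 'n::finite) set" where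
  "cylinder i j S = {v. (v $ i, v $ j) \<in> S}"

end

theory Submission
  imports Defs
begin

text \<open>
  Only one geometric function has to be understood. Near the origin Hadamard's lemma writes the surface as
  \<open>f = m h\<close> with \<open>h = A x\<^sup>2 + 2 B x y + C y\<^sup>2\<close>, where \<open>A\<close>, \<open>B\<close>, \<open>C\<close> are smooth, and \<open>A = C = 1\<close>, \<open>B = 0\<close> at the
  umbilic. Rank two means that \<open>\<lambda>\<close> and \<open>\<mu>\<close> can be used as two of the parameters
  (\<open>ex_umbilic_family\<close>). The level \<open>h = s\<^sup>2\<close> is then a curve \<open>r = s P\<close> in polar coordinates, with \<open>P\<close> smooth
  in the angle, the parameters and \<open>s\<close>, even at \<open>s = 0\<close> and for negative \<open>s\<close> (\<open>ex_polar_radius\<close>).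

  A circle restricted to the curve, divided by \<open>r\<close>, is a combination of \<open>P\<close>, \<open>u = 1 / P\<close>, \<open>cos\<close> and \<open>sin\<close>. The
  operator \<open>g \<mapsto> g'' + g\<close> removes the last two, so tangency with the osculating circle is governed by
  \<open>Q = (P'' + P) / (u'' + u)\<close>: vertices are the zeros of \<open>Q'\<close>, degenerate vertices its double zeros
  (\<open>degenerate_vertex_iff\<close>). To first order at the umbilic \<open>V = (m / 6) Q'\<close> is
  \<open>- s (c - b) cos 3t - \<lambda> sin 2t + \<mu> cos 2t\<close> (\<open>V_principal_part\<close>), and genericity is exactly \<open>c \<noteq> b\<close>.
  What follows uses only this principal part and the symmetry \<open>(s, t) \<mapsto> (- s, t + \<pi>)\<close>, collected in the locale
  \<open>vertex_family\<close>.

  Double zeros of the principal part lie over a cone on a hypocycloid with six cusps: \<open>(\<lambda>, \<mu>)\<close> is \<open>s\<close> times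
  the point with angle parameter \<open>t\<close>. The hypocycloid has no self-intersections, so each point of the
  bifurcation diagram with \<open>s > 0\<close> carries exactly one double zero. The diagram is a smooth hypersurface
  where this zero is not triple (\<open>smooth_at_double_zero\<close>) and is not one where it is triple
  (\<open>not_smooth_at_triple_zero\<close>). Hence the singular locus consists of the edges of cusps, together with some of
  the boundary points with \<open>s = 0\<close>, and these all lie over \<open>\<lambda> = \<mu> = 0\<close>. Blowing up the cone, the implicit
  function theorem gives for every cusp a smooth sheet \<open>(\<lambda>, \<mu>) = s (P\<^sub>1, P\<^sub>2)\<close> of triple zeros. Opposite
  cusps are exchanged by the symmetry, so the six cusps with \<open>s > 0\<close> are three sheets with \<open>s\<close> of either sign
  (\<open>Z3_param\<close>). Forgetting \<open>s\<close>, the sheets become three smooth hypersurfaces through \<open>\<lambda> = \<mu> = 0\<close>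
  with pairwise different tangent hyperplanes.

  Finally a diffeomorphism of the parameter space carries three such hypersurfaces to three hyperplanes
  through a common subspace of codimension two (\<open>ex_straightening\<close>). The curves of the theorem can therefore be
  chosen to be the three lines themselves. A point with \<open>\<lambda> = \<mu> = 0\<close> belongs to the discriminant because
  \<open>(\<tau>, 0)\<close> is a limit of cusp points and smoothness is an open condition (\<open>ex_discriminant\<close>).
\<close>

section \<open>Directional derivatives and smooth maps\<close>

definition dird :: "'a::real_normed_vector \<Rightarrow> ('a \<Rightarrow> 'b::real_normed_vector) \<Rightarrow> 'a \<Rightarrow> 'b" where
  "dird v f = (\<lambda>x. frechet_derivative f (at x) v)"

lemma Ck_on_Suc_dird:
  "Ck_on (Suc k) S f \<longleftrightarrow> (\<forall>x\<in>S. f differentiable (at x)) \<and> (\<forall>v. Ck_on k S (dird v f))"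
  by (simp add: dird_def)

lemma dirdI: "(f has_derivative f') (at x) \<Longrightarrow> dird v f x = f' v"
  unfolding dird_def by (metis frechet_derivative_at)

lemma dird_has_derivative:
  "f differentiable (at x) \<Longrightarrow> (f has_derivative (\<lambda>v. dird v f x)) (at x)"
  unfolding dird_def by (metis eta_contract_eq frechet_derivative_works)

lemma dird_cong:
  assumes "open S" "x \<in> S" "\<And>x. x \<in> S \<Longrightarrow> f x = g x"
  shows "dird v f x = dird v g x"
proof (cases "f differentiable (at x)")
  case True
  then show ?thesis
    unfolding dird_def using frechet_derivative_transform_within_open assms by metis
next
  case False
  have "(f has_derivative d) (at x) \<longleftrightarrow> (g has_derivative d) (at x)" for d
    using has_derivative_transform_within_open[OF _ assms(1,2), of f d UNIV g]
      has_derivative_transform_within_open[OF _ assms(1,2), of g d UNIV f] assms(3)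
    by auto
  then show ?thesis unfolding dird_def frechet_derivative_def by simp
qed

lemma differentiable_at_cong:
  assumes "open S" "x \<in> S" "\<And>x. x \<in> S \<Longrightarrow> f x = g x" "f differentiable (at x)"
  shows "g differentiable (at x)"
  using has_derivative_transform_within_open[OF _ assms(1,2)] assms(3,4)
  unfolding differentiable_def by blast

lemma Ck_on_Suc_has_derivative:
  "Ck_on (Suc k) S f \<Longrightarrow> x \<in> S \<Longrightarrow> (f has_derivative (\<lambda>v. dird v f x)) (at x)"
  unfolding Ck_on_Suc_dird by (intro dird_has_derivative) blast

lemma Ck_on_cong:
  assumes "open S" "\<And>x. x \<in> S \<Longrightarrow> f x = g x"
  shows "Ck_on k S f \<longleftrightarrow> Ck_on k S g"
  using assms(2)
proof (induction k arbitrary: f g)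
  case 0
  then show ?case by (auto intro: continuous_on_eq)
next
  case (Suc k)
  have "Ck_on k S (dird v f) \<longleftrightarrow> Ck_on k S (dird v g)" for v
    by (rule Suc.IH) (rule dird_cong[OF assms(1)], auto intro: Suc.prems)
  moreover have "(\<forall>x\<in>S. f differentiable (at x)) \<longleftrightarrow> (\<forall>x\<in>S. g differentiable (at x))"
    using differentiable_at_cong[OF assms(1), of _ f g] differentiable_at_cong[OF assms(1), of _ g f]
      Suc.prems by metis
  ultimately show ?case unfolding Ck_on_Suc_dird by simp
qed

lemma Ck_on_subset: "Ck_on k S f \<Longrightarrow> T \<subseteq> S \<Longrightarrow> Ck_on k T f"
  by (induction k arbitrary: f) (auto intro: continuous_on_subset)

lemma Ck_on_SucD: "Ck_on (Suc k) S f \<Longrightarrow> Ck_on k S f"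
proof (induction k arbitrary: f)
  case 0
  then show ?case
    by (auto intro!: continuous_at_imp_continuous_on differentiable_imp_continuous_within)
next
  case (Suc k)
  then show ?case by (simp only: Ck_on_Suc_dird) blast
qed

lemma Ck_on_local:
  assumes "\<And>x. x \<in> S \<Longrightarrow> \<exists>U. open U \<and> x \<in> U \<and> Ck_on k U f"
  shows "Ck_on k S f"
  using assms
proof (induction k arbitrary: f)
  case 0
  show ?case
    unfolding Ck_on.simps
  proof (rule continuous_at_imp_continuous_on, safe)
    fix x assume "x \<in> S"
    with 0 obtain U where "open U" "x \<in> U" "continuous_on U f" by auto
    then show "isCont f x" by (simp add: continuous_on_eq_continuous_at)
  qed
next
  case (Suc k)
  have "f differentiable (at x)" if "x \<in> S" for x
    using Suc.prems[OF that] unfolding Ck_on_Suc_dird by blast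
  moreover have "Ck_on k S (dird v f)" for v
    by (rule Suc.IH, drule Suc.prems) (auto simp only: Ck_on_Suc_dird)
  ultimately show ?case unfolding Ck_on_Suc_dird by blast
qed

subsection \<open>Closure properties\<close>

lemma Ck_on_const: "Ck_on k S (\<lambda>x. c)"
  by (induction k arbitrary: c) auto

lemma Ck_on_bounded_linear_comp:
  assumes "open S" "bounded_linear L" "Ck_on k S f"
  shows "Ck_on k S (\<lambda>x. L (f x))"
  using assms(3)
proof (induction k arbitrary: f)
  case 0
  then show ?case using assms(2)
    by (auto intro: bounded_linear.continuous_on)
next
  case (Suc k)
  have der: "((\<lambda>x. L (f x)) has_derivative (\<lambda>v. L (dird v f x))) (at x)" if "x \<in> S" for x
    by (rule bounded_linear.has_derivative[OF assms(2) Ck_on_Suc_has_derivative[OF Suc.prems that]])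
  have "Ck_on k S (dird v (\<lambda>x. L (f x)))" for v
  proof -
    have "Ck_on k S (\<lambda>x. L (dird v f x))"
      using Suc unfolding Ck_on_Suc_dird by blast
    then show ?thesis
      using Ck_on_cong[OF assms(1), of "dird v (\<lambda>x. L (f x))" "\<lambda>x. L (dird v f x)" k] dirdI[OF der]
      by simp
  qed
  then show ?case unfolding Ck_on_Suc_dird using der differentiable_def by blast
qed

lemma Ck_on_bounded_linear:
  assumes "bounded_linear L"
  shows "Ck_on k S L"
proof -
  have "Ck_on k UNIV L"
  proof (cases k)
    case 0
    then show ?thesis using assms by (simp add: linear_continuous_on)
  next
    case (Suc j)
    have "dird v L = (\<lambda>x. L v)" for v
      by (rule ext, rule dirdI, rule bounded_linear_imp_has_derivative[OF assms])
    then show ?thesis unfolding Suc Ck_on_Suc_dird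
      using Ck_on_const bounded_linear_imp_differentiable[OF assms] by auto
  qed
  then show ?thesis using Ck_on_subset by blast
qed

lemma Ck_on_add:
  assumes "open S" "Ck_on k S f" "Ck_on k S g"
  shows "Ck_on k S (\<lambda>x. f x + g x)"
  using assms(2,3)
proof (induction k arbitrary: f g)
  case 0
  then show ?case by (auto intro: continuous_intros)
next
  case (Suc k)
  have der: "((\<lambda>x. f x + g x) has_derivative (\<lambda>v. dird v f x + dird v g x)) (at x)" if "x \<in> S" for x
    by (intro has_derivative_add Ck_on_Suc_has_derivative[OF Suc.prems(1) that]
        Ck_on_Suc_has_derivative[OF Suc.prems(2) that])
  have "Ck_on k S (dird v (\<lambda>x. f x + g x))" for v
  proof -
    have "Ck_on k S (\<lambda>x. dird v f x + dird v g x)"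
      using Suc unfolding Ck_on_Suc_dird by blast
    then show ?thesis
      using Ck_on_cong[OF assms(1), of "dird v (\<lambda>x. f x + g x)" "\<lambda>x. dird v f x + dird v g x" k] dirdI[OF der]
      by simp
  qed
  then show ?case unfolding Ck_on_Suc_dird using der differentiable_def by blast
qed

lemma Ck_on_sum:
  assumes "open S" "\<And>i. i \<in> I \<Longrightarrow> Ck_on k S (f i)"
  shows "Ck_on k S (\<lambda>x. \<Sum>i\<in>I. f i x)"
  using assms(2)
  by (induction I rule: infinite_finite_induct) (auto intro!: Ck_on_add Ck_on_const assms(1))

lemma Ck_on_bilinear:
  assumes "open S" "bounded_bilinear B" "Ck_on k S f" "Ck_on k S g"
  shows "Ck_on k S (\<lambda>x. B (f x) (g x))"
  using assms(3,4)
proof (induction k arbitrary: f g)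
  case 0
  then show ?case using bounded_bilinear.continuous_on[OF assms(2)] by auto
next
  case (Suc k)
  let ?h = "\<lambda>x. B (f x) (g x)"
  have der: "(?h has_derivative (\<lambda>v. B (f x) (dird v g x) + B (dird v f x) (g x))) (at x)" if "x \<in> S" for x
    by (rule bounded_bilinear.FDERIV[OF assms(2) Ck_on_Suc_has_derivative[OF Suc.prems(1) that]
        Ck_on_Suc_has_derivative[OF Suc.prems(2) that]])
  have "Ck_on k S (dird v ?h)" for v
  proof -
    have "Ck_on k S (\<lambda>x. B (f x) (dird v g x) + B (dird v f x) (g x))"
      using Suc.prems Ck_on_SucD[OF Suc.prems(1)] Ck_on_SucD[OF Suc.prems(2)]
      unfolding Ck_on_Suc_dird by (intro Ck_on_add assms(1) Suc.IH) blast+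
    then show ?thesis
      using Ck_on_cong[OF assms(1), of "dird v ?h" "\<lambda>x. B (f x) (dird v g x) + B (dird v f x) (g x)" k]
        dirdI[OF der] by simp
  qed
  then show ?case unfolding Ck_on_Suc_dird using der differentiable_def by blast
qed

lemma linear_euclidean_representation:
  fixes w :: "'b::euclidean_space"
  assumes "linear L"
  shows "L w = (\<Sum>b\<in>Basis. (w \<bullet> b) *\<^sub>R L b)"
proof -
  have "L w = L (\<Sum>b\<in>Basis. (w \<bullet> b) *\<^sub>R b)" by (simp add: euclidean_representation)
  then show ?thesis by (simp add: linear_sum[OF assms] linear_scale[OF assms])
qed

lemma dird_linear: "f differentiable (at x) \<Longrightarrow> linear (\<lambda>v. dird v f x)"
  unfolding dird_def by (metis eta_contract_eq linear_frechet_derivative)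

text \<open>The chain rule is used with the outer derivative expanded in the standard basis, since only
  derivatives in constant directions fall under the induction hypothesis.\<close>

lemma Ck_on_compose:
  fixes g :: "'a::real_normed_vector \<Rightarrow> 'b::euclidean_space" and f :: "'b \<Rightarrow> 'c::real_normed_vector"
  assumes "open S" "open T" "Ck_on k S g" "Ck_on k T f" "g ` S \<subseteq> T"
  shows "Ck_on k S (\<lambda>x. f (g x))"
  using assms(3-5)
proof (induction k arbitrary: f g)
  case 0
  then show ?case by (auto intro: continuous_on_compose2)
next
  case (Suc k)
  let ?h = "\<lambda>x. f (g x)"
  have "((f \<circ> g) has_derivative (\<lambda>w. dird w f (g x)) \<circ> (\<lambda>v. dird v g x)) (at x)" if "x \<in> S" for x
    using Suc.prems(3) that
    by (intro diff_chain_at Ck_on_Suc_has_derivative[OF Suc.prems(1)]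
        Ck_on_Suc_has_derivative[OF Suc.prems(2)]) auto
  then have der: "(?h has_derivative (\<lambda>v. dird (dird v g x) f (g x))) (at x)" if "x \<in> S" for x
    using that by (simp add: o_def)
  have "Ck_on k S (dird v ?h)" for v
  proof -
    let ?d = "\<lambda>x. \<Sum>b\<in>Basis. (dird v g x \<bullet> b) *\<^sub>R dird b f (g x)"
    have "Ck_on k S ?d"
    proof (intro Ck_on_sum Ck_on_bilinear[OF _ bounded_bilinear_scaleR] assms(1))
      fix b :: 'b
      show "Ck_on k S (\<lambda>x. dird v g x \<bullet> b)"
        using Suc.prems unfolding Ck_on_Suc_dird
        by (intro Ck_on_bounded_linear_comp[OF assms(1) bounded_linear_inner_left]) blast
      show "Ck_on k S (\<lambda>x. dird b f (g x))"
        using Suc.prems Ck_on_SucD[OF Suc.prems(1)] unfolding Ck_on_Suc_dird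
        by (intro Suc.IH) auto
    qed
    moreover have "dird v ?h x = ?d x" if "x \<in> S" for x
    proof -
      have "f differentiable (at (g x))" using Suc.prems that unfolding Ck_on_Suc_dird by auto
      then show ?thesis
        unfolding dirdI[OF der[OF that]] by (rule linear_euclidean_representation[OF dird_linear])
    qed
    ultimately show ?thesis using Ck_on_cong[OF assms(1), of "dird v ?h" ?d k] by simp
  qed
  then show ?case unfolding Ck_on_Suc_dird using der differentiable_def by blast
qed

subsection \<open>Smooth functions\<close>

lemma smooth_onI: "(\<And>k. Ck_on k S f) \<Longrightarrow> smooth_on S f"
  and smooth_onD: "smooth_on S f \<Longrightarrow> Ck_on k S f"
  by (auto simp: smooth_on_def)

lemma smooth_on_differentiable: "smooth_on S f \<Longrightarrow> x \<in> S \<Longrightarrow> f differentiable (at x)"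
  using smooth_onD[of S f "Suc 0"] unfolding Ck_on_Suc_dird by blast

lemma smooth_on_has_derivative:
  "smooth_on S f \<Longrightarrow> x \<in> S \<Longrightarrow> (f has_derivative (\<lambda>v. dird v f x)) (at x)"
  by (rule dird_has_derivative) (rule smooth_on_differentiable)

lemma smooth_on_dird: "smooth_on S f \<Longrightarrow> smooth_on S (dird v f)"
  by (rule smooth_onI) (metis Ck_on_Suc_dird smooth_onD)

lemma smooth_on_continuous: "smooth_on S f \<Longrightarrow> continuous_on S f"
  using smooth_onD[of S f 0] by simp

lemma smooth_on_isCont: "smooth_on S f \<Longrightarrow> open S \<Longrightarrow> x \<in> S \<Longrightarrow> isCont f x"
  using smooth_on_continuous continuous_on_eq_continuous_at by blast

lemma smooth_on_subset: "smooth_on S f \<Longrightarrow> T \<subseteq> S \<Longrightarrow> smooth_on T f"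
  by (meson Ck_on_subset smooth_on_def)

lemma smooth_on_cong:
  "open S \<Longrightarrow> (\<And>x. x \<in> S \<Longrightarrow> f x = g x) \<Longrightarrow> smooth_on S f \<Longrightarrow> smooth_on S g"
  unfolding smooth_on_def using Ck_on_cong by metis

lemma smooth_on_local:
  "(\<And>x. x \<in> S \<Longrightarrow> \<exists>U. open U \<and> x \<in> U \<and> smooth_on U f) \<Longrightarrow> smooth_on S f"
  unfolding smooth_on_def by (metis Ck_on_local)

lemma smooth_on_linear_comp:
  "open S \<Longrightarrow> bounded_linear L \<Longrightarrow> smooth_on S f \<Longrightarrow> smooth_on S (\<lambda>x. L (f x))"
  by (simp add: smooth_on_def Ck_on_bounded_linear_comp)

lemma smooth_on_bounded_linear: "bounded_linear L \<Longrightarrow> smooth_on S L"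
  by (simp add: smooth_on_def Ck_on_bounded_linear)

lemma smooth_on_bilinear:
  "bounded_bilinear B \<Longrightarrow> open S \<Longrightarrow> smooth_on S f \<Longrightarrow> smooth_on S g \<Longrightarrow> smooth_on S (\<lambda>x. B (f x) (g x))"
  by (simp add: smooth_on_def Ck_on_bilinear)

named_theorems smooth_intros

lemma smooth_on_const [smooth_intros]: "smooth_on S (\<lambda>x. c)"
  by (simp add: smooth_on_def Ck_on_const)

lemma smooth_on_id [smooth_intros]: "smooth_on S (\<lambda>x. x)"
  using smooth_on_bounded_linear[OF bounded_linear_ident] .

lemma smooth_on_add [smooth_intros]:
  "open S \<Longrightarrow> smooth_on S f \<Longrightarrow> smooth_on S g \<Longrightarrow> smooth_on S (\<lambda>x. f x + g x)"
  by (simp add: smooth_on_def Ck_on_add)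

lemma smooth_on_minus [smooth_intros]:
  "open S \<Longrightarrow> smooth_on S f \<Longrightarrow> smooth_on S (\<lambda>x. - f x)"
  by (rule smooth_on_linear_comp[of S uminus f]) (auto intro: bounded_linear_minus bounded_linear_ident)

lemma smooth_on_diff [smooth_intros]:
  "open S \<Longrightarrow> smooth_on S f \<Longrightarrow> smooth_on S g \<Longrightarrow> smooth_on S (\<lambda>x. f x - g x)"
  using smooth_on_add[of S f "\<lambda>x. - g x"] smooth_on_minus[of S g] by simp

lemma smooth_on_mult [smooth_intros]:
  fixes f g :: "'a::real_normed_vector \<Rightarrow> real"
  shows "open S \<Longrightarrow> smooth_on S f \<Longrightarrow> smooth_on S g \<Longrightarrow> smooth_on S (\<lambda>x. f x * g x)"
  by (rule smooth_on_bilinear[OF bounded_bilinear_mult])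

lemma smooth_on_scaleR [smooth_intros]:
  "open S \<Longrightarrow> smooth_on S f \<Longrightarrow> smooth_on S g \<Longrightarrow> smooth_on S (\<lambda>x. f x *\<^sub>R g x)"
  by (rule smooth_on_bilinear[OF bounded_bilinear_scaleR])

lemma smooth_on_inner [smooth_intros]:
  "open S \<Longrightarrow> smooth_on S f \<Longrightarrow> smooth_on S g \<Longrightarrow> smooth_on S (\<lambda>x. f x \<bullet> g x)"
  by (rule smooth_on_bilinear[OF bounded_bilinear_inner])

lemma smooth_on_power [smooth_intros]:
  fixes f :: "'a::real_normed_vector \<Rightarrow> real"
  shows "open S \<Longrightarrow> smooth_on S f \<Longrightarrow> smooth_on S (\<lambda>x. f x ^ n)"
  by (induction n) (auto intro: smooth_intros)

lemma smooth_on_fst [smooth_intros]: "open S \<Longrightarrow> smooth_on S f \<Longrightarrow> smooth_on S (\<lambda>x. fst (f x))"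
  and smooth_on_snd [smooth_intros]: "open S \<Longrightarrow> smooth_on S f \<Longrightarrow> smooth_on S (\<lambda>x. snd (f x))"
  by (auto intro: smooth_on_linear_comp bounded_linear_fst bounded_linear_snd)

lemma smooth_on_Pair [smooth_intros]:
  assumes "open S" "smooth_on S f" "smooth_on S g"
  shows "smooth_on S (\<lambda>x. (f x, g x))"
proof -
  have "bounded_linear (\<lambda>a. (a, 0))" "bounded_linear (\<lambda>b. (0, b))"
    by (auto intro: bounded_linear_Pair bounded_linear_ident bounded_linear_zero)
  then have "smooth_on S (\<lambda>x. (f x, 0) + (0, g x))"
    using assms smooth_on_linear_comp[of S "\<lambda>a. (a, 0)" f] smooth_on_linear_comp[of S "\<lambda>b. (0, b)" g]
    by (intro smooth_on_add) auto
  then show ?thesis by simp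
qed

lemma smooth_on_vec_nth [smooth_intros]: "open S \<Longrightarrow> smooth_on S f \<Longrightarrow> smooth_on S (\<lambda>x. f x $ i)"
  by (auto intro: smooth_on_linear_comp bounded_linear_vec_nth)

lemma smooth_on_compose:
  fixes g :: "'a::real_normed_vector \<Rightarrow> 'b::euclidean_space" and f :: "'b \<Rightarrow> 'c::real_normed_vector"
  assumes "smooth_on T f" "open S" "open T" "smooth_on S g" "\<And>x. x \<in> S \<Longrightarrow> g x \<in> T"
  shows "smooth_on S (\<lambda>x. f (g x))"
  using assms by (simp add: smooth_on_def Ck_on_compose image_subset_iff)

lemma dird_compose:
  fixes g :: "'a::real_normed_vector \<Rightarrow> 'b::real_normed_vector" and f :: "'b \<Rightarrow> 'c::real_normed_vector"
  assumes "g differentiable (at x)" "f differentiable (at (g x))"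
  shows "dird v (\<lambda>x. f (g x)) x = dird (dird v g x) f (g x)"
  using dirdI[OF diff_chain_at[OF dird_has_derivative[OF assms(1)] dird_has_derivative[OF assms(2)]], of v]
  by (simp add: o_def)

lemma Ck_on_sin_cos: "Ck_on k UNIV (sin :: real \<Rightarrow> real) \<and> Ck_on k UNIV (cos :: real \<Rightarrow> real)"
proof (induction k)
  case 0
  then show ?case by (auto intro: continuous_intros)
next
  case (Suc k)
  have s: "(sin has_derivative (\<lambda>v. v * cos x)) (at x)" and c: "(cos has_derivative (\<lambda>v. v * - sin x)) (at x)"
    for x :: real by (auto intro!: derivative_eq_intros)
  have "Ck_on k UNIV (\<lambda>x::real. v * cos x)" "Ck_on k UNIV (\<lambda>x::real. v * - sin x)" for v :: real
    using Suc by (auto intro!: Ck_on_bilinear[OF _ bounded_bilinear_mult] Ck_on_const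
        Ck_on_bounded_linear_comp[OF _ bounded_linear_minus[OF bounded_linear_ident]]
        simp del: mult_minus_right)
  moreover have "dird v (sin::real\<Rightarrow>real) = (\<lambda>x. v * cos x)" "dird v (cos::real\<Rightarrow>real) = (\<lambda>x. v * - sin x)" for v
    using dirdI[OF s] dirdI[OF c] by blast+
  ultimately have "Ck_on k UNIV (dird v (sin::real\<Rightarrow>real))" "Ck_on k UNIV (dird v (cos::real\<Rightarrow>real))" for v
    by simp_all
  then show ?case unfolding Ck_on_Suc_dird using s c differentiable_def by blast
qed

lemma smooth_on_sin [smooth_intros]:
  fixes f :: "'a::real_normed_vector \<Rightarrow> real"
  shows "open S \<Longrightarrow> smooth_on S f \<Longrightarrow> smooth_on S (\<lambda>x. sin (f x))"
  by (rule smooth_on_compose[of UNIV sin]) (auto simp: smooth_on_def Ck_on_sin_cos)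

lemma smooth_on_cos [smooth_intros]:
  fixes f :: "'a::real_normed_vector \<Rightarrow> real"
  shows "open S \<Longrightarrow> smooth_on S f \<Longrightarrow> smooth_on S (\<lambda>x. cos (f x))"
  by (rule smooth_on_compose[of UNIV cos]) (auto simp: smooth_on_def Ck_on_sin_cos)

lemma Ck_on_inverse: "Ck_on k (- {0}) (inverse :: real \<Rightarrow> real)"
proof (induction k)
  case 0
  then show ?case by (auto intro!: continuous_intros)
next
  case (Suc k)
  have d: "(inverse has_derivative (\<lambda>v. (- v) * (inverse x * inverse x))) (at x)" if "x \<noteq> 0" for x :: real
    using that by (auto intro!: derivative_eq_intros simp: field_simps)
  have "Ck_on k (- {0}) (\<lambda>x::real. (- v) * (inverse x * inverse x))" for v :: real
    using Suc by (intro Ck_on_bilinear[OF _ bounded_bilinear_mult] Ck_on_const) auto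
  moreover have "Ck_on k (- {0}) (dird v (inverse::real\<Rightarrow>real)) \<longleftrightarrow>
      Ck_on k (- {0}) (\<lambda>x::real. (- v) * (inverse x * inverse x))" for v
    by (rule Ck_on_cong) (use dirdI[OF d] in auto)
  ultimately have "Ck_on k (- {0}) (dird v (inverse::real\<Rightarrow>real))" for v by blast
  then show ?case unfolding Ck_on_Suc_dird using d differentiable_def by blast
qed

lemma smooth_on_inverse [smooth_intros]:
  fixes f :: "'a::real_normed_vector \<Rightarrow> real"
  shows "open S \<Longrightarrow> smooth_on S f \<Longrightarrow> (\<And>x. x \<in> S \<Longrightarrow> f x \<noteq> 0) \<Longrightarrow> smooth_on S (\<lambda>x. inverse (f x))"
  by (rule smooth_on_compose[of "-{0}" inverse]) (auto simp: smooth_on_def Ck_on_inverse)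

lemma smooth_on_divide [smooth_intros]:
  fixes f g :: "'a::real_normed_vector \<Rightarrow> real"
  shows "open S \<Longrightarrow> smooth_on S f \<Longrightarrow> smooth_on S g \<Longrightarrow> (\<And>x. x \<in> S \<Longrightarrow> g x \<noteq> 0) \<Longrightarrow>
    smooth_on S (\<lambda>x. f x / g x)"
  unfolding divide_inverse by (intro smooth_intros) auto

section \<open>The inverse function theorem in the smooth category\<close>

definition fder :: "('a::real_normed_vector \<Rightarrow> 'b::real_normed_vector) \<Rightarrow> 'a \<Rightarrow> 'a \<Rightarrow>\<^sub>L 'b" where
  "fder f x = Blinfun (\<lambda>v. dird v f x)"

lemma blinfun_apply_fder: "f differentiable (at x) \<Longrightarrow> blinfun_apply (fder f x) = (\<lambda>v. dird v f x)"
  unfolding fder_def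
  by (rule bounded_linear_Blinfun_apply) (metis dird_has_derivative has_derivative_bounded_linear)

lemma continuous_on_fder:
  fixes f :: "'a::euclidean_space \<Rightarrow> 'b::real_normed_vector"
  assumes "smooth_on S f"
  shows "continuous_on S (fder f)"
proof (rule continuous_on_blinfun_componentwise)
  fix i :: 'a
  show "continuous_on S (\<lambda>x. blinfun_apply (fder f x) i)"
    using continuous_on_eq[OF smooth_on_continuous[OF smooth_on_dird[OF assms, of i]]]
      blinfun_apply_fder[OF smooth_on_differentiable[OF assms]] by simp
qed

lemma has_derivative_scaleR_vanishing:
  fixes c :: "'a::real_normed_vector \<Rightarrow> real" and g :: "'a \<Rightarrow> 'b::real_normed_vector"
  assumes c: "(c has_derivative c') (at x)" "c x = 0" and g: "isCont g x"
  shows "((\<lambda>y. c y *\<^sub>R g y) has_derivative (\<lambda>h. c' h *\<^sub>R g x)) (at x)"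
proof -
  interpret c': bounded_linear c' using has_derivative_bounded_linear[OF c(1)] .
  obtain K where K: "norm (c' h) \<le> norm h * K" for h using c'.bounded by blast
  let ?r = "\<lambda>y. norm (c y - c x - c' (y - x)) / norm (y - x)"
  have r: "(?r \<longlongrightarrow> 0) (at x)" using c(1) unfolding has_derivative_iff_norm by simp
  have "((\<lambda>y. c y *\<^sub>R (g y - g x)) has_derivative (\<lambda>h. 0)) (at x)"
    unfolding has_derivative_iff_norm
  proof safe
    have "((\<lambda>y. (K + ?r y) * norm (g y - g x)) \<longlongrightarrow> (K + 0) * norm (g x - g x)) (at x)"
      using g r by (intro tendsto_intros) (auto simp: isCont_def)
    then have lim: "((\<lambda>y. (K + ?r y) * norm (g y - g x)) \<longlongrightarrow> 0) (at x)" by simp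
    have bound: "norm (norm (c y *\<^sub>R (g y - g x) - c x *\<^sub>R (g x - g x) - 0) / norm (y - x))
        \<le> (K + ?r y) * norm (g y - g x)" if "y \<noteq> x" for y
    proof -
      have "norm (c y) \<le> norm (c y - c x - c' (y - x)) + norm (y - x) * K"
        using K[of "y - x"] norm_triangle_ineq[of "c y - c' (y - x)" "c' (y - x)"] c(2) by simp
      then have "norm (c y) / norm (y - x) \<le> K + ?r y"
        using that by (simp add: field_simps)
      then have "norm (c y) / norm (y - x) * norm (g y - g x) \<le> (K + ?r y) * norm (g y - g x)"
        by (rule mult_right_mono) simp
      then show ?thesis using c(2) by (simp add: mult_ac)
    qed
    show "((\<lambda>y. norm (c y *\<^sub>R (g y - g x) - c x *\<^sub>R (g x - g x) - 0) / norm (y - x)) \<longlongrightarrow> 0) (at x)"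
      by (rule Lim_null_comparison[OF _ lim]) (simp only: eventually_at_filter, rule always_eventually, use bound in blast)
  qed (rule bounded_linear_zero)
  moreover have "((\<lambda>y. c y *\<^sub>R g x) has_derivative (\<lambda>h. c' h *\<^sub>R g x)) (at x)"
    using c(1) by (auto intro!: derivative_eq_intros)
  ultimately have "((\<lambda>y. c y *\<^sub>R (g y - g x) + c y *\<^sub>R g x) has_derivative (\<lambda>h. 0 + c' h *\<^sub>R g x)) (at x)"
    by (rule has_derivative_add)
  then show ?thesis by (simp add: algebra_simps)
qed

lemma inverse_family_isCont:
  fixes A :: "'x::real_normed_vector \<Rightarrow> 'a::euclidean_space \<Rightarrow> 'a"
  assumes "open S" "x0 \<in> S" and lin: "\<And>x. x \<in> S \<Longrightarrow> linear (A x)" and bij: "\<And>x. x \<in> S \<Longrightarrow> bij (A x)"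
    and cont: "\<And>u. continuous_on S (\<lambda>x. A x u)"
  shows "isCont (\<lambda>x. inv (A x) v) x0"
proof -
  have isC: "isCont (\<lambda>x. A x u) x0" for u
    using cont[of u] assms(1,2) by (simp add: continuous_on_eq_continuous_at)
  let ?W = "inv (A x0)"
  have "linear ?W"
    using inj_linear_imp_inv_linear lin[OF assms(2)] bij[OF assms(2)] bij_is_inj by blast
  then obtain K where K: "K > 0" "\<And>z. norm (?W z) \<le> K * norm z"
    using linear_bounded_pos by blast
  let ?\<eta> = "\<lambda>x. \<Sum>b\<in>Basis. norm (A x b - A x0 b)"
  have \<eta>: "norm (A x u - A x0 u) \<le> ?\<eta> x * norm u" if "x \<in> S" for x u
  proof -
    have "A x u - A x0 u = (\<Sum>b\<in>Basis. (u \<bullet> b) *\<^sub>R (A x b - A x0 b))"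
      using linear_euclidean_representation[OF lin[OF that], of u]
        linear_euclidean_representation[OF lin[OF assms(2)], of u]
      by (simp add: sum_subtractf scaleR_diff_right)
    also have "norm \<dots> \<le> (\<Sum>b\<in>Basis. norm u * norm (A x b - A x0 b))"
      by (rule sum_norm_le) (auto intro!: mult_right_mono Basis_le_norm)
    also have "\<dots> = ?\<eta> x * norm u" by (simp add: sum_distrib_left mult.commute)
    finally show ?thesis .
  qed
  have "(?\<eta> \<longlongrightarrow> ?\<eta> x0) (at x0)"
    using isC by (intro tendsto_sum tendsto_norm tendsto_diff tendsto_const) (simp add: isCont_def)
  then have "\<forall>\<^sub>F x in at x0. ?\<eta> x < 1 / (2 * K)"
    by (rule order_tendstoD) (use K(1) in simp)
  moreover have "\<forall>\<^sub>F x in at x0. x \<in> S" using assms(1,2) by (rule eventually_at_in_open')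
  ultimately have ev: "\<forall>\<^sub>F x in at x0. norm (inv (A x) v - ?W v) \<le> 2 * K * norm (A x (?W v) - A x0 (?W v))"
  proof eventually_elim
    case (elim x)
    let ?u = "inv (A x) v - ?W v"
    have "norm ?u = norm (?W (A x0 ?u))" using bij[OF assms(2)] by (simp add: bij_is_inj)
    also have "\<dots> \<le> K * norm (A x0 ?u)" by (rule K)
    also have "norm (A x0 ?u) \<le> norm (A x ?u) + norm (A x ?u - A x0 ?u)" by norm
    also have "norm (A x ?u - A x0 ?u) \<le> 1 / (2 * K) * norm ?u"
      using \<eta>[OF elim(2), of ?u] elim(1) by (meson less_eq_real_def mult_right_mono norm_ge_zero order_trans)
    finally have "norm ?u \<le> K * (norm (A x ?u) + 1 / (2 * K) * norm ?u)" using K(1) by simp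
    also have "\<dots> = K * norm (A x ?u) + norm ?u / 2" using K(1) by (simp add: field_simps)
    finally have "norm ?u \<le> 2 * K * norm (A x ?u)" by simp
    also have "A x ?u = A x0 (?W v) - A x (?W v)"
      using bij[OF assms(2)] bij[OF elim(2)] lin[OF elim(2)]
      by (simp add: linear_diff bij_is_surj surj_f_inv_f)
    finally show ?case by (simp add: norm_minus_commute)
  qed
  have "((\<lambda>x. 2 * K * norm (A x (?W v) - A x0 (?W v))) \<longlongrightarrow> 2 * K * norm (A x0 (?W v) - A x0 (?W v))) (at x0)"
    using isC by (intro tendsto_intros) (simp add: isCont_def)
  then have "((\<lambda>x. inv (A x) v - ?W v) \<longlongrightarrow> 0) (at x0)"
    by (intro Lim_null_comparison[OF ev]) simp
  then show ?thesis unfolding isCont_def by (simp add: LIM_zero_iff)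
qed

text \<open>Near \<open>x0\<close> one has
  \<open>A x\<^sup>-\<^sup>1 v = w - A x\<^sup>-\<^sup>1 (A x w - v)\<close> with \<open>w = A x0\<^sup>-\<^sup>1 v\<close>, and \<open>A x w - v\<close> vanishes at \<open>x0\<close>: so continuity
  of the inverse already gives its derivative, which is again built from \<open>A\<close> and its inverse.\<close>

lemma Ck_on_inverse_family:
  fixes A :: "'x::real_normed_vector \<Rightarrow> 'a::euclidean_space \<Rightarrow> 'a"
  assumes "open S" and lin: "\<And>x. x \<in> S \<Longrightarrow> linear (A x)" and bij: "\<And>x. x \<in> S \<Longrightarrow> bij (A x)"
    and smooth: "\<And>u. smooth_on S (\<lambda>x. A x u)"
  shows "Ck_on k S (\<lambda>x. inv (A x) v)"
proof (induction k arbitrary: v)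
  case 0
  show ?case
    using inverse_family_isCont[OF assms(1) _ lin bij smooth_on_continuous[OF smooth]]
    by (simp add: continuous_at_imp_continuous_on)
next
  case (Suc k)
  let ?d = "\<lambda>h x. \<Sum>b\<in>Basis. (\<Sum>c\<in>Basis. (inv (A x) v \<bullet> c) *\<^sub>R dird h (\<lambda>x. A x c) x \<bullet> b) *\<^sub>R inv (A x) b"
  have der: "((\<lambda>x. inv (A x) v) has_derivative (\<lambda>h. - ?d h x0)) (at x0)" if x0: "x0 \<in> S" for x0
  proof -
    let ?w = "inv (A x0) v"
    have inv: "A x (inv (A x) u) = u" "inv (A x) (A x u) = u" if "x \<in> S" for x u
      using bij[OF that] by (simp_all add: bij_is_surj surj_f_inv_f bij_is_inj)
    have linv: "linear (inv (A x))" if "x \<in> S" for x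
      using inj_linear_imp_inv_linear lin[OF that] bij[OF that] bij_is_inj by blast
    have Aw: "((\<lambda>x. A x ?w) has_derivative (\<lambda>h. \<Sum>c\<in>Basis. (?w \<bullet> c) *\<^sub>R dird h (\<lambda>x. A x c) x0)) (at x0)"
    proof (rule has_derivative_transform_within_open[OF _ assms(1) x0])
      show "((\<lambda>x. \<Sum>c\<in>Basis. (?w \<bullet> c) *\<^sub>R A x c) has_derivative
          (\<lambda>h. \<Sum>c\<in>Basis. (?w \<bullet> c) *\<^sub>R dird h (\<lambda>x. A x c) x0)) (at x0)"
        by (intro has_derivative_sum has_derivative_scaleR_right smooth_on_has_derivative[OF smooth x0])
    qed (use linear_euclidean_representation[OF lin] in simp)
    have "((\<lambda>x. ?w - (\<Sum>b\<in>Basis. ((A x ?w - v) \<bullet> b) *\<^sub>R inv (A x) b)) has_derivative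
        (\<lambda>h. 0 - ?d h x0)) (at x0)"
    proof (intro has_derivative_diff has_derivative_const has_derivative_sum has_derivative_scaleR_vanishing)
      fix b :: 'a assume "b \<in> Basis"
      have "((\<lambda>x. (A x ?w - v) \<bullet> b) has_derivative
          (\<lambda>h. ((\<Sum>c\<in>Basis. (?w \<bullet> c) *\<^sub>R dird h (\<lambda>x. A x c) x0) - 0) \<bullet> b)) (at x0)"
        by (intro has_derivative_inner_left has_derivative_diff Aw has_derivative_const)
      then show "((\<lambda>x. (A x ?w - v) \<bullet> b) has_derivative
          (\<lambda>h. \<Sum>c\<in>Basis. (?w \<bullet> c) *\<^sub>R dird h (\<lambda>x. A x c) x0 \<bullet> b)) (at x0)"
        by (simp add: inner_sum_left)
      show "(A x0 ?w - v) \<bullet> b = 0" using inv[OF x0] by simp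
      show "isCont (\<lambda>x. inv (A x) b) x0"
        by (rule inverse_family_isCont[OF assms(1) x0 lin bij smooth_on_continuous[OF smooth]])
    qed
    then have "((\<lambda>x. inv (A x) v) has_derivative (\<lambda>h. 0 - ?d h x0)) (at x0)"
    proof (rule has_derivative_transform_within_open[OF _ assms(1) x0])
      fix x assume x: "x \<in> S"
      have "(\<Sum>b\<in>Basis. ((A x ?w - v) \<bullet> b) *\<^sub>R inv (A x) b) = inv (A x) (A x ?w - v)"
        using linear_euclidean_representation[OF linv[OF x], of "A x ?w - v"] by simp
      also have "\<dots> = ?w - inv (A x) v" using inv[OF x] linear_diff[OF linv[OF x]] by simp
      finally show "?w - (\<Sum>b\<in>Basis. ((A x ?w - v) \<bullet> b) *\<^sub>R inv (A x) b) = inv (A x) v" by simp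
    qed
    then show ?thesis by simp
  qed
  have "Ck_on k S (dird h (\<lambda>x. inv (A x) v))" for h
  proof -
    have "Ck_on k S (\<lambda>x. - ?d h x)"
      using Suc.IH smooth_onD[OF smooth_on_dird[OF smooth]]
      by (intro Ck_on_bounded_linear_comp[OF assms(1) bounded_linear_minus[OF bounded_linear_ident]]
          Ck_on_sum Ck_on_bilinear[OF _ bounded_bilinear_scaleR] assms(1)
          Ck_on_bounded_linear_comp[OF assms(1) bounded_linear_inner_left])
    moreover have "dird h (\<lambda>x. inv (A x) v) x = - ?d h x" if "x \<in> S" for x
      by (rule dirdI[OF der[OF that]])
    ultimately show ?thesis using Ck_on_cong[OF assms(1), of "dird h (\<lambda>x. inv (A x) v)" "\<lambda>x. - ?d h x"] by simp
  qed
  then show ?case unfolding Ck_on_Suc_dird using der differentiable_def by blast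
qed

text \<open>The derivative of the local inverse is the inverse of the derivative of \<open>f\<close>; smoothness of inverses of
  families of linear maps then gives one more derivative at each step of an induction.\<close>

theorem smooth_inverse_function:
  fixes f :: "'a::euclidean_space \<Rightarrow> 'a"
  assumes "open S" "smooth_on S f" "x0 \<in> S" and inj: "\<And>v. dird v f x0 = 0 \<Longrightarrow> v = 0"
  obtains N N' g where "x0 \<in> N" "N \<subseteq> S" "diffeo N N' f g"
proof -
  have fder: "blinfun_apply (fder f x) = (\<lambda>v. dird v f x)" if "x \<in> S" for x
    by (rule blinfun_apply_fder[OF smooth_on_differentiable[OF assms(2) that]])
  have lin: "linear (\<lambda>v. dird v f x)" if "x \<in> S" for x
    by (rule dird_linear[OF smooth_on_differentiable[OF assms(2) that]])
  have "inj (\<lambda>v. dird v f x0)" using linear_injective_0[OF lin[OF assms(3)]] inj by blast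
  then obtain W where W: "linear W" "W \<circ> (\<lambda>v. dird v f x0) = id"
    using linear_injective_left_inverse[OF lin[OF assms(3)]] by blast
  have winv: "Blinfun W o\<^sub>L fder f x0 = id_blinfun"
    using W linear_conv_bounded_linear[of W]
    by (intro blinfun_eqI) (simp add: fder[OF assms(3)] fun_eq_iff bounded_linear_Blinfun_apply)
  have fd: "(f has_derivative blinfun_apply (fder f x)) (at x)" if "x \<in> S" for x
    unfolding fder[OF that] by (rule smooth_on_has_derivative[OF assms(2) that])
  obtain U V g g' where *: "open U" "U \<subseteq> S" "x0 \<in> U" "open V" "f x0 \<in> V" "homeomorphism U V f g"
    and g: "\<And>y. y \<in> V \<Longrightarrow> (g has_derivative (g' y)) (at y)"
      "\<And>y. y \<in> V \<Longrightarrow> g' y = inv (blinfun_apply (fder f (g y)))"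
      "\<And>y. y \<in> V \<Longrightarrow> bij (blinfun_apply (fder f (g y)))"
  proof (rule inverse_function_theorem[OF assms(1) fd continuous_on_fder[OF assms(2)] assms(3) winv], assumption)
    fix U V g g'
    assume *: "open U" "U \<subseteq> S" "x0 \<in> U" "open V" "f x0 \<in> V" "homeomorphism U V f g"
      "\<And>y. y \<in> V \<Longrightarrow> (g has_derivative g' y) (at y)"
      "\<And>y. y \<in> V \<Longrightarrow> g' y = inv (blinfun_apply (fder f (g y)))"
      "\<And>y. y \<in> V \<Longrightarrow> bij (blinfun_apply (fder f (g y)))"
    show thesis by (rule that[OF *])
  qed
  have gV: "g y \<in> U" if "y \<in> V" for y using *(6) that by (auto simp: homeomorphism_def)
  have U: "x = g (f x) \<and> f x \<in> V" if "x \<in> U" for x using *(6) that by (auto simp: homeomorphism_def)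
  have bij: "bij (\<lambda>v. dird v f x)" if "x \<in> U" for x
    using g(3)[of "f x"] U[OF that] fder *(2) that by auto
  have Ck: "Ck_on k U (\<lambda>x. inv (\<lambda>u. dird u f x) v)" for k v
    using *(2) by (intro Ck_on_inverse_family *(1) bij lin smooth_on_dird smooth_on_subset[OF assms(2)]) auto
  have "Ck_on k V g" for k
  proof (induction k)
    case 0
    then show ?case using *(6) by (simp add: homeomorphism_def)
  next
    case (Suc k)
    have "dird v g y = inv (\<lambda>u. dird u f (g y)) v" if "y \<in> V" for y v
      using dirdI[OF g(1)[OF that]] g(2)[OF that] fder gV[OF that] *(2) by auto
    moreover have "Ck_on k V (\<lambda>y. inv (\<lambda>u. dird u f (g y)) v)" for v
      using Ck_on_compose[OF *(4,1) Suc Ck] gV by auto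
    ultimately have "Ck_on k V (dird v g)" for v
      using Ck_on_cong[OF *(4), of "dird v g" "\<lambda>y. inv (\<lambda>u. dird u f (g y)) v"] by simp
    then show ?case unfolding Ck_on_Suc_dird using g(1) differentiable_def by blast
  qed
  then have "diffeo U V f g"
    unfolding diffeo_def using * smooth_on_subset[OF assms(2)] smooth_onI by blast
  then show ?thesis using that * by blast
qed

section \<open>Hadamard's lemma\<close>

text \<open>Differentiation under the integral sign, repeated; it is what makes the quotients of Hadamard's lemma smooth.\<close>

lemma smooth_on_integral:
  fixes g :: "real \<times> 'a::euclidean_space \<Rightarrow> real"
  assumes "open S" "open W" "smooth_on W g" "{0..1} \<times> S \<subseteq> W"
  shows "smooth_on S (\<lambda>x. integral {0..1} (\<lambda>t. g (t, x)))"
proof (rule smooth_onI)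
  fix k
  show "Ck_on k S (\<lambda>x. integral {0..1} (\<lambda>t. g (t, x)))"
    using assms(3)
  proof (induction k arbitrary: g)
    have cont: "continuous_on {0..1} (\<lambda>t. g (t, x))" if "x \<in> S" "smooth_on W g" for x and g :: "real \<times> 'a \<Rightarrow> real"
      using that assms(4) by (intro continuous_on_compose2[OF smooth_on_continuous[of W g]] continuous_intros) auto
    have der: "((\<lambda>x. integral {0..1} (\<lambda>t. g (t, x))) has_derivative
          (\<lambda>h. integral {0..1} (\<lambda>t. dird (0, h) g (t, x)))) (at x)"
      if x: "x \<in> S" and g: "smooth_on W g" for g :: "real \<times> 'a \<Rightarrow> real" and x
    proof -
      obtain r where r: "r > 0" "ball x r \<subseteq> S" using assms(1) x open_contains_ball by blast
      let ?L = "Blinfun (\<lambda>h. (0::real, h::'a))"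
      have L: "blinfun_apply ?L = (\<lambda>h. (0, h))"
        by (rule bounded_linear_Blinfun_apply) (intro bounded_linear_Pair bounded_linear_ident bounded_linear_zero)
      let ?D = "\<lambda>x t. fder g (t, x) o\<^sub>L ?L"
      have D: "blinfun_apply (?D y t) h = dird (0, h) g (t, y)" if "(t, y) \<in> W" for h y t
        using blinfun_apply_fder[OF smooth_on_differentiable[OF g that]] L by simp
      have D': "((\<lambda>x. g (t, x)) has_derivative blinfun_apply (?D y t)) (at y within T)" if "(t, y) \<in> W" for t y T
      proof -
        have "((\<lambda>x. (t, x)) has_derivative (\<lambda>h. (0, h))) (at y)" by (auto intro!: derivative_eq_intros)
        then have "(g \<circ> (\<lambda>x. (t, x)) has_derivative (\<lambda>v. dird v g (t, y)) \<circ> (\<lambda>h. (0, h))) (at y)"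
          by (rule diff_chain_at) (rule smooth_on_has_derivative[OF g that])
        moreover have "blinfun_apply (?D y t) = (\<lambda>v. dird v g (t, y)) \<circ> (\<lambda>h. (0, h))"
          using D[OF that] by (auto simp: fun_eq_iff)
        ultimately show ?thesis by (simp add: o_def has_derivative_at_withinI)
      qed
      have "((\<lambda>y. integral (cbox 0 1) (\<lambda>t. g (t, y))) has_derivative integral (cbox 0 1) (?D x)) (at x within ball x r)"
      proof (rule leibniz_rule)
        show "continuous_on (ball x r \<times> cbox 0 1) (\<lambda>(y, t). ?D y t)"
          unfolding split_beta using r assms(4)
          by (intro bounded_bilinear.continuous_on[OF bounded_bilinear_blinfun_compose] continuous_on_const
              continuous_on_compose2[OF continuous_on_fder[OF g]] continuous_intros)
            (auto intro!: subsetD[OF assms(4)] subsetD[OF r(2)])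
        show "(\<lambda>t. g (t, y)) integrable_on cbox 0 1" if "y \<in> ball x r" for y
          using cont[of y g] r that g by (auto intro!: integrable_continuous_real)
        show "((\<lambda>y. g (t, y)) has_derivative blinfun_apply (?D y t)) (at y within ball x r)"
          if "y \<in> ball x r" "t \<in> cbox 0 1" for y t
          using that r by (intro D') (auto intro!: subsetD[OF assms(4)] subsetD[OF r(2)])
      qed (use r in auto)
      moreover have "blinfun_apply (integral {0..1} (?D x)) = (\<lambda>h. integral {0..1} (\<lambda>t. dird (0, h) g (t, x)))"
      proof (rule ext)
        fix h
        have "?D x integrable_on {0..1}"
          using x assms(4)
          by (intro integrable_continuous_real bounded_bilinear.continuous_on[OF bounded_bilinear_blinfun_compose]
            continuous_on_const continuous_on_compose2[OF continuous_on_fder[OF g]] continuous_intros) auto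
        then have "blinfun_apply (integral {0..1} (?D x)) h = integral {0..1} (\<lambda>t. blinfun_apply (?D x t) h)"
          by (rule blinfun_apply_integral)
        also have "\<dots> = integral {0..1} (\<lambda>t. dird (0, h) g (t, x))"
          using x by (intro integral_cong D) (auto intro!: subsetD[OF assms(4)])
        finally show "blinfun_apply (integral {0..1} (?D x)) h = integral {0..1} (\<lambda>t. dird (0, h) g (t, x))" .
      qed
      ultimately show ?thesis using r(1) by (simp add: at_within_open[of x "ball x r"])
    qed
    {
      case 0
      show ?case using der[OF _ 0]
        by (auto intro!: continuous_at_imp_continuous_on has_derivative_continuous)
    next
      case (Suc k)
      have "Ck_on k S (dird h (\<lambda>x. integral {0..1} (\<lambda>t. g (t, x))))" for h
        using Suc.IH[OF smooth_on_dird[OF Suc.prems, of "(0, h)"]] dirdI[OF der[OF _ Suc.prems]]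
          Ck_on_cong[OF assms(1), of "dird h (\<lambda>x. integral {0..1} (\<lambda>t. g (t, x)))"
            "\<lambda>x. integral {0..1} (\<lambda>t. dird (0, h) g (t, x))"] by simp
      then show ?case unfolding Ck_on_Suc_dird using der[OF _ Suc.prems] differentiable_def by blast
    }
  qed
qed

lemma dird_sum:
  assumes "linear (\<lambda>v. dird v f z)"
  shows "dird (\<Sum>b\<in>T. c b *\<^sub>R g b) f z = (\<Sum>b\<in>T. c b *\<^sub>R dird (g b) f z)"
  using linear_sum[OF assms, of "\<lambda>b. c b *\<^sub>R g b" T] linear_scale[OF assms] by simp

text \<open>Integrating the derivative along the segment to the subspace where the coordinates in \<open>T\<close> vanish expresses
  \<open>f\<close> as a combination of these coordinates. The values of the coefficients on the subspace come for free.\<close>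

lemma hadamard:
  fixes f :: "'a::euclidean_space \<Rightarrow> real"
  assumes "open S" "smooth_on S f" "finite T" "T \<subseteq> Basis"
    and star: "\<And>x t. x \<in> S \<Longrightarrow> 0 \<le> t \<Longrightarrow> t \<le> 1 \<Longrightarrow> x - t *\<^sub>R (\<Sum>b\<in>T. (x \<bullet> b) *\<^sub>R b) \<in> S"
    and zero: "\<And>x. x \<in> S \<Longrightarrow> (\<And>b. b \<in> T \<Longrightarrow> x \<bullet> b = 0) \<Longrightarrow> f x = 0"
  obtains F where "\<And>b. b \<in> T \<Longrightarrow> smooth_on S (F b)" "\<And>x. x \<in> S \<Longrightarrow> f x = (\<Sum>b\<in>T. (x \<bullet> b) * F b x)"
    "\<And>x b. x \<in> S \<Longrightarrow> b \<in> T \<Longrightarrow> (\<And>b. b \<in> T \<Longrightarrow> x \<bullet> b = 0) \<Longrightarrow> F b x = dird b f x"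
proof
  define p where "p x = (\<Sum>b\<in>T. (x \<bullet> b) *\<^sub>R b)" for x :: 'a
  have p: "bounded_linear p" unfolding p_def
    by (intro bounded_linear_sum bounded_linear_scaleR_left[THEN bounded_linear_compose] bounded_linear_inner_left)
  have pb: "p x \<bullet> b = (if b \<in> T then x \<bullet> b else 0)" if "b \<in> Basis" for x b
  proof -
    have "p x \<bullet> b = (\<Sum>c\<in>T. if c = b then x \<bullet> c else 0)"
      unfolding p_def inner_sum_left using assms(4) that by (intro sum.cong) (auto simp: inner_Basis)
    then show ?thesis using assms(3) by simp
  qed
  let ?c = "\<lambda>z. snd z - (1 - fst z) *\<^sub>R p (snd z)"
  define F where "F b x = integral {0..1} (\<lambda>t. dird b f (x - (1 - t) *\<^sub>R p x))" for b x
  define W where "W = {z. ?c z \<in> S}"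
  have c: "smooth_on X ?c" if "open X" for X
    using that by (intro smooth_intros smooth_on_linear_comp[OF _ p]) auto
  have W: "open W"
    unfolding W_def using open_vimage[OF assms(1) smooth_on_continuous[OF c[OF open_UNIV]]]
    by (simp add: vimage_def)
  have SW: "{0..1} \<times> S \<subseteq> W"
    unfolding W_def using star unfolding p_def[symmetric] by auto
  show "smooth_on S (F b)" if "b \<in> T" for b
  proof -
    have "smooth_on W (\<lambda>z. dird b f (?c z))"
      by (rule smooth_on_compose[OF smooth_on_dird[OF assms(2)] W assms(1) c[OF W]]) (auto simp: W_def)
    from smooth_on_integral[OF assms(1) W this SW] show ?thesis unfolding F_def by simp
  qed
  show "F b x = dird b f x" if "x \<in> S" "b \<in> T" "\<And>b. b \<in> T \<Longrightarrow> x \<bullet> b = 0" for x b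
    using that(3) unfolding F_def p_def by simp
  show "f x = (\<Sum>b\<in>T. (x \<bullet> b) * F b x)" if x: "x \<in> S" for x
  proof -
    let ?l = "\<lambda>t. x - (1 - t) *\<^sub>R p x"
    have l: "?l t \<in> S" if "t \<in> {0..1}" for t
    proof -
      have "(t, x) \<in> W" using subsetD[OF SW] that x by blast
      then show ?thesis unfolding W_def by simp
    qed
    have dl: "(?l has_derivative (\<lambda>h. h *\<^sub>R p x)) (at t)" for t
      by (auto intro!: derivative_eq_intros)
    have "((\<lambda>t. f (?l t)) has_vector_derivative dird (p x) f (?l t)) (at t within {0..1})" if "t \<in> {0..1}" for t
    proof -
      have "(f \<circ> ?l has_derivative (\<lambda>v. dird v f (?l t)) \<circ> (\<lambda>h. h *\<^sub>R p x)) (at t)"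
        by (rule diff_chain_at[OF dl smooth_on_has_derivative[OF assms(2) l[OF that]]])
      then have "((\<lambda>t. f (?l t)) has_derivative (\<lambda>h. h *\<^sub>R dird (p x) f (?l t))) (at t)"
        using linear_scale[OF dird_linear[OF smooth_on_differentiable[OF assms(2) l[OF that]]]]
        by (simp add: o_def)
      then show ?thesis
        unfolding has_vector_derivative_def by (rule has_derivative_at_withinI)
    qed
    then have "((\<lambda>t. dird (p x) f (?l t)) has_integral (f (?l 1) - f (?l 0))) {0..1}"
      by (intro fundamental_theorem_of_calculus) auto
    moreover have "f (?l 0) = 0"
    proof (rule zero)
      show "?l 0 \<in> S" by (rule l) simp
      show "?l 0 \<bullet> b = 0" if "b \<in> T" for b using pb[of b x] that assms(4) by (auto simp: inner_diff_left)
    qed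
    ultimately have "f x = integral {0..1} (\<lambda>t. dird (p x) f (?l t))" by (simp add: integral_unique)
    also have "\<dots> = integral {0..1} (\<lambda>t. \<Sum>b\<in>T. (x \<bullet> b) * dird b f (?l t))"
    proof (rule integral_cong)
      fix t :: real assume "t \<in> {0..1}"
      then have lin: "linear (\<lambda>v. dird v f (?l t))"
        using dird_linear smooth_on_differentiable[OF assms(2) l] by blast
      show "dird (p x) f (?l t) = (\<Sum>b\<in>T. (x \<bullet> b) * dird b f (?l t))"
        using dird_sum[OF lin, of "\<lambda>b. x \<bullet> b" "\<lambda>b. b" T] by (simp add: p_def)
    qed
    also have "\<dots> = (\<Sum>b\<in>T. integral {0..1} (\<lambda>t. (x \<bullet> b) * dird b f (?l t)))"
    proof (rule integral_sum[OF assms(3)])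
      fix b
      have "continuous_on {0..1} (\<lambda>t. dird b f (?l t))"
        by (rule continuous_on_compose2[OF smooth_on_continuous[OF smooth_on_dird[OF assms(2)]]])
          (use l in \<open>auto intro!: continuous_intros\<close>)
      then show "(\<lambda>t. (x \<bullet> b) * dird b f (?l t)) integrable_on {0..1}"
        by (intro integrable_continuous_real continuous_intros)
    qed
    finally show ?thesis unfolding F_def by simp
  qed
qed

section \<open>Diffeomorphisms and submanifolds\<close>

lemma line_has_derivative:
  fixes f :: "'a::real_normed_vector \<Rightarrow> real"
  assumes "f differentiable (at (x + t *\<^sub>R v))"
  shows "((\<lambda>t. f (x + t *\<^sub>R v)) has_real_derivative dird v f (x + t *\<^sub>R v)) (at t)"
proof -
  have "((\<lambda>t. x + t *\<^sub>R v) has_derivative (\<lambda>h. h *\<^sub>R v)) (at t)" by (auto intro!: derivative_eq_intros)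
  from diff_chain_at[OF this dird_has_derivative[OF assms]]
  have "((\<lambda>t. f (x + t *\<^sub>R v)) has_derivative (\<lambda>h. h * dird v f (x + t *\<^sub>R v))) (at t)"
    using linear_scale[OF dird_linear[OF assms]] by (simp add: o_def)
  then show ?thesis by (simp add: has_field_derivative_def mult_commute_abs)
qed

lemma dird_line:
  fixes f :: "'a::real_normed_vector \<Rightarrow> real"
  assumes "f differentiable (at x)" "((\<lambda>t. f (x + t *\<^sub>R v)) has_real_derivative d) (at 0)"
  shows "dird v f x = d"
  using DERIV_unique[OF assms(2)] line_has_derivative[of f x 0 v] assms(1) by simp

lemma DERIV_transfer:
  "(f has_field_derivative d) (at x) \<Longrightarrow> \<forall>\<^sub>F y in nhds x. f y = g y \<Longrightarrow> (g has_field_derivative d) (at x)"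
  by (metis DERIV_cong_ev)

text \<open>Writing \<open>f (z + t *\<^sub>R v) - f z = t * H (z, t)\<close>, both orders of differentiation produce the
  derivative of \<open>H\<close> in direction \<open>u\<close>.\<close>

lemma dird_commute:
  fixes f :: "'a::euclidean_space \<Rightarrow> real"
  assumes "open S" "smooth_on S f" "x \<in> S"
  shows "dird u (dird v f) x = dird v (dird u f) x"
proof -
  obtain r where r: "r > 0" "ball x r \<subseteq> S" using assms(1,3) open_contains_ball by blast
  define D where "D = {z :: 'a \<times> real. dist (fst z) x + norm (snd z *\<^sub>R v) < r}"
  have D: "open D" unfolding D_def by (intro open_Collect_less continuous_intros)
  have DS: "fst z \<in> S" "fst z + snd z *\<^sub>R v \<in> S" if "z \<in> D" for z
  proof -
    have "dist (fst z + snd z *\<^sub>R v) x \<le> dist (fst z) x + norm (snd z *\<^sub>R v)"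
      unfolding dist_norm by (metis add_diff_eq add.commute norm_triangle_ineq diff_add_eq)
    moreover have "dist (fst z) x \<le> dist (fst z) x + norm (snd z *\<^sub>R v)" by simp
    ultimately have "dist (fst z + snd z *\<^sub>R v) x < r" "dist (fst z) x < r"
      using that unfolding D_def by (blast intro: le_less_trans)+
    then show "fst z + snd z *\<^sub>R v \<in> S" "fst z \<in> S"
      using r(2) by (auto simp: subset_iff dist_commute)
  qed
  let ?F = "\<lambda>z::'a \<times> real. f (fst z + snd z *\<^sub>R v) - f (fst z)"
  have F: "smooth_on D ?F"
    by (intro smooth_on_diff[OF D] smooth_on_compose[OF assms(2) D assms(1)] smooth_intros D DS)
  obtain H where H: "smooth_on D (H (0, 1::real))" "\<And>z. z \<in> D \<Longrightarrow> ?F z = (\<Sum>b\<in>{(0,1)}. (z \<bullet> b) * H b z)"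
    "\<And>z. z \<in> D \<Longrightarrow> (\<And>b. b \<in> {(0,1)} \<Longrightarrow> z \<bullet> b = 0) \<Longrightarrow> H (0,1) z = dird (0,1) ?F z"
  proof (rule hadamard[OF D F, of "{(0, 1)}"])
    show "z - t *\<^sub>R (\<Sum>b\<in>{(0, 1)}. (z \<bullet> b) *\<^sub>R b) \<in> D" if "z \<in> D" "0 \<le> t" "t \<le> 1" for z t
    proof -
      have "norm ((snd z - t * snd z) *\<^sub>R v) = (1 - t) * norm (snd z *\<^sub>R v)"
        using that abs_mult[of "1 - t" "snd z"] by (simp add: left_diff_distrib mult.assoc)
      also have "\<dots> \<le> norm (snd z *\<^sub>R v)" using that by (intro mult_left_le_one_le) auto
      finally show ?thesis using that(1) unfolding D_def by (simp add: inner_prod_def)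
    qed
  qed (auto simp: Basis_prod_def inner_prod_def)
  define K where "K = H (0, 1)"
  have K: "smooth_on D K" and FK: "\<And>z. z \<in> D \<Longrightarrow> ?F z = snd z * K z"
    using H(1,2) by (auto simp: K_def inner_prod_def)
  have xt: "\<forall>\<^sub>F t in nhds 0. (x, t) \<in> D"
  proof -
    have "open {t::real. norm (t *\<^sub>R v) < r}" by (intro open_Collect_less continuous_intros)
    then show ?thesis unfolding D_def eventually_nhds using r(1) by (intro exI[of _ "{t. norm (t *\<^sub>R v) < r}"]) auto
  qed
  have x0: "(x, 0) \<in> D" using r(1) by (simp add: D_def)
  have K0: "K (z, 0) = dird v f z" if z: "(z, 0) \<in> D" for z
  proof -
    have "K (z, 0) = dird (0, 1) ?F (z, 0)" unfolding K_def by (rule H(3)[OF z]) (simp add: inner_prod_def)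
    also have "\<dots> = dird v f z"
    proof (rule dird_line[OF smooth_on_differentiable[OF F z]])
      show "((\<lambda>t. ?F ((z, 0) + t *\<^sub>R (0, 1))) has_real_derivative dird v f z) (at 0)"
        using line_has_derivative[of f z 0 v] smooth_on_differentiable[OF assms(2)] DS(1)[OF z]
        by (auto intro!: derivative_eq_intros)
    qed
    finally show ?thesis .
  qed
  have dF: "dird u f (x + t *\<^sub>R v) - dird u f x = t * dird (u, 0) K (x, t)" if "(x, t) \<in> D" for t
  proof -
    have "dird (u, 0) ?F (x, t) = dird u f (x + t *\<^sub>R v) - dird u f x"
    proof (rule dird_line[OF smooth_on_differentiable[OF F that]])
      have "((\<lambda>s. f ((x + t *\<^sub>R v) + s *\<^sub>R u)) has_real_derivative dird u f (x + t *\<^sub>R v)) (at 0)"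
        using line_has_derivative[of f "x + t *\<^sub>R v" 0 u] smooth_on_differentiable[OF assms(2)] DS(2)[OF that] by auto
      moreover have "((\<lambda>s. f (x + s *\<^sub>R u)) has_real_derivative dird u f x) (at 0)"
        using line_has_derivative[of f x 0 u] smooth_on_differentiable[OF assms(2,3)] by auto
      ultimately show "((\<lambda>s. ?F ((x, t) + s *\<^sub>R (u, 0))) has_real_derivative
          dird u f (x + t *\<^sub>R v) - dird u f x) (at 0)"
        by (auto intro!: derivative_eq_intros simp: algebra_simps)
    qed
    moreover have "dird (u, 0) ?F (x, t) = dird (u, 0) (\<lambda>z. snd z * K z) (x, t)"
      by (rule dird_cong[OF D that FK])
    moreover have "dird (u, 0) (\<lambda>z. snd z * K z) (x, t) = t * dird (u, 0) K (x, t)"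
    proof (rule dird_line)
      show "(\<lambda>z. snd z * K z) differentiable at (x, t)"
        by (rule smooth_on_differentiable[OF _ that]) (intro smooth_intros D K)
      show "((\<lambda>s. snd ((x, t) + s *\<^sub>R (u, 0)) * K ((x, t) + s *\<^sub>R (u, 0))) has_real_derivative t * dird (u, 0) K (x, t)) (at 0)"
        using line_has_derivative[of K "(x, t)" 0 "(u, 0)"] smooth_on_differentiable[OF K that]
        by (auto intro!: derivative_eq_intros)
    qed
    ultimately show ?thesis by simp
  qed
  have d1: "((\<lambda>t. dird u f (x + t *\<^sub>R v)) has_real_derivative dird v (dird u f) x) (at 0)"
    using line_has_derivative[of "dird u f" x 0 v] smooth_on_differentiable[OF smooth_on_dird[OF assms(2)] assms(3)] by auto
  have d2: "((\<lambda>t. dird u f x + t * dird (u, 0) K (x, t)) has_real_derivative dird (u, 0) K (x, 0)) (at 0)"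
    using line_has_derivative[of "dird (u, 0) K" "(x, 0)" 0 "(0, 1)"]
      smooth_on_differentiable[OF smooth_on_dird[OF K] x0]
    by (auto intro!: derivative_eq_intros)
  have "\<forall>\<^sub>F t in nhds 0. dird u f (x + t *\<^sub>R v) = dird u f x + t * dird (u, 0) K (x, t)"
    using xt by eventually_elim (use dF in \<open>simp add: algebra_simps\<close>)
  from DERIV_unique[OF DERIV_transfer[OF d1 this] d2]
  have "dird v (dird u f) x = dird (u, 0) K (x, 0)" .
  also have "\<dots> = dird u (dird v f) x"
  proof (rule dird_line[OF smooth_on_differentiable[OF K x0]])
    have "((\<lambda>s. dird v f (x + s *\<^sub>R u)) has_real_derivative dird u (dird v f) x) (at 0)"
      using line_has_derivative[of "dird v f" x 0 u] smooth_on_differentiable[OF smooth_on_dird[OF assms(2)] assms(3)] by auto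
    moreover have "\<forall>\<^sub>F s in nhds 0. dird v f (x + s *\<^sub>R u) = K ((x, 0) + s *\<^sub>R (u, 0))"
    proof -
      have "open {s. (x + s *\<^sub>R u, 0) \<in> D}"
        unfolding D_def by (auto intro!: open_Collect_less continuous_intros)
      then have "\<forall>\<^sub>F s in nhds 0. (x + s *\<^sub>R u, 0) \<in> D"
        unfolding eventually_nhds using x0 by (intro exI[of _ "{s. (x + s *\<^sub>R u, 0) \<in> D}"]) auto
      then show ?thesis by eventually_elim (simp add: K0)
    qed
    ultimately show "((\<lambda>s. K ((x, 0) + s *\<^sub>R (u, 0))) has_real_derivative dird u (dird v f) x) (at 0)"
      by (rule DERIV_transfer)
  qed
  finally show ?thesis by simp
qed

section \<open>Submanifolds\<close>

lemma diffeo_sym: "diffeo N N' \<Phi> \<Psi> \<Longrightarrow> diffeo N' N \<Psi> \<Phi>"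
  using homeomorphism_sym[of N N' \<Phi> \<Psi>] unfolding diffeo_def by blast

lemma diffeoD:
  assumes "diffeo N N' \<Phi> \<Psi>"
  shows "open N" "open N'" "smooth_on N \<Phi>" "smooth_on N' \<Psi>" "\<Phi> ` N = N'" "\<Psi> ` N' = N"
    "\<And>x. x \<in> N \<Longrightarrow> \<Psi> (\<Phi> x) = x" "\<And>y. y \<in> N' \<Longrightarrow> \<Phi> (\<Psi> y) = y"
    "\<And>x. x \<in> N \<Longrightarrow> \<Phi> x \<in> N'" "\<And>y. y \<in> N' \<Longrightarrow> \<Psi> y \<in> N"
  using assms unfolding diffeo_def homeomorphism_def by blast+

lemma diffeoI:
  assumes "open N" "open N'" "smooth_on N \<Phi>" "smooth_on N' \<Psi>"
    "\<And>x. x \<in> N \<Longrightarrow> \<Psi> (\<Phi> x) = x" "\<And>y. y \<in> N' \<Longrightarrow> \<Phi> (\<Psi> y) = y"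
    "\<And>x. x \<in> N \<Longrightarrow> \<Phi> x \<in> N'" "\<And>y. y \<in> N' \<Longrightarrow> \<Psi> y \<in> N"
  shows "diffeo N N' \<Phi> \<Psi>"
proof -
  have "\<Phi> ` N = N'" "\<Psi> ` N' = N" using assms(5-8) by force+
  then show ?thesis
    unfolding diffeo_def homeomorphism_def
    using assms smooth_on_continuous[OF assms(3)] smooth_on_continuous[OF assms(4)] by simp
qed

lemma diffeo_restrict:
  assumes "diffeo N N' \<Phi> \<Psi>" "open U"
  shows "diffeo (N \<inter> U) (N' \<inter> \<Psi> -` U) \<Phi> \<Psi>"
proof (rule diffeoI)
  note D = diffeoD[OF assms(1)]
  show "open (N' \<inter> \<Psi> -` U)"
    using continuous_open_preimage[OF smooth_on_continuous[OF D(4)] D(2) assms(2)] by simp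
qed (use diffeoD[OF assms(1)] assms(2) in \<open>auto intro: smooth_on_subset\<close>)

lemma diffeo_image_inter:
  assumes "diffeo N N' \<Phi> \<Psi>" "\<Phi> ` (M \<inter> N) = N' \<inter> L"
  shows "\<Phi> ` (M \<inter> (N \<inter> U)) = (N' \<inter> \<Psi> -` U) \<inter> L"
proof (intro set_eqI iffI)
  note D = diffeoD[OF assms(1)]
  fix y
  {
    assume "y \<in> \<Phi> ` (M \<inter> (N \<inter> U))"
    then obtain x where "y = \<Phi> x" "x \<in> M" "x \<in> N" "x \<in> U" by blast
    then show "y \<in> (N' \<inter> \<Psi> -` U) \<inter> L" using assms(2) D by auto
  next
    assume y: "y \<in> (N' \<inter> \<Psi> -` U) \<inter> L"
    then obtain x where "y = \<Phi> x" "x \<in> M" "x \<in> N" using assms(2) by blast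
    then show "y \<in> \<Phi> ` (M \<inter> (N \<inter> U))" using y D by auto
  }
qed

lemma diffeo_compose:
  fixes \<Phi> :: "'a::euclidean_space \<Rightarrow> 'b::euclidean_space" and \<eta> :: "'b \<Rightarrow> 'c::euclidean_space"
  assumes "diffeo N N' \<Phi> \<Psi>" "diffeo N' N'' \<eta> \<omega>"
  shows "diffeo N N'' (\<lambda>x. \<eta> (\<Phi> x)) (\<lambda>y. \<Psi> (\<omega> y))"
proof (rule diffeoI)
  note A = diffeoD[OF assms(1)] and B = diffeoD[OF assms(2)]
  show "smooth_on N (\<lambda>x. \<eta> (\<Phi> x))" by (rule smooth_on_compose[OF B(3) A(1,2,3,9)])
  show "smooth_on N'' (\<lambda>y. \<Psi> (\<omega> y))" by (rule smooth_on_compose[OF A(4) B(2) A(2) B(4,10)])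
qed (simp_all add: diffeoD(1,2,7-10)[OF assms(1)] diffeoD(1,2,7-10)[OF assms(2)])

lemma diffeo_dird:
  fixes \<Phi> :: "'a::real_normed_vector \<Rightarrow> 'b::real_normed_vector"
  assumes "diffeo N N' \<Phi> \<Psi>" "x \<in> N"
  shows "dird (dird v \<Phi> x) \<Psi> (\<Phi> x) = v"
proof -
  note D = diffeoD[OF assms(1)]
  have "dird (dird v \<Phi> x) \<Psi> (\<Phi> x) = dird v (\<lambda>x. \<Psi> (\<Phi> x)) x"
    using D assms(2) by (intro dird_compose[symmetric]) (auto intro: smooth_on_differentiable)
  also have "\<dots> = dird v (\<lambda>x. x) x" by (rule dird_cong[OF D(1) assms(2) D(7)])
  also have "\<dots> = v" by (rule dirdI) (rule has_derivative_ident)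
  finally show ?thesis .
qed

lemma smooth_submanifold_atE:
  fixes M :: "'a::euclidean_space set"
  assumes "smooth_submanifold_at d M p"
  obtains N N' \<Phi> \<Psi> and L :: "'a set" where "p \<in> M" "p \<in> N" "diffeo N N' \<Phi> \<Psi>" "subspace L" "dim L = d"
    "\<Phi> ` (M \<inter> N) = N' \<inter> L"
  using assms unfolding smooth_submanifold_at_def by (elim conjE exE) (rule that, assumption+)

lemma smooth_submanifold_atI:
  fixes M L :: "'a::euclidean_space set"
  assumes "p \<in> M" "p \<in> N" "diffeo N N' \<Phi> \<Psi>" "subspace L" "dim L = d" "\<Phi> ` (M \<inter> N) = N' \<inter> L"
  shows "smooth_submanifold_at d M p"
  unfolding smooth_submanifold_at_def
  by (rule conjI[OF assms(1)], rule exI[of _ N], rule exI[of _ N'], rule exI[of _ \<Phi>],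
      rule exI[of _ \<Psi>], rule exI[of _ L]) (simp only: assms(2-) simp_thms)

lemma smooth_submanifold_at_cong:
  fixes M :: "'a::euclidean_space set"
  assumes "open U" "p \<in> U" "M \<inter> U = M' \<inter> U" "smooth_submanifold_at d M p"
  shows "smooth_submanifold_at d M' p"
proof -
  obtain N N' \<Phi> \<Psi> and L :: "'a set" where *: "p \<in> M" "p \<in> N" "diffeo N N' \<Phi> \<Psi>" "subspace L" "dim L = d"
    "\<Phi> ` (M \<inter> N) = N' \<inter> L" by (rule smooth_submanifold_atE[OF assms(4)])
  have "\<Phi> ` (M' \<inter> (N \<inter> U)) = (N' \<inter> \<Psi> -` U) \<inter> L"
  proof -
    have "M' \<inter> (N \<inter> U) = M \<inter> (N \<inter> U)" using assms(3) by auto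
    then show ?thesis using diffeo_image_inter[OF *(3,6), of U] by simp
  qed
  then show ?thesis
    using *(1,2) assms(2,3) by (intro smooth_submanifold_atI[OF _ _ diffeo_restrict[OF *(3) assms(1)] *(4,5)]) auto
qed

text \<open>The same chart serves all nearby points.\<close>

lemma smooth_submanifold_at_nearby:
  fixes M :: "'a::euclidean_space set"
  assumes "smooth_submanifold_at d M p"
  obtains U where "open U" "p \<in> U" "\<And>q. q \<in> M \<inter> U \<Longrightarrow> smooth_submanifold_at d M q"
proof -
  obtain N N' \<Phi> \<Psi> and L :: "'a set" where *: "p \<in> M" "p \<in> N" "diffeo N N' \<Phi> \<Psi>" "subspace L" "dim L = d"
    "\<Phi> ` (M \<inter> N) = N' \<inter> L" by (rule smooth_submanifold_atE[OF assms])
  then show ?thesis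
    by (intro that[OF diffeoD(1)[OF *(3)]]) (simp, rule smooth_submanifold_atI[OF _ _ *(3-6)], simp_all)
qed

lemma smooth_submanifold_at_diffeo:
  fixes M :: "'a::euclidean_space set"
  assumes "smooth_submanifold_at d M p" "diffeo U V \<eta> \<omega>" "p \<in> U"
  shows "smooth_submanifold_at d (\<eta> ` (M \<inter> U)) (\<eta> p :: 'a)"
proof -
  obtain N N' \<Phi> \<Psi> and L :: "'a set" where *: "p \<in> M" "p \<in> N" "diffeo N N' \<Phi> \<Psi>" "subspace L" "dim L = d"
    "\<Phi> ` (M \<inter> N) = N' \<inter> L" by (rule smooth_submanifold_atE[OF assms(1)])
  note D = diffeoD[OF assms(2)]
  have "diffeo (N \<inter> U) (N' \<inter> \<Psi> -` U) \<Phi> \<Psi>" by (rule diffeo_restrict[OF *(3) D(1)])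
  moreover have "diffeo (V \<inter> \<omega> -` N) (N \<inter> U) \<omega> \<eta>"
  proof -
    have "diffeo (U \<inter> N) (V \<inter> \<omega> -` N) \<eta> \<omega>" by (rule diffeo_restrict[OF assms(2) diffeoD(1)[OF *(3)]])
    then show ?thesis by (simp add: diffeo_sym Int_commute)
  qed
  ultimately have d: "diffeo (V \<inter> \<omega> -` N) (N' \<inter> \<Psi> -` U) (\<lambda>x. \<Phi> (\<omega> x)) (\<lambda>y. \<eta> (\<Psi> y))"
    by (rule diffeo_compose[rotated])
  have "(\<lambda>x. \<Phi> (\<omega> x)) ` (\<eta> ` (M \<inter> U) \<inter> (V \<inter> \<omega> -` N)) = (N' \<inter> \<Psi> -` U) \<inter> L"
  proof -
    have "\<eta> ` (M \<inter> U) \<inter> (V \<inter> \<omega> -` N) = \<eta> ` (M \<inter> (N \<inter> U))"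
      using D(7,9) by (auto simp: image_iff)
    moreover have "(\<lambda>x. \<Phi> (\<omega> x)) ` \<eta> ` (M \<inter> (N \<inter> U)) = \<Phi> ` (M \<inter> (N \<inter> U))"
      unfolding image_image using D(7) by (intro image_cong) auto
    ultimately show ?thesis using diffeo_image_inter[OF *(3,6), of U] by simp
  qed
  moreover have "\<eta> p \<in> \<eta> ` (M \<inter> U)" using *(1) assms(3) by blast
  moreover have "\<eta> p \<in> V \<inter> \<omega> -` N" using D(7,9)[OF assms(3)] *(2) by simp
  ultimately show ?thesis by (intro smooth_submanifold_atI[OF _ _ d *(4,5)])
qed

text \<open>The chart is \<open>x\<close> corrected along the gradient \<open>n\<close> so that its \<open>n\<close>-component becomes \<open>h x\<close>;
  its derivative at \<open>p\<close> is the identity.\<close>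

lemma regular_level_set:
  fixes h :: "'a::euclidean_space \<Rightarrow> real"
  assumes "open S" "smooth_on S h" "p \<in> S" "h p = 0" "dird w h p \<noteq> 0"
  shows "smooth_submanifold_at (DIM('a) - 1) {x \<in> S. h x = 0} p"
proof -
  have lin: "linear (\<lambda>v. dird v h p)" by (rule dird_linear[OF smooth_on_differentiable[OF assms(2,3)]])
  define n where "n = (\<Sum>b\<in>Basis. dird b h p *\<^sub>R b)"
  have n: "dird v h p = v \<bullet> n" for v
    using linear_euclidean_representation[OF lin, of v] unfolding n_def by (simp add: inner_sum_right mult.commute)
  have n0: "n \<bullet> n \<noteq> 0" using assms(5) n by auto
  define \<Phi> where "\<Phi> x = x + ((h x - x \<bullet> n) / (n \<bullet> n)) *\<^sub>R n" for x
  have \<Phi>: "smooth_on S \<Phi>" unfolding \<Phi>_def using n0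
    by (intro smooth_intros assms(1,2)) auto
  have \<Phi>n: "\<Phi> x \<bullet> n = h x" for x unfolding \<Phi>_def using n0 by (simp add: inner_add_left)
  have "(\<Phi> has_derivative (\<lambda>v. v + ((dird v h p - v \<bullet> n) / (n \<bullet> n)) *\<^sub>R n)) (at p)"
    unfolding \<Phi>_def using n0
    by (auto intro!: derivative_eq_intros smooth_on_has_derivative[OF assms(2,3)] simp: field_simps)
  then have "dird v \<Phi> p = v" for v using dirdI n by fastforce
  then obtain N N' g where N: "p \<in> N" "N \<subseteq> S" "diffeo N N' \<Phi> g"
    using smooth_inverse_function[OF assms(1) \<Phi> assms(3)] by metis
  have "\<Phi> ` ({x \<in> S. h x = 0} \<inter> N) = N' \<inter> {v. n \<bullet> v = 0}"
  proof (intro set_eqI iffI)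
    note D = diffeoD[OF N(3)]
    fix y assume y: "y \<in> N' \<inter> {v. n \<bullet> v = 0}"
    then have "h (g y) = 0" using \<Phi>n[of "g y"] D(8) by (simp add: inner_commute)
    then show "y \<in> \<Phi> ` ({x \<in> S. h x = 0} \<inter> N)"
      using y D(8,10) N(2) by (intro image_eqI[of _ _ "g y"]) auto
  qed (use diffeoD(9)[OF N(3)] \<Phi>n in \<open>auto simp: inner_commute\<close>)
  moreover have "subspace {v. n \<bullet> v = 0}" by (rule subspace_hyperplane)
  moreover have "dim {v. n \<bullet> v = 0} = DIM('a) - 1" using n0 by (intro dim_hyperplane) auto
  moreover have "p \<in> {x \<in> S. h x = 0}" using assms(3,4) by simp
  ultimately show ?thesis by (intro smooth_submanifold_atI[OF _ N(1,3)])
qed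

text \<open>The last coordinate of a chart is a regular equation. Nonsmoothness will be shown by proving that every
  such equation has derivative zero.\<close>

lemma hypersurface_equation:
  fixes M :: "'a::euclidean_space set"
  assumes "smooth_submanifold_at (DIM('a) - 1) M p"
  obtains U h w where "open U" "p \<in> U" "smooth_on U h" "\<And>x. x \<in> M \<inter> U \<Longrightarrow> h x = (0::real)" "dird w h p \<noteq> 0"
proof -
  obtain N N' \<Phi> \<Psi> and L :: "'a set" where *: "p \<in> M" "p \<in> N" "diffeo N N' \<Phi> \<Psi>" "subspace L"
    "dim L = DIM('a) - 1" "\<Phi> ` (M \<inter> N) = N' \<inter> L" by (rule smooth_submanifold_atE[OF assms])
  note D = diffeoD[OF *(3)]
  have "dim L < DIM('a)" using *(5) by simp
  then obtain n where n: "n \<noteq> 0" "\<And>y. y \<in> span L \<Longrightarrow> orthogonal n y"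
    using orthogonal_to_subspace_exists by blast
  let ?v = "dird n \<Psi> (\<Phi> p)"
  have "dird ?v \<Phi> p = n"
    using diffeo_dird[OF diffeo_sym[OF *(3)], of "\<Phi> p" n] D *(2) by simp
  moreover have "dird ?v (\<lambda>x. \<Phi> x \<bullet> n) p = dird ?v \<Phi> p \<bullet> n"
    by (rule dirdI) (intro has_derivative_inner_left smooth_on_has_derivative[OF D(3) *(2)])
  ultimately have "dird ?v (\<lambda>x. \<Phi> x \<bullet> n) p \<noteq> 0" using n(1) by simp
  moreover have "\<Phi> x \<bullet> n = 0" if "x \<in> M \<inter> N" for x
    using n(2)[OF span_base, of "\<Phi> x"] *(6) that by (auto simp: orthogonal_def inner_commute)
  ultimately show ?thesis
    using that[OF D(1) *(2) smooth_on_inner[OF D(1,3) smooth_on_const]] by blast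
qed

section \<open>Implicit functions and compactness\<close>

text \<open>The tube lemma: a property that holds near each point of a compact fibre holds on all nearby fibres.
  The compact set will be an interval of angles.\<close>

lemma eventually_ball_compact:
  fixes K :: "'b::metric_space set" and x0 :: "'a::metric_space"
  assumes "compact K" "\<And>t. t \<in> K \<Longrightarrow> \<forall>\<^sub>F z in nhds (x0, t). P (fst z) (snd z)"
  shows "\<forall>\<^sub>F x in nhds x0. \<forall>t\<in>K. P x t"
proof -
  let ?W = "interior {z. P (fst z) (snd z)}"
  have "(x0, t) \<in> ?W" if "t \<in> K" for t
  proof -
    have "\<exists>S. open S \<and> (x0, t) \<in> S \<and> (\<forall>z\<in>S. P (fst z) (snd z))"
      using assms(2)[OF that] by (simp only: eventually_nhds)
    then obtain S where "open S" "(x0, t) \<in> S" "\<forall>z\<in>S. P (fst z) (snd z)" by (elim exE conjE) (rule that)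
    then show ?thesis by (intro interiorI[of S] subsetI CollectI) simp_all
  qed
  then have "{x0} \<times> K \<subseteq> ?W" by blast
  from Elementary_Topology.tube_lemma[OF assms(1) open_interior this]
  obtain X where X: "x0 \<in> X" "open X" "X \<times> K \<subseteq> ?W" by blast
  have "P x t" if "x \<in> X" "t \<in> K" for x t
  proof -
    have "(x, t) \<in> ?W" using X(3) that by blast
    then have "(x, t) \<in> {z. P (fst z) (snd z)}" by (rule subsetD[OF interior_subset])
    then show ?thesis by simp
  qed
  then have "\<forall>x\<in>X. \<forall>t\<in>K. P x t" by simp
  then show ?thesis unfolding eventually_nhds using X(1,2) by (intro exI[of _ X] conjI)
qed

text \<open>Monotonicity makes the solution unique on the whole interval, so the local solutions of the implicit
  function theorem agree and give a single smooth function.\<close>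

lemma monotone_implicit_function:
  fixes F :: "'x::euclidean_space \<times> real \<Rightarrow> real"
  assumes "open X" "smooth_on (X \<times> {a<..<b}) F"
    and pos: "\<And>x t. x \<in> X \<Longrightarrow> a < t \<Longrightarrow> t < b \<Longrightarrow> dird (0, 1) F (x, t) > 0"
    and ex: "\<And>x. x \<in> X \<Longrightarrow> \<exists>t. a < t \<and> t < b \<and> F (x, t) = c"
  obtains P where "smooth_on X P"
    "\<And>x t. x \<in> X \<Longrightarrow> (a < t \<and> t < b \<and> F (x, t) = c) \<longleftrightarrow> t = P x"
proof -
  let ?D = "X \<times> {a<..<b}"
  have D: "open ?D" using assms(1) by (intro open_Times) auto
  have mono: "F (x, s) < F (x, t)" if "x \<in> X" "a < s" "s < t" "t < b" for x s t
  proof (rule DERIV_pos_imp_increasing[OF that(3)])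
    fix u assume "s \<le> u" "u \<le> t"
    then have u: "(x, u) \<in> ?D" using that by auto
    show "\<exists>y. ((\<lambda>t. F (x, t)) has_real_derivative y) (at u) \<and> 0 < y"
      using line_has_derivative[of F "(x, 0)" u "(0, 1)"] smooth_on_differentiable[OF assms(2) u]
        pos[of x u] u by auto
  qed
  have "\<exists>P. \<forall>x\<in>X. a < P x \<and> P x < b \<and> F (x, P x) = c" using ex by metis
  then obtain P where P: "\<And>x. x \<in> X \<Longrightarrow> a < P x \<and> P x < b \<and> F (x, P x) = c" by blast
  have uniq: "(a < t \<and> t < b \<and> F (x, t) = c) \<longleftrightarrow> t = P x" if "x \<in> X" for x t
    using mono[OF that, of t "P x"] mono[OF that, of "P x" t] P[OF that] by (metis linorder_less_linear less_irrefl)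
  have "smooth_on X P"
  proof (rule smooth_on_local)
    fix x assume x: "x \<in> X"
    let ?J = "\<lambda>z::'x \<times> real. (fst z, F z)"
    have z: "(x, P x) \<in> ?D" using P x by auto
    have J: "smooth_on ?D ?J" by (intro smooth_intros D assms(2))
    have dJ: "dird v ?J (x, P x) = (fst v, dird v F (x, P x))" for v
      by (rule dirdI) (auto intro!: derivative_eq_intros smooth_on_has_derivative[OF assms(2) z])
    have lin: "linear (\<lambda>v. dird v F (x, P x))" by (rule dird_linear[OF smooth_on_differentiable[OF assms(2) z]])
    have "v = 0" if "dird v ?J (x, P x) = 0" for v
    proof -
      have v: "v = snd v *\<^sub>R (0, 1)" using that dJ by (simp add: prod_eq_iff)
      have "snd v * dird (0, 1) F (x, P x) = 0"
        using that dJ[of v] linear_scale[OF lin, of "snd v" "(0, 1)"] v by (metis prod.sel(2) real_scaleR_def snd_zero)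
      then show ?thesis using pos[OF x] P[OF x] v by (metis less_irrefl mult_eq_0_iff scaleR_zero_left)
    qed
    then obtain N N' g where N: "(x, P x) \<in> N" "N \<subseteq> ?D" "diffeo N N' ?J g"
      using smooth_inverse_function[OF D J z] by blast
    note G = diffeoD[OF N(3)]
    let ?U = "{y. (y, c) \<in> N'}"
    have U: "open ?U"
      using open_vimage[OF G(2), of "\<lambda>y. (y, c)"] by (simp add: vimage_def continuous_on_Pair continuous_on_id)
    have xU: "x \<in> ?U" using G(9)[OF N(1)] P[OF x] by simp
    have "smooth_on ?U (\<lambda>y. snd (g (y, c)))"
      by (intro smooth_intros U smooth_on_compose[OF G(4) U G(2)]) auto
    moreover have "snd (g (y, c)) = P y" if "y \<in> ?U" for y
    proof -
      have yc: "(y, c) \<in> N'" using that by simp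
      have "g (y, c) \<in> ?D" using G(10)[OF yc] N(2) by blast
      moreover have "fst (g (y, c)) = y" "F (g (y, c)) = c" using G(8)[OF yc] by auto
      ultimately show ?thesis using uniq[of y "snd (g (y, c))"] by (metis greaterThanLessThan_iff mem_Sigma_iff prod.collapse)
    qed
    ultimately show "\<exists>U. open U \<and> x \<in> U \<and> smooth_on U P"
      using U xU smooth_on_cong[OF U, of "\<lambda>y. snd (g (y, c))" P] by blast
  qed
  then show ?thesis using that uniq by blast
qed

section \<open>Functions with a hypocycloid of double zeros\<close>

lemma eventually_continuous_on:
  assumes "continuous_on S f" "open S" "z \<in> S" "open T" "f z \<in> T"
  shows "\<forall>\<^sub>F z' in nhds z. z' \<in> S \<and> f z' \<in> T"
proof -
  have "open (S \<inter> f -` T)" by (rule continuous_open_preimage[OF assms(1,2,4)])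
  then show ?thesis unfolding eventually_nhds using assms(3,5) by (intro exI[of _ "S \<inter> f -` T"]) auto
qed

lemma Rolle_double_zeros:
  fixes f :: "real \<Rightarrow> real"
  assumes "a < b" and f: "\<And>t. (f has_real_derivative f1 t) (at t)" "\<And>t. (f1 has_real_derivative f2 t) (at t)"
    "\<And>t. (f2 has_real_derivative f3 t) (at t)"
    and "f a = 0" "f1 a = 0" "f b = 0" "f1 b = 0"
  shows "\<exists>t. a < t \<and> t < b \<and> f2 t = 0" "\<exists>t. a < t \<and> t < b \<and> f3 t = 0"
proof -
  have rolle: "\<exists>t. u < t \<and> t < v \<and> g' t = 0"
    if uv: "u < v" "g u = g v" and g: "\<And>t. (g has_real_derivative g' t) (at t)" for g g' :: "real \<Rightarrow> real" and u v
  proof -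
    have "continuous_on {u..v} g" using g by (meson DERIV_isCont continuous_at_imp_continuous_on)
    then obtain z where z: "u < z" "z < v" "(\<lambda>h. g' z * h) = (\<lambda>v. 0)"
      using Rolle_deriv[OF uv, of "\<lambda>t h. g' t * h"] g unfolding has_field_derivative_def by blast
    from fun_cong[OF z(3), of 1] have "g' z = 0" by simp
    then show ?thesis using z by blast
  qed
  obtain c where c: "a < c" "c < b" "f1 c = 0" using rolle[OF assms(1) _ f(1)] assms by auto
  obtain c1 where c1: "a < c1" "c1 < c" "f2 c1 = 0" using rolle[OF c(1) _ f(2)] c assms by auto
  obtain c2 where c2: "c < c2" "c2 < b" "f2 c2 = 0" using rolle[OF c(2) _ f(2)] c assms by auto
  have "c1 < c2" using c1 c2 by linarith
  then obtain c3 where c3: "c1 < c3" "c3 < c2" "f3 c3 = 0" using rolle[OF _ _ f(3)] c1 c2 by metis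
  show "\<exists>t. a < t \<and> t < b \<and> f2 t = 0" using c1 c by (intro exI[of _ c1]) auto
  show "\<exists>t. a < t \<and> t < b \<and> f3 t = 0" using c1 c2 c3 by (intro exI[of _ c3]) auto
qed

section \<open>The hypocycloid\<close>

text \<open>The equations \<open>e cos 3t + l sin 2t - m cos 2t = 0\<close> and its \<open>t\<close>-derivative say that \<open>(l, m)\<close> lies
  on a hypocycloid with six cusps, parametrised by \<open>t\<close>.\<close>

definition hypo1 :: "real \<Rightarrow> real \<Rightarrow> real" where
  "hypo1 e t = e * (3 / 2 * sin (3 * t) * cos (2 * t) - cos (3 * t) * sin (2 * t))"

definition hypo2 :: "real \<Rightarrow> real \<Rightarrow> real" where
  "hypo2 e t = e * (3 / 2 * sin (3 * t) * sin (2 * t) + cos (3 * t) * cos (2 * t))"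

lemma hypo_harmonics:
  "hypo1 e t = e / 4 * (5 * sin t + sin (5 * t))" "hypo2 e t = e / 4 * (5 * cos t - cos (5 * t))"
proof -
  have "sin (3 * t + 2 * t) = sin (5 * t)" "sin (3 * t - 2 * t) = sin t"
    "cos (3 * t + 2 * t) = cos (5 * t)" "cos (3 * t - 2 * t) = cos t" by simp_all
  then have *: "sin (5 * t) = sin (3 * t) * cos (2 * t) + cos (3 * t) * sin (2 * t)"
    "sin t = sin (3 * t) * cos (2 * t) - cos (3 * t) * sin (2 * t)"
    "cos (5 * t) = cos (3 * t) * cos (2 * t) - sin (3 * t) * sin (2 * t)"
    "cos t = cos (3 * t) * cos (2 * t) + sin (3 * t) * sin (2 * t)"
    by (metis sin_add sin_diff cos_add cos_diff)+
  show "hypo1 e t = e / 4 * (5 * sin t + sin (5 * t))"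
    unfolding hypo1_def *(1) by (subst *(2)) (simp add: field_simps)
  show "hypo2 e t = e / 4 * (5 * cos t - cos (5 * t))"
    unfolding hypo2_def *(3) by (subst *(4)) (simp add: field_simps)
qed

lemma chord_eq: "(sin a - sin b)\<^sup>2 + (cos a - cos b)\<^sup>2 = 2 - 2 * cos (a - b :: real)"
proof -
  have "(sin a)\<^sup>2 + (cos a)\<^sup>2 = 1" "(sin b)\<^sup>2 + (cos b)\<^sup>2 = 1" by simp_all
  then show ?thesis unfolding cos_diff power2_diff by (simp add: algebra_simps)
qed

lemma cos_5: "cos (5 * x) = 16 * cos x ^ 5 - 20 * cos x ^ 3 + 5 * cos (x::real)"
proof -
  have "cos (5 * x) = cos (2 * x + 3 * x)" by simp
  also have "\<dots> = cos (2 * x) * cos (3 * x) - sin (2 * x) * sin (3 * x)" by (rule cos_add)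
  also have "sin (3 * x) = sin (2 * x + x)" by simp
  also have "\<dots> = sin (2 * x) * cos x + cos (2 * x) * sin x" by (rule sin_add)
  also have "sin (2 * x) * (sin (2 * x) * cos x + cos (2 * x) * sin x)
      = (sin x)\<^sup>2 * (4 * cos x ^ 3 + 2 * cos x * cos (2 * x))"
    unfolding sin_double[of x] by (simp add: power2_eq_square power3_eq_cube algebra_simps)
  also have "(sin x)\<^sup>2 = 1 - (cos x)\<^sup>2" by (simp add: sin_squared_eq)
  finally show ?thesis unfolding cos_treble_cos cos_double_cos
    by (simp add: algebra_simps power2_eq_square power3_eq_cube power_numeral_reduce)
qed

text \<open>The distance of two points of the hypocycloid is computed from the chords of its two harmonics, and the
  faster one is too small to compensate the slower one: the curve has no self-intersections.\<close>

lemma hypo_inj: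
  assumes "e \<noteq> 0" "hypo1 e s = hypo1 e t" "hypo2 e s = hypo2 e t"
  shows "cos (s - t) = 1"
proof -
  have a: "5 * (sin s - sin t) = - (sin (5 * s) - sin (5 * t))" "5 * (cos s - cos t) = cos (5 * s) - cos (5 * t)"
  proof -
    have "5 * sin s + sin (5 * s) = 5 * sin t + sin (5 * t)" "5 * cos s - cos (5 * s) = 5 * cos t - cos (5 * t)"
      using assms unfolding hypo_harmonics by simp_all
    then show "5 * (sin s - sin t) = - (sin (5 * s) - sin (5 * t))" "5 * (cos s - cos t) = cos (5 * s) - cos (5 * t)"
      by (simp_all add: algebra_simps)
  qed
  have "25 * ((sin s - sin t)\<^sup>2 + (cos s - cos t)\<^sup>2) = (5 * (sin s - sin t))\<^sup>2 + (5 * (cos s - cos t))\<^sup>2"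
    unfolding power_mult_distrib by simp
  also have "\<dots> = (sin (5 * s) - sin (5 * t))\<^sup>2 + (cos (5 * s) - cos (5 * t))\<^sup>2"
    unfolding a using power2_commute[of "sin (5 * t)" "sin (5 * s)"] by simp
  finally have "25 * (2 - 2 * cos (s - t)) = 2 - 2 * cos (5 * s - 5 * t)" unfolding chord_eq .
  then have "25 * (2 - 2 * cos (s - t)) = 2 - 2 * cos (5 * (s - t))"
    by (simp only: right_diff_distrib)
  moreover have "25 * (2 - 2 * A) = 2 - 2 * B \<Longrightarrow> 25 * (1 - A) = 1 - B" for A B :: real by (simp add: field_simps)
  ultimately have "25 * (1 - cos (s - t)) = 1 - cos (5 * (s - t))" by blast
  then have "(cos (s - t) - 1)\<^sup>2 * ((cos (s - t) + 1) * ((2 * cos (s - t) + 1)\<^sup>2 + 2) + 3) = 0"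
    unfolding cos_5 by (simp add: algebra_simps power2_eq_square power3_eq_cube power_numeral_reduce)
  moreover have "(cos (s - t) + 1) * ((2 * cos (s - t) + 1)\<^sup>2 + 2) + 3 > 0"
  proof -
    have "0 \<le> cos (s - t) + 1" using cos_ge_minus_one[of "s - t"] by linarith
    then have "0 \<le> (cos (s - t) + 1) * ((2 * cos (s - t) + 1)\<^sup>2 + 2)" by (rule mult_nonneg_nonneg) simp
    then show ?thesis by linarith
  qed
  ultimately show ?thesis by (metis less_irrefl mult_eq_0_iff power_eq_0_iff right_minus_eq)
qed

section \<open>Families of functions with the principal part of the vertex function\<close>

lemma reduce_angle: "\<exists>k::int. a \<le> t + 2 * pi * of_int k \<and> t + 2 * pi * of_int k < a + 2 * pi"
proof (rule exI[of _ "- \<lfloor>(t - a) / (2 * pi)\<rfloor>"])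
  let ?q = "(t - a) / (2 * pi)"
  have q: "of_int \<lfloor>?q\<rfloor> \<le> ?q" "?q < of_int \<lfloor>?q\<rfloor> + 1" by linarith+
  have tq: "t - a = 2 * pi * ?q" by simp
  have "2 * pi * of_int \<lfloor>?q\<rfloor> \<le> 2 * pi * ?q" by (intro mult_left_mono q) simp
  moreover have "2 * pi * ?q < 2 * pi * (of_int \<lfloor>?q\<rfloor> + 1)" by (intro mult_strict_left_mono q) simp
  ultimately show "a \<le> t + 2 * pi * of_int (- \<lfloor>?q\<rfloor>) \<and> t + 2 * pi * of_int (- \<lfloor>?q\<rfloor>) < a + 2 * pi"
    using tq by (simp add: algebra_simps)
qed

text \<open>The coordinate along \<open>bs\<close> is the square root \<open>s\<close> of the level, those along \<open>bl\<close> and \<open>bm\<close> are \<open>\<lambda>\<close>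
  and \<open>\<mu>\<close>, and all others are parameters. The values of the coefficients at \<open>0\<close> are the principal part, and \<open>V_flip\<close>
  says that a half turn exchanges \<open>s\<close> and \<open>- s\<close>.\<close>

locale vertex_family =
  fixes V a0 a1 a2 :: "'x::euclidean_space \<times> real \<Rightarrow> real" and e r :: real and bs bl bm :: 'x
  assumes e: "e \<noteq> 0" and r: "r > 0"
    and basis: "bs \<in> Basis" "bl \<in> Basis" "bm \<in> Basis" "bs \<noteq> bl" "bs \<noteq> bm" "bl \<noteq> bm"
    and smooth_a: "smooth_on (ball 0 r \<times> UNIV) a0" "smooth_on (ball 0 r \<times> UNIV) a1" "smooth_on (ball 0 r \<times> UNIV) a2"
    and V_eq: "\<And>x t. x \<in> ball 0 r \<Longrightarrow> V (x, t) = (x \<bullet> bs) * a0 (x, t) + (x \<bullet> bl) * a1 (x, t) + (x \<bullet> bm) * a2 (x, t)"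
    and a_0: "\<And>t. a0 (0, t) = - e * cos (3 * t)" "\<And>t. a1 (0, t) = - sin (2 * t)" "\<And>t. a2 (0, t) = cos (2 * t)"
    and V_flip: "\<And>x t. x \<in> ball 0 r \<Longrightarrow> V (x, t + pi) = V (x - (2 * (x \<bullet> bs)) *\<^sub>R bs, t)"
begin

abbreviation D :: "('x \<times> real \<Rightarrow> real) \<Rightarrow> 'x \<times> real \<Rightarrow> real" where
  "D \<equiv> dird (0, 1)"

abbreviation \<Omega> :: "('x \<times> real) set" where
  "\<Omega> \<equiv> ball 0 r \<times> UNIV"

lemma open_\<Omega>: "open \<Omega>" by (intro open_Times) auto

lemma inner_basis [simp]: "bs \<bullet> bs = 1" "bl \<bullet> bl = 1" "bm \<bullet> bm = 1" "bs \<bullet> bl = 0" "bl \<bullet> bs = 0"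
  "bs \<bullet> bm = 0" "bm \<bullet> bs = 0" "bl \<bullet> bm = 0" "bm \<bullet> bl = 0"
  using basis by (simp_all add: inner_Basis inner_not_same_Basis)

lemma smooth_V: "smooth_on \<Omega> V"
proof (rule smooth_on_cong[OF open_\<Omega>])
  show "smooth_on \<Omega> (\<lambda>z. (fst z \<bullet> bs) * a0 z + (fst z \<bullet> bl) * a1 z + (fst z \<bullet> bm) * a2 z)"
    by (intro smooth_intros open_\<Omega> smooth_a)
qed (auto simp: V_eq)

lemma D_deriv:
  assumes "smooth_on \<Omega> f" "x \<in> ball 0 r"
  shows "((\<lambda>t. f (x, t)) has_real_derivative D f (x, t)) (at t)"
  using line_has_derivative[of f "(x, 0)" t "(0, 1)"] smooth_on_differentiable[OF assms(1), of "(x, t)"] assms(2)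
  by auto

lemma D_eqI:
  assumes "smooth_on \<Omega> f" "x \<in> ball 0 r" "((\<lambda>t. f (x, t)) has_real_derivative d) (at t)"
  shows "D f (x, t) = d"
  using DERIV_unique[OF D_deriv[OF assms(1,2)] assms(3)] .

lemma smooth_D: "smooth_on \<Omega> f \<Longrightarrow> smooth_on \<Omega> (D f)"
  by (rule smooth_on_dird)

lemmas smooth_DV = smooth_V[THEN smooth_D] smooth_V[THEN smooth_D, THEN smooth_D]
  smooth_V[THEN smooth_D, THEN smooth_D, THEN smooth_D]
lemmas smooth_Da = smooth_a[THEN smooth_D] smooth_a[THEN smooth_D, THEN smooth_D]
  smooth_a[THEN smooth_D, THEN smooth_D, THEN smooth_D]

lemma D_combination:
  assumes sm: "smooth_on \<Omega> f" "smooth_on \<Omega> f0" "smooth_on \<Omega> f1" "smooth_on \<Omega> f2" and x: "x \<in> ball 0 r"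
    and f: "\<And>t. f (x, t) = (x \<bullet> bs) * f0 (x, t) + (x \<bullet> bl) * f1 (x, t) + (x \<bullet> bm) * f2 (x, t)"
  shows "D f (x, t) = (x \<bullet> bs) * D f0 (x, t) + (x \<bullet> bl) * D f1 (x, t) + (x \<bullet> bm) * D f2 (x, t)"
  unfolding f
  by (rule D_eqI[OF sm(1) x]) (auto intro!: derivative_eq_intros D_deriv[OF sm(2) x] D_deriv[OF sm(3) x] D_deriv[OF sm(4) x] simp: f)

lemma DV_eq:
  assumes x: "x \<in> ball 0 r"
  shows "D V (x, t) = (x \<bullet> bs) * D a0 (x, t) + (x \<bullet> bl) * D a1 (x, t) + (x \<bullet> bm) * D a2 (x, t)"
    and "D (D V) (x, t) = (x \<bullet> bs) * D (D a0) (x, t) + (x \<bullet> bl) * D (D a1) (x, t) + (x \<bullet> bm) * D (D a2) (x, t)"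
    and "D (D (D V)) (x, t) = (x \<bullet> bs) * D (D (D a0)) (x, t) + (x \<bullet> bl) * D (D (D a1)) (x, t) + (x \<bullet> bm) * D (D (D a2)) (x, t)"
  by (intro D_combination smooth_V smooth_a smooth_DV smooth_Da x V_eq)+

lemma D_a_0:
  "D a0 (0, t) = 3 * e * sin (3 * t)" "D a1 (0, t) = - 2 * cos (2 * t)" "D a2 (0, t) = - 2 * sin (2 * t)"
  "D (D a0) (0, t) = 9 * e * cos (3 * t)" "D (D a1) (0, t) = 4 * sin (2 * t)" "D (D a2) (0, t) = - 4 * cos (2 * t)"
  "D (D (D a0)) (0, t) = - 27 * e * sin (3 * t)" "D (D (D a1)) (0, t) = 8 * cos (2 * t)"
  "D (D (D a2)) (0, t) = 8 * sin (2 * t)"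
proof -
  have 0: "0 \<in> ball (0::'x) r" using r by simp
  show 1: "D a0 (0, t) = 3 * e * sin (3 * t)" "D a1 (0, t) = - 2 * cos (2 * t)" "D a2 (0, t) = - 2 * sin (2 * t)" for t
    by (rule D_eqI[OF _ 0], rule smooth_a, unfold a_0, (auto intro!: derivative_eq_intros)[1])+
  show 2: "D (D a0) (0, t) = 9 * e * cos (3 * t)" "D (D a1) (0, t) = 4 * sin (2 * t)" "D (D a2) (0, t) = - 4 * cos (2 * t)" for t
    by (rule D_eqI[OF _ 0], rule smooth_Da, unfold 1, (auto intro!: derivative_eq_intros)[1])+
  show "D (D (D a0)) (0, t) = - 27 * e * sin (3 * t)" "D (D (D a1)) (0, t) = 8 * cos (2 * t)"
    "D (D (D a2)) (0, t) = 8 * sin (2 * t)"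
    by (rule D_eqI[OF _ 0], rule smooth_Da, unfold 2, (auto intro!: derivative_eq_intros)[1])+
qed

definition \<Delta> :: "'x \<times> real \<Rightarrow> real" where
  "\<Delta> z = a1 z * D a2 z - a2 z * D a1 z"
definition M1 :: "'x \<times> real \<Rightarrow> real" where
  "M1 z = (a2 z * D a0 z - a0 z * D a2 z) / \<Delta> z"
definition M2 :: "'x \<times> real \<Rightarrow> real" where
  "M2 z = (a0 z * D a1 z - a1 z * D a0 z) / \<Delta> z"
definition \<Delta>x :: "'x \<times> real \<Rightarrow> real" where
  "\<Delta>x z = dird (bl, 0) V z * dird (bm, 0) (D V) z - dird (bm, 0) V z * dird (bl, 0) (D V) z"

lemma \<Delta>_0: "\<Delta> (0, t) = 2"
proof -
  have "\<Delta> (0, t) = 2 * ((sin (2 * t))\<^sup>2 + (cos (2 * t))\<^sup>2)"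
    unfolding \<Delta>_def a_0 D_a_0 by (simp add: power2_eq_square)
  then show ?thesis by simp
qed

lemma M_0: "M1 (0, t) = hypo1 e t" "M2 (0, t) = hypo2 e t"
  unfolding M1_def M2_def \<Delta>_0 hypo1_def hypo2_def unfolding a_0 D_a_0 by (simp_all add: field_simps)

lemma dird_V_0:
  "dird (b, 0) V (0, t) = (b \<bullet> bs) * a0 (0, t) + (b \<bullet> bl) * a1 (0, t) + (b \<bullet> bm) * a2 (0, t)" (is "?A t")
  "dird (b, 0) (D V) (0, t) = (b \<bullet> bs) * D a0 (0, t) + (b \<bullet> bl) * D a1 (0, t) + (b \<bullet> bm) * D a2 (0, t)" (is ?B)
proof -
  have 0: "0 \<in> ball (0::'x) r" and z0: "(0, t) \<in> \<Omega>" for t using r by auto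
  show A: "?A t" for t
  proof -
    have "dird (b, 0) V (0, t) = dird (b, 0) (\<lambda>z. (fst z \<bullet> bs) * a0 z + (fst z \<bullet> bl) * a1 z + (fst z \<bullet> bm) * a2 z) (0, t)"
      by (rule dird_cong[OF open_\<Omega> z0]) (auto simp: V_eq)
    also have "\<dots> = (b \<bullet> bs) * a0 (0, t) + (b \<bullet> bl) * a1 (0, t) + (b \<bullet> bm) * a2 (0, t)"
    proof (rule dird_line)
      show "(\<lambda>z. (fst z \<bullet> bs) * a0 z + (fst z \<bullet> bl) * a1 z + (fst z \<bullet> bm) * a2 z) differentiable at (0, t)"
        by (rule smooth_on_differentiable[OF _ z0]) (intro smooth_intros open_\<Omega> smooth_a)
      have a: "((\<lambda>\<sigma>. f ((0, t) + \<sigma> *\<^sub>R (b, 0))) has_real_derivative dird (b, 0) f (0, t)) (at 0)"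
        if "smooth_on \<Omega> f" for f
        using line_has_derivative[of f "(0, t)" 0 "(b, 0)"] smooth_on_differentiable[OF that z0] by simp
      show "((\<lambda>\<sigma>. (fst ((0, t) + \<sigma> *\<^sub>R (b, 0)) \<bullet> bs) * a0 ((0, t) + \<sigma> *\<^sub>R (b, 0)) +
          (fst ((0, t) + \<sigma> *\<^sub>R (b, 0)) \<bullet> bl) * a1 ((0, t) + \<sigma> *\<^sub>R (b, 0)) +
          (fst ((0, t) + \<sigma> *\<^sub>R (b, 0)) \<bullet> bm) * a2 ((0, t) + \<sigma> *\<^sub>R (b, 0))) has_real_derivative
          (b \<bullet> bs) * a0 (0, t) + (b \<bullet> bl) * a1 (0, t) + (b \<bullet> bm) * a2 (0, t)) (at 0)"
        using a[OF smooth_a(1)] a[OF smooth_a(2)] a[OF smooth_a(3)] by (auto intro!: derivative_eq_intros)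
    qed
    finally show ?thesis .
  qed
  have "dird (b, 0) (D V) (0, t) = D (dird (b, 0) V) (0, t)"
    by (rule dird_commute[OF open_\<Omega> smooth_V z0])
  also have "\<dots> = (b \<bullet> bs) * D a0 (0, t) + (b \<bullet> bl) * D a1 (0, t) + (b \<bullet> bm) * D a2 (0, t)"
    by (rule D_eqI[OF smooth_on_dird[OF smooth_V] 0], unfold A)
      (auto intro!: derivative_eq_intros D_deriv[OF smooth_a(1) 0] D_deriv[OF smooth_a(2) 0] D_deriv[OF smooth_a(3) 0])
  finally show ?B .
qed

lemma \<Delta>x_0: "\<Delta>x (0, t) = 2"
  using \<Delta>_0[of t] unfolding \<Delta>x_def \<Delta>_def dird_V_0 by simp

lemma continuous_coeffs:
  "continuous_on \<Omega> \<Delta>" "continuous_on \<Omega> \<Delta>x"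
  "continuous_on {z \<in> \<Omega>. \<Delta> z \<noteq> 0} M1" "continuous_on {z \<in> \<Omega>. \<Delta> z \<noteq> 0} M2" "open {z \<in> \<Omega>. \<Delta> z \<noteq> 0}"
proof -
  note c = smooth_on_continuous
  show \<Delta>: "continuous_on \<Omega> \<Delta>" "continuous_on \<Omega> \<Delta>x"
    unfolding \<Delta>_def \<Delta>x_def
    by (intro continuous_intros c smooth_a smooth_Da smooth_on_dird smooth_V)+
  have sub: "{z \<in> \<Omega>. \<Delta> z \<noteq> 0} \<subseteq> \<Omega>" by blast
  show "continuous_on {z \<in> \<Omega>. \<Delta> z \<noteq> 0} M1" "continuous_on {z \<in> \<Omega>. \<Delta> z \<noteq> 0} M2"
    unfolding M1_def M2_def
    by (intro continuous_intros continuous_on_subset[OF c sub] continuous_on_subset[OF \<Delta>(1) sub] smooth_a smooth_Da; simp)+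
  show "open {z \<in> \<Omega>. \<Delta> z \<noteq> 0}"
    using continuous_open_preimage[OF \<Delta>(1) open_\<Omega>, of "- {0}"] by (simp add: vimage_def Int_def open_Compl)
qed

subsection \<open>Double and triple zeros\<close>

definition Z2 :: "'x \<Rightarrow> real \<Rightarrow> bool" where
  "Z2 x t \<longleftrightarrow> V (x, t) = 0 \<and> D V (x, t) = 0"
definition Z3 :: "'x \<Rightarrow> real \<Rightarrow> bool" where
  "Z3 x t \<longleftrightarrow> Z2 x t \<and> D (D V) (x, t) = 0"
definition flip :: "'x \<Rightarrow> 'x" where
  "flip x = x - (2 * (x \<bullet> bs)) *\<^sub>R bs"

lemma flip_inner [simp]: "flip x \<bullet> bs = - (x \<bullet> bs)" "flip x \<bullet> bl = x \<bullet> bl" "flip x \<bullet> bm = x \<bullet> bm"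
  by (simp_all add: flip_def inner_diff_left)

lemma flip_flip [simp]: "flip (flip x) = x"
  unfolding flip_def by (simp add: inner_diff_left algebra_simps)

lemma norm_flip [simp]: "norm (flip x) = norm x"
proof -
  have "flip x \<bullet> flip x = x \<bullet> x"
    unfolding flip_def by (simp add: inner_diff_left inner_diff_right inner_commute algebra_simps)
  then show ?thesis by (simp add: norm_eq_sqrt_inner)
qed

lemma D_shift:
  assumes "smooth_on \<Omega> f" "x \<in> ball 0 r" "y \<in> ball 0 r" "\<And>t. f (x, t + c) = f (y, t)"
  shows "D f (x, t + c) = D f (y, t)"
proof (rule D_eqI[OF assms(1,3), symmetric])
  have "((\<lambda>t. f (x, t + c)) has_real_derivative D f (x, t + c)) (at t)"
    using D_deriv[OF assms(1,2), of "t + c"] by (simp add: DERIV_shift)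
  then show "((\<lambda>t. f (y, t)) has_real_derivative D f (x, t + c)) (at t)" unfolding assms(4) .
qed

lemma Z_flip:
  assumes x: "x \<in> ball 0 r"
  shows "Z2 x (t + pi) \<longleftrightarrow> Z2 (flip x) t" "Z3 x (t + pi) \<longleftrightarrow> Z3 (flip x) t"
proof -
  have y: "flip x \<in> ball 0 r" using x by simp
  have 0: "V (x, t + pi) = V (flip x, t)" for t using V_flip[OF x] by (simp add: flip_def)
  have 1: "D V (x, t + pi) = D V (flip x, t)" for t by (rule D_shift[OF smooth_V x y 0])
  have 2: "D (D V) (x, t + pi) = D (D V) (flip x, t)" for t by (rule D_shift[OF smooth_DV(1) x y 1])
  show "Z2 x (t + pi) \<longleftrightarrow> Z2 (flip x) t" "Z3 x (t + pi) \<longleftrightarrow> Z3 (flip x) t"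
    unfolding Z2_def Z3_def 0 1 2 by simp_all
qed

lemma Z_2pi:
  assumes x: "x \<in> ball 0 r"
  shows "Z2 x (t + 2 * pi) \<longleftrightarrow> Z2 x t" "Z3 x (t + 2 * pi) \<longleftrightarrow> Z3 x t"
  using Z_flip[OF x, of "t + pi"] Z_flip[of "flip x" t] x by (simp_all add: add.assoc flip: mult_2)

lemma Z_2pi_int:
  assumes x: "x \<in> ball 0 r"
  shows "Z2 x (t + 2 * pi * of_int k) \<longleftrightarrow> Z2 x t" "Z3 x (t + 2 * pi * of_int k) \<longleftrightarrow> Z3 x t"
proof -
  have *: "P (t + 2 * pi * of_int k) \<longleftrightarrow> P t" if P: "\<And>t. P (t + 2 * pi) \<longleftrightarrow> P t" for P :: "real \<Rightarrow> bool"
  proof (induction k rule: int_induct[where k = 0])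
    case (step1 i)
    then show ?case using P[of "t + 2 * pi * of_int i"] by (simp add: algebra_simps)
  next
    case (step2 i)
    then show ?case using P[of "t + 2 * pi * of_int (i - 1)"] by (simp add: algebra_simps)
  qed simp
  show "Z2 x (t + 2 * pi * of_int k) \<longleftrightarrow> Z2 x t" "Z3 x (t + 2 * pi * of_int k) \<longleftrightarrow> Z3 x t"
    by (rule *, rule Z_2pi[OF x])+
qed

text \<open>Cramer's rule for the linear system \<open>V = V\<^sub>t = 0\<close> in \<open>(\<lambda>, \<mu>)\<close>; \<open>M1\<close> and \<open>M2\<close> deform the hypocycloid.\<close>

lemma Z2_iff_M:
  assumes "x \<in> ball 0 r" "\<Delta> (x, t) \<noteq> 0"
  shows "Z2 x t \<longleftrightarrow> x \<bullet> bl = (x \<bullet> bs) * M1 (x, t) \<and> x \<bullet> bm = (x \<bullet> bs) * M2 (x, t)" (is "_ \<longleftrightarrow> ?R")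
proof -
  let ?s = "x \<bullet> bs" and ?l = "x \<bullet> bl" and ?m = "x \<bullet> bm"
  let ?z = "(x, t)"
  have V: "V ?z = ?s * a0 ?z + ?l * a1 ?z + ?m * a2 ?z" "D V ?z = ?s * D a0 ?z + ?l * D a1 ?z + ?m * D a2 ?z"
    using V_eq DV_eq(1) assms(1) by auto
  have l: "?l * \<Delta> ?z - ?s * (a2 ?z * D a0 ?z - a0 ?z * D a2 ?z) = D a2 ?z * V ?z - a2 ?z * D V ?z"
    and m: "?m * \<Delta> ?z - ?s * (a0 ?z * D a1 ?z - a1 ?z * D a0 ?z) = a1 ?z * D V ?z - D a1 ?z * V ?z"
    unfolding V \<Delta>_def by (simp_all add: algebra_simps)
  have "?R \<longleftrightarrow> D a2 ?z * V ?z - a2 ?z * D V ?z = 0 \<and> a1 ?z * D V ?z - D a1 ?z * V ?z = 0"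
    unfolding l[symmetric] m[symmetric] M1_def M2_def using assms(2) by (simp add: field_simps)
  also have "\<dots> \<longleftrightarrow> V ?z = 0 \<and> D V ?z = 0"
  proof safe
    assume h: "D a2 ?z * V ?z - a2 ?z * D V ?z = 0" "a1 ?z * D V ?z - D a1 ?z * V ?z = 0"
    have "V ?z * \<Delta> ?z = a1 ?z * (D a2 ?z * V ?z - a2 ?z * D V ?z) + a2 ?z * (a1 ?z * D V ?z - D a1 ?z * V ?z)"
      "D V ?z * \<Delta> ?z = D a1 ?z * (D a2 ?z * V ?z - a2 ?z * D V ?z) + D a2 ?z * (a1 ?z * D V ?z - D a1 ?z * V ?z)"
      unfolding \<Delta>_def by (simp_all add: algebra_simps)
    then show "V ?z = 0" "D V ?z = 0" unfolding h using assms(2) by simp_all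
  qed auto
  finally show ?thesis unfolding Z2_def by blast
qed

subsection \<open>Uniqueness of the degenerate point\<close>

text \<open>When \<open>u\<close> is a double zero, \<open>V\<^sub>t\<^sub>t\<close> and \<open>V\<^sub>t\<^sub>t\<^sub>t\<close> are divisible by \<open>s\<close>; \<open>N2\<close> and \<open>N3\<close> are the quotients,
  which remain meaningful at \<open>s = 0\<close>. Keeping \<open>u\<close> and \<open>t\<close> apart allows an application of Rolle's theorem in \<open>t\<close>.\<close>

definition N2 :: "'x \<times> real \<times> real \<Rightarrow> real" where
  "N2 = (\<lambda>(x, u, t). D (D a0) (x, t) + M1 (x, u) * D (D a1) (x, t) + M2 (x, u) * D (D a2) (x, t))"
definition N3 :: "'x \<times> real \<times> real \<Rightarrow> real" where
  "N3 = (\<lambda>(x, u, t). D (D (D a0)) (x, t) + M1 (x, u) * D (D (D a1)) (x, t) + M2 (x, u) * D (D (D a2)) (x, t))"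

definition \<Omega>3 :: "('x \<times> real \<times> real) set" where
  "\<Omega>3 = {z. (fst z, fst (snd z)) \<in> {z \<in> \<Omega>. \<Delta> z \<noteq> 0}}"

lemma D_V_N:
  assumes "x \<in> ball 0 r" "\<Delta> (x, u) \<noteq> 0" "Z2 x u"
  shows "D (D V) (x, t) = (x \<bullet> bs) * N2 (x, u, t)" "D (D (D V)) (x, t) = (x \<bullet> bs) * N3 (x, u, t)"
  using assms(3) unfolding Z2_iff_M[OF assms(1,2)] DV_eq(2,3)[OF assms(1)] N2_def N3_def
  by (simp_all add: algebra_simps)

lemma open_\<Omega>3: "open \<Omega>3"
  using open_vimage[OF continuous_coeffs(5), of "\<lambda>z::'x \<times> real \<times> real. (fst z, fst (snd z))"]
  unfolding \<Omega>3_def vimage_def by (simp add: continuous_on_Pair continuous_on_fst continuous_on_snd continuous_on_id)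

lemma continuous_N: "continuous_on \<Omega>3 N2" "continuous_on \<Omega>3 N3"
proof -
  have M: "continuous_on \<Omega>3 (\<lambda>z. M1 (fst z, fst (snd z)))" "continuous_on \<Omega>3 (\<lambda>z. M2 (fst z, fst (snd z)))"
    by (rule continuous_on_compose2[OF continuous_coeffs(3)] continuous_on_compose2[OF continuous_coeffs(4)];
        (intro continuous_intros | (simp only: \<Omega>3_def, blast)))+
  have a: "continuous_on \<Omega>3 (\<lambda>z. f (fst z, snd (snd z)))" if "smooth_on \<Omega> f" for f :: "'x \<times> real \<Rightarrow> real"
    by (rule continuous_on_compose2[OF smooth_on_continuous[OF that]]) (auto simp: \<Omega>3_def intro!: continuous_intros)
  show "continuous_on \<Omega>3 N2" "continuous_on \<Omega>3 N3"
    unfolding N2_def N3_def split_beta by (intro continuous_intros M a smooth_Da)+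
qed

lemma N_0: "N2 (0, t, t) = 5 * e * cos (3 * t)" "N3 (0, t, t) = - 15 * e * sin (3 * t)"
proof -
  have sc: "(sin (2 * t))\<^sup>2 + (cos (2 * t))\<^sup>2 = 1" by simp
  have "N2 (0, t, t) = 9 * e * cos (3 * t) - 4 * e * cos (3 * t) * ((sin (2 * t))\<^sup>2 + (cos (2 * t))\<^sup>2)"
    unfolding N2_def prod.case M_0 D_a_0 hypo1_def hypo2_def by algebra
  then show "N2 (0, t, t) = 5 * e * cos (3 * t)" unfolding sc by simp
  have "N3 (0, t, t) = - 27 * e * sin (3 * t) + 12 * e * sin (3 * t) * ((sin (2 * t))\<^sup>2 + (cos (2 * t))\<^sup>2)"
    unfolding N3_def prod.case M_0 D_a_0 hypo1_def hypo2_def by algebra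
  then show "N3 (0, t, t) = - 15 * e * sin (3 * t)" unfolding sc by simp
qed

lemma N_0_nonzero: "N2 (0, t, t) \<noteq> 0 \<or> N3 (0, t, t) \<noteq> 0"
  using e sin_zero_norm_cos_one[of "3 * t"] unfolding N_0 by force

text \<open>A radius on which the four properties of the principal part that matter persist: \<open>(\<lambda>, \<mu>)\<close> can be eliminated in two
  ways, the double zeros stay near the cone, they are unique up to full turns, and triple zeros are never quadruple.\<close>

definition good :: "real \<Rightarrow> bool" where
  "good \<rho> \<longleftrightarrow> 0 < \<rho> \<and> \<rho> \<le> r \<and> (\<forall>x\<in>ball 0 \<rho>.
     (\<forall>t\<in>{-4*pi..4*pi}. \<Delta> (x, t) > 1 \<and> \<Delta>x (x, t) > 1 \<and> \<bar>M1 (x, t)\<bar> < 3 * \<bar>e\<bar> \<and> \<bar>M2 (x, t)\<bar> < 3 * \<bar>e\<bar>) \<and>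
     (\<forall>z\<in>{0..2*pi} \<times> {-pi..pi}. x \<bullet> bs \<noteq> 0 \<longrightarrow> Z2 x (fst z) \<longrightarrow> Z2 x (fst z + snd z) \<longrightarrow> snd z = 0) \<and>
     (\<forall>t\<in>{0..2*pi}. x \<bullet> bs \<noteq> 0 \<longrightarrow> Z3 x t \<longrightarrow> D (D (D V)) (x, t) \<noteq> 0))"

lemma zero_in [simp]: "(0, t) \<in> \<Omega>" "(0, t) \<in> {z \<in> \<Omega>. \<Delta> z \<noteq> 0}" "(0, u, t) \<in> \<Omega>3"
  using r \<Delta>_0 by (simp_all add: \<Omega>3_def)

lemma hypo_bound: "\<bar>hypo1 e t\<bar> < 3 * \<bar>e\<bar>" "\<bar>hypo2 e t\<bar> < 3 * \<bar>e\<bar>"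
proof -
  have "\<bar>5 * sin t + sin (5 * t)\<bar> \<le> 6" "\<bar>5 * cos t - cos (5 * t)\<bar> \<le> 6"
    using abs_sin_le_one[of t] abs_sin_le_one[of "5 * t"] abs_cos_le_one[of t] abs_cos_le_one[of "5 * t"] by linarith+
  then have "\<bar>e\<bar> / 4 * \<bar>5 * sin t + sin (5 * t)\<bar> \<le> \<bar>e\<bar> / 4 * 6" "\<bar>e\<bar> / 4 * \<bar>5 * cos t - cos (5 * t)\<bar> \<le> \<bar>e\<bar> / 4 * 6"
    by (intro mult_left_mono; simp)+
  then show "\<bar>hypo1 e t\<bar> < 3 * \<bar>e\<bar>" "\<bar>hypo2 e t\<bar> < 3 * \<bar>e\<bar>"
    unfolding hypo_harmonics using e by (simp_all add: abs_mult)
qed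

lemma cos_eq_1_imp_0: "cos d = 1 \<Longrightarrow> -pi \<le> d \<Longrightarrow> d \<le> pi \<Longrightarrow> d = (0::real)"
  using cos_inj_pi[of d 0] cos_inj_pi[of "- d" 0] by (cases "0 \<le> d") simp_all

text \<open>For different angles the points of the hypocycloid are different, which is stable. For equal angles
  two nearby double zeros would produce, by Rolle's theorem, zeros of both \<open>N2\<close> and \<open>N3\<close> close to the same angle, but
  these do not vanish simultaneously.\<close>

lemma unique_nearby:
  assumes d: "- pi \<le> d" "d \<le> pi"
  shows "\<forall>\<^sub>F z in nhds (0, (u, d)). fst z \<bullet> bs \<noteq> 0 \<longrightarrow> Z2 (fst z) (fst (snd z)) \<longrightarrow>
    Z2 (fst z) (fst (snd z) + snd (snd z)) \<longrightarrow> snd (snd z) = 0"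
proof (cases "d = 0")
  case False
  let ?u = "\<lambda>z::'x \<times> real \<times> real. (fst z, fst (snd z))" and ?v = "\<lambda>z::'x \<times> real \<times> real. (fst z, fst (snd z) + snd (snd z))"
  let ?S = "?u -` {z \<in> \<Omega>. \<Delta> z \<noteq> 0} \<inter> ?v -` {z \<in> \<Omega>. \<Delta> z \<noteq> 0}"
  let ?f = "\<lambda>z. (M1 (?u z) - M1 (?v z))\<^sup>2 + (M2 (?u z) - M2 (?v z))\<^sup>2"
  have S: "open ?S" by (intro open_Int open_vimage continuous_coeffs(5) continuous_intros)
  have cM: "continuous_on ?S (\<lambda>z. M1 (?u z))" "continuous_on ?S (\<lambda>z. M1 (?v z))"
    "continuous_on ?S (\<lambda>z. M2 (?u z))" "continuous_on ?S (\<lambda>z. M2 (?v z))"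
    by (rule continuous_on_compose2[OF continuous_coeffs(3)] continuous_on_compose2[OF continuous_coeffs(4)];
        (intro continuous_intros | blast))+
  have f: "continuous_on ?S ?f" by (intro continuous_intros cM)
  have "?f (0, (u, d)) \<noteq> 0"
  proof
    assume "?f (0, (u, d)) = 0"
    then have "hypo1 e u = hypo1 e (u + d)" "hypo2 e u = hypo2 e (u + d)"
      unfolding M_0[symmetric] by (auto simp: sum_power2_eq_zero_iff)
    then have "cos (u - (u + d)) = 1" by (rule hypo_inj[OF e])
    then show False using cos_eq_1_imp_0[OF _ d] False by simp
  qed
  then have "\<forall>\<^sub>F z in nhds (0, (u, d)). z \<in> ?S \<and> ?f z \<in> - {0}"
    by (intro eventually_continuous_on[OF f S]) (use zero_in in \<open>auto simp: open_Compl\<close>)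
  then show ?thesis
  proof eventually_elim
    case (elim z)
    show ?case
    proof (intro impI)
      assume s: "fst z \<bullet> bs \<noteq> 0" and Z: "Z2 (fst z) (fst (snd z))" "Z2 (fst z) (fst (snd z) + snd (snd z))"
      have in_S: "fst z \<in> ball 0 r" "\<Delta> (?u z) \<noteq> 0" "\<Delta> (?v z) \<noteq> 0" using elim by auto
      have "(fst z \<bullet> bs) * M1 (?u z) = (fst z \<bullet> bs) * M1 (?v z)" "(fst z \<bullet> bs) * M2 (?u z) = (fst z \<bullet> bs) * M2 (?v z)"
        using Z2_iff_M[OF in_S(1,2)] Z2_iff_M[OF in_S(1,3)] Z by metis+
      then have "?f z = 0" using s by simp
      then show "snd (snd z) = 0" using elim by blast
    qed
  qed
next
  case True
  have key: ?thesis
    if N: "continuous_on \<Omega>3 N" "N (0, u, u) \<noteq> 0"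
      and zero: "\<And>x a b. x \<in> ball 0 r \<Longrightarrow> a < b \<Longrightarrow> Z2 x a \<Longrightarrow> Z2 x b \<Longrightarrow> \<exists>t. a < t \<and> t < b \<and> Dk (x, t) = 0"
      and DkN: "\<And>x u t. x \<in> ball 0 r \<Longrightarrow> \<Delta> (x, u) \<noteq> 0 \<Longrightarrow> Z2 x u \<Longrightarrow> Dk (x, t) = (x \<bullet> bs) * N (x, u, t)"
    for N Dk
  proof -
    have "\<forall>\<^sub>F z in nhds (0, u, u). z \<in> \<Omega>3 \<and> N z \<in> - {0}"
      by (rule eventually_continuous_on[OF N(1) open_\<Omega>3]) (use N(2) zero_in in \<open>auto simp: open_Compl\<close>)
    then obtain \<epsilon> where \<epsilon>: "\<epsilon> > 0" "\<And>z. dist z (0, u, u) < \<epsilon> \<Longrightarrow> z \<in> \<Omega>3 \<and> N z \<noteq> 0"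
      unfolding eventually_nhds_metric by auto
    have box: "(x, v, t) \<in> \<Omega>3 \<and> N (x, v, t) \<noteq> 0"
      if "norm x < \<epsilon> / 6" "\<bar>v - u\<bar> < \<epsilon> / 6" "\<bar>t - u\<bar> < \<epsilon> / 3" for x v t
    proof (rule \<epsilon>(2))
      have "dist (x, v, t) (0, u, u) \<le> dist x 0 + dist (v, t) (u, u)"
        unfolding dist_Pair_Pair[of x] by (rule sqrt_sum_squares_le_sum) auto
      also have "dist (v, t) (u, u) \<le> dist v u + dist t u"
        unfolding dist_Pair_Pair by (rule sqrt_sum_squares_le_sum) auto
      finally have "dist (x, v, t) (0, u, u) \<le> norm x + (\<bar>v - u\<bar> + \<bar>t - u\<bar>)"
        by (simp only: dist_real_def dist_norm diff_zero)
      then show "dist (x, v, t) (0, u, u) < \<epsilon>" using that by linarith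
    qed
    show ?thesis
      unfolding eventually_nhds_metric
    proof (intro exI[of _ "\<epsilon> / 6"] conjI allI impI)
      fix z :: "'x \<times> real \<times> real"
      assume z: "dist z (0, u, d) < \<epsilon> / 6"
        and s: "fst z \<bullet> bs \<noteq> 0" and Z: "Z2 (fst z) (fst (snd z))" "Z2 (fst z) (fst (snd z) + snd (snd z))"
      obtain x v \<delta> where zeq: "z = (x, v, \<delta>)" by (metis prod.exhaust)
      have x: "norm x < \<epsilon> / 6" using dist_fst_le[of z "(0, u, d)"] z by (simp add: zeq dist_norm)
      have v: "\<bar>v - u\<bar> < \<epsilon> / 6"
        using dist_snd_le[of z "(0, u, d)"] dist_fst_le[of "(v, \<delta>)" "(u, d)"] z by (simp add: zeq dist_real_def)
      have \<delta>: "\<bar>\<delta>\<bar> < \<epsilon> / 6"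
        using dist_snd_le[of z "(0, u, d)"] dist_snd_le[of "(v, \<delta>)" "(u, d)"] z True by (simp add: zeq dist_real_def)
      have xv: "x \<in> ball 0 r" "\<Delta> (x, v) \<noteq> 0"
        using box[OF x v, of u] \<epsilon>(1) by (auto simp: \<Omega>3_def)
      show "snd (snd z) = 0"
      proof (rule ccontr)
        assume "snd (snd z) \<noteq> 0"
        then obtain t where t: "min v (v + \<delta>) < t" "t < max v (v + \<delta>)" "Dk (x, t) = 0"
          using zero[OF xv(1), of "min v (v + \<delta>)" "max v (v + \<delta>)"] Z
          by (cases "\<delta> > 0") (auto simp: zeq min_def max_def)
        then have "N (x, v, t) = 0" using DkN[OF xv] Z s by (simp add: zeq)
        moreover have "v - \<bar>\<delta>\<bar> \<le> min v (v + \<delta>)" "max v (v + \<delta>) \<le> v + \<bar>\<delta>\<bar>" by auto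
        then have "\<bar>t - u\<bar> < \<epsilon> / 3" using t(1,2) v \<delta> by linarith
        ultimately show False using box[OF x v] by blast
      qed
    qed (use \<epsilon> in auto)
  qed
  have R: "\<exists>t. a < t \<and> t < b \<and> D (D V) (x, t) = 0" "\<exists>t. a < t \<and> t < b \<and> D (D (D V)) (x, t) = 0"
    if "x \<in> ball 0 r" "a < b" "Z2 x a" "Z2 x b" for x a b
    using Rolle_double_zeros[OF that(2) D_deriv[OF smooth_V that(1)] D_deriv[OF smooth_DV(1) that(1)]
        D_deriv[OF smooth_DV(2) that(1)]] that(3,4) unfolding Z2_def by blast+
  show ?thesis
    using N_0_nonzero[of u] key[OF continuous_N(1) _ R(1) D_V_N(1)] key[OF continuous_N(2) _ R(2) D_V_N(2)] by blast
qed

lemma third_derivative_nearby: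
  "\<forall>\<^sub>F z in nhds (0, t). fst z \<bullet> bs \<noteq> 0 \<longrightarrow> Z3 (fst z) (snd z) \<longrightarrow> D (D (D V)) z \<noteq> 0"
proof -
  let ?w = "\<lambda>z::'x \<times> real. (fst z, snd z, snd z)"
  let ?S = "?w -` \<Omega>3" and ?f = "\<lambda>z. (N2 (?w z))\<^sup>2 + (N3 (?w z))\<^sup>2"
  have f: "continuous_on ?S ?f" "open ?S"
    by (intro continuous_intros open_vimage open_\<Omega>3 continuous_on_compose2[OF continuous_N(1)]
        continuous_on_compose2[OF continuous_N(2)]; blast)+
  have "\<forall>\<^sub>F z in nhds (0, t). z \<in> ?S \<and> ?f z \<in> - {0}"
    by (rule eventually_continuous_on[OF f])
      (use N_0_nonzero[of t] zero_in in \<open>auto simp: open_Compl sum_power2_eq_zero_iff\<close>)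
  then show ?thesis
  proof eventually_elim
    case (elim z)
    then have z: "fst z \<in> ball 0 r" "\<Delta> (fst z, snd z) \<noteq> 0" by (auto simp: \<Omega>3_def)
    show ?case
      using D_V_N[OF z, of "snd z"] elim unfolding Z3_def by auto
  qed
qed

lemma ex_good: "\<exists>\<rho>. good \<rho>"
proof -
  have 1: "\<forall>\<^sub>F x in nhds 0. \<forall>t\<in>{-4*pi..4*pi}. \<Delta> (x, t) > 1 \<and> \<Delta>x (x, t) > 1 \<and>
      \<bar>M1 (x, t)\<bar> < 3 * \<bar>e\<bar> \<and> \<bar>M2 (x, t)\<bar> < 3 * \<bar>e\<bar>"
  proof (rule eventually_ball_compact)
    fix t :: real
    have "\<forall>\<^sub>F z in nhds (0, t). z \<in> \<Omega> \<and> \<Delta> z \<in> {1<..}" "\<forall>\<^sub>F z in nhds (0, t). z \<in> \<Omega> \<and> \<Delta>x z \<in> {1<..}"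
      by (rule eventually_continuous_on[OF continuous_coeffs(1) open_\<Omega>] eventually_continuous_on[OF continuous_coeffs(2) open_\<Omega>];
          simp add: \<Delta>_0 \<Delta>x_0 r)+
    moreover have "\<forall>\<^sub>F z in nhds (0, t). z \<in> {z \<in> \<Omega>. \<Delta> z \<noteq> 0} \<and> M1 z \<in> {- (3 * \<bar>e\<bar>)<..<3 * \<bar>e\<bar>}"
      "\<forall>\<^sub>F z in nhds (0, t). z \<in> {z \<in> \<Omega>. \<Delta> z \<noteq> 0} \<and> M2 z \<in> {- (3 * \<bar>e\<bar>)<..<3 * \<bar>e\<bar>}"
      using hypo_bound[of t] zero_in(2)[of t]
      by (intro eventually_continuous_on[OF continuous_coeffs(3,5)] eventually_continuous_on[OF continuous_coeffs(4,5)];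
          auto simp: M_0 abs_less_iff)+
    ultimately show "\<forall>\<^sub>F z in nhds (0, t). \<Delta> (fst z, snd z) > 1 \<and> \<Delta>x (fst z, snd z) > 1 \<and>
        \<bar>M1 (fst z, snd z)\<bar> < 3 * \<bar>e\<bar> \<and> \<bar>M2 (fst z, snd z)\<bar> < 3 * \<bar>e\<bar>"
      by eventually_elim auto
  qed simp
  have 2: "\<forall>\<^sub>F x in nhds 0. \<forall>z\<in>{0..2*pi} \<times> {-pi..pi}. x \<bullet> bs \<noteq> 0 \<longrightarrow> Z2 x (fst z) \<longrightarrow>
      Z2 x (fst z + snd z) \<longrightarrow> snd z = 0"
    by (rule eventually_ball_compact) (auto intro!: compact_Times unique_nearby)
  have 3: "\<forall>\<^sub>F x in nhds 0. \<forall>t\<in>{0..2*pi}. x \<bullet> bs \<noteq> 0 \<longrightarrow> Z3 x t \<longrightarrow> D (D (D V)) (x, t) \<noteq> 0"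
    by (rule eventually_ball_compact) (use third_derivative_nearby in auto)
  have 4: "\<forall>\<^sub>F x in nhds 0. x \<in> ball (0::'x) r" using r by (intro eventually_nhds_in_open) auto
  from 1 2 3 4 have "\<forall>\<^sub>F x in nhds 0. x \<in> ball (0::'x) r \<and>
     (\<forall>t\<in>{-4*pi..4*pi}. \<Delta> (x, t) > 1 \<and> \<Delta>x (x, t) > 1 \<and> \<bar>M1 (x, t)\<bar> < 3 * \<bar>e\<bar> \<and> \<bar>M2 (x, t)\<bar> < 3 * \<bar>e\<bar>) \<and>
     (\<forall>z\<in>{0..2*pi} \<times> {-pi..pi}. x \<bullet> bs \<noteq> 0 \<longrightarrow> Z2 x (fst z) \<longrightarrow> Z2 x (fst z + snd z) \<longrightarrow> snd z = 0) \<and>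
     (\<forall>t\<in>{0..2*pi}. x \<bullet> bs \<noteq> 0 \<longrightarrow> Z3 x t \<longrightarrow> D (D (D V)) (x, t) \<noteq> 0)" (is "\<forall>\<^sub>F x in _. ?P x")
    by eventually_elim blast
  then obtain \<rho> where "\<rho> > 0" "\<And>x. dist x 0 < \<rho> \<Longrightarrow> ?P x" unfolding eventually_nhds_metric by blast
  then have "good (min \<rho> r)" unfolding good_def using r by (auto simp: dist_commute)
  then show ?thesis ..
qed

end

section \<open>The bifurcation set at double and triple zeros\<close>

lemma DERIV_nonzero_imp_isolated_zero:
  fixes f :: "real \<Rightarrow> real"
  assumes "(f has_real_derivative d) (at x)" "f x = 0" "d \<noteq> 0"
  shows "\<forall>\<^sub>F y in at x. f y \<noteq> 0"
proof -
  have "((\<lambda>y. (f y - f x) / (y - x)) \<longlongrightarrow> d) (at x)"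
    using assms(1) by (simp add: has_field_derivative_iff)
  then have "\<forall>\<^sub>F y in at x. (f y - f x) / (y - x) \<noteq> 0" using assms(3) by (rule tendsto_imp_eventually_ne)
  then show ?thesis by eventually_elim (use assms(2) in auto)
qed

lemma DERIV_punctured_zero:
  fixes f :: "real \<Rightarrow> real"
  assumes "(f has_real_derivative d) (at x)" "\<forall>\<^sub>F y in at x. f y = 0"
  shows "f x = 0" "d = 0"
proof -
  have "(f \<longlongrightarrow> f x) (at x)" using DERIV_isCont[OF assms(1)] by (simp add: isCont_def)
  moreover have "(f \<longlongrightarrow> 0) (at x)" using assms(2) by (rule tendsto_eventually)
  ultimately show "f x = 0" by (rule tendsto_unique[OF trivial_limit_at])
  then have "\<forall>\<^sub>F y in nhds x. f y = 0" using assms(2) by (simp add: eventually_nhds_conv_at)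
  then have "((\<lambda>y. 0) has_real_derivative d) (at x)" by (rule DERIV_transfer[OF assms(1)])
  then show "d = 0" using DERIV_unique[OF DERIV_const] by blast
qed

context vertex_family
begin

lemma goodD:
  assumes "good \<rho>" "x \<in> ball 0 \<rho>"
  shows "x \<in> ball 0 r" "\<And>t. -4 * pi \<le> t \<Longrightarrow> t \<le> 4 * pi \<Longrightarrow> \<Delta> (x, t) > 1 \<and> \<Delta>x (x, t) > 1 \<and>
      \<bar>M1 (x, t)\<bar> < 3 * \<bar>e\<bar> \<and> \<bar>M2 (x, t)\<bar> < 3 * \<bar>e\<bar>"
    "\<And>t d. 0 \<le> t \<Longrightarrow> t \<le> 2 * pi \<Longrightarrow> -pi \<le> d \<Longrightarrow> d \<le> pi \<Longrightarrow> x \<bullet> bs \<noteq> 0 \<Longrightarrow> Z2 x t \<Longrightarrow> Z2 x (t + d) \<Longrightarrow> d = 0"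
    "\<And>t. 0 \<le> t \<Longrightarrow> t \<le> 2 * pi \<Longrightarrow> x \<bullet> bs \<noteq> 0 \<Longrightarrow> Z3 x t \<Longrightarrow> D (D (D V)) (x, t) \<noteq> 0"
proof -
  note g = assms(1)[unfolded good_def]
  show "x \<in> ball 0 r" using g assms(2) by auto
  show "\<Delta> (x, t) > 1 \<and> \<Delta>x (x, t) > 1 \<and> \<bar>M1 (x, t)\<bar> < 3 * \<bar>e\<bar> \<and> \<bar>M2 (x, t)\<bar> < 3 * \<bar>e\<bar>"
    if "-4 * pi \<le> t" "t \<le> 4 * pi" for t
    using g assms(2) that by (meson atLeastAtMost_iff)
  show "d = 0" if "0 \<le> t" "t \<le> 2 * pi" "-pi \<le> d" "d \<le> pi" "x \<bullet> bs \<noteq> 0" "Z2 x t" "Z2 x (t + d)" for t d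
  proof -
    have "(t, d) \<in> {0..2*pi} \<times> {-pi..pi}" using that by simp
    then show ?thesis using g assms(2) that(5-7) by (metis fst_conv snd_conv)
  qed
  show "D (D (D V)) (x, t) \<noteq> 0" if "0 \<le> t" "t \<le> 2 * pi" "x \<bullet> bs \<noteq> 0" "Z3 x t" for t
    using g assms(2) that by (meson atLeastAtMost_iff)
qed

lemma Z2_reduce:
  assumes "x \<in> ball 0 r" "Z2 x t"
  obtains k :: int where "0 \<le> t + 2 * pi * of_int k" "t + 2 * pi * of_int k < 2 * pi" "Z2 x (t + 2 * pi * of_int k)"
  using reduce_angle[of 0 t] Z_2pi_int(1)[OF assms(1)] assms(2) by auto

lemma Z2_bound:
  assumes "good \<rho>" "x \<in> ball 0 \<rho>" "Z2 x t"
  shows "\<bar>x \<bullet> bl\<bar> \<le> 3 * \<bar>e\<bar> * \<bar>x \<bullet> bs\<bar>" "\<bar>x \<bullet> bm\<bar> \<le> 3 * \<bar>e\<bar> * \<bar>x \<bullet> bs\<bar>"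
proof -
  note x = goodD[OF assms(1,2)]
  obtain k :: int where k: "0 \<le> t + 2 * pi * of_int k" "t + 2 * pi * of_int k < 2 * pi" "Z2 x (t + 2 * pi * of_int k)"
    using Z2_reduce[OF x(1) assms(3)] .
  let ?t = "t + 2 * pi * of_int k"
  have G: "\<Delta> (x, ?t) > 1" "\<bar>M1 (x, ?t)\<bar> < 3 * \<bar>e\<bar>" "\<bar>M2 (x, ?t)\<bar> < 3 * \<bar>e\<bar>" using x(2)[of ?t] k by auto
  have "x \<bullet> bl = (x \<bullet> bs) * M1 (x, ?t)" "x \<bullet> bm = (x \<bullet> bs) * M2 (x, ?t)"
    using Z2_iff_M[OF x(1), of ?t] G(1) k(3) by auto
  then have "\<bar>x \<bullet> bl\<bar> = \<bar>M1 (x, ?t)\<bar> * \<bar>x \<bullet> bs\<bar>" "\<bar>x \<bullet> bm\<bar> = \<bar>M2 (x, ?t)\<bar> * \<bar>x \<bullet> bs\<bar>"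
    by (simp_all only: abs_mult mult.commute)
  then show "\<bar>x \<bullet> bl\<bar> \<le> 3 * \<bar>e\<bar> * \<bar>x \<bullet> bs\<bar>" "\<bar>x \<bullet> bm\<bar> \<le> 3 * \<bar>e\<bar> * \<bar>x \<bullet> bs\<bar>"
    using G by (simp_all only: mult_right_mono abs_ge_zero less_imp_le)
qed

lemma Z2_unique:
  assumes "good \<rho>" "x \<in> ball 0 \<rho>" "x \<bullet> bs \<noteq> 0" "Z2 x t" "Z2 x t'"
  shows "\<exists>k::int. t' = t + 2 * pi * of_int k"
proof -
  note x = goodD[OF assms(1,2)]
  obtain k :: int where k: "0 \<le> t + 2 * pi * of_int k" "t + 2 * pi * of_int k < 2 * pi" "Z2 x (t + 2 * pi * of_int k)"
    using Z2_reduce[OF x(1) assms(4)] .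
  obtain j :: int where j: "t + 2 * pi * of_int k - pi \<le> t' + 2 * pi * of_int j"
    "t' + 2 * pi * of_int j < t + 2 * pi * of_int k - pi + 2 * pi"
    using reduce_angle by blast
  have "t' + 2 * pi * of_int j - (t + 2 * pi * of_int k) = 0"
    using k j Z_2pi_int(1)[OF x(1), of t' j] assms(3,5) by (intro x(3)[of "t + 2 * pi * of_int k"]) auto
  then have "t' = t + 2 * pi * of_int (k - j)" by (simp add: algebra_simps)
  then show ?thesis ..
qed

text \<open>Uniqueness of the double zero localizes the problem: near \<open>x0\<close> only angles near \<open>t0\<close> matter.\<close>

lemma isolated_angle:
  assumes "good \<rho>" "x0 \<in> ball 0 \<rho>" "x0 \<bullet> bs \<noteq> 0" "Z2 x0 t0" "open N" "(x0, t0) \<in> N"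
  shows "\<forall>\<^sub>F x in nhds x0. \<forall>t\<in>{t0 - pi..t0 + pi}. Z2 x t \<longrightarrow> (x, t) \<in> N"
proof (rule eventually_ball_compact)
  note x0 = goodD[OF assms(1,2)]
  fix t assume t: "t \<in> {t0 - pi..t0 + pi}"
  show "\<forall>\<^sub>F z in nhds (x0, t). Z2 (fst z) (snd z) \<longrightarrow> (fst z, snd z) \<in> N"
  proof (cases "t = t0")
    case True
    then have "\<forall>\<^sub>F z in nhds (x0, t). z \<in> N" using assms(5,6) by (intro eventually_nhds_in_open) auto
    then show ?thesis by eventually_elim simp
  next
    case False
    have "\<not> Z2 x0 t"
    proof
      assume "Z2 x0 t"
      then obtain k :: int where k: "t = t0 + 2 * pi * of_int k" using Z2_unique[OF assms(1-4)] by blast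
      have "\<bar>t - t0\<bar> \<le> pi" using t by (simp add: abs_le_iff)
      moreover have "t - t0 = 2 * pi * of_int k" using k by simp
      ultimately have "\<bar>2 * pi * of_int k\<bar> \<le> pi" by (simp only:)
      then have "\<bar>of_int k :: real\<bar> \<le> 1 / 2" by (simp add: abs_mult field_simps)
      then have "k = 0" by linarith
      then show False using k False by simp
    qed
    then consider "V (x0, t) \<noteq> 0" | "D V (x0, t) \<noteq> 0" unfolding Z2_def by blast
    then show ?thesis
    proof cases
      case 1
      have "\<forall>\<^sub>F z in nhds (x0, t). z \<in> \<Omega> \<and> V z \<in> - {0}"
        by (rule eventually_continuous_on[OF smooth_on_continuous[OF smooth_V] open_\<Omega>]) (use 1 x0(1) in \<open>auto simp: open_Compl\<close>)
      then show ?thesis by eventually_elim (auto simp: Z2_def)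
    next
      case 2
      have "\<forall>\<^sub>F z in nhds (x0, t). z \<in> \<Omega> \<and> D V z \<in> - {0}"
        by (rule eventually_continuous_on[OF smooth_on_continuous[OF smooth_DV(1)] open_\<Omega>]) (use 2 x0(1) in \<open>auto simp: open_Compl\<close>)
      then show ?thesis by eventually_elim (auto simp: Z2_def)
    qed
  qed
qed simp

definition E :: "real \<Rightarrow> 'x set" where
  "E \<rho> = {x \<in> ball 0 \<rho>. x \<bullet> bs > 0 \<and> (\<exists>t. Z2 x t)}"

text \<open>Having no double zero is stable, because the angles form a compact set.\<close>

lemma closure_E:
  assumes "good \<rho>" "x \<in> ball 0 \<rho>" "x \<in> closure (E \<rho>)"
  shows "\<exists>t. Z2 x t"
proof (rule ccontr)
  assume no: "\<nexists>t. Z2 x t"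
  note x = goodD[OF assms(1,2)]
  have "\<forall>\<^sub>F y in nhds x. \<forall>t\<in>{0..2*pi}. \<not> Z2 y t"
  proof (rule eventually_ball_compact)
    fix t
    consider "V (x, t) \<noteq> 0" | "D V (x, t) \<noteq> 0" using no unfolding Z2_def by blast
    then show "\<forall>\<^sub>F z in nhds (x, t). \<not> Z2 (fst z) (snd z)"
    proof cases
      case 1
      have "\<forall>\<^sub>F z in nhds (x, t). z \<in> \<Omega> \<and> V z \<in> - {0}"
        by (rule eventually_continuous_on[OF smooth_on_continuous[OF smooth_V] open_\<Omega>]) (use 1 x(1) in \<open>auto simp: open_Compl\<close>)
      then show ?thesis by eventually_elim (auto simp: Z2_def)
    next
      case 2
      have "\<forall>\<^sub>F z in nhds (x, t). z \<in> \<Omega> \<and> D V z \<in> - {0}"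
        by (rule eventually_continuous_on[OF smooth_on_continuous[OF smooth_DV(1)] open_\<Omega>]) (use 2 x(1) in \<open>auto simp: open_Compl\<close>)
      then show ?thesis by eventually_elim (auto simp: Z2_def)
    qed
  qed simp
  then obtain S where S: "open S" "x \<in> S" "\<And>y t. y \<in> S \<Longrightarrow> t \<in> {0..2*pi} \<Longrightarrow> \<not> Z2 y t"
    unfolding eventually_nhds by blast
  obtain y where y: "y \<in> E \<rho>" "y \<in> S"
    using assms(3) S(1,2) by (auto simp: closure_iff_nhds_not_empty)
  then obtain t where t: "Z2 y t" "y \<in> ball 0 \<rho>" unfolding E_def by blast
  from Z2_reduce[OF goodD(1)[OF assms(1) t(2)] t(1)] show False using S(3)[OF y(2)] by force
qed

lemma dird_split:
  assumes "smooth_on S f" "z \<in> S"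
  shows "dird (a *\<^sub>R bl + b *\<^sub>R bm, c) f z = a * dird (bl, 0) f z + b * dird (bm, 0) f z + c * dird (0, 1) f (z :: 'x \<times> real)"
proof -
  have lin: "linear (\<lambda>v. dird v f z)" by (rule dird_linear[OF smooth_on_differentiable[OF assms]])
  have "(a *\<^sub>R bl + b *\<^sub>R bm, c) = a *\<^sub>R (bl, 0) + b *\<^sub>R (bm, 0) + c *\<^sub>R (0, 1)" by simp
  then show ?thesis
    using linear_add[OF lin] linear_scale[OF lin] by (metis real_scaleR_def)
qed

text \<open>Where \<open>V\<^sub>t\<^sub>t \<noteq> 0\<close>, the equation \<open>V\<^sub>t = 0\<close> can be solved for \<open>t\<close>, and \<open>E\<close> becomes the zero set of the
  resulting function of \<open>x\<close>, which is regular because \<open>V\<close> has a nonzero derivative in the plane of \<open>bl\<close> and \<open>bm\<close>.\<close>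

lemma smooth_at_double_zero:
  assumes good: "good \<rho>" and x0: "x0 \<in> E \<rho>" and t0: "Z2 x0 t0" "0 \<le> t0" "t0 \<le> 2 * pi" and nd: "D (D V) (x0, t0) \<noteq> 0"
  shows "smooth_submanifold_at (DIM('x) - 1) (E \<rho>) x0"
proof -
  have x0': "x0 \<in> ball 0 \<rho>" "x0 \<bullet> bs > 0" using x0 unfolding E_def by auto
  note G = goodD[OF good x0'(1)]
  have z0: "(x0, t0) \<in> \<Omega>" using G(1) by simp
  let ?J = "\<lambda>z::'x \<times> real. (fst z, D V z)"
  have J: "smooth_on \<Omega> ?J" by (intro smooth_intros open_\<Omega> smooth_DV)
  have dJ: "dird v ?J (x0, t0) = (fst v, dird v (D V) (x0, t0))" for v
    by (rule dirdI) (auto intro!: derivative_eq_intros smooth_on_has_derivative[OF smooth_DV(1) z0])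
  have "v = 0" if "dird v ?J (x0, t0) = 0" for v
  proof -
    have v: "v = (0 *\<^sub>R bl + 0 *\<^sub>R bm, snd v)" using that dJ by (simp add: prod_eq_iff)
    have "dird v (D V) (x0, t0) = 0" using that dJ by (simp add: zero_prod_def)
    then have "snd v * D (D V) (x0, t0) = 0"
      using dird_split[OF smooth_DV(1) z0, of 0 0 "snd v"] v by simp
    then show ?thesis using nd v by (simp add: prod_eq_iff)
  qed
  then obtain N N' g where N: "(x0, t0) \<in> N" "N \<subseteq> \<Omega>" "diffeo N N' ?J g"
    using smooth_inverse_function[OF open_\<Omega> J z0] by blast
  note D = diffeoD[OF N(3)]
  obtain U0 where U0: "open U0" "x0 \<in> U0" "\<And>x t. x \<in> U0 \<Longrightarrow> t \<in> {t0 - pi..t0 + pi} \<Longrightarrow> Z2 x t \<Longrightarrow> (x, t) \<in> N"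
    using isolated_angle[OF good x0'(1) _ t0(1) D(1) N(1)] x0'(2) unfolding eventually_nhds by auto
  define U where "U = U0 \<inter> ball 0 \<rho> \<inter> {x. x \<bullet> bs > 0} \<inter> (\<lambda>x. (x, 0)) -` N'"
  have U: "open U" unfolding U_def
    by (intro open_Int U0 open_ball open_Collect_less continuous_intros open_vimage D)
  have DV0: "D V (x0, t0) = 0" "V (x0, t0) = 0" using t0(1) unfolding Z2_def by auto
  have x0U: "x0 \<in> U" unfolding U_def using U0(2) x0' D(9)[OF N(1)] DV0 by simp
  define \<theta> where "\<theta> x = snd (g (x, 0))" for x
  have g: "g (x, 0) = (x, \<theta> x)" "(x, \<theta> x) \<in> N" "D V (x, \<theta> x) = 0" if "x \<in> U" for x
  proof -
    have x: "(x, 0) \<in> N'" using that unfolding U_def by simp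
    have f: "fst (g (x, 0)) = x" "D V (g (x, 0)) = 0" using D(8)[OF x] by auto
    then show 1: "g (x, 0) = (x, \<theta> x)" unfolding \<theta>_def by (simp add: prod_eq_iff)
    show "(x, \<theta> x) \<in> N" "D V (x, \<theta> x) = 0" using D(10)[OF x] f unfolding 1 by simp_all
  qed
  have \<theta>0: "\<theta> x0 = t0" using D(7)[OF N(1)] DV0 unfolding \<theta>_def by simp
  have \<theta>: "smooth_on U \<theta>" unfolding \<theta>_def
    by (intro smooth_intros U smooth_on_compose[OF D(4) U D(2)]) (simp add: U_def)
  define h where "h x = V (x, \<theta> x)" for x
  have h: "smooth_on U h" unfolding h_def
    by (rule smooth_on_compose[OF smooth_V U open_\<Omega> smooth_on_Pair[OF U smooth_on_id \<theta>]])
      (rule subsetD[OF N(2) g(2)])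
  have eq: "E \<rho> \<inter> U = {x \<in> U. h x = 0}"
  proof (intro set_eqI iffI)
    fix x assume "x \<in> E \<rho> \<inter> U"
    then have x: "x \<in> U" "x \<in> ball 0 \<rho>" and "\<exists>t. Z2 x t" unfolding E_def by auto
    then obtain t where t: "Z2 x t" by blast
    obtain k :: int where k: "t0 - pi \<le> t + 2 * pi * of_int k" "t + 2 * pi * of_int k < t0 - pi + 2 * pi"
      using reduce_angle by blast
    let ?t = "t + 2 * pi * of_int k"
    have Z: "Z2 x ?t" using t Z_2pi_int(1)[OF goodD(1)[OF good x(2)]] by blast
    have "(x, ?t) \<in> N" using k x(1) by (intro U0(3) Z) (auto simp: U_def)
    then have "g (x, 0) = (x, ?t)" using D(7)[of "(x, ?t)"] Z unfolding Z2_def by simp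
    then have "h x = 0" using Z unfolding h_def \<theta>_def Z2_def by simp
    then show "x \<in> {x \<in> U. h x = 0}" using x by simp
  next
    fix x assume x: "x \<in> {x \<in> U. h x = 0}"
    then have "Z2 x (\<theta> x)" using g(3) unfolding Z2_def h_def by simp
    then show "x \<in> E \<rho> \<inter> U" using x unfolding E_def U_def by auto
  qed
  have dh: "dird w h x0 = dird (w, 0) V (x0, t0)" for w
  proof -
    have "dird w h x0 = dird (w, dird w \<theta> x0) V (x0, t0)"
    proof -
      have "((\<lambda>x. (x, \<theta> x)) has_derivative (\<lambda>v. (v, dird v \<theta> x0))) (at x0)"
        by (intro derivative_intros smooth_on_has_derivative[OF \<theta> x0U])
      from diff_chain_at[OF this, of V] show ?thesis
        unfolding h_def using smooth_on_has_derivative[OF smooth_V z0] \<theta>0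
        by (intro dirdI[of _ "\<lambda>w. dird (w, dird w \<theta> x0) V (x0, t0)"]) (simp add: o_def)
    qed
    also have "\<dots> = dird ((w, 0) + dird w \<theta> x0 *\<^sub>R (0, 1)) V (x0, t0)" by simp
    also have "\<dots> = dird (w, 0) V (x0, t0) + dird w \<theta> x0 * D V (x0, t0)"
    proof -
      have lin: "linear (\<lambda>v. dird v V (x0, t0))" by (rule dird_linear[OF smooth_on_differentiable[OF smooth_V z0]])
      show ?thesis
        using linear_add[OF lin, of "(w, 0)" "dird w \<theta> x0 *\<^sub>R (0, 1)"] linear_scale[OF lin, of "dird w \<theta> x0" "(0, 1)"]
        unfolding real_scaleR_def by (rule trans[OF _ arg_cong[where f = "(+) _"]])
    qed
    finally show ?thesis using DV0 by simp
  qed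
  have "\<Delta>x (x0, t0) > 1" using G(2)[of t0] t0 pi_gt_zero by linarith
  then have "dird bl h x0 \<noteq> 0 \<or> dird bm h x0 \<noteq> 0" unfolding \<Delta>x_def dh by auto
  then obtain w where "dird w h x0 \<noteq> 0" by blast
  moreover have "h x0 = 0" using DV0 \<theta>0 by (simp add: h_def)
  ultimately have "smooth_submanifold_at (DIM('x) - 1) {x \<in> U. h x = 0} x0"
    by (intro regular_level_set U h x0U)
  then show ?thesis
    by (rule smooth_submanifold_at_cong[OF U x0U, rotated]) (use eq in blast)
qed

definition strip :: "'x \<Rightarrow> 'x" where
  "strip x = x - (x \<bullet> bl) *\<^sub>R bl - (x \<bullet> bm) *\<^sub>R bm"

text \<open>The functions \<open>p\<close> and \<open>q\<close> replace the coordinates along \<open>bl\<close> and \<open>bm\<close>, and \<open>w\<close> replaces the angle.\<close>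

definition J :: "('x \<times> real \<Rightarrow> real) \<Rightarrow> ('x \<times> real \<Rightarrow> real) \<Rightarrow> ('x \<times> real \<Rightarrow> real) \<Rightarrow> 'x \<times> real \<Rightarrow> 'x \<times> real" where
  "J p q w z = (fst z + (p z - fst z \<bullet> bl) *\<^sub>R bl + (q z - fst z \<bullet> bm) *\<^sub>R bm, w z)"

lemma local_chart:
  assumes S: "open S" "smooth_on S p" "smooth_on S q" "smooth_on S w" "z0 \<in> S"
    and inj: "\<And>a b c. dird (a *\<^sub>R bl + b *\<^sub>R bm, c) p z0 = 0 \<Longrightarrow> dird (a *\<^sub>R bl + b *\<^sub>R bm, c) q z0 = 0 \<Longrightarrow>
      dird (a *\<^sub>R bl + b *\<^sub>R bm, c) w z0 = 0 \<Longrightarrow> a = 0 \<and> b = 0 \<and> c = 0"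
  obtains N N' g where "z0 \<in> N" "N \<subseteq> S" "diffeo N N' (J p q w) g"
proof -
  have J: "smooth_on S (J p q w)" unfolding J_def by (intro smooth_intros S)
  have dJ: "dird v (J p q w) z0 = (fst v + (dird v p z0 - fst v \<bullet> bl) *\<^sub>R bl + (dird v q z0 - fst v \<bullet> bm) *\<^sub>R bm, dird v w z0)" for v
    unfolding J_def
    by (rule dirdI) (auto intro!: derivative_eq_intros smooth_on_has_derivative[OF S(2,5)]
        smooth_on_has_derivative[OF S(3,5)] smooth_on_has_derivative[OF S(4,5)])
  have "v = 0" if "dird v (J p q w) z0 = 0" for v
  proof -
    let ?A = "dird v p z0 - fst v \<bullet> bl" and ?B = "dird v q z0 - fst v \<bullet> bm"
    have 0: "fst v + ?A *\<^sub>R bl + ?B *\<^sub>R bm = 0" "dird v w z0 = 0" using that dJ by (simp_all add: prod_eq_iff)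
    have "(fst v + ?A *\<^sub>R bl + ?B *\<^sub>R bm) \<bullet> bl = dird v p z0" "(fst v + ?A *\<^sub>R bl + ?B *\<^sub>R bm) \<bullet> bm = dird v q z0"
      by (simp_all add: inner_add_left)
    then have pq: "dird v p z0 = 0" "dird v q z0 = 0" unfolding 0 by simp_all
    have "fst v = (fst v \<bullet> bl) *\<^sub>R bl + (fst v \<bullet> bm) *\<^sub>R bm"
      using 0(1) unfolding pq by (simp add: algebra_simps)
    then have v: "v = ((fst v \<bullet> bl) *\<^sub>R bl + (fst v \<bullet> bm) *\<^sub>R bm, snd v)" by (simp add: prod_eq_iff)
    have "fst v \<bullet> bl = 0 \<and> fst v \<bullet> bm = 0 \<and> snd v = 0"
      by (rule inj) (use v pq 0(2) in \<open>simp_all add: v[symmetric]\<close>)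
    then show ?thesis using v by (metis add.right_neutral scaleR_zero_left zero_prod_def)
  qed
  from smooth_inverse_function[OF S(1) J S(5) this] that show ?thesis by metis
qed

lemma J_eq:
  assumes "p z = 0" "q z = 0"
  shows "J p q w z = (strip (fst z), w z)"
  unfolding J_def strip_def assms by simp

lemma J_inv:
  assumes "J p q w z = (y, c)" "y \<bullet> bl = 0" "y \<bullet> bm = 0"
  shows "p z = 0" "q z = 0" "w z = c" "fst z = y + (fst z \<bullet> bl) *\<^sub>R bl + (fst z \<bullet> bm) *\<^sub>R bm"
proof -
  have 1: "y = fst z + (p z - fst z \<bullet> bl) *\<^sub>R bl + (q z - fst z \<bullet> bm) *\<^sub>R bm" "w z = c"
    using assms(1) unfolding J_def by auto
  have "y \<bullet> bl = p z" "y \<bullet> bm = q z" unfolding 1(1) by (simp_all add: inner_add_left)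
  then show pq: "p z = 0" "q z = 0" "w z = c" using assms 1 by simp_all
  show "fst z = y + (fst z \<bullet> bl) *\<^sub>R bl + (fst z \<bullet> bm) *\<^sub>R bm" using 1(1) unfolding pq by simp
qed

lemma strip_inner [simp]: "strip x \<bullet> bl = 0" "strip x \<bullet> bm = 0" "strip x \<bullet> bs = x \<bullet> bs"
  by (simp_all add: strip_def inner_diff_left)

lemma plane_eq_0:
  fixes a b c d u v :: real
  assumes "a * d - b * c \<noteq> 0" "u * a + v * b = 0" "u * c + v * d = 0"
  shows "u = 0" "v = 0"
proof -
  have "u * (a * d - b * c) = d * (u * a + v * b) - b * (u * c + v * d)"
    "v * (a * d - b * c) = a * (u * c + v * d) - c * (u * a + v * b)" by (simp_all add: algebra_simps)
  then have "u * (a * d - b * c) = 0" "v * (a * d - b * c) = 0" unfolding assms(2,3) by simp_all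
  then show "u = 0" "v = 0" using assms(1) by simp_all
qed

text \<open>Take \<open>V\<close> and \<open>V\<^sub>t\<close> as coordinates in place of \<open>\<lambda>\<close> and \<open>\<mu>\<close>: the points with a double zero are then
  parametrized by the angle and the other coordinates. If \<open>h = 0\<close> were a regular equation of \<open>E\<close>, differentiating it along
  the curve of double zeros shows that the derivative of \<open>h\<close> annihilates the tangent vector of the cuspidal curve
  away from the cusp, hence in the limit also the cuspidal direction, and differentiating once more, where the third
  derivative of \<open>V\<close> enters, it annihilates the plane of \<open>bl\<close> and \<open>bm\<close>. The other directions are tangent to \<open>E\<close>,
  so the derivative of \<open>h\<close> vanishes.\<close>

lemma not_smooth_at_triple_zero:
  assumes good: "good \<rho>" and x0: "x0 \<in> E \<rho>" and t0: "Z3 x0 t0" "0 \<le> t0" "t0 \<le> 2 * pi"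
  shows "\<not> smooth_submanifold_at (DIM('x) - 1) (E \<rho>) x0"
proof
  assume sub: "smooth_submanifold_at (DIM('x) - 1) (E \<rho>) x0"
  obtain U h w0 where U: "open U" "x0 \<in> U" "smooth_on U h" "\<And>x. x \<in> E \<rho> \<inter> U \<Longrightarrow> h x = (0::real)" "dird w0 h x0 \<noteq> 0"
    using hypersurface_equation[OF sub] by metis
  have x0': "x0 \<in> ball 0 \<rho>" "x0 \<bullet> bs > 0" using x0 unfolding E_def by auto
  note G = goodD[OF good x0'(1)]
  have z0: "(x0, t0) \<in> \<Omega>" using G(1) by simp
  have V0: "V (x0, t0) = 0" "D V (x0, t0) = 0" "D (D V) (x0, t0) = 0" using t0(1) unfolding Z3_def Z2_def by auto
  have V3: "D (D (D V)) (x0, t0) \<noteq> 0" using G(4)[OF t0(2,3) _ t0(1)] x0'(2) by simp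
  have \<Delta>x: "\<Delta>x (x0, t0) \<noteq> 0" using G(2)[of t0] t0 pi_gt_zero by force
  obtain N N' g where N: "(x0, t0) \<in> N" "N \<subseteq> \<Omega>" "diffeo N N' (J V (D V) snd) g"
  proof (rule local_chart[OF open_\<Omega> smooth_V smooth_DV(1) _ z0])
    show "smooth_on \<Omega> snd" using smooth_on_snd[OF open_\<Omega> smooth_on_id] by simp
    fix a b c assume d: "dird (a *\<^sub>R bl + b *\<^sub>R bm, c) V (x0, t0) = 0" "dird (a *\<^sub>R bl + b *\<^sub>R bm, c) (D V) (x0, t0) = 0"
      "dird (a *\<^sub>R bl + b *\<^sub>R bm, c) snd (x0, t0) = 0"
    have "dird (a *\<^sub>R bl + b *\<^sub>R bm, c) snd (x0, t0) = c"
      by (rule dirdI[THEN trans]) (rule bounded_linear_imp_has_derivative[OF bounded_linear_snd], simp)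
    then have c: "c = 0" using d(3) by simp
    have "a * dird (bl, 0) V (x0, t0) + b * dird (bm, 0) V (x0, t0) = 0"
      "a * dird (bl, 0) (D V) (x0, t0) + b * dird (bm, 0) (D V) (x0, t0) = 0"
      using d(1,2) unfolding dird_split[OF smooth_V z0] dird_split[OF smooth_DV(1) z0] c by simp_all
    from plane_eq_0[OF \<Delta>x[unfolded \<Delta>x_def] this] c show "a = 0 \<and> b = 0 \<and> c = 0" by blast
  qed
  note D = diffeoD[OF N(3)]
  let ?y0 = "strip x0"
  have y0: "(?y0, t0) \<in> N'" "g (?y0, t0) = (x0, t0)"
    using D(9)[OF N(1)] D(7)[OF N(1)] J_eq[of V "(x0, t0)" "D V" snd] V0 by simp_all
  \<comment> \<open>points of \<open>N'\<close> over which \<open>g\<close> parametrizes \<open>E \<rho> \<inter> U\<close>\<close>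
  define Q where "Q = N' \<inter> g -` ((ball 0 \<rho> \<inter> {x. x \<bullet> bs > 0} \<inter> U) \<times> UNIV)"
  have Q: "open Q" unfolding Q_def
    by (intro continuous_open_preimage smooth_on_continuous[OF D(4)] D(2) open_Times open_Int open_ball U(1)
        open_Collect_less continuous_intros open_UNIV)
  have y0Q: "(?y0, t0) \<in> Q" unfolding Q_def using y0 x0' U(2) by simp
  define L where "L q = fst (g q) \<bullet> bl" for q
  define M where "M q = fst (g q) \<bullet> bm" for q
  have LM: "smooth_on Q L" "smooth_on Q M" unfolding L_def M_def
    by (intro smooth_intros Q smooth_on_subset[OF D(4)]; simp add: Q_def)+
  have gq: "g q = (fst q + L q *\<^sub>R bl + M q *\<^sub>R bm, snd q)" "V (g q) = 0" "D V (g q) = 0" "h (fst (g q)) = 0" "g q \<in> \<Omega>" "fst (g q) \<in> U"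
    if q: "q \<in> Q" "fst q \<bullet> bl = 0" "fst q \<bullet> bm = 0" for q
  proof -
    have "q \<in> N'" using q unfolding Q_def by simp
    then have "J V (D V) snd (g q) = (fst q, snd q)" using D(8) by simp
    note Ji = J_inv[OF this q(2,3)]
    show "g q = (fst q + L q *\<^sub>R bl + M q *\<^sub>R bm, snd q)" using Ji(3,4) unfolding L_def M_def by (simp add: prod_eq_iff)
    show V: "V (g q) = 0" "D V (g q) = 0" by (rule Ji)+
    show "g q \<in> \<Omega>" using D(10)[OF \<open>q \<in> N'\<close>] N(2) by blast
    have "Z2 (fst (g q)) (snd (g q))" unfolding Z2_def using V by simp
    then have "fst (g q) \<in> E \<rho> \<inter> U" using q(1) unfolding Q_def E_def by auto
    then show "h (fst (g q)) = 0" "fst (g q) \<in> U" using U(4) by auto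
  qed
  \<comment> \<open>chain rule along a curve \<open>q\<close> in the parameter domain\<close>
  have chain: "((\<lambda>\<sigma>. f (g (q \<sigma>))) has_real_derivative dird (v + L' *\<^sub>R bl + M' *\<^sub>R bm, c) f (g (q \<sigma>0))) (at \<sigma>0)"
    if f: "f differentiable (at (g (q \<sigma>0)))" and q: "\<And>\<sigma>. q \<sigma> = (y + \<sigma> *\<^sub>R v, u + \<sigma> * c)" and y: "y \<bullet> bl = 0" "y \<bullet> bm = 0" "v \<bullet> bl = 0" "v \<bullet> bm = 0"
      and qQ: "q \<sigma>0 \<in> Q" and L: "((\<lambda>\<sigma>. L (q \<sigma>)) has_real_derivative L') (at \<sigma>0)" "((\<lambda>\<sigma>. M (q \<sigma>)) has_real_derivative M') (at \<sigma>0)"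
    for f :: "'x \<times> real \<Rightarrow> real" and q y v u c \<sigma>0 L' M'
  proof -
    let ?g = "\<lambda>\<sigma>. (y + \<sigma> *\<^sub>R v + L (q \<sigma>) *\<^sub>R bl + M (q \<sigma>) *\<^sub>R bm, u + \<sigma> * c)"
    have gg: "g (q \<sigma>) = ?g \<sigma>" if "q \<sigma> \<in> Q" for \<sigma>
      using gq(1)[OF that] y q[of \<sigma>] by (simp add: inner_add_left)
    have dg: "(?g has_derivative (\<lambda>\<eta>. \<eta> *\<^sub>R (v + L' *\<^sub>R bl + M' *\<^sub>R bm, c))) (at \<sigma>0)"
      using L unfolding has_field_derivative_def
      by (auto intro!: derivative_eq_intros simp: algebra_simps)
    have lin: "linear (\<lambda>v. dird v f (g (q \<sigma>0)))" by (rule dird_linear[OF f])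
    have "(f \<circ> ?g has_derivative (\<lambda>v. dird v f (g (q \<sigma>0))) \<circ> (\<lambda>\<eta>. \<eta> *\<^sub>R (v + L' *\<^sub>R bl + M' *\<^sub>R bm, c))) (at \<sigma>0)"
      by (rule diff_chain_at[OF dg]) (use dird_has_derivative[OF f] gg[OF qQ] in simp)
    moreover have "(\<lambda>v. dird v f (g (q \<sigma>0))) \<circ> (\<lambda>\<eta>. \<eta> *\<^sub>R (v + L' *\<^sub>R bl + M' *\<^sub>R bm, c)) =
        (*) (dird (v + L' *\<^sub>R bl + M' *\<^sub>R bm, c) f (g (q \<sigma>0)))"
      unfolding o_def linear_scale[OF lin] by (simp add: fun_eq_iff mult.commute)
    ultimately have "((\<lambda>\<sigma>. f (?g \<sigma>)) has_real_derivative dird (v + L' *\<^sub>R bl + M' *\<^sub>R bm, c) f (g (q \<sigma>0))) (at \<sigma>0)"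
      by (simp only: o_def has_field_derivative_def)
    moreover have "\<forall>\<^sub>F \<sigma> in nhds \<sigma>0. f (?g \<sigma>) = f (g (q \<sigma>))"
    proof -
      have "open (q -` Q)" unfolding q by (intro open_vimage Q continuous_intros)
      then have "\<forall>\<^sub>F \<sigma> in nhds \<sigma>0. \<sigma> \<in> q -` Q" using qQ by (intro eventually_nhds_in_open) auto
      then show ?thesis by eventually_elim (simp add: gg)
    qed
    ultimately show ?thesis by (rule DERIV_transfer)
  qed
  \<comment> \<open>first along the curve over \<open>?y0\<close> parametrized by the angle\<close>
  let ?q = "\<lambda>t. (?y0, t)"
  have q: "?q t = (?y0 + t *\<^sub>R 0, 0 + t * 1)" for t by simp
  have ev: "\<forall>\<^sub>F t in nhds t0. ?q t \<in> Q"
  proof -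
    have "open (?q -` Q)" by (intro open_vimage Q continuous_intros)
    then show ?thesis using y0Q eventually_nhds_in_open[of "?q -` Q" t0] by simp
  qed
  define L' where "L' t = dird (0, 1) L (?q t)" for t
  define M' where "M' t = dird (0, 1) M (?q t)" for t
  have dLM: "((\<lambda>t. L (?q t)) has_real_derivative L' t) (at t)" "((\<lambda>t. M (?q t)) has_real_derivative M' t) (at t)"
    if "?q t \<in> Q" for t
    using line_has_derivative[of L "(?y0, 0)" t "(0, 1)"] line_has_derivative[of M "(?y0, 0)" t "(0, 1)"]
      smooth_on_differentiable[OF LM(1) that] smooth_on_differentiable[OF LM(2) that] unfolding L'_def M'_def by simp_all
  have ch: "((\<lambda>t. f (g (?q t))) has_real_derivative L' t * dird (bl, 0) f (g (?q t)) + M' t * dird (bm, 0) f (g (?q t)) + D f (g (?q t))) (at t)"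
    if "smooth_on S f" "g (?q t) \<in> S" "?q t \<in> Q" for f S t
    using chain[OF smooth_on_differentiable[OF that(1,2)] q _ _ _ _ that(3) dLM[OF that(3)]]
      dird_split[OF that(1,2), of "L' t" "M' t" 1] by simp
  have zero: "d = 0" if "(\<phi> has_real_derivative d) (at t)" "?q t \<in> Q" "\<And>t. ?q t \<in> Q \<Longrightarrow> \<phi> t = 0" for \<phi> d t
  proof (rule DERIV_punctured_zero(2)[OF that(1)])
    have "open (?q -` Q)" by (intro open_vimage Q continuous_intros)
    then have "\<forall>\<^sub>F t in at t. t \<in> ?q -` Q" using that(2) by (intro eventually_at_in_open') auto
    then show "\<forall>\<^sub>F t in at t. \<phi> t = 0" by eventually_elim (simp add: that(3))
  qed
  have gqq: "V (g (?q t)) = 0" "D V (g (?q t)) = 0" "h (fst (g (?q t))) = 0" "g (?q t) \<in> \<Omega>" "g (?q t) \<in> U \<times> UNIV"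
    if "?q t \<in> Q" for t
    using gq(2-6)[OF that] by (simp_all add: mem_Times_iff)
  define H where "H z = h (fst z)" for z :: "'x \<times> real"
  have UU: "open (U \<times> (UNIV :: real set))" by (intro open_Times U) auto
  have H: "smooth_on (U \<times> UNIV) H" unfolding H_def
    by (rule smooth_on_compose[OF U(3) UU U(1)]) (auto intro!: smooth_intros UU)
  have dH: "dird (v, c) H (x, t) = dird v h x" if "x \<in> U" for v c x t
  proof -
    have "dird (v, c) fst (x, t) = v"
      by (rule dirdI[THEN trans]) (rule bounded_linear_imp_has_derivative[OF bounded_linear_fst], simp)
    then show ?thesis
      unfolding H_def using dird_compose[of fst "(x, t)" h "(v, c)"] smooth_on_differentiable[OF U(3) that]
      by (simp add: bounded_linear_imp_differentiable[OF bounded_linear_fst])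
  qed
  have E1: "L' t * dird (bl, 0) V (g (?q t)) + M' t * dird (bm, 0) V (g (?q t)) = 0" if "?q t \<in> Q" for t
    using zero[OF ch[OF smooth_V gqq(4)[OF that] that] that gqq(1)] gqq(2)[OF that] by simp
  have E2: "L' t * dird (bl, 0) (D V) (g (?q t)) + M' t * dird (bm, 0) (D V) (g (?q t)) + D (D V) (g (?q t)) = 0" if "?q t \<in> Q" for t
    using zero[OF ch[OF smooth_DV(1) gqq(4)[OF that] that] that gqq(2)] .
  have E3: "L' t * dird (bl, 0) H (g (?q t)) + M' t * dird (bm, 0) H (g (?q t)) = 0" if "?q t \<in> Q" for t
  proof -
    have "D H (g (?q t)) = dird 0 h (fst (g (?q t)))"
      using dH[of "fst (g (?q t))" 0 1 "snd (g (?q t))"] gqq(5)[OF that] by (simp add: mem_Times_iff)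
    also have "\<dots> = 0"
      using linear_0[OF dird_linear[OF smooth_on_differentiable[OF U(3)]]] gqq(5)[OF that] by (simp add: mem_Times_iff)
    finally show ?thesis
      using zero[OF ch[OF H gqq(5)[OF that] that] that] gqq(3) by (simp add: H_def)
  qed
  have LM0: "L' t0 = 0" "M' t0 = 0"
    by (rule plane_eq_0[OF \<Delta>x[unfolded \<Delta>x_def] E1[OF y0Q, unfolded y0(2)]
          E2[OF y0Q, unfolded y0(2) V0(3) add_0_right]])+
  have ch0: "((\<lambda>t. f (g (?q t))) has_real_derivative D f (x0, t0)) (at t0)" if "smooth_on S f" "(x0, t0) \<in> S" for f S
    using ch[OF that(1), of t0] that(2) y0Q y0(2) LM0 by simp
  \<comment> \<open>the angle derivative of the curve vanishes at \<open>t0\<close> only, because the third derivative of \<open>V\<close> does not\<close>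
  have "\<forall>\<^sub>F t in at t0. D (D V) (g (?q t)) \<noteq> 0"
    by (rule DERIV_nonzero_imp_isolated_zero[OF ch0[OF smooth_DV(2) z0]]) (use y0(2) V0(3) V3 in simp_all)
  moreover have "\<forall>\<^sub>F t in at t0. ?q t \<in> Q" using ev by (simp add: eventually_nhds_conv_at)
  ultimately have parallel: "\<forall>\<^sub>F t in at t0. dird (bl, 0) V (g (?q t)) * dird (bm, 0) H (g (?q t))
      - dird (bm, 0) V (g (?q t)) * dird (bl, 0) H (g (?q t)) = 0"
  proof eventually_elim
    case (elim t)
    show ?case
    proof (rule ccontr)
      assume ne: "\<not> ?case"
      from plane_eq_0[OF ne E1[OF elim(2)] E3[OF elim(2)]] show False using E2[OF elim(2)] elim(1) by simp
    qed
  qed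
  have x0t0: "(x0, t0) \<in> U \<times> UNIV" using U(2) by simp
  have "((\<lambda>t. dird (bl, 0) V (g (?q t)) * dird (bm, 0) H (g (?q t)) - dird (bm, 0) V (g (?q t)) * dird (bl, 0) H (g (?q t)))
      has_real_derivative
      (D (dird (bl, 0) V) (x0, t0) * dird (bm, 0) H (x0, t0) + D (dird (bm, 0) H) (x0, t0) * dird (bl, 0) V (x0, t0))
      - (D (dird (bm, 0) V) (x0, t0) * dird (bl, 0) H (x0, t0) + D (dird (bl, 0) H) (x0, t0) * dird (bm, 0) V (x0, t0))) (at t0)"
    using DERIV_diff[OF DERIV_mult[OF ch0[OF smooth_on_dird[OF smooth_V, of "(bl, 0)"] z0] ch0[OF smooth_on_dird[OF H, of "(bm, 0)"] x0t0]]
      DERIV_mult[OF ch0[OF smooth_on_dird[OF smooth_V, of "(bm, 0)"] z0] ch0[OF smooth_on_dird[OF H, of "(bl, 0)"] x0t0]]]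
    unfolding y0(2) .
  note eqs = DERIV_punctured_zero[OF this parallel]
  have "D (dird (b, 0) H) (x0, t0) = 0" for b
  proof (rule dird_line[OF smooth_on_differentiable[OF smooth_on_dird[OF H] x0t0]])
    have "((\<lambda>\<sigma>. dird b h x0) has_real_derivative 0) (at 0)" by simp
    then show "((\<lambda>\<sigma>. dird (b, 0) H ((x0, t0) + \<sigma> *\<^sub>R (0, 1))) has_real_derivative 0) (at 0)"
      using dH[OF U(2), of b 0] by simp
  qed
  then have e2: "dird (bl, 0) (D V) (x0, t0) * dird (bm, 0) H (x0, t0) - dird (bm, 0) (D V) (x0, t0) * dird (bl, 0) H (x0, t0) = 0"
    using eqs(2) dird_commute[OF open_\<Omega> smooth_V z0] by (simp add: mult.commute)
  have e1: "dird (bl, 0) V (x0, t0) * dird (bm, 0) H (x0, t0) - dird (bm, 0) V (x0, t0) * dird (bl, 0) H (x0, t0) = 0"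
    using eqs(1) unfolding y0(2) .
  have Hlm: "dird bl h x0 = 0" "dird bm h x0 = 0"
  proof -
    have "dird bm h x0 * dird (bl, 0) V (x0, t0) + (- dird bl h x0) * dird (bm, 0) V (x0, t0) = 0"
      "dird bm h x0 * dird (bl, 0) (D V) (x0, t0) + (- dird bl h x0) * dird (bm, 0) (D V) (x0, t0) = 0"
      using e1 e2 unfolding dH[OF U(2)] by (simp_all add: mult.commute)
    from plane_eq_0[OF \<Delta>x[unfolded \<Delta>x_def] this] show "dird bl h x0 = 0" "dird bm h x0 = 0" by simp_all
  qed
  have linh: "linear (\<lambda>v. dird v h x0)" by (rule dird_linear[OF smooth_on_differentiable[OF U(3,2)]])
  \<comment> \<open>the remaining directions are tangent to \<open>E \<rho>\<close>\<close>
  have other: "dird v h x0 = 0" if v: "v \<bullet> bl = 0" "v \<bullet> bm = 0" for v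
  proof -
    let ?p = "\<lambda>\<sigma>. (?y0 + \<sigma> *\<^sub>R v, t0)"
    have p: "?p \<sigma> = (?y0 + \<sigma> *\<^sub>R v, t0 + \<sigma> * 0)" for \<sigma> by simp
    have p0: "?p 0 = (?y0, t0)" by simp
    have dp: "((\<lambda>\<sigma>. F (?p \<sigma>)) has_real_derivative dird (v, 0) F (?y0, t0)) (at 0)" if "smooth_on Q F" for F
      using line_has_derivative[of F "(?y0, t0)" 0 "(v, 0)"] smooth_on_differentiable[OF that y0Q] by simp
    have gp: "g (?p 0) = (x0, t0)" unfolding p0 by (rule y0)
    have "((\<lambda>\<sigma>. H (g (?p \<sigma>))) has_real_derivative
        dird (v + dird (v, 0) L (?y0, t0) *\<^sub>R bl + dird (v, 0) M (?y0, t0) *\<^sub>R bm, 0) H (x0, t0)) (at 0)"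
      using chain[of H ?p 0 ?y0 v t0 0, OF _ p _ _ v _ dp[OF LM(1)] dp[OF LM(2)]] y0Q
        smooth_on_differentiable[OF H x0t0] unfolding gp p0 by (simp add: y0(2))
    moreover have "\<forall>\<^sub>F \<sigma> in at 0. H (g (?p \<sigma>)) = 0"
    proof -
      have "open (?p -` Q)" by (intro open_vimage Q continuous_intros)
      then have "\<forall>\<^sub>F \<sigma> in at 0. \<sigma> \<in> ?p -` Q" using y0Q by (intro eventually_at_in_open') auto
      then show ?thesis by eventually_elim (use gq(4) v in \<open>simp add: H_def inner_add_left\<close>)
    qed
    ultimately have "dird (v + dird (v, 0) L (?y0, t0) *\<^sub>R bl + dird (v, 0) M (?y0, t0) *\<^sub>R bm, 0) H (x0, t0) = 0"
      by (rule DERIV_punctured_zero(2))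
    then show ?thesis unfolding dH[OF U(2)] linear_add[OF linh] linear_scale[OF linh] Hlm by simp
  qed
  have "w0 = strip w0 + (w0 \<bullet> bl) *\<^sub>R bl + (w0 \<bullet> bm) *\<^sub>R bm" unfolding strip_def by simp
  then have "dird w0 h x0 = dird (strip w0) h x0 + (w0 \<bullet> bl) * dird bl h x0 + (w0 \<bullet> bm) * dird bm h x0"
    using linear_add[OF linh] linear_scale[OF linh] by (metis real_scaleR_def)
  then show False using U(5) other[of "strip w0"] Hlm by simp
qed

end

section \<open>The three edges of triple zeros\<close>

lemma cos_treble_zeros:
  assumes "0 \<le> t" "t \<le> pi" "cos (3 * t) = 0"
  shows "t \<in> {pi / 6, pi / 2, 5 * pi / 6}"
proof -
  obtain i :: int where i: "odd i" "3 * t = of_int i * (pi / 2)" using assms(3) unfolding cos_zero_iff_int by blast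
  have t: "t = of_int i * (pi / 6)" using i(2) by simp
  have [simp]: "\<not> pi \<le> 0" using pi_gt_zero by linarith
  have "0 \<le> real_of_int i" "real_of_int i \<le> 6"
    using assms(1,2) unfolding t by (simp_all add: zero_le_mult_iff)
  then have "i \<in> {0..6}" by simp
  then have "i \<in> {0,1,2,3,4,5,6}" by auto
  then have "i = 1 \<or> i = 3 \<or> i = 5" using i(1) by auto
  then show ?thesis unfolding t by auto
qed

lemma cos_treble_zero_angles:
  assumes "t \<in> {pi / 6, pi / 2, 5 * pi / 6}"
  shows "cos (3 * t) = 0"
proof -
  have "3 * t = pi / 2 \<or> 3 * t = 3 / 2 * pi \<or> 3 * t = pi / 2 + 2 * pi" using assms by auto
  then show ?thesis using cos_periodic[of "pi / 2"] cos_3over2_pi by (elim disjE) (simp_all only: cos_pi_half)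
qed

context vertex_family
begin

text \<open>In the blown-up coordinates \<open>(s, l, m) \<mapsto> (s, s l, s m)\<close> the function \<open>V\<close> is divisible by \<open>s\<close>.\<close>

definition blow :: "'x \<Rightarrow> 'x" where
  "blow x = x + ((x \<bullet> bs) - 1) *\<^sub>R ((x \<bullet> bl) *\<^sub>R bl + (x \<bullet> bm) *\<^sub>R bm)"

definition lifted :: "('x \<times> real \<Rightarrow> real) \<Rightarrow> ('x \<times> real \<Rightarrow> real) \<Rightarrow> ('x \<times> real \<Rightarrow> real) \<Rightarrow> 'x \<times> real \<Rightarrow> real" where
  "lifted f0 f1 f2 z = f0 (blow (fst z), snd z) + (fst z \<bullet> bl) * f1 (blow (fst z), snd z) + (fst z \<bullet> bm) * f2 (blow (fst z), snd z)"

abbreviation U0 where "U0 \<equiv> lifted a0 a1 a2"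
abbreviation U1 where "U1 \<equiv> lifted (D a0) (D a1) (D a2)"
abbreviation U2 where "U2 \<equiv> lifted (D (D a0)) (D (D a1)) (D (D a2))"

definition \<Omega>b :: "('x \<times> real) set" where
  "\<Omega>b = {z. (blow (fst z), snd z) \<in> \<Omega>}"

lemma smooth_blow: "open S \<Longrightarrow> smooth_on S (\<lambda>z::'x \<times> real. (blow (fst z), snd z))"
  unfolding blow_def by (intro smooth_intros)

lemma open_\<Omega>b: "open \<Omega>b"
  unfolding \<Omega>b_def
  using open_vimage[OF open_\<Omega> smooth_on_continuous[OF smooth_blow[OF open_UNIV]]] by (simp add: vimage_def)

lemma smooth_lifted:
  assumes "smooth_on \<Omega> f0" "smooth_on \<Omega> f1" "smooth_on \<Omega> f2"
  shows "smooth_on \<Omega>b (lifted f0 f1 f2)"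
proof -
  have c: "smooth_on \<Omega>b (\<lambda>z. f (blow (fst z), snd z))" if "smooth_on \<Omega> f" for f :: "'x \<times> real \<Rightarrow> real"
    by (rule smooth_on_compose[OF that open_\<Omega>b open_\<Omega> smooth_blow[OF open_\<Omega>b]]) (simp add: \<Omega>b_def)
  show ?thesis unfolding lifted_def by (intro smooth_on_add[OF open_\<Omega>b] smooth_on_mult[OF open_\<Omega>b] c assms smooth_intros open_\<Omega>b)
qed

lemma blow_inner: "blow x \<bullet> bs = x \<bullet> bs" "blow x \<bullet> bl = (x \<bullet> bs) * (x \<bullet> bl)" "blow x \<bullet> bm = (x \<bullet> bs) * (x \<bullet> bm)"
  unfolding blow_def by (simp_all add: inner_add_left algebra_simps)

lemma V_blow:
  assumes "blow x \<in> ball 0 r"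
  shows "V (blow x, t) = (x \<bullet> bs) * U0 (x, t)" "D V (blow x, t) = (x \<bullet> bs) * U1 (x, t)"
    "D (D V) (blow x, t) = (x \<bullet> bs) * U2 (x, t)"
  unfolding V_eq[OF assms] DV_eq[OF assms] lifted_def blow_inner by (simp_all add: algebra_simps)

lemma Z3_blow:
  assumes "blow x \<in> ball 0 r" "x \<bullet> bs \<noteq> 0"
  shows "Z3 (blow x) t \<longleftrightarrow> U0 (x, t) = 0 \<and> U1 (x, t) = 0 \<and> U2 (x, t) = 0"
  unfolding Z3_def Z2_def V_blow[OF assms(1)] using assms(2) by auto

lemma lifted_slice:
  "lifted f0 f1 f2 (a *\<^sub>R bl + b *\<^sub>R bm, t) = f0 (0, t) + a * f1 (0, t) + b * f2 (0, t)"
proof -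
  have "blow (a *\<^sub>R bl + b *\<^sub>R bm) = 0" by (simp add: blow_def inner_add_left)
  then show ?thesis by (simp add: lifted_def inner_add_left)
qed

lemma dird_lifted_slice:
  assumes sm: "smooth_on \<Omega> f0" "smooth_on \<Omega> f1" "smooth_on \<Omega> f2"
  shows "dird (a *\<^sub>R bl + b *\<^sub>R bm, c) (lifted f0 f1 f2) (u *\<^sub>R bl + v *\<^sub>R bm, t) =
    a * f1 (0, t) + b * f2 (0, t) + c * (D f0 (0, t) + u * D f1 (0, t) + v * D f2 (0, t))"
proof (rule dird_line)
  have 0: "0 \<in> ball (0::'x) r" using r by simp
  have "blow (u *\<^sub>R bl + v *\<^sub>R bm) = 0" by (simp add: blow_def inner_add_left)
  then show "lifted f0 f1 f2 differentiable at (u *\<^sub>R bl + v *\<^sub>R bm, t)"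
    by (intro smooth_on_differentiable[OF smooth_lifted[OF sm]]) (simp add: \<Omega>b_def r)
  have eq: "(u *\<^sub>R bl + v *\<^sub>R bm, t) + \<sigma> *\<^sub>R (a *\<^sub>R bl + b *\<^sub>R bm, c) = ((u + \<sigma> * a) *\<^sub>R bl + (v + \<sigma> * b) *\<^sub>R bm, t + \<sigma> * c)" for \<sigma>
    by (simp add: algebra_simps)
  have d: "((\<lambda>\<sigma>. f (0, t + \<sigma> * c)) has_real_derivative c * D f (0, t)) (at 0)" if "smooth_on \<Omega> f" for f
  proof -
    have l: "((\<lambda>\<sigma>. t + \<sigma> * c) has_real_derivative c) (at 0)" by (auto intro!: derivative_eq_intros)
    have "((\<lambda>t. f (0, t)) has_real_derivative D f (0, t)) (at (t + 0 * c))"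
      using D_deriv[OF that 0, of t] by simp
    from DERIV_chain2[OF this l] show ?thesis by (simp only: mult.commute)
  qed
  show "((\<lambda>\<sigma>. lifted f0 f1 f2 ((u *\<^sub>R bl + v *\<^sub>R bm, t) + \<sigma> *\<^sub>R (a *\<^sub>R bl + b *\<^sub>R bm, c))) has_real_derivative
      a * f1 (0, t) + b * f2 (0, t) + c * (D f0 (0, t) + u * D f1 (0, t) + v * D f2 (0, t))) (at 0)"
    unfolding eq lifted_slice using d[OF sm(1)] d[OF sm(2)] d[OF sm(3)]
    by (auto intro!: derivative_eq_intros simp: algebra_simps)
qed

lemma slice_values:
  "lifted a0 a1 a2 (hypo1 e t *\<^sub>R bl + hypo2 e t *\<^sub>R bm, t) = 0"
  "lifted (D a0) (D a1) (D a2) (hypo1 e t *\<^sub>R bl + hypo2 e t *\<^sub>R bm, t) = 0"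
  "lifted (D (D a0)) (D (D a1)) (D (D a2)) (hypo1 e t *\<^sub>R bl + hypo2 e t *\<^sub>R bm, t) = 5 * e * cos (3 * t)"
  "lifted (D (D (D a0))) (D (D (D a1))) (D (D (D a2))) (hypo1 e t *\<^sub>R bl + hypo2 e t *\<^sub>R bm, t) = - 15 * e * sin (3 * t)"
proof -
  let ?s = "sin (2 * t)" and ?c = "cos (2 * t)"
  have sc: "?s\<^sup>2 + ?c\<^sup>2 = 1" by simp
  have "lifted a0 a1 a2 (hypo1 e t *\<^sub>R bl + hypo2 e t *\<^sub>R bm, t) = - e * cos (3 * t) + e * cos (3 * t) * (?s\<^sup>2 + ?c\<^sup>2)"
    unfolding lifted_slice a_0 hypo1_def hypo2_def by algebra
  then show "lifted a0 a1 a2 (hypo1 e t *\<^sub>R bl + hypo2 e t *\<^sub>R bm, t) = 0" unfolding sc by simp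
  have "lifted (D a0) (D a1) (D a2) (hypo1 e t *\<^sub>R bl + hypo2 e t *\<^sub>R bm, t) = 3 * e * sin (3 * t) - 3 * e * sin (3 * t) * (?s\<^sup>2 + ?c\<^sup>2)"
    unfolding lifted_slice D_a_0 hypo1_def hypo2_def by algebra
  then show "lifted (D a0) (D a1) (D a2) (hypo1 e t *\<^sub>R bl + hypo2 e t *\<^sub>R bm, t) = 0" unfolding sc by simp
  show "lifted (D (D a0)) (D (D a1)) (D (D a2)) (hypo1 e t *\<^sub>R bl + hypo2 e t *\<^sub>R bm, t) = 5 * e * cos (3 * t)"
    "lifted (D (D (D a0))) (D (D (D a1))) (D (D (D a2))) (hypo1 e t *\<^sub>R bl + hypo2 e t *\<^sub>R bm, t) = - 15 * e * sin (3 * t)"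
    using N_0[of t] unfolding lifted_slice N2_def N3_def M_0 prod.case by simp_all
qed

text \<open>At a cusp of the hypocycloid the functions \<open>U0\<close>, \<open>U1\<close>, \<open>U2\<close> have independent derivatives in
  \<open>\<lambda>\<close>, \<open>\<mu>\<close> and the angle, because the third derivative of \<open>V\<close> divided by \<open>s\<close> is not zero there.\<close>

lemma triple_zero_chart:
  assumes "cos (3 * t) = 0"
  obtains N N' g where "(hypo1 e t *\<^sub>R bl + hypo2 e t *\<^sub>R bm, t) \<in> N" "N \<subseteq> \<Omega>b" "diffeo N N' (J U0 U1 U2) g"
proof (rule local_chart[OF open_\<Omega>b smooth_lifted[OF smooth_a] smooth_lifted[OF smooth_Da(1-3)] smooth_lifted[OF smooth_Da(4-6)]])
  let ?z = "(hypo1 e t *\<^sub>R bl + hypo2 e t *\<^sub>R bm, t)"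
  have "blow (hypo1 e t *\<^sub>R bl + hypo2 e t *\<^sub>R bm) = 0" by (simp add: blow_def inner_add_left)
  then show "?z \<in> \<Omega>b" using r by (simp add: \<Omega>b_def)
  fix a b c
  assume d: "dird (a *\<^sub>R bl + b *\<^sub>R bm, c) U0 ?z = 0" "dird (a *\<^sub>R bl + b *\<^sub>R bm, c) U1 ?z = 0" "dird (a *\<^sub>R bl + b *\<^sub>R bm, c) U2 ?z = 0"
  have 1: "a * a1 (0, t) + b * a2 (0, t) = 0"
    using d(1) slice_values(2)[of t] unfolding dird_lifted_slice[OF smooth_a] lifted_slice by simp
  have 2: "a * D a1 (0, t) + b * D a2 (0, t) = 0"
    using d(2) slice_values(3)[of t] assms unfolding dird_lifted_slice[OF smooth_Da(1-3)] lifted_slice by simp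
  have "a1 (0, t) * D a2 (0, t) - a2 (0, t) * D a1 (0, t) \<noteq> 0" using \<Delta>_0[of t] unfolding \<Delta>_def by simp
  from plane_eq_0[OF this 1 2] have ab: "a = 0" "b = 0" .
  have "c * (- 15 * e * sin (3 * t)) = 0"
    using d(3) slice_values(4)[of t] unfolding dird_lifted_slice[OF smooth_Da(4-6)] lifted_slice ab by simp
  moreover have "sin (3 * t) \<noteq> 0" using assms sin_zero_norm_cos_one[of "3 * t"] by force
  ultimately show "a = 0 \<and> b = 0 \<and> c = 0" using ab e by simp
qed

definition on_edge :: "('x \<Rightarrow> real) \<Rightarrow> ('x \<Rightarrow> real) \<Rightarrow> 'x \<Rightarrow> bool" where
  "on_edge P1 P2 x \<longleftrightarrow> x \<bullet> bl = (x \<bullet> bs) * P1 (strip x) \<and> x \<bullet> bm = (x \<bullet> bs) * P2 (strip x)"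

lemma norm_strip: "norm (strip x) \<le> norm x"
proof -
  have "x \<bullet> x = strip x \<bullet> strip x + (x \<bullet> bl)\<^sup>2 + (x \<bullet> bm)\<^sup>2"
    unfolding strip_def by (simp add: inner_diff_left inner_diff_right inner_commute power2_eq_square)
  then have "strip x \<bullet> strip x \<le> x \<bullet> x" by simp
  then show ?thesis by (simp add: norm_le)
qed

lemma blow_strip:
  "blow (strip x + u *\<^sub>R bl + v *\<^sub>R bm) = strip x + ((x \<bullet> bs) * u) *\<^sub>R bl + ((x \<bullet> bs) * v) *\<^sub>R bm"
  unfolding blow_def by (simp add: inner_add_left algebra_simps)

lemma strip_add: "x = strip x + (x \<bullet> bl) *\<^sub>R bl + (x \<bullet> bm) *\<^sub>R bm"
  unfolding strip_def by simp

text \<open>Each zero of \<open>cos 3t\<close> carries one smooth sheet of triple zeros, given by the implicit function theorem in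
  the blown-up coordinates.\<close>

lemma edge_sheet:
  assumes t0: "cos (3 * t0) = 0"
  obtains \<rho> P1 P2 W where "\<rho> > 0" "smooth_on (ball 0 \<rho>) P1" "smooth_on (ball 0 \<rho>) P2" "P1 0 = hypo1 e t0" "P2 0 = hypo2 e t0"
    "open W" "(0, t0) \<in> W"
    "\<And>x. x \<in> ball 0 \<rho> \<Longrightarrow> x \<in> ball 0 r \<Longrightarrow> x \<bullet> bs \<noteq> 0 \<Longrightarrow> on_edge P1 P2 x \<Longrightarrow> \<exists>t. Z3 x t"
    "\<And>x t. (x, t) \<in> W \<Longrightarrow> x \<in> ball 0 \<rho> \<Longrightarrow> x \<in> ball 0 r \<Longrightarrow> x \<bullet> bs \<noteq> 0 \<Longrightarrow> Z3 x t \<Longrightarrow> on_edge P1 P2 x"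
proof -
  let ?z = "(hypo1 e t0 *\<^sub>R bl + hypo2 e t0 *\<^sub>R bm, t0)"
  obtain N N' g where N: "?z \<in> N" "N \<subseteq> \<Omega>b" "diffeo N N' (J U0 U1 U2) g" using triple_zero_chart[OF t0] .
  note DD = diffeoD[OF N(3)]
  have Jz: "J U0 U1 U2 ?z = (0, 0)"
    using J_eq[of U0 ?z U1 U2] slice_values(1-3)[of t0] t0 by (simp add: strip_def inner_add_left)
  have N0: "(0, 0) \<in> N'" "g (0, 0) = ?z" using DD(9)[OF N(1)] DD(7)[OF N(1)] unfolding Jz by simp_all
  have "open ((\<lambda>x::'x. (x, 0::real)) -` N')" by (intro open_vimage DD continuous_intros)
  then obtain \<rho> where \<rho>: "\<rho> > 0" "ball 0 \<rho> \<subseteq> (\<lambda>x. (x, 0)) -` N'" using N0(1) open_contains_ball by blast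
  define P1 where "P1 x = fst (g (x, 0)) \<bullet> bl" for x
  define P2 where "P2 x = fst (g (x, 0)) \<bullet> bm" for x
  have g: "smooth_on (ball 0 \<rho>) (\<lambda>x. g (x, 0))"
    by (rule smooth_on_compose[OF DD(4) _ DD(2)]) (use \<rho>(2) in \<open>auto intro!: smooth_intros\<close>)
  have P: "smooth_on (ball 0 \<rho>) P1" "smooth_on (ball 0 \<rho>) P2" unfolding P1_def P2_def
    by (intro smooth_intros open_ball g)+
  have P0: "P1 0 = hypo1 e t0" "P2 0 = hypo2 e t0" unfolding P1_def P2_def N0(2) by (simp_all add: inner_add_left)
  let ?Y = "\<lambda>z. (strip (fst z) + M1 z *\<^sub>R bl + M2 z *\<^sub>R bm, snd z)"
  have cY: "continuous_on {z \<in> \<Omega>. \<Delta> z \<noteq> 0} ?Y"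
    unfolding strip_def by (intro continuous_intros continuous_coeffs)
  define W where "W = {z \<in> \<Omega>. \<Delta> z \<noteq> 0} \<inter> ?Y -` N"
  have W: "open W" unfolding W_def by (rule continuous_open_preimage[OF cY continuous_coeffs(5) DD(1)])
  have W0: "(0, t0) \<in> W" unfolding W_def using N(1) zero_in(2)[of t0] by (simp add: M_0 strip_def)
  have "\<exists>t. Z3 x t" if x: "x \<in> ball 0 \<rho>" "x \<in> ball 0 r" "x \<bullet> bs \<noteq> 0" "on_edge P1 P2 x" for x
  proof -
    have "strip x \<in> ball 0 \<rho>" using norm_strip[of x] x(1) by simp
    then have sN: "(strip x, 0) \<in> N'" using \<rho>(2) by blast
    let ?q = "g (strip x, 0)"
    have q: "U0 ?q = 0" "U1 ?q = 0" "U2 ?q = 0" "fst ?q = strip x + (fst ?q \<bullet> bl) *\<^sub>R bl + (fst ?q \<bullet> bm) *\<^sub>R bm"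
      using J_inv[OF DD(8)[OF sN]] by simp_all
    then have X: "fst ?q = strip x + P1 (strip x) *\<^sub>R bl + P2 (strip x) *\<^sub>R bm" unfolding P1_def P2_def by simp
    have "blow (fst ?q) = x"
      unfolding X blow_strip using x(4) strip_add[of x] unfolding on_edge_def by simp
    moreover have "fst ?q \<bullet> bs = x \<bullet> bs" unfolding X by (simp add: inner_add_left)
    ultimately have "Z3 x (snd ?q)" using Z3_blow[of "fst ?q" "snd ?q"] x q by simp
    then show ?thesis ..
  qed
  moreover have "on_edge P1 P2 x" if x: "(x, t) \<in> W" "x \<in> ball 0 \<rho>" "x \<in> ball 0 r" "x \<bullet> bs \<noteq> 0" "Z3 x t" for x t
  proof -
    have \<Delta>: "\<Delta> (x, t) \<noteq> 0" and Y: "?Y (x, t) \<in> N" using x(1) unfolding W_def by auto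
    have M: "x \<bullet> bl = (x \<bullet> bs) * M1 (x, t)" "x \<bullet> bm = (x \<bullet> bs) * M2 (x, t)"
      using Z2_iff_M[OF x(3) \<Delta>] x(5) unfolding Z3_def by auto
    let ?X = "strip x + M1 (x, t) *\<^sub>R bl + M2 (x, t) *\<^sub>R bm"
    have b: "blow ?X = x" unfolding blow_strip using strip_add[of x] M by simp
    have "U0 (?X, t) = 0 \<and> U1 (?X, t) = 0 \<and> U2 (?X, t) = 0"
      using Z3_blow[of ?X t] x(3-5) unfolding b by (simp add: inner_add_left)
    then have "J U0 U1 U2 (?X, t) = (strip x, 0)"
      using J_eq[of U0 "(?X, t)" U1 U2] by (simp add: strip_def inner_add_left inner_diff_left)
    then have "g (strip x, 0) = (?X, t)" using DD(7)[OF Y] by simp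
    then show ?thesis unfolding on_edge_def P1_def P2_def using M by (simp add: inner_add_left)
  qed
  ultimately show ?thesis using that[OF \<rho>(1) P P0 W W0] by blast
qed

text \<open>At the vertex of the cone the quotient of \<open>V\<^sub>t\<^sub>t\<close> by \<open>s\<close> is \<open>5 e cos 3t\<close>, so triple zeros nearby have angles
  close to a zero of \<open>cos 3t\<close>. A half turn takes care of the angles beyond \<open>\<pi>\<close>.\<close>

lemma triple_zeros_near_edges:
  assumes W: "\<And>t. t \<in> {pi / 6, pi / 2, 5 * pi / 6} \<Longrightarrow> open (W t) \<and> (0, t) \<in> W t"
  shows "\<forall>\<^sub>F x in nhds 0. \<forall>t\<in>{0..pi}. x \<bullet> bs \<noteq> 0 \<longrightarrow> Z3 x t \<longrightarrow> (\<exists>t0\<in>{pi / 6, pi / 2, 5 * pi / 6}. (x, t) \<in> W t0)"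
proof (rule eventually_ball_compact)
  fix t assume t: "t \<in> {0..pi}"
  show "\<forall>\<^sub>F z in nhds (0, t). fst z \<bullet> bs \<noteq> 0 \<longrightarrow> Z3 (fst z) (snd z) \<longrightarrow>
      (\<exists>t0\<in>{pi / 6, pi / 2, 5 * pi / 6}. (fst z, snd z) \<in> W t0)"
  proof (cases "cos (3 * t) = 0")
    case True
    then have tin: "t \<in> {pi / 6, pi / 2, 5 * pi / 6}" by (intro cos_treble_zeros True) (use t in simp_all)
    have "\<forall>\<^sub>F z in nhds (0, t). z \<in> W t" using W[OF tin] by (intro eventually_nhds_in_open) auto
    then show ?thesis by eventually_elim (use tin in \<open>simp only: prod.collapse, blast\<close>)
  next
    case False
    let ?w = "\<lambda>z::'x \<times> real. (fst z, snd z, snd z)"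
    have f: "continuous_on (?w -` \<Omega>3) (\<lambda>z. N2 (?w z))" "open (?w -` \<Omega>3)"
      by (intro continuous_intros open_vimage open_\<Omega>3 continuous_on_compose2[OF continuous_N(1)]; blast)+
    have "\<forall>\<^sub>F z in nhds (0, t). z \<in> ?w -` \<Omega>3 \<and> N2 (?w z) \<in> - {0}"
      by (rule eventually_continuous_on[OF f]) (use False e N_0(1)[of t] zero_in(3) in \<open>auto simp: open_Compl\<close>)
    then show ?thesis
    proof eventually_elim
      case (elim z)
      then have z: "fst z \<in> ball 0 r" "\<Delta> (fst z, snd z) \<noteq> 0" by (auto simp: \<Omega>3_def)
      show ?case using D_V_N(1)[OF z, of "snd z"] elim unfolding Z3_def by auto
    qed
  qed
qed simp

lemma Z3_param:
  obtains \<rho> P1 P2 where "\<rho> > 0"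
    "\<And>t. t \<in> {pi / 6, pi / 2, 5 * pi / 6} \<Longrightarrow> smooth_on (ball 0 \<rho>) (P1 t) \<and> smooth_on (ball 0 \<rho>) (P2 t) \<and>
       P1 t 0 = hypo1 e t \<and> P2 t 0 = hypo2 e t"
    "\<And>x. x \<in> ball 0 \<rho> \<Longrightarrow> x \<bullet> bs \<noteq> 0 \<Longrightarrow> (\<exists>t. Z3 x t) \<longleftrightarrow>
       (\<exists>t\<in>{pi / 6, pi / 2, 5 * pi / 6}. on_edge (P1 t) (P2 t) x \<or> on_edge (P1 t) (P2 t) (flip x))"
proof -
  let ?T = "{pi / 6, pi / 2, 5 * pi / 6}"
  define good_sheet where "good_sheet t \<rho> P1 P2 W \<longleftrightarrow> \<rho> > 0 \<and> smooth_on (ball 0 \<rho>) P1 \<and> smooth_on (ball 0 \<rho>) P2 \<and>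
     P1 0 = hypo1 e t \<and> P2 0 = hypo2 e t \<and> open W \<and> (0, t) \<in> W \<and>
     (\<forall>x. x \<in> ball 0 \<rho> \<longrightarrow> x \<in> ball 0 r \<longrightarrow> x \<bullet> bs \<noteq> 0 \<longrightarrow> on_edge P1 P2 x \<longrightarrow> (\<exists>t. Z3 x t)) \<and>
     (\<forall>x t. (x, t) \<in> W \<longrightarrow> x \<in> ball 0 \<rho> \<longrightarrow> x \<in> ball 0 r \<longrightarrow> x \<bullet> bs \<noteq> 0 \<longrightarrow> Z3 x t \<longrightarrow> on_edge P1 P2 x)"
    for t \<rho> P1 P2 W
  have "\<exists>\<rho> P1 P2 W. good_sheet t \<rho> P1 P2 W" if "t \<in> ?T" for t
    unfolding good_sheet_def by (rule edge_sheet[OF cos_treble_zero_angles[OF that]]) blast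
  then obtain \<rho>' P1 P2 W where sheet: "\<And>t. t \<in> ?T \<Longrightarrow> good_sheet t (\<rho>' t) (P1 t) (P2 t) (W t)" by metis
  have "\<forall>\<^sub>F x in nhds 0. \<forall>t\<in>{0..pi}. x \<bullet> bs \<noteq> 0 \<longrightarrow> Z3 x t \<longrightarrow> (\<exists>t0\<in>?T. (x, t) \<in> W t0)"
    by (rule triple_zeros_near_edges) (use sheet in \<open>auto simp: good_sheet_def\<close>)
  then obtain \<epsilon> where \<epsilon>: "\<epsilon> > 0" "\<And>x t. x \<in> ball 0 \<epsilon> \<Longrightarrow> t \<in> {0..pi} \<Longrightarrow> x \<bullet> bs \<noteq> 0 \<Longrightarrow> Z3 x t \<Longrightarrow> (\<exists>t0\<in>?T. (x, t) \<in> W t0)"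
    unfolding eventually_nhds_metric by (auto simp: dist_commute)
  define \<rho> where "\<rho> = Min (insert r (insert \<epsilon> (\<rho>' ` ?T)))"
  have "\<rho>' t > 0" if "t \<in> ?T" for t using sheet[OF that] unfolding good_sheet_def by blast
  then have "\<forall>u\<in>insert r (insert \<epsilon> (\<rho>' ` ?T)). u > 0" using r \<epsilon>(1) by blast
  then have \<rho>: "\<rho> > 0" unfolding \<rho>_def by (subst Min_gr_iff) auto
  have \<rho>_le: "\<rho> \<le> r" "\<rho> \<le> \<epsilon>" "\<And>t. t \<in> ?T \<Longrightarrow> \<rho> \<le> \<rho>' t"
    unfolding \<rho>_def by (rule Min_le; blast)+
  have in_ball: "x \<in> ball 0 r" "x \<in> ball 0 \<epsilon>" "\<And>t. t \<in> ?T \<Longrightarrow> x \<in> ball 0 (\<rho>' t)" if "x \<in> ball 0 \<rho>" for x :: 'x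
  proof -
    have n: "norm x < \<rho>" using that by simp
    show "x \<in> ball 0 r" "x \<in> ball 0 \<epsilon>" using n \<rho>_le(1,2) by simp_all
    show "x \<in> ball 0 (\<rho>' t)" if "t \<in> ?T" for t using n \<rho>_le(3)[OF that] by simp
  qed
  show ?thesis
  proof (rule that[of \<rho> P1 P2])
    show "\<rho> > 0" by (rule \<rho>)
    show "smooth_on (ball 0 \<rho>) (P1 t) \<and> smooth_on (ball 0 \<rho>) (P2 t) \<and> P1 t 0 = hypo1 e t \<and> P2 t 0 = hypo2 e t"
      if "t \<in> ?T" for t
      using sheet[OF that] \<rho>_le(3)[OF that] unfolding good_sheet_def by (auto elim!: smooth_on_subset)
    fix x :: 'x assume x: "x \<in> ball 0 \<rho>" "x \<bullet> bs \<noteq> 0"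
    have half: "\<exists>t\<in>?T. on_edge (P1 t) (P2 t) y" if y: "y \<in> ball 0 \<rho>" "y \<bullet> bs \<noteq> 0" "Z3 y t" "0 \<le> t" "t \<le> pi" for y t
    proof -
      have "t \<in> {0..pi}" using y(4,5) by simp
      from \<epsilon>(2)[OF in_ball(2)[OF y(1)] this y(2,3)]
      obtain t0 where "t0 \<in> ?T" "(y, t) \<in> W t0" by blast
      then show ?thesis using sheet[of t0] in_ball[OF y(1)] y(2,3) unfolding good_sheet_def by blast
    qed
    show "(\<exists>t. Z3 x t) \<longleftrightarrow> (\<exists>t\<in>?T. on_edge (P1 t) (P2 t) x \<or> on_edge (P1 t) (P2 t) (flip x))"
    proof
      assume "\<exists>t. Z3 x t"
      then obtain t where "Z3 x t" by blast
      moreover obtain k :: int where k: "0 \<le> t + 2 * pi * of_int k" "t + 2 * pi * of_int k < 0 + 2 * pi"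
        using reduce_angle by blast
      ultimately have Z: "Z3 x (t + 2 * pi * of_int k)" using Z_2pi_int(2)[OF in_ball(1)[OF x(1)]] by blast
      let ?t = "t + 2 * pi * of_int k"
      show "\<exists>t\<in>?T. on_edge (P1 t) (P2 t) x \<or> on_edge (P1 t) (P2 t) (flip x)"
      proof (cases "?t \<le> pi")
        case True
        then show ?thesis using half[OF x Z k(1)] by blast
      next
        case False
        have "Z3 (flip x) (?t - pi)" using Z Z_flip(2)[OF in_ball(1)[OF x(1)], of "?t - pi"] by simp
        moreover have "flip x \<in> ball 0 \<rho>" "flip x \<bullet> bs \<noteq> 0" using x by simp_all
        ultimately show ?thesis using half[of "flip x" "?t - pi"] False k by auto
      qed
    next
      have converse: "\<exists>t. Z3 y t" if "y \<in> ball 0 \<rho>" "y \<bullet> bs \<noteq> 0" "t \<in> ?T" "on_edge (P1 t) (P2 t) y" for y t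
        using sheet[OF that(3)] in_ball[OF that(1)] that unfolding good_sheet_def by blast
      assume "\<exists>t\<in>?T. on_edge (P1 t) (P2 t) x \<or> on_edge (P1 t) (P2 t) (flip x)"
      then obtain t where t: "t \<in> ?T" "on_edge (P1 t) (P2 t) x \<or> on_edge (P1 t) (P2 t) (flip x)" by blast
      from t(2) show "\<exists>t. Z3 x t"
      proof
        assume "on_edge (P1 t) (P2 t) x"
        then show ?thesis using converse[OF x t(1)] by blast
      next
        assume "on_edge (P1 t) (P2 t) (flip x)"
        then obtain u where "Z3 (flip x) u" using converse[of "flip x"] x t(1) by auto
        then show ?thesis using Z_flip(2)[OF in_ball(1)[OF x(1)]] by blast
      qed
    qed
  qed
qed

end

section \<open>Order of vanishing of functions of one variable\<close>

definition vanish :: "nat \<Rightarrow> (real \<Rightarrow> real) \<Rightarrow> real \<Rightarrow> bool" where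
  "vanish m h x \<longleftrightarrow> (\<forall>j\<le>m. (deriv ^^ j) h x = 0)"

lemma vanish_0 [simp]: "vanish 0 h x \<longleftrightarrow> h x = 0"
  by (simp add: vanish_def)

lemma vanish_Suc: "vanish (Suc m) h x \<longleftrightarrow> h x = 0 \<and> vanish m (deriv h) x"
proof
  assume v: "vanish (Suc m) h x"
  have "(deriv ^^ j) (deriv h) x = 0" if "j \<le> m" for j
    using v that unfolding vanish_def by (metis Suc_le_mono funpow_simps_right(2) o_apply)
  moreover have "h x = 0" using v unfolding vanish_def by (metis funpow_0 zero_le)
  ultimately show "h x = 0 \<and> vanish m (deriv h) x" unfolding vanish_def by blast
next
  assume v: "h x = 0 \<and> vanish m (deriv h) x"
  show "vanish (Suc m) h x" unfolding vanish_def
  proof (intro allI impI)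
    fix j assume "j \<le> Suc m"
    then show "(deriv ^^ j) h x = 0" using v unfolding vanish_def
      by (cases j) (simp_all add: funpow_swap1)
  qed
qed

lemma vanish_mono: "vanish m h x \<Longrightarrow> n \<le> m \<Longrightarrow> vanish n h x"
  unfolding vanish_def by simp

lemma smooth_DERIV:
  fixes h :: "real \<Rightarrow> real"
  assumes "smooth_on S h" "x \<in> S"
  shows "(h has_real_derivative deriv h x) (at x)"
  using smooth_on_differentiable[OF assms] by (simp add: DERIV_deriv_iff_real_differentiable)

lemma smooth_deriv:
  fixes h :: "real \<Rightarrow> real"
  assumes "open S" "smooth_on S h"
  shows "smooth_on S (deriv h)"
proof (rule smooth_on_cong[OF assms(1) _ smooth_on_dird[OF assms(2), of 1]])
  fix x assume "x \<in> S"
  then show "dird 1 h x = deriv h x"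
    using dirdI[OF smooth_DERIV[OF assms(2), unfolded has_field_derivative_def]] by simp
qed

lemma deriv_cong_on:
  fixes f g :: "real \<Rightarrow> real"
  assumes "open S" "x \<in> S" "\<And>y. y \<in> S \<Longrightarrow> f y = g y"
  shows "deriv f x = deriv g x"
  by (rule deriv_cong_ev) (use assms in \<open>auto simp: eventually_nhds\<close>)

lemma vanish_cong:
  assumes "open S" "x \<in> S" "\<And>y. y \<in> S \<Longrightarrow> f y = g y"
  shows "vanish m f x \<longleftrightarrow> vanish m g x"
  using assms(3)
proof (induction m arbitrary: f g)
  case (Suc m)
  have "vanish m (deriv f) x \<longleftrightarrow> vanish m (deriv g) x"
    by (rule Suc.IH) (rule deriv_cong_on[OF assms(1)], auto intro: Suc.prems)
  then show ?case unfolding vanish_Suc using Suc.prems assms(2) by simp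
qed (use assms in simp)

lemma vanish_add:
  assumes "open S" "x \<in> S" "smooth_on S f" "smooth_on S g" "vanish m f x" "vanish m g x"
  shows "vanish m (\<lambda>y. f y + g y) x"
  using assms(3-6)
proof (induction m arbitrary: f g)
  case (Suc m)
  have "vanish m (\<lambda>y. deriv f y + deriv g y) x"
    using Suc.prems by (intro Suc.IH smooth_deriv assms(1)) (auto simp: vanish_Suc)
  moreover have "deriv (\<lambda>y. f y + g y) y = deriv f y + deriv g y" if "y \<in> S" for y
    using smooth_DERIV[OF Suc.prems(1) that] smooth_DERIV[OF Suc.prems(2) that] by (intro DERIV_imp_deriv DERIV_add)
  ultimately show ?case using Suc.prems
    unfolding vanish_Suc using vanish_cong[OF assms(1,2), of "deriv (\<lambda>y. f y + g y)" "\<lambda>y. deriv f y + deriv g y"] by simp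
qed simp

lemma vanish_mult:
  assumes "open S" "x \<in> S" "smooth_on S a" "smooth_on S b" "vanish m b x"
  shows "vanish m (\<lambda>y. a y * b y) x"
  using assms(3-5)
proof (induction m arbitrary: a b)
  case (Suc m)
  have "vanish m (\<lambda>y. deriv a y * b y + a y * deriv b y) x"
  proof (rule vanish_add[OF assms(1,2)])
    show "vanish m (\<lambda>y. deriv a y * b y) x"
      using Suc.prems by (intro Suc.IH smooth_deriv assms(1)) (auto intro: vanish_mono)
    show "vanish m (\<lambda>y. a y * deriv b y) x"
      using Suc.prems by (intro Suc.IH smooth_deriv assms(1)) (auto simp: vanish_Suc)
  qed (intro smooth_intros smooth_deriv assms(1) Suc.prems)+
  moreover have "deriv (\<lambda>y. a y * b y) y = deriv a y * b y + a y * deriv b y" if "y \<in> S" for y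
    using DERIV_mult[OF smooth_DERIV[OF Suc.prems(1) that] smooth_DERIV[OF Suc.prems(2) that]]
    by (intro DERIV_imp_deriv) (simp add: algebra_simps)
  ultimately show ?case using Suc.prems
    unfolding vanish_Suc using vanish_cong[OF assms(1,2), of "deriv (\<lambda>y. a y * b y)" "\<lambda>y. deriv a y * b y + a y * deriv b y"] by simp
qed simp

lemma vanish_mult_iff:
  assumes "open S" "x \<in> S" "smooth_on S a" "smooth_on S b" "\<And>y. y \<in> S \<Longrightarrow> a y \<noteq> 0"
  shows "vanish m (\<lambda>y. a y * b y) x \<longleftrightarrow> vanish m b x"
proof
  assume v: "vanish m (\<lambda>y. a y * b y) x"
  have "vanish m (\<lambda>y. inverse (a y) * (a y * b y)) x"
    by (rule vanish_mult[OF assms(1,2) _ _ v]) (intro smooth_intros assms | use assms in simp)+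
  then show "vanish m b x"
    using vanish_cong[OF assms(1,2), of "\<lambda>y. inverse (a y) * (a y * b y)" b] assms(5) by simp
qed (rule vanish_mult[OF assms(1-4)])

text \<open>Contact does not depend on the parametrization of the curve.\<close>

lemma vanish_compose:
  assumes "open S" "smooth_on S h" "open T" "smooth_on T \<phi>" "t \<in> T" "\<And>t. t \<in> T \<Longrightarrow> \<phi> t \<in> S" "\<And>t. t \<in> T \<Longrightarrow> deriv \<phi> t \<noteq> 0"
  shows "vanish m (\<lambda>t. h (\<phi> t)) t \<longleftrightarrow> vanish m h (\<phi> t)"
  using assms(2)
proof (induction m arbitrary: h)
  case (Suc m)
  have "deriv (\<lambda>t. h (\<phi> t)) t = deriv \<phi> t * deriv h (\<phi> t)" if "t \<in> T" for t
    using DERIV_chain2[OF smooth_DERIV[OF Suc.prems assms(6)[OF that]] smooth_DERIV[OF assms(4) that]]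
    by (intro DERIV_imp_deriv) (simp add: mult.commute)
  then have "vanish m (deriv (\<lambda>t. h (\<phi> t))) t \<longleftrightarrow> vanish m (\<lambda>t. deriv \<phi> t * deriv h (\<phi> t)) t"
    by (rule vanish_cong[OF assms(3,5)])
  also have "\<dots> \<longleftrightarrow> vanish m (\<lambda>t. deriv h (\<phi> t)) t"
    by (rule vanish_mult_iff[OF assms(3,5) smooth_deriv[OF assms(3,4)] smooth_on_compose[OF smooth_deriv[OF assms(1) Suc.prems] assms(3,1,4,6)] assms(7)])
  also have "\<dots> \<longleftrightarrow> vanish m (deriv h) (\<phi> t)"
    by (rule Suc.IH[OF smooth_deriv[OF assms(1) Suc.prems]])
  finally show ?case unfolding vanish_Suc by simp
qed simp

section \<open>Vertices of curves in polar coordinates\<close>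

definition polar :: "real \<times> real \<Rightarrow> real \<times> real" where
  "polar z = (fst z * cos (snd z), fst z * sin (snd z))"

lemma smooth_polar: "open S \<Longrightarrow> smooth_on S polar"
  unfolding polar_def by (intro smooth_intros)

lemma polar_has_derivative:
  "(polar has_derivative (\<lambda>v. (fst v * cos t - snd v * (r * sin t), fst v * sin t + snd v * (r * cos t)))) (at (r, t))"
  unfolding polar_def by (auto intro!: derivative_eq_intros simp: algebra_simps)

lemma rotation_eq_0:
  fixes a b t :: real
  assumes "a * cos t - b * sin t = 0" "a * sin t + b * cos t = 0"
  shows "a = 0" "b = 0"
proof -
  have "a * ((sin t)\<^sup>2 + (cos t)\<^sup>2) = cos t * (a * cos t - b * sin t) + sin t * (a * sin t + b * cos t)"
    "b * ((sin t)\<^sup>2 + (cos t)\<^sup>2) = cos t * (a * sin t + b * cos t) - sin t * (a * cos t - b * sin t)" by algebra+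
  then show "a = 0" "b = 0" unfolding assms by simp_all
qed

lemma rotation_solve:
  fixes p q t :: real
  shows "\<exists>Y W. Y * cos t + W * sin t = p \<and> - Y * sin t + W * cos t = q"
proof (intro exI conjI)
  have sc: "(sin t)\<^sup>2 + (cos t)\<^sup>2 = 1" by simp
  have "(p * cos t - q * sin t) * cos t + (p * sin t + q * cos t) * sin t = p * ((sin t)\<^sup>2 + (cos t)\<^sup>2)" by algebra
  then show "(p * cos t - q * sin t) * cos t + (p * sin t + q * cos t) * sin t = p" unfolding sc by simp
  have "- (p * cos t - q * sin t) * sin t + (p * sin t + q * cos t) * cos t = q * ((sin t)\<^sup>2 + (cos t)\<^sup>2)" by algebra
  then show "- (p * cos t - q * sin t) * sin t + (p * sin t + q * cos t) * cos t = q" unfolding sc by simp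
qed

lemma polar_chart:
  assumes "r > 0"
  obtains N N' G where "(r, t) \<in> N" "N \<subseteq> {z. fst z > 0}" "diffeo N N' polar G"
proof -
  let ?S = "{z :: real \<times> real. fst z > 0}"
  have S: "open ?S" by (intro open_Collect_less continuous_intros)
  have inj: "v = 0" if "dird v polar (r, t) = 0" for v
  proof -
    have "fst v * cos t - (snd v * r) * sin t = 0" "fst v * sin t + (snd v * r) * cos t = 0"
      using that unfolding dirdI[OF polar_has_derivative] by (simp_all add: zero_prod_def mult.assoc)
    from rotation_eq_0[OF this] show ?thesis using assms by (simp add: prod_eq_iff)
  qed
  have "(r, t) \<in> ?S" using assms by simp
  from smooth_inverse_function[OF S smooth_polar[OF S] this inj] that show ?thesis by metis
qed

text \<open>A curve \<open>r = s * P t\<close> in polar coordinates, and a set that coincides with it.\<close>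

locale polar_curve =
  fixes M :: "(real \<times> real) set" and s :: real and P :: "real \<Rightarrow> real"
  assumes s: "s > 0" and P: "smooth_on UNIV P" "\<And>t. P t > 0"
    and on_M: "\<And>t. polar (s * P t, t) \<in> M"
    and only_M: "\<And>r t. r > 0 \<Longrightarrow> polar (r, t) \<in> M \<Longrightarrow> r = s * P t"
    and regular_M: "\<And>t. smooth_submanifold_at 1 M (polar (s * P t, t))"
    and u_pos: "\<And>t. deriv (deriv (\<lambda>t. inverse (P t))) t + inverse (P t) \<noteq> 0"
begin

definition c :: "real \<Rightarrow> real \<times> real" where
  "c t = polar (s * P t, t)"

lemma smooth_c: "open S \<Longrightarrow> smooth_on S c"
  unfolding c_def polar_def
  by (intro smooth_intros smooth_on_subset[OF P(1)]) auto

lemma c_derivative: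
  "(c has_vector_derivative (s * deriv P t * cos t - s * P t * sin t, s * deriv P t * sin t + s * P t * cos t)) (at t)"
proof -
  have "(P has_real_derivative deriv P t) (at t)" by (rule smooth_DERIV[OF P(1)]) simp
  then have P': "(P has_derivative (\<lambda>h. h * deriv P t)) (at t)" by (simp add: has_field_derivative_def mult_commute_abs)
  show ?thesis unfolding has_vector_derivative_def c_def polar_def
    by (auto intro!: derivative_eq_intros P' simp: algebra_simps)
qed

lemma c_derivative_nonzero: "(s * deriv P t * cos t - s * P t * sin t, s * deriv P t * sin t + s * P t * cos t) \<noteq> 0"
  using rotation_eq_0(2)[of "s * deriv P t" t "s * P t"] s P(2)[of t] by (force simp: zero_prod_def)

lemma smooth_circle: "circle_equation g \<Longrightarrow> smooth_on S g" if "open S" for g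
proof -
  assume "circle_equation g"
  then obtain A B k where g: "\<And>p. g p = A * (p \<bullet> p) + B \<bullet> p + k" unfolding circle_equation_def by blast
  show "smooth_on S g" unfolding g[abs_def] by (intro smooth_intros that)
qed

text \<open>The definition of tangency allows any regular parametrization; polar coordinates reduce all of them to
  the parametrization by the angle.\<close>

lemma tangency_iff:
  assumes g: "circle_equation g"
  shows "tangency_at_least m M (c t0) g \<longleftrightarrow> vanish m (\<lambda>t. g (c t)) t0"
proof
  have gc: "smooth_on UNIV (\<lambda>t. g (c t))"
    by (rule smooth_on_compose[OF smooth_circle[OF open_UNIV g] open_UNIV open_UNIV smooth_c]) auto
  {
    assume v: "vanish m (\<lambda>t. g (c t)) t0"
    let ?\<gamma> = "\<lambda>t. c (t0 + t)"
    have d1: "deriv (\<lambda>t. t0 + t) t = 1" for t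
      by (rule DERIV_imp_deriv) (auto intro!: derivative_eq_intros)
    have "regular_param M (c t0) ?\<gamma>" unfolding regular_param_def
    proof (intro conjI exI[of _ "1::real"])
      show "smooth_on {-1<..<1} ?\<gamma>"
        by (rule smooth_on_compose[OF smooth_c[OF open_UNIV]]) (auto intro!: smooth_intros)
      show "?\<gamma> ` {-1<..<1} \<subseteq> M" using on_M by (auto simp: c_def)
      have "((c \<circ> (\<lambda>t. t0 + t)) has_vector_derivative 1 *\<^sub>R (s * deriv P (t0 + 0) * cos (t0 + 0) - s * P (t0 + 0) * sin (t0 + 0), s * deriv P (t0 + 0) * sin (t0 + 0) + s * P (t0 + 0) * cos (t0 + 0))) (at 0)"
        by (rule vector_diff_chain_at[OF _ c_derivative]) (auto intro!: derivative_eq_intros simp: has_real_derivative_iff_has_vector_derivative[symmetric])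
      then have "vector_derivative ?\<gamma> (at 0) = (s * deriv P t0 * cos t0 - s * P t0 * sin t0, s * deriv P t0 * sin t0 + s * P t0 * cos t0)"
        by (intro vector_derivative_at) (simp add: o_def)
      then show "vector_derivative ?\<gamma> (at 0) \<noteq> 0" using c_derivative_nonzero[of t0] by simp
    qed simp_all
    moreover have "vanish m (\<lambda>t. g (c (t0 + t))) 0 \<longleftrightarrow> vanish m (\<lambda>t. g (c t)) (t0 + 0)"
      by (rule vanish_compose[OF open_UNIV gc open_UNIV, of "\<lambda>t. t0 + t"]) (auto intro!: smooth_intros simp: d1)
    ultimately show "tangency_at_least m M (c t0) g"
      unfolding tangency_at_least_def using v by (intro exI[of _ ?\<gamma>]) (simp add: vanish_def o_def)
  next
    assume "tangency_at_least m M (c t0) g"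
    then obtain \<gamma> where \<gamma>: "regular_param M (c t0) \<gamma>" "\<forall>j\<le>m. (deriv ^^ j) (g \<circ> \<gamma>) 0 = 0"
      unfolding tangency_at_least_def by blast
    obtain \<epsilon> where \<epsilon>: "\<epsilon> > 0" "smooth_on {-\<epsilon><..<\<epsilon>} \<gamma>" "\<gamma> ` {-\<epsilon><..<\<epsilon>} \<subseteq> M" "\<gamma> 0 = c t0" "vector_derivative \<gamma> (at 0) \<noteq> 0"
      using \<gamma>(1) unfolding regular_param_def by blast
    have r0: "s * P t0 > 0" using s P(2) by simp
    obtain N N' G where N: "(s * P t0, t0) \<in> N" "N \<subseteq> {z. fst z > 0}" "diffeo N N' polar G"
      by (rule polar_chart[OF r0])
    note DD = diffeoD[OF N(3)]
    define T where "T = {-\<epsilon><..<\<epsilon>} \<inter> \<gamma> -` N'"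
    have T: "open T" unfolding T_def
      by (intro continuous_open_preimage smooth_on_continuous[OF \<epsilon>(2)] DD) simp
    have T0: "0 \<in> T" using \<epsilon>(1,4) DD(9)[OF N(1)] by (simp add: T_def c_def)
    define \<phi> where "\<phi> t = snd (G (\<gamma> t))" for t
    have G: "smooth_on T (\<lambda>t. G (\<gamma> t))"
      by (rule smooth_on_compose[OF DD(4) T DD(2) smooth_on_subset[OF \<epsilon>(2)]]) (auto simp: T_def)
    have \<phi>: "smooth_on T \<phi>" unfolding \<phi>_def by (intro smooth_intros T G)
    have \<gamma>c: "\<gamma> t = c (\<phi> t)" if "t \<in> T" for t
    proof -
      have t: "\<gamma> t \<in> N'" "\<gamma> t \<in> M" using that \<epsilon>(3) unfolding T_def by auto
      have p: "polar (fst (G (\<gamma> t)), \<phi> t) = \<gamma> t" using DD(8)[OF t(1)] by (simp add: \<phi>_def)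
      have "fst (G (\<gamma> t)) > 0" using N(2) DD(10)[OF t(1)] by auto
      then have "fst (G (\<gamma> t)) = s * P (\<phi> t)" using only_M[of "fst (G (\<gamma> t))" "\<phi> t"] p t(2) by simp
      then show ?thesis using p by (simp add: c_def)
    qed
    have \<phi>0: "\<phi> 0 = t0" unfolding \<phi>_def \<epsilon>(4) c_def using DD(7)[OF N(1)] by simp
    have d\<phi>: "(\<phi> has_real_derivative deriv \<phi> 0) (at 0)" by (rule smooth_DERIV[OF \<phi> T0])
    have "deriv \<phi> 0 \<noteq> 0"
    proof
      assume d0: "deriv \<phi> 0 = 0"
      have "((c \<circ> \<phi>) has_vector_derivative deriv \<phi> 0 *\<^sub>R (s * deriv P (\<phi> 0) * cos (\<phi> 0) - s * P (\<phi> 0) * sin (\<phi> 0), s * deriv P (\<phi> 0) * sin (\<phi> 0) + s * P (\<phi> 0) * cos (\<phi> 0))) (at 0)"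
        using d\<phi> by (intro vector_diff_chain_at c_derivative) (simp add: has_real_derivative_iff_has_vector_derivative)
      then have "((c \<circ> \<phi>) has_vector_derivative 0) (at 0)" unfolding d0 by (simp add: zero_prod_def)
      then have "(\<gamma> has_vector_derivative 0) (at 0)"
        by (rule has_vector_derivative_transform_within_open[OF _ T T0]) (simp add: \<gamma>c)
      then show False using \<epsilon>(5) vector_derivative_at by blast
    qed
    moreover have "isCont (deriv \<phi>) 0" by (rule smooth_on_isCont[OF smooth_deriv[OF T \<phi>] T T0])
    ultimately have "\<forall>\<^sub>F t in nhds 0. t \<in> T \<and> deriv \<phi> t \<in> - {0}"
      by (intro eventually_continuous_on[OF smooth_on_continuous[OF smooth_deriv[OF T \<phi>]] T T0]) (auto simp: open_Compl)
    then obtain T' where T': "open T'" "0 \<in> T'" "\<And>t. t \<in> T' \<Longrightarrow> t \<in> T \<and> deriv \<phi> t \<noteq> 0"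
      unfolding eventually_nhds by blast
    have "vanish m (\<lambda>t. g (\<gamma> t)) 0" using \<gamma>(2) by (simp add: vanish_def o_def)
    then have "vanish m (\<lambda>t. g (c (\<phi> t))) 0"
      using vanish_cong[OF T'(1,2), of "\<lambda>t. g (\<gamma> t)" "\<lambda>t. g (c (\<phi> t))"] \<gamma>c T'(3) by simp
    moreover have "smooth_on T' \<phi>" by (rule smooth_on_subset[OF \<phi>]) (use T'(3) in blast)
    ultimately show "vanish m (\<lambda>t. g (c t)) t0"
      using vanish_compose[OF open_UNIV gc T'(1) _ T'(2)] T'(3) \<phi>0 by (metis UNIV_I)
  }
qed

abbreviation u :: "real \<Rightarrow> real" where "u t \<equiv> inverse (P t)"

lemma smooth_u: "smooth_on UNIV u"
  by (intro smooth_intros P(1)) (use P(2) in \<open>auto simp: less_imp_neq[symmetric]\<close>)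

definition Q :: "real \<Rightarrow> real" where
  "Q t = (deriv (deriv P) t + P t) / (deriv (deriv u) t + u t)"

lemma smooth_Q: "smooth_on UNIV Q"
  unfolding Q_def by (intro smooth_intros smooth_deriv P(1) smooth_u) (use u_pos in auto)

text \<open>Along the curve, the equation \<open>A r\<^sup>2 + r (B1 cos t + B2 sin t) + k\<close> of a circle becomes \<open>P t\<close> times the
  function \<open>trace\<close>.  The operator \<open>f \<mapsto> f'' + f\<close> kills its trigonometric part.\<close>

definition trace :: "real \<Rightarrow> real \<Rightarrow> real \<Rightarrow> real \<Rightarrow> real \<Rightarrow> real" where
  "trace X Y W Z t = X * P t + Y * cos t + W * sin t + Z * u t"

lemma smooth_trace: "smooth_on UNIV (trace X Y W Z)"
  unfolding trace_def[abs_def] by (intro smooth_intros P(1) smooth_u open_UNIV)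

lemma deriv_trace:
  "deriv (trace X Y W Z) t = X * deriv P t - Y * sin t + W * cos t + Z * deriv u t" (is "?A t")
  "deriv (deriv (trace X Y W Z)) t = (deriv (deriv u) t + u t) * (X * Q t + Z) - trace X Y W Z t" (is "?B")
proof -
  have d: "(f has_real_derivative deriv f t) (at t)" if "smooth_on UNIV f" for f :: "real \<Rightarrow> real" and t
    by (rule smooth_DERIV[OF that]) simp
  have combine: "((\<lambda>t. X * p t + Y * cos t + W * sin t + Z * q t) has_real_derivative
      X * p' - Y * sin t + W * cos t + Z * q') (at t)"
    if "(p has_real_derivative p') (at t)" "(q has_real_derivative q') (at t)" for p q p' q' Y W t
    using that by (auto intro!: derivative_eq_intros simp: algebra_simps)
  show A: "?A t" for t
    unfolding trace_def[abs_def] by (rule DERIV_imp_deriv[OF combine[OF d[OF P(1)] d[OF smooth_u]]])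
  have "deriv (deriv (trace X Y W Z)) t = deriv (\<lambda>t. X * deriv P t + W * cos t + (- Y) * sin t + Z * deriv u t) t"
    unfolding A by (simp add: algebra_simps)
  also have "\<dots> = X * deriv (deriv P) t - W * sin t + (- Y) * cos t + Z * deriv (deriv u) t"
    by (rule DERIV_imp_deriv[OF combine[OF d[OF smooth_deriv[OF open_UNIV P(1)]] d[OF smooth_deriv[OF open_UNIV smooth_u]]]])
  finally have "deriv (deriv (trace X Y W Z)) t = X * deriv (deriv P) t - Y * cos t - W * sin t + Z * deriv (deriv u) t"
    by simp
  moreover have "(deriv (deriv u) t + u t) * Q t = deriv (deriv P) t + P t" unfolding Q_def using u_pos[of t] by simp
  then have "(deriv (deriv u) t + u t) * (X * Q t + Z) = X * (deriv (deriv P) t + P t) + Z * (deriv (deriv u) t + u t)"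
    by algebra
  ultimately show ?B unfolding trace_def by (simp add: algebra_simps)
qed

lemma vanish_trace:
  "vanish (Suc (Suc m)) (trace X Y W Z) t \<longleftrightarrow>
     trace X Y W Z t = 0 \<and> deriv (trace X Y W Z) t = 0 \<and> vanish m (\<lambda>t. X * Q t + Z) t"
proof -
  let ?f = "trace X Y W Z" and ?b = "\<lambda>t. deriv (deriv u) t + u t"
  let ?\<psi> = "\<lambda>t. ?b t * (X * Q t + Z)"
  have sb: "smooth_on UNIV ?b" by (intro smooth_intros smooth_deriv smooth_u open_UNIV)
  have sQ: "smooth_on UNIV (\<lambda>t. X * Q t + Z)" by (intro smooth_intros smooth_Q open_UNIV)
  have s\<psi>: "smooth_on UNIV ?\<psi>" by (intro smooth_on_mult open_UNIV sb sQ)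
  have f2: "deriv (deriv ?f) = (\<lambda>t. ?\<psi> t + (- 1) * ?f t)" using deriv_trace(2) by auto
  have \<psi>: "?\<psi> = (\<lambda>t. deriv (deriv ?f) t + ?f t)" using deriv_trace(2) by auto
  have "vanish m (deriv (deriv ?f)) t \<longleftrightarrow> vanish m ?\<psi> t" if f0: "?f t = 0" "deriv ?f t = 0"
  proof
    assume "vanish m (deriv (deriv ?f)) t"
    moreover have "vanish m ?f t"
    proof (cases m)
      case (Suc k)
      then show ?thesis using \<open>vanish m (deriv (deriv ?f)) t\<close> f0
        by (metis le_Suc_eq vanish_Suc vanish_mono)
    qed (use f0 in simp)
    ultimately show "vanish m ?\<psi> t" unfolding \<psi>
      by (intro vanish_add[of UNIV] smooth_deriv smooth_trace) auto
  next
    assume "vanish m ?\<psi> t"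
    then show "vanish m (deriv (deriv ?f)) t"
    proof (induction m)
      case 0
      then show ?case using f0 by (simp add: f2)
    next
      case (Suc m)
      have "vanish m (deriv (deriv ?f)) t" by (rule Suc.IH) (rule vanish_mono[OF Suc.prems], simp)
      then have "vanish (Suc m) ?f t" using f0 by (metis le_Suc_eq vanish_Suc vanish_mono)
      then have "vanish (Suc m) (\<lambda>t. (-1) * ?f t) t"
        by (intro vanish_mult[of UNIV] smooth_trace smooth_on_const) auto
      then show ?case unfolding f2
        by (intro vanish_add[of UNIV] s\<psi> Suc.prems smooth_on_mult smooth_trace smooth_on_const) auto
    qed
  qed
  moreover have "vanish m ?\<psi> t \<longleftrightarrow> vanish m (\<lambda>t. X * Q t + Z) t"
    by (rule vanish_mult_iff[OF open_UNIV _ sb sQ]) (use u_pos in auto)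
  ultimately show ?thesis unfolding vanish_Suc by blast
qed

lemma vanish_affine:
  "vanish (Suc 0) (\<lambda>t. X * Q t + Z) t \<longleftrightarrow> X * Q t + Z = 0 \<and> X * deriv Q t = 0"
  "vanish (Suc (Suc 0)) (\<lambda>t. X * Q t + Z) t \<longleftrightarrow> X * Q t + Z = 0 \<and> X * deriv Q t = 0 \<and> X * deriv (deriv Q) t = 0"
proof -
  have d: "(f has_real_derivative deriv f t) (at t)" if "smooth_on UNIV f" for f :: "real \<Rightarrow> real" and t
    by (rule smooth_DERIV[OF that]) simp
  have 1: "deriv (\<lambda>t. X * Q t + Z) = (\<lambda>t. X * deriv Q t)"
    by (intro ext DERIV_imp_deriv) (auto intro!: derivative_eq_intros d[OF smooth_Q])
  have 2: "deriv (\<lambda>t. X * deriv Q t) = (\<lambda>t. X * deriv (deriv Q) t)"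
    by (intro ext DERIV_imp_deriv) (auto intro!: derivative_eq_intros d[OF smooth_deriv[OF open_UNIV smooth_Q]])
  show "vanish (Suc 0) (\<lambda>t. X * Q t + Z) t \<longleftrightarrow> X * Q t + Z = 0 \<and> X * deriv Q t = 0"
    "vanish (Suc (Suc 0)) (\<lambda>t. X * Q t + Z) t \<longleftrightarrow> X * Q t + Z = 0 \<and> X * deriv Q t = 0 \<and> X * deriv (deriv Q) t = 0"
    unfolding vanish_Suc vanish_0 1 2 by auto
qed

lemma circle_trace:
  assumes g: "\<And>p. g p = A * (p \<bullet> p) + B \<bullet> p + k"
  shows "vanish m (\<lambda>t. g (c t)) t0 \<longleftrightarrow> vanish m (trace (A * s\<^sup>2) (s * fst B) (s * snd B) k) t0"
proof -
  have "g (c t) = P t * trace (A * s\<^sup>2) (s * fst B) (s * snd B) k t" for t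
  proof -
    have pp: "c t \<bullet> c t = (s * P t)\<^sup>2 * ((sin t)\<^sup>2 + (cos t)\<^sup>2)"
      unfolding c_def polar_def inner_prod_def fst_conv snd_conv inner_real_def by algebra
    have "B \<bullet> c t = P t * (s * fst B * cos t + s * snd B * sin t)"
      unfolding c_def polar_def inner_prod_def by (simp add: algebra_simps)
    then show ?thesis unfolding g pp trace_def using P(2)[of t] by (simp add: algebra_simps power2_eq_square)
  qed
  then have "(\<lambda>t. g (c t)) = (\<lambda>t. P t * trace (A * s\<^sup>2) (s * fst B) (s * snd B) k t)" by (rule ext)
  then show ?thesis
    using vanish_mult_iff[OF open_UNIV UNIV_I P(1) smooth_trace, of m] P(2) by (simp add: less_imp_neq[symmetric])
qed

text \<open>Tangency of order two makes the trace vanish to order two, and the trigonometric part of the trace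
  disappears under \<open>f \<mapsto> f'' + f\<close>. What remains is \<open>X * Q + Z\<close> up to a nonzero factor, and \<open>X\<close> cannot vanish since otherwise
  all coefficients of the circle would.\<close>

lemma osculating_circleE:
  assumes "osculating_circle M (c t0) g"
  obtains X Z where "X \<noteq> 0" "X * Q t0 + Z = 0"
    "tangency_at_least 3 M (c t0) g \<longleftrightarrow> deriv Q t0 = 0"
    "tangency_at_least 4 M (c t0) g \<longleftrightarrow> deriv Q t0 = 0 \<and> deriv (deriv Q) t0 = 0"
proof -
  have circ: "circle_equation g" and t2: "tangency_at_least 2 M (c t0) g" using assms unfolding osculating_circle_def by auto
  obtain A B k where AB: "(A, B) \<noteq> (0, 0)" and g: "\<And>p. g p = A * (p \<bullet> p) + B \<bullet> p + k"
    using circ unfolding circle_equation_def by blast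
  let ?f = "trace (A * s\<^sup>2) (s * fst B) (s * snd B) k"
  let ?X = "A * s\<^sup>2"
  have t: "tangency_at_least m M (c t0) g \<longleftrightarrow> vanish m ?f t0" for m
    unfolding tangency_iff[OF circ] circle_trace[OF g] ..
  have v2: "?f t0 = 0" "deriv ?f t0 = 0" "?X * Q t0 + k = 0"
    using t2 vanish_trace[of 0] unfolding t numeral_2_eq_2 by auto
  have X: "?X \<noteq> 0"
  proof
    assume X: "?X = 0"
    then have k: "k = 0" using v2(3) unfolding X by simp
    have "(s * fst B) * cos t0 + (s * snd B) * sin t0 = 0" "- (s * fst B) * sin t0 + (s * snd B) * cos t0 = 0"
      using v2(1,2) unfolding deriv_trace(1) unfolding trace_def X k by simp_all
    then have "s * fst B = 0" "s * snd B = 0"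
      using rotation_eq_0[of "s * snd B" t0 "s * fst B"] by (simp_all add: algebra_simps)
    then show False using AB X s by (auto simp: prod_eq_iff zero_prod_def)
  qed
  have "tangency_at_least 3 M (c t0) g \<longleftrightarrow> deriv Q t0 = 0"
    unfolding t numeral_3_eq_3 vanish_trace vanish_affine using v2 X by auto
  moreover have "tangency_at_least 4 M (c t0) g \<longleftrightarrow> deriv Q t0 = 0 \<and> deriv (deriv Q) t0 = 0"
  proof -
    have 4: "(4::nat) = Suc (Suc (Suc (Suc 0)))" by simp
    show ?thesis unfolding t 4 vanish_trace vanish_affine using v2 X by auto
  qed
  ultimately show ?thesis using that X v2(3) by blast
qed

lemma ex_osculating_circle: "\<exists>g. osculating_circle M (c t0) g"
proof -
  \<comment> \<open>the trigonometric coefficients are found by solving for the value and the derivative at \<open>t0\<close>\<close>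
  let ?X = "s\<^sup>2" and ?Z = "- (s\<^sup>2 * Q t0)"
  let ?p = "?X * P t0 + ?Z * u t0" and ?q = "?X * deriv P t0 + ?Z * deriv u t0"
  obtain Y W where YW: "Y * cos t0 + W * sin t0 = - ?p" "- Y * sin t0 + W * cos t0 = - ?q"
    using rotation_solve by blast
  define g where "g p = 1 * (p \<bullet> p) + (Y / s, W / s) \<bullet> p + ?Z" for p :: "real \<times> real"
  have circ: "circle_equation g" unfolding circle_equation_def g_def
    by (intro exI[of _ 1] exI[of _ "(Y / s, W / s)"] exI[of _ ?Z]) auto
  have "trace ?X Y W ?Z t0 = ?p + (Y * cos t0 + W * sin t0)" unfolding trace_def by simp
  moreover have "deriv (trace ?X Y W ?Z) t0 = ?q + (- Y * sin t0 + W * cos t0)" unfolding deriv_trace(1) by simp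
  ultimately have "trace ?X Y W ?Z t0 = 0" "deriv (trace ?X Y W ?Z) t0 = 0"
    unfolding YW by simp_all
  then have "vanish 2 (trace ?X Y W ?Z) t0"
    unfolding numeral_2_eq_2 vanish_trace by simp
  moreover have "trace (1 * s\<^sup>2) (s * fst (Y / s, W / s)) (s * snd (Y / s, W / s)) ?Z = trace ?X Y W ?Z"
    using s by simp
  ultimately have "vanish 2 (\<lambda>t. g (c t)) t0"
    unfolding circle_trace[OF g_def] by (simp only:)
  then show ?thesis unfolding osculating_circle_def using circ tangency_iff[OF circ] by blast
qed

theorem degenerate_vertex_iff:
  "degenerate_vertex M (c t0) \<longleftrightarrow> deriv Q t0 = 0 \<and> deriv (deriv Q) t0 = 0"
proof -
  have M: "smooth_submanifold_at 1 M (c t0)" unfolding c_def by (rule regular_M)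
  show ?thesis
    unfolding degenerate_vertex_def vertex_def nondegenerate_vertex_def
    using M ex_osculating_circle[of t0] osculating_circleE[of t0] by metis
qed

end

section \<open>Level curves near an umbilic in polar coordinates\<close>

lemma angle_has_derivative:
  fixes f :: "'x::real_normed_vector \<times> real \<Rightarrow> real"
  assumes "smooth_on (X \<times> UNIV) f" "x \<in> X"
  shows "((\<lambda>t. f (x, t)) has_real_derivative dird (0, 1) f (x, t)) (at t)"
  using line_has_derivative[of f "(x, 0)" t "(0, 1)"] smooth_on_differentiable[OF assms(1), of "(x, t)"] assms(2)
  by auto

lemma angle_dird_eqI:
  fixes f :: "'x::real_normed_vector \<times> real \<Rightarrow> real"
  assumes "smooth_on (X \<times> UNIV) f" "x \<in> X" "((\<lambda>t. f (x, t)) has_real_derivative d) (at t)"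
  shows "dird (0, 1) f (x, t) = d"
  using DERIV_unique[OF angle_has_derivative[OF assms(1,2)] assms(3)] .

lemma angle_dird_shift:
  fixes f :: "'x::real_normed_vector \<times> real \<Rightarrow> real"
  assumes "smooth_on (X \<times> UNIV) f" "x \<in> X" "y \<in> X" "\<And>t. f (x, t + c) = f (y, t)"
  shows "dird (0, 1) f (x, t + c) = dird (0, 1) f (y, t)"
proof (rule angle_dird_eqI[OF assms(1,3), symmetric])
  have "((\<lambda>t. f (x, t + c)) has_real_derivative dird (0, 1) f (x, t + c)) (at t)"
    using angle_has_derivative[OF assms(1,2), of "t + c"] by (simp add: DERIV_shift)
  then show "((\<lambda>t. f (y, t)) has_real_derivative dird (0, 1) f (x, t + c)) (at t)" unfolding assms(4) .
qed

lemma polar_exists: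
  assumes "p \<noteq> (0 :: real \<times> real)"
  obtains r t where "r > 0" "p = polar (r, t)"
proof -
  let ?r = "sqrt ((fst p)\<^sup>2 + (snd p)\<^sup>2)"
  have r: "?r > 0" using assms by (auto simp: prod_eq_iff sum_power2_gt_zero_iff)
  have "(fst p / ?r)\<^sup>2 + (snd p / ?r)\<^sup>2 = 1"
  proof -
    have "(fst p)\<^sup>2 + (snd p)\<^sup>2 \<noteq> 0" using r by auto
    then show ?thesis
      unfolding power_divide by (simp add: add_divide_distrib[symmetric] del: sum_power2_eq_zero_iff)
  qed
  then obtain t where t: "fst p / ?r = cos t" "snd p / ?r = sin t" using sincos_total_2pi by metis
  have "p = polar (?r, t)" unfolding polar_def fst_conv snd_conv t[symmetric] using r by (simp add: prod_eq_iff)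
  then show ?thesis using that r by blast
qed

lemma norm_polar: "norm (polar (r, t)) = \<bar>r\<bar>"
proof -
  have "(r * cos t)\<^sup>2 + (r * sin t)\<^sup>2 = r\<^sup>2 * ((sin t)\<^sup>2 + (cos t)\<^sup>2)" by algebra
  then show ?thesis by (simp add: polar_def norm_prod_def)
qed

text \<open>The surface in the form of Hadamard's lemma, divided by \<open>m\<close>, with \<open>\<lambda>\<close> and \<open>\<mu>\<close> as the coordinates along \<open>bi\<close>
  and \<open>bj\<close>. The bounds keep the quadratic form close to \<open>x\<^sup>2 + y\<^sup>2\<close>; the last assumption is the normalized cubic part.\<close>

locale umbilic_family =
  fixes A B C :: "(real \<times> real) \<times> 'y::euclidean_space \<Rightarrow> real" and m a b c \<delta> :: real and bi bj :: 'y
  assumes \<delta>: "\<delta> > 0" and m: "m \<noteq> 0" and bc: "b \<noteq> c"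
    and smooth_ABC: "smooth_on (ball 0 \<delta> \<times> ball 0 \<delta>) A" "smooth_on (ball 0 \<delta> \<times> ball 0 \<delta>) B" "smooth_on (ball 0 \<delta> \<times> ball 0 \<delta>) C"
    and bound: "\<And>p y. p \<in> ball 0 \<delta> \<Longrightarrow> y \<in> ball 0 \<delta> \<Longrightarrow> \<bar>A (p, y) - 1\<bar> < 1 / 4 \<and> \<bar>B (p, y)\<bar> < 1 / 8 \<and> \<bar>C (p, y) - 1\<bar> < 1 / 4"
    and basis_ij: "bi \<in> Basis" "bj \<in> Basis" "bi \<noteq> bj"
    and linear_part: "\<And>y. y \<in> ball 0 \<delta> \<Longrightarrow> A (0, y) - C (0, y) = 2 * (y \<bullet> bi) / m" "\<And>y. y \<in> ball 0 \<delta> \<Longrightarrow> B (0, y) = (y \<bullet> bj) / m"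
    and A_0: "A (0, 0) = 1"
    and cubic: "\<And>v w. dird ((v, w), 0) A (0, 0) * v\<^sup>2 + 2 * dird ((v, w), 0) B (0, 0) * v * w + dird ((v, w), 0) C (0, 0) * w\<^sup>2
      = (a * v ^ 3 + b * v\<^sup>2 * w + a * v * w\<^sup>2 + c * w ^ 3) / m"
begin

abbreviation W :: "((real \<times> real) \<times> 'y) set" where "W \<equiv> ball 0 \<delta> \<times> ball 0 \<delta>"

lemma open_W: "open W" by (intro open_Times open_ball)

lemma zero_W: "(0, 0) \<in> W" using \<delta> by simp

lemma BC_0: "B (0, 0) = 0" "C (0, 0) = 1"
  using linear_part[of 0] A_0 \<delta> by simp_all

definition h :: "(real \<times> real) \<times> 'y \<Rightarrow> real" where
  "h z = A z * (fst (fst z))\<^sup>2 + 2 * B z * fst (fst z) * snd (fst z) + C z * (snd (fst z))\<^sup>2"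

definition G :: "(real \<times> real) \<times> 'y \<Rightarrow> real \<Rightarrow> real" where
  "G z t = A z * (cos t)\<^sup>2 + 2 * B z * cos t * sin t + C z * (sin t)\<^sup>2"

lemma h_polar: "h (polar (r, t), y) = r\<^sup>2 * G (polar (r, t), y) t"
  unfolding h_def G_def polar_def by (simp add: algebra_simps power2_eq_square)

lemma G_bound:
  assumes "z \<in> W"
  shows "1 / 2 < G z t" "G z t < 3 / 2"
proof -
  have AB: "\<bar>A z - 1\<bar> < 1 / 4" "\<bar>B z\<bar> < 1 / 8" "\<bar>C z - 1\<bar> < 1 / 4" using bound[of "fst z" "snd z"] assms by (auto simp: mem_Times_iff)
  have sc: "(sin t)\<^sup>2 + (cos t)\<^sup>2 = 1" by simp
  have "G z t - ((sin t)\<^sup>2 + (cos t)\<^sup>2) = (A z - 1) * (cos t)\<^sup>2 + 2 * (B z * (cos t * sin t)) + (C z - 1) * (sin t)\<^sup>2"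
    unfolding G_def by algebra
  then have eq: "G z t - 1 = (A z - 1) * (cos t)\<^sup>2 + 2 * (B z * (cos t * sin t)) + (C z - 1) * (sin t)\<^sup>2"
    unfolding sc .
  have "\<bar>A z - 1\<bar> * (cos t)\<^sup>2 \<le> 1 / 4 * (cos t)\<^sup>2" "\<bar>C z - 1\<bar> * (sin t)\<^sup>2 \<le> 1 / 4 * (sin t)\<^sup>2"
    using AB by (intro mult_right_mono; simp)+
  then have 1: "\<bar>(A z - 1) * (cos t)\<^sup>2\<bar> \<le> 1 / 4 * (cos t)\<^sup>2" "\<bar>(C z - 1) * (sin t)\<^sup>2\<bar> \<le> 1 / 4 * (sin t)\<^sup>2"
    by (simp_all add: abs_mult)
  have "\<bar>cos t * sin t\<bar> \<le> 1" unfolding abs_mult by (intro mult_le_one) auto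
  then have "\<bar>B z\<bar> * \<bar>cos t * sin t\<bar> \<le> \<bar>B z\<bar> * 1" by (intro mult_left_mono) auto
  then have "\<bar>B z * (cos t * sin t)\<bar> < 1 / 8" unfolding abs_mult using AB(2) by linarith
  with 1 eq sc have "1 / 2 < G z t \<and> G z t < 3 / 2" by linarith
  then show "1 / 2 < G z t" "G z t < 3 / 2" by blast+
qed

text \<open>On the ray with direction \<open>d\<close>, the level curve \<open>h = s\<^sup>2\<close> is at distance \<open>s * q\<close> from the origin, where
  \<open>F (y, s) d q = 1\<close>.  The direction is a point of the circle rather than an angle because the circle is compact.\<close>

definition F :: "('y \<times> real) \<times> (real \<times> real) \<times> real \<Rightarrow> real" where
  "F = (\<lambda>((y, s), (d1, d2), q). q\<^sup>2 * (A ((s * q * d1, s * q * d2), y) * d1\<^sup>2 + 2 * B ((s * q * d1, s * q * d2), y) * d1 * d2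
     + C ((s * q * d1, s * q * d2), y) * d2\<^sup>2))"

definition \<Omega>F :: "(('y \<times> real) \<times> (real \<times> real) \<times> real) set" where
  "\<Omega>F = (\<lambda>z. ((snd (fst z) * snd (snd z) * fst (fst (snd z)), snd (fst z) * snd (snd z) * snd (fst (snd z))), fst (fst z))) -` W"

lemma open_\<Omega>F: "open \<Omega>F" unfolding \<Omega>F_def by (intro open_vimage open_W continuous_intros)

lemma smooth_F: "smooth_on \<Omega>F F"
proof -
  let ?k = "\<lambda>z::('y \<times> real) \<times> (real \<times> real) \<times> real.
    ((snd (fst z) * snd (snd z) * fst (fst (snd z)), snd (fst z) * snd (snd z) * snd (fst (snd z))), fst (fst z))"
  have k: "smooth_on \<Omega>F ?k" by (intro smooth_intros open_\<Omega>F)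
  have c: "smooth_on \<Omega>F (\<lambda>z. f (?k z))" if "smooth_on W f" for f :: "(real \<times> real) \<times> 'y \<Rightarrow> real"
    by (rule smooth_on_compose[OF that open_\<Omega>F open_W k]) (simp add: \<Omega>F_def)
  have F: "F = (\<lambda>z. (snd (snd z))\<^sup>2 * (A (?k z) * (fst (fst (snd z)))\<^sup>2 + 2 * B (?k z) * fst (fst (snd z)) * snd (fst (snd z))
     + C (?k z) * (snd (fst (snd z)))\<^sup>2))"
    by (auto simp: F_def split_beta fun_eq_iff)
  show ?thesis unfolding F
    by (intro smooth_on_mult[OF open_\<Omega>F] smooth_on_add[OF open_\<Omega>F] c smooth_ABC) (intro smooth_intros open_\<Omega>F)+
qed

lemma in_\<Omega>F:
  assumes "norm y < \<delta>" "\<bar>s\<bar> < \<delta> / 8" "norm d = 1" "0 \<le> q" "q \<le> 4"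
  shows "((y, s), d, q) \<in> \<Omega>F"
proof -
  have "(s * q * fst d, s * q * snd d) = (s * q) *\<^sub>R d" by (simp add: prod_eq_iff)
  then have "norm (s * q * fst d, s * q * snd d) = \<bar>s\<bar> * q" using assms by (simp add: abs_mult)
  also have "\<bar>s\<bar> * q \<le> \<bar>s\<bar> * 4" using assms by (intro mult_left_mono) auto
  finally show ?thesis using assms by (simp add: \<Omega>F_def)
qed

lemma F_polar: "F ((y, s), (cos t, sin t), q) = q\<^sup>2 * G (polar (s * q, t), y) t"
  unfolding F_def G_def polar_def by simp

lemma norm_cos_sin [simp]: "norm (cos t, sin (t :: real)) = 1"
  by (simp add: norm_prod_def)

text \<open>At \<open>s = 0\<close> and \<open>y = 0\<close> the function is \<open>q\<^sup>2\<close>, whose derivative is positive; compactness of the circle and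
  of the interval of radii gives a uniform neighbourhood.\<close>

lemma F_monotone: "\<exists>\<epsilon>>0. \<epsilon> \<le> \<delta> / 8 \<and> (\<forall>x\<in>ball 0 \<epsilon>. \<forall>w\<in>sphere 0 1 \<times> {1/4..4}. dird (0, 0, 1) F (x, w) > 0)"
proof -
  have "\<forall>\<^sub>F x in nhds 0. \<forall>w\<in>sphere 0 1 \<times> {1/4..4}. dird (0, 0, 1) F (x, w) > 0"
  proof (rule eventually_ball_compact)
    fix w :: "(real \<times> real) \<times> real" assume w: "w \<in> sphere 0 1 \<times> {1/4..4}"
    obtain d1 d2 q where weq: "w = ((d1, d2), q)" by (metis prod.exhaust)
    have d: "norm (d1, d2) = 1" "1 / 4 \<le> q" "q \<le> 4" using w unfolding weq by auto
    have d2: "d1\<^sup>2 + d2\<^sup>2 = 1" using d(1) by (simp add: norm_prod_def)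
    have in0: "(0, w) \<in> \<Omega>F" using in_\<Omega>F[of 0 0 "(d1, d2)" q] d \<delta> by (simp add: weq zero_prod_def)
    have "dird (0, 0, 1) F (0, w) = 2 * q"
    proof (rule dird_line[OF smooth_on_differentiable[OF smooth_F in0]])
      have "F ((0, w) + \<sigma> *\<^sub>R (0, 0, 1)) = (q + \<sigma>)\<^sup>2" for \<sigma>
        using d2 by (simp add: F_def weq zero_prod_def A_0[unfolded zero_prod_def] BC_0[unfolded zero_prod_def])
      then show "((\<lambda>\<sigma>. F ((0, w) + \<sigma> *\<^sub>R (0, 0, 1))) has_real_derivative 2 * q) (at 0)"
        by (auto intro!: derivative_eq_intros)
    qed
    then have "\<forall>\<^sub>F z in nhds (0, w). z \<in> \<Omega>F \<and> dird (0, 0, 1) F z \<in> {0<..}"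
      using d by (intro eventually_continuous_on[OF smooth_on_continuous[OF smooth_on_dird[OF smooth_F]] open_\<Omega>F in0]) auto
    then show "\<forall>\<^sub>F z in nhds (0, w). dird (0, 0, 1) F (fst z, snd z) > 0" by eventually_elim simp
  qed (intro compact_Times compact_sphere compact_Icc)
  then obtain \<epsilon> where "\<epsilon> > 0" "\<And>x. dist x 0 < \<epsilon> \<Longrightarrow> \<forall>w\<in>sphere 0 1 \<times> {1/4..4}. dird (0, 0, 1) F (x, w) > 0"
    unfolding eventually_nhds_metric by blast
  then show ?thesis using \<delta> by (intro exI[of _ "min \<epsilon> (\<delta> / 8)"]) (auto simp: dist_commute)
qed

text \<open>The interval \<open>1 / 4 < q < 4\<close> contains the solution because the quadratic form is close to \<open>x\<^sup>2 + y\<^sup>2\<close>.\<close>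

lemma ex_polar_radius:
  obtains P :: "('y \<times> real) \<times> real \<Rightarrow> real" and \<epsilon> where "\<epsilon> > 0" "\<epsilon> \<le> \<delta> / 8" "smooth_on (ball 0 \<epsilon> \<times> UNIV) P"
    "\<And>x t q. x \<in> ball 0 \<epsilon> \<Longrightarrow> (1 / 4 < q \<and> q < 4 \<and> F (x, (cos t, sin t), q) = 1) \<longleftrightarrow> q = P (x, t)"
    "\<And>x t q. x \<in> ball 0 \<epsilon> \<Longrightarrow> 1 / 4 < q \<Longrightarrow> q < 4 \<Longrightarrow> dird (0, 0, 1) F (x, (cos t, sin t), q) > 0"
proof -
  obtain \<epsilon> where \<epsilon>: "\<epsilon> > 0" "\<epsilon> \<le> \<delta> / 8"
    "\<And>x w. x \<in> ball 0 \<epsilon> \<Longrightarrow> w \<in> sphere 0 1 \<times> {1/4..4} \<Longrightarrow> dird (0, 0, 1) F (x, w) > 0"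
    using F_monotone by blast
  let ?X = "ball 0 \<epsilon> \<times> UNIV :: (('y \<times> real) \<times> real) set"
  have X: "open ?X" by (intro open_Times) auto
  let ?k = "\<lambda>z::(('y \<times> real) \<times> real) \<times> real. (fst (fst z), (cos (snd (fst z)), sin (snd (fst z))), snd z)"
  have k\<Omega>: "?k ((x, t), q) \<in> \<Omega>F" if "x \<in> ball 0 \<epsilon>" "0 \<le> q" "q \<le> 4" for x t q
  proof -
    have "norm (fst x) \<le> norm x" "\<bar>snd x\<bar> \<le> norm x" using norm_fst_le[of "fst x" "snd x"] norm_snd_le[of "snd x" "fst x"] by simp_all
    then show ?thesis using in_\<Omega>F[of "fst x" "snd x" "(cos t, sin t)" q] that \<epsilon>(2) \<delta> by simp
  qed
  have XI: "open (?X \<times> {1/4<..<4::real})" by (intro open_Times X) auto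
  have sm: "smooth_on (?X \<times> {1/4<..<4}) (\<lambda>z. F (?k z))"
    by (rule smooth_on_compose[OF smooth_F XI open_\<Omega>F]) (use k\<Omega> in \<open>auto intro!: smooth_intros XI\<close>)
  have pos: "dird (0, 0, 1) F (x, (cos t, sin t), q) > 0" if "x \<in> ball 0 \<epsilon>" "1/4 < q" "q < 4" for x t q
    using \<epsilon>(3)[OF that(1), of "((cos t, sin t), q)"] that by simp
  have pos': "dird (0, 1) (\<lambda>z. F (?k z)) (z, q) > 0" if z: "z \<in> ?X" "1/4 < q" "q < 4" for z q
  proof -
    obtain x t where xt: "z = (x, t)" by (metis prod.exhaust)
    have "dird (0, 1) (\<lambda>z. F (?k z)) (z, q) = dird (0, 0, 1) F (x, (cos t, sin t), q)"
    proof (rule dird_line[OF smooth_on_differentiable[OF sm]])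
      show "((\<lambda>\<sigma>. F (?k ((z, q) + \<sigma> *\<^sub>R (0, 1)))) has_real_derivative dird (0, 0, 1) F (x, (cos t, sin t), q)) (at 0)"
        using line_has_derivative[of F "(x, (cos t, sin t), q)" 0 "(0, 0, 1)"]
          smooth_on_differentiable[OF smooth_F k\<Omega>[of x q t]] z by (simp add: xt)
    qed (use z in auto)
    then show ?thesis using pos[of x q t] z xt by auto
  qed
  have ex: "\<exists>q. 1/4 < q \<and> q < 4 \<and> F (?k (z, q)) = 1" if z: "z \<in> ?X" for z
  proof -
    obtain y s t where xt: "z = ((y, s), t)" by (metis prod.exhaust)
    have x: "(y, s) \<in> ball 0 \<epsilon>" using z xt by simp
    let ?g = "\<lambda>q. F (?k (z, q))"
    have g: "?g q = q\<^sup>2 * G (polar (s * q, t), y) t" for q unfolding xt by (simp add: F_polar)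
    have W: "(polar (s * q, t), y) \<in> W" if "0 \<le> q" "q \<le> 4" for q
      using k\<Omega>[OF x that, of t] by (simp add: \<Omega>F_def polar_def)
    have lt: "?g (1/2) < 1" "1 < ?g 2" unfolding g
      using G_bound[OF W[of "1/2"], of t] G_bound[OF W[of 2], of t] by (simp_all add: power2_eq_square)
    have "continuous_on {1/2..2} ?g"
      by (rule continuous_on_compose2[OF smooth_on_continuous[OF smooth_F]])
        (use k\<Omega>[OF x, of _ t] in \<open>auto intro!: continuous_intros simp: xt\<close>)
    then obtain q where "1/2 \<le> q" "q \<le> 2" "?g q = 1" using IVT'[of ?g "1/2" 1 2] lt by auto
    then show ?thesis by (intro exI[of _ q]) auto
  qed
  obtain P where P: "smooth_on ?X P"
    "\<And>x t. x \<in> ?X \<Longrightarrow> (1/4 < t \<and> t < 4 \<and> F (?k (x, t)) = 1) \<longleftrightarrow> t = P x"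
    using monotone_implicit_function[OF X sm pos' ex] by blast
  show ?thesis
  proof (rule that[OF \<epsilon>(1,2) P(1) _ pos])
    fix x t q assume "x \<in> ball (0 :: 'y \<times> real) \<epsilon>"
    then show "(1 / 4 < q \<and> q < 4 \<and> F (x, (cos t, sin t), q) = 1) \<longleftrightarrow> q = P (x, t)"
      using P(2)[of "(x, t)" q] by simp
  qed
qed

end

section \<open>The vertex function of an umbilic family\<close>

locale umbilic_polar = umbilic_family A B C m a b c \<delta> bi bj
  for A B C :: "(real \<times> real) \<times> 'y::euclidean_space \<Rightarrow> real" and m a b c \<delta> :: real and bi bj :: 'y +
  fixes P :: "('y \<times> real) \<times> real \<Rightarrow> real" and \<epsilon> :: real
  assumes \<epsilon>: "\<epsilon> > 0" "\<epsilon> \<le> \<delta> / 8" and smooth_P: "smooth_on (ball 0 \<epsilon> \<times> UNIV) P"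
    and P_iff: "\<And>x t q. x \<in> ball 0 \<epsilon> \<Longrightarrow> (1 / 4 < q \<and> q < 4 \<and> F (x, (cos t, sin t), q) = 1) \<longleftrightarrow> q = P (x, t)"
    and F_pos: "\<And>x t q. x \<in> ball 0 \<epsilon> \<Longrightarrow> 1 / 4 < q \<Longrightarrow> q < 4 \<Longrightarrow> dird (0, 0, 1) F (x, (cos t, sin t), q) > 0"
begin

abbreviation D :: "(('y \<times> real) \<times> real \<Rightarrow> real) \<Rightarrow> ('y \<times> real) \<times> real \<Rightarrow> real" where "D \<equiv> dird (0, 1)"
abbreviation \<Omega> :: "(('y \<times> real) \<times> real) set" where "\<Omega> \<equiv> ball 0 \<epsilon> \<times> UNIV"

lemma open_\<Omega>: "open \<Omega>" by (intro open_Times) auto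

lemma zero_\<Omega> [simp]: "(0, t) \<in> \<Omega>" "0 \<in> ball (0::'y \<times> real) \<epsilon>" using \<epsilon> by simp_all

lemma P_bounds:
  assumes "x \<in> ball 0 \<epsilon>"
  shows "1 / 4 < P (x, t)" "P (x, t) < 4" "F (x, (cos t, sin t), P (x, t)) = 1"
  using P_iff[OF assms, of "P (x, t)" t] by auto

lemma P_nonzero: "z \<in> \<Omega> \<Longrightarrow> P z \<noteq> 0"
  using P_bounds(1)[of "fst z" "snd z"] by (auto simp: mem_Times_iff)

lemma P_0: "P (0, t) = 1"
proof -
  have "F ((0, 0), (cos t, sin t), 1) = 1 * G (polar (0 * 1, t), 0) t" unfolding F_polar by simp
  also have "polar (0 * 1, t) = 0" by (simp add: polar_def zero_prod_def)
  also have "G (0, 0) t = (sin t)\<^sup>2 + (cos t)\<^sup>2" unfolding G_def A_0 BC_0 by simp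
  finally have "F (0, (cos t, sin t), 1) = 1" by (simp add: zero_prod_def)
  then show ?thesis using P_iff[of 0 1 t] \<epsilon>(1) by simp
qed

lemma in_ball_flip: "x \<in> ball 0 d \<longleftrightarrow> (fst x, - snd x) \<in> ball (0 :: 'y \<times> real) d"
  by (cases x) (simp add: norm_Pair)

text \<open>The point at distance \<open>s P\<close> in direction \<open>t + \<pi>\<close> is the point at distance \<open>- s P\<close> in direction \<open>t\<close>.\<close>

lemma P_flip:
  assumes x: "x \<in> ball 0 \<epsilon>"
  shows "P (x, t + pi) = P ((fst x, - snd x), t)"
proof -
  have "F (x, (cos (t + pi), sin (t + pi)), q) = F ((fst x, - snd x), (cos t, sin t), q)" for q
    by (simp add: F_def split_beta)
  then have "q = P (x, t + pi) \<longleftrightarrow> q = P ((fst x, - snd x), t)" for q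
    using P_iff[OF x, of q "t + pi"] P_iff[of "(fst x, - snd x)" q t] x in_ball_flip[of x \<epsilon>] by simp
  then show ?thesis by blast
qed

lemma P_2pi: "x \<in> ball 0 \<epsilon> \<Longrightarrow> P (x, t + 2 * pi) = P (x, t)"
  using P_flip[of x "t + pi"] P_flip[of "(fst x, - snd x)" t] in_ball_flip[of x \<epsilon>]
  by (simp add: add.assoc flip: mult_2)

definition u :: "('y \<times> real) \<times> real \<Rightarrow> real" where "u z = inverse (P z)"
definition num :: "('y \<times> real) \<times> real \<Rightarrow> real" where "num z = D (D P) z + P z"
definition den :: "('y \<times> real) \<times> real \<Rightarrow> real" where "den z = D (D u) z + u z"

lemma smooth_u: "smooth_on \<Omega> u"
  unfolding u_def[abs_def] by (intro smooth_intros open_\<Omega> smooth_P P_nonzero)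

lemma smooth_num_den: "smooth_on \<Omega> num" "smooth_on \<Omega> den"
  unfolding num_def[abs_def] den_def[abs_def] by (intro smooth_intros open_\<Omega> smooth_P smooth_u smooth_on_dird)+

lemma shift_dird2:
  assumes sm: "smooth_on \<Omega> f" and x: "x \<in> ball 0 \<epsilon>" "y \<in> ball 0 \<epsilon>" and f: "\<And>t. f (x, t + k) = f (y, t)"
  shows "D (D f) (x, t + k) = D (D f) (y, t)"
  by (rule angle_dird_shift[OF smooth_on_dird[OF sm] x]) (rule angle_dird_shift[OF sm x f])

lemma num_den_shift:
  assumes x: "x \<in> ball 0 \<epsilon>" "y \<in> ball 0 \<epsilon>" and P: "\<And>t. P (x, t + k) = P (y, t)"
  shows "num (x, t + k) = num (y, t)" "den (x, t + k) = den (y, t)"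
proof -
  have u: "u (x, t + k) = u (y, t)" for t unfolding u_def P ..
  show "num (x, t + k) = num (y, t)" "den (x, t + k) = den (y, t)"
    unfolding num_def den_def shift_dird2[OF smooth_P x P] shift_dird2[OF smooth_u x u] P u by simp_all
qed

lemma constant_dird2:
  assumes sm: "smooth_on \<Omega> f" and x: "x \<in> ball 0 \<epsilon>" and f: "\<And>t. f (x, t) = k"
  shows "D f (x, t) = 0" "D (D f) (x, t) = 0"
proof -
  show 1: "D f (x, t) = 0" for t by (rule angle_dird_eqI[OF sm x]) (simp add: f)
  show "D (D f) (x, t) = 0" by (rule angle_dird_eqI[OF smooth_on_dird[OF sm] x]) (simp add: 1)
qed

lemma u_0: "u (0, t) = 1" unfolding u_def P_0 by simp

lemma num_den_0: "num (0, t) = 1" "den (0, t) = 1"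
  unfolding num_def den_def constant_dird2(2)[OF smooth_P zero_\<Omega>(2) P_0] constant_dird2(2)[OF smooth_u zero_\<Omega>(2) u_0]
  by (simp_all add: P_0 u_0)

lemma ex_den_pos: "\<exists>r>0. r \<le> \<epsilon> \<and> (\<forall>x\<in>ball 0 r. \<forall>t. den (x, t) > 0)"
proof -
  have "\<forall>\<^sub>F x in nhds 0. \<forall>t\<in>{0..2*pi}. den (x, t) > 0"
  proof (rule eventually_ball_compact)
    fix t
    have "\<forall>\<^sub>F z in nhds (0, t). z \<in> \<Omega> \<and> den z \<in> {0<..}"
      by (rule eventually_continuous_on[OF smooth_on_continuous[OF smooth_num_den(2)] open_\<Omega> zero_\<Omega>(1)]) (simp_all add: num_den_0)
    then show "\<forall>\<^sub>F z in nhds (0, t). den (fst z, snd z) > 0" by eventually_elim simp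
  qed simp
  then obtain d where d: "d > 0" "\<And>x t. dist x 0 < d \<Longrightarrow> t \<in> {0..2*pi} \<Longrightarrow> den (x, t) > 0"
    unfolding eventually_nhds_metric by blast
  have "den (x, t) > 0" if x: "x \<in> ball 0 (min d \<epsilon>)" for x t
  proof -
    have x': "x \<in> ball 0 \<epsilon>" "dist x 0 < d" using x by (auto simp: dist_commute)
    have per: "den (x, t + 2 * pi * of_int k) = den (x, t)" for t and k :: int
    proof (induction k rule: int_induct[where k = 0])
      case (step1 i)
      then show ?case using num_den_shift(2)[OF x'(1) x'(1) P_2pi[OF x'(1)], of "t + 2 * pi * of_int i"] by (simp add: algebra_simps)
    next
      case (step2 i)
      then show ?case using num_den_shift(2)[OF x'(1) x'(1) P_2pi[OF x'(1)], of "t + 2 * pi * of_int (i - 1)"] by (simp add: algebra_simps)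
    qed simp
    obtain k :: int where "0 \<le> t + 2 * pi * of_int k" "t + 2 * pi * of_int k < 0 + 2 * pi" using reduce_angle by blast
    then show ?thesis using d(2)[OF x'(2), of "t + 2 * pi * of_int k"] per[of t k] by simp
  qed
  then show ?thesis using d(1) \<epsilon>(1) by (intro exI[of _ "min d \<epsilon>"]) auto
qed

text \<open>The first variation of the polar radius is minus half that of \<open>G\<close>.\<close>

lemma dird_P_0:
  "dird ((\<eta>, \<sigma>), 0) P (0, t) = - (dird ((\<sigma> * cos t, \<sigma> * sin t), \<eta>) A (0, 0) * (cos t)\<^sup>2
     + 2 * dird ((\<sigma> * cos t, \<sigma> * sin t), \<eta>) B (0, 0) * cos t * sin t
     + dird ((\<sigma> * cos t, \<sigma> * sin t), \<eta>) C (0, 0) * (sin t)\<^sup>2) / 2"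
proof -
  let ?k = "\<lambda>z::('y \<times> real) \<times> real. ((snd (fst z) * P z * cos (snd z), snd (fst z) * P z * sin (snd z)), fst (fst z))"
  let ?w = "((\<eta>, \<sigma>), 0 :: real)" and ?v = "((\<sigma> * cos t, \<sigma> * sin t), \<eta>)"
  have k: "smooth_on \<Omega> ?k" by (intro smooth_intros open_\<Omega> smooth_P)
  have k0: "?k (0, t) = (0, 0)" by (simp add: zero_prod_def)
  have kW: "?k z \<in> W" if "z \<in> \<Omega>" for z
  proof -
    obtain y s t where z: "z = ((y, s), t)" by (metis prod.exhaust)
    have x: "(y, s) \<in> ball 0 \<epsilon>" using that z by simp
    have "norm y \<le> norm (y, s)" "\<bar>s\<bar> \<le> norm (y, s)" using norm_fst_le[of y s] norm_snd_le[of s y] by simp_all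
    then show ?thesis using in_\<Omega>F[of y s "(cos t, sin t)" "P z"] x \<epsilon>(2) \<delta> P_bounds(1,2)[OF x, of t]
      by (simp add: z \<Omega>F_def)
  qed
  have "(?k has_derivative (\<lambda>v. ((snd (fst v) * cos t, snd (fst v) * sin t), fst (fst v)))) (at (0, t))"
    by (auto intro!: derivative_eq_intros smooth_on_has_derivative[OF smooth_P zero_\<Omega>(1)] simp: P_0)
  from dirdI[OF this, of ?w] have dk: "dird ?w ?k (0, t) = ?v" by simp
  have sc: "smooth_on \<Omega> (\<lambda>z. f (?k z))" if "smooth_on W f" for f :: "(real \<times> real) \<times> 'y \<Rightarrow> real"
    by (rule smooth_on_compose[OF that open_\<Omega> open_W k kW])
  have df: "dird ?w (\<lambda>z. f (?k z)) (0, t) = dird ?v f (0, 0)" if "smooth_on W f" for f :: "(real \<times> real) \<times> 'y \<Rightarrow> real"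
    using dird_compose[of ?k "(0, t)" f ?w] smooth_on_differentiable[OF k zero_\<Omega>(1)] smooth_on_differentiable[OF that zero_W]
    unfolding dk k0 by simp
  let ?g = "\<lambda>z. A (?k z) * (cos (snd z))\<^sup>2 + 2 * B (?k z) * cos (snd z) * sin (snd z) + C (?k z) * (sin (snd z))\<^sup>2"
  have g: "smooth_on \<Omega> ?g"
    by (intro smooth_on_add[OF open_\<Omega>] smooth_on_mult[OF open_\<Omega>] sc smooth_ABC smooth_intros open_\<Omega>)
  have Pg: "(P z)\<^sup>2 * ?g z = 1" if "z \<in> \<Omega>" for z
  proof -
    obtain y s t where z: "z = ((y, s), t)" by (metis prod.exhaust)
    have x: "(y, s) \<in> ball 0 \<epsilon>" using that z by simp
    show ?thesis using P_bounds(3)[OF x, of t] unfolding F_polar G_def polar_def z by simp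
  qed
  have g0: "?g (0, t) = 1" using Pg[OF zero_\<Omega>(1), of t] P_0 by simp
  have l: "((\<lambda>\<tau>. f ((0, t) + \<tau> *\<^sub>R ?w)) has_real_derivative dird ?w f (0, t)) (at 0)" if "smooth_on \<Omega> f" for f
    using line_has_derivative[of f "(0, t)" 0 ?w] smooth_on_differentiable[OF that zero_\<Omega>(1)] by (simp add: zero_prod_def)
  have dg: "dird ?w ?g (0, t) = dird ?v A (0, 0) * (cos t)\<^sup>2 + 2 * dird ?v B (0, 0) * cos t * sin t + dird ?v C (0, 0) * (sin t)\<^sup>2"
  proof (rule dird_line[OF smooth_on_differentiable[OF g zero_\<Omega>(1)]])
    have sn: "snd ((0, t) + \<tau> *\<^sub>R ?w) = t" for \<tau> by simp
    show "((\<lambda>\<tau>. ?g ((0, t) + \<tau> *\<^sub>R ?w)) has_real_derivative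
      dird ?v A (0, 0) * (cos t)\<^sup>2 + 2 * dird ?v B (0, 0) * cos t * sin t + dird ?v C (0, 0) * (sin t)\<^sup>2) (at 0)"
      unfolding sn
      by (intro DERIV_add DERIV_cmult_right DERIV_cmult l[OF sc[OF smooth_ABC(1)], unfolded df[OF smooth_ABC(1)] sn]
          l[OF sc[OF smooth_ABC(2)], unfolded df[OF smooth_ABC(2)] sn] l[OF sc[OF smooth_ABC(3)], unfolded df[OF smooth_ABC(3)] sn])
  qed
  have "dird ?w (\<lambda>z. (P z)\<^sup>2 * ?g z) (0, t) = dird ?w (\<lambda>z. 1) (0, t)"
    by (rule dird_cong[OF open_\<Omega> zero_\<Omega>(1) Pg])
  also have "\<dots> = 0" by (rule dirdI[THEN trans]) auto
  finally have "dird ?w (\<lambda>z. (P z)\<^sup>2 * ?g z) (0, t) = 0" .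
  moreover have "dird ?w (\<lambda>z. (P z)\<^sup>2 * ?g z) (0, t) = 2 * dird ?w P (0, t) + dird ?w ?g (0, t)"
  proof (rule dirdI[THEN trans])
    show "((\<lambda>z. (P z)\<^sup>2 * ?g z) has_derivative
        (\<lambda>v. (P (0, t))\<^sup>2 * dird v ?g (0, t) + of_nat 2 * dird v P (0, t) * P (0, t) ^ (2 - 1) * ?g (0, t))) (at (0, t))"
      by (intro has_derivative_mult has_derivative_power smooth_on_has_derivative[OF smooth_P zero_\<Omega>(1)] smooth_on_has_derivative[OF g zero_\<Omega>(1)])
  qed (use g0 P_0 in simp)
  ultimately show ?thesis unfolding dg by simp
qed

end

locale umbilic_vertex = umbilic_polar A B C m a b c \<delta> bi bj P \<epsilon>
  for A B C :: "(real \<times> real) \<times> 'y::euclidean_space \<Rightarrow> real" and m a b c \<delta> :: real and bi bj :: 'y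
    and P :: "('y \<times> real) \<times> real \<Rightarrow> real" and \<epsilon> +
  fixes r :: real
  assumes r: "r > 0" "r \<le> \<epsilon>" and den_pos: "\<And>x t. x \<in> ball 0 r \<Longrightarrow> den (x, t) > 0"
begin

definition Q :: "('y \<times> real) \<times> real \<Rightarrow> real" where "Q z = num z / den z"
definition V :: "('y \<times> real) \<times> real \<Rightarrow> real" where "V z = m / 6 * D Q z"

abbreviation \<Omega>r :: "(('y \<times> real) \<times> real) set" where "\<Omega>r \<equiv> ball 0 r \<times> UNIV"

lemma open_\<Omega>r: "open \<Omega>r" by (intro open_Times) auto
lemma \<Omega>r_subset: "\<Omega>r \<subseteq> \<Omega>" using r by auto
lemma zero_\<Omega>r [simp]: "(0, t) \<in> \<Omega>r" "0 \<in> ball (0 :: 'y \<times> real) r" using r by simp_all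

lemma smooth_Q: "smooth_on \<Omega>r Q"
proof -
  have "den z \<noteq> 0" if "z \<in> \<Omega>r" for z using den_pos[of "fst z" "snd z"] that by (auto simp: mem_Times_iff)
  then show ?thesis
    unfolding Q_def[abs_def]
    by (intro smooth_intros open_\<Omega>r smooth_on_subset[OF smooth_num_den(1) \<Omega>r_subset] smooth_on_subset[OF smooth_num_den(2) \<Omega>r_subset])
qed

lemma smooth_V: "smooth_on \<Omega>r V"
  unfolding V_def[abs_def] by (intro smooth_intros open_\<Omega>r smooth_on_dird smooth_Q)

lemma V_flip:
  assumes x: "x \<in> ball 0 r"
  shows "V (x, t + pi) = V ((fst x, - snd x), t)"
proof -
  have y: "(fst x, - snd x) \<in> ball 0 r" using x in_ball_flip by blast
  have x': "x \<in> ball 0 \<epsilon>" "(fst x, - snd x) \<in> ball 0 \<epsilon>" using x y r by auto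
  have "Q (x, t + pi) = Q ((fst x, - snd x), t)" for t
    unfolding Q_def num_den_shift[OF x' P_flip[OF x'(1)]] ..
  from angle_dird_shift[OF smooth_Q x y this] show ?thesis unfolding V_def by simp
qed

text \<open>At \<open>s = \<lambda> = \<mu> = 0\<close> the curve \<open>P\<close> is a round circle, all of whose points are vertices.\<close>

lemma V_zero:
  assumes x: "x \<in> ball 0 r" "snd x = 0" "fst x \<bullet> bi = 0" "fst x \<bullet> bj = 0"
  shows "V (x, t) = 0"
proof -
  have x': "x \<in> ball 0 \<epsilon>" using x r by auto
  obtain y where y: "x = (y, 0)" using x(2) by (metis prod.collapse)
  have y\<delta>: "y \<in> ball 0 \<delta>" using x'(1) norm_fst_le[of y 0] \<epsilon>(2) \<delta> by (simp add: y)
  have B: "B (0, y) = 0" and C: "C (0, y) = A (0, y)" using linear_part[OF y\<delta>] x(3,4) by (simp_all add: y)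
  have F1: "F (x, (cos t, sin t), q) = q\<^sup>2 * (A (0, y) * ((sin t)\<^sup>2 + (cos t)\<^sup>2))" for q t
  proof -
    have "polar (0 * q, t) = 0" by (simp add: polar_def zero_prod_def)
    then have "F (x, (cos t, sin t), q) = q\<^sup>2 * G (0, y) t" unfolding y F_polar by simp
    then show ?thesis unfolding G_def B C by algebra
  qed
  have "F (x, (cos t, sin t), q) = F (x, (cos 0, sin 0), q)" for q t
    unfolding F1[of t] F1[of 0] sin_cos_squared_add ..
  then have P: "P (x, t) = P (x, 0)" for t using P_iff[OF x', of _ t] P_iff[OF x', of _ 0] by metis
  then have u: "u (x, t) = u (x, 0)" for t unfolding u_def by simp
  have "Q (x, t) = P (x, 0) / u (x, 0)" for t
    unfolding Q_def num_def den_def constant_dird2(2)[OF smooth_P x' P] constant_dird2(2)[OF smooth_u x' u] P[of t] u[of t] by simp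
  then have "((\<lambda>t. Q (x, t)) has_real_derivative 0) (at t)" by simp
  then have "D Q (x, t) = 0" by (rule angle_dird_eqI[OF smooth_Q x(1)])
  then show ?thesis unfolding V_def by simp
qed

text \<open>To first order at the umbilic, \<open>Q - 1\<close> is twice \<open>p'' + p\<close>, where \<open>p\<close> is the variation of the polar radius.\<close>

lemma dird_V_0:
  assumes p: "\<And>t. dird (w, 0) P (0, t) = p t"
    and p1: "\<And>t. (p has_real_derivative p1 t) (at t)" and p2: "\<And>t. (p1 has_real_derivative p2 t) (at t)"
    and p3: "\<And>t. (p2 has_real_derivative p3 t) (at t)"
  shows "dird (w, 0) V (0, t) = m / 3 * (p3 t + p1 t)"
proof -
  let ?w = "(w, 0 :: real)"
  have D1: "D (dird ?w f) (0, t) = f1 t" if f: "smooth_on \<Omega> f" "\<And>t. dird ?w f (0, t) = f0 t" "\<And>t. (f0 has_real_derivative f1 t) (at t)"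
    for f f0 f1 t
    by (rule angle_dird_eqI[OF smooth_on_dird[OF f(1)] zero_\<Omega>(2)]) (unfold f(2), rule f(3))
  have D2: "dird ?w (D (D f)) (0, t) = f2 t" if f: "smooth_on \<Omega> f" "\<And>t. dird ?w f (0, t) = f0 t"
    "\<And>t. (f0 has_real_derivative f1 t) (at t)" "\<And>t. (f1 has_real_derivative f2 t) (at t)" for f f0 f1 f2 t
  proof -
    have DD: "dird ?w (D f) (0, t) = f1 t" for t
      using D1[OF f(1-3)] dird_commute[OF open_\<Omega> f(1) zero_\<Omega>(1)] by simp
    have "dird ?w (D (D f)) (0, t) = D (dird ?w (D f)) (0, t)"
      by (rule dird_commute[OF open_\<Omega> smooth_on_dird[OF f(1)] zero_\<Omega>(1)])
    also have "\<dots> = f2 t" by (rule D1[OF smooth_on_dird[OF f(1)] DD f(4)])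
    finally show ?thesis .
  qed
  have hd: "(f has_derivative (\<lambda>v. dird v f (0, t))) (at (0, t))" if "smooth_on \<Omega> f" for f :: "('y \<times> real) \<times> real \<Rightarrow> real" and t
    by (rule smooth_on_has_derivative[OF that zero_\<Omega>(1)])
  have u: "dird ?w u (0, t) = - p t" for t
    unfolding u_def[abs_def]
    using dirdI[OF Deriv.has_derivative_inverse[OF P_nonzero[OF zero_\<Omega>(1)[of t]] hd[OF smooth_P, of t]], of ?w]
    by (simp add: P_0 p)
  have num: "dird ?w num (0, t) = p2 t + p t" for t
  proof -
    have "dird ?w num (0, t) = dird ?w (D (D P)) (0, t) + dird ?w P (0, t)"
      unfolding num_def[abs_def]
      by (rule dirdI) (intro has_derivative_add hd smooth_on_dird smooth_P)
    then show ?thesis using D2[OF smooth_P p p1 p2] p by simp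
  qed
  have den: "dird ?w den (0, t) = - (p2 t + p t)" for t
  proof -
    have "dird ?w den (0, t) = dird ?w (D (D u)) (0, t) + dird ?w u (0, t)"
      unfolding den_def[abs_def]
      by (rule dirdI) (intro has_derivative_add hd smooth_on_dird smooth_u)
    then show ?thesis using D2[OF smooth_u u DERIV_minus[OF p1] DERIV_minus[OF p2]] u by simp
  qed
  have Q: "dird ?w Q (0, t) = 2 * (p2 t + p t)" for t
  proof -
    have "dird ?w Q (0, t) = (dird ?w num (0, t) * den (0, t) - num (0, t) * dird ?w den (0, t)) / (den (0, t) * den (0, t))"
      unfolding Q_def[abs_def]
      by (rule dirdI) (intro has_derivative_divide' hd smooth_num_den, simp add: num_den_0)
    then show ?thesis unfolding num den num_den_0 by simp
  qed
  have "dird ?w (D Q) (0, t) = D (dird ?w Q) (0, t)" by (rule dird_commute[OF open_\<Omega>r smooth_Q zero_\<Omega>r(1)])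
  also have "\<dots> = 2 * (p3 t + p1 t)"
    by (rule angle_dird_eqI[OF smooth_on_dird[OF smooth_Q] zero_\<Omega>r(2)]) (unfold Q, auto intro!: derivative_eq_intros p1 p3)
  finally have dQ: "dird ?w (D Q) (0, t) = 2 * (p3 t + p1 t)" .
  have "dird ?w V (0, t) = m / 6 * dird ?w (D Q) (0, t)"
    unfolding V_def[abs_def]
    by (rule dirdI) (intro has_derivative_mult_right smooth_on_has_derivative[OF smooth_on_dird[OF smooth_Q] zero_\<Omega>r(1)])
  then show ?thesis unfolding dQ by (rule trans) (simp add: algebra_simps)
qed

definition bs :: "'y \<times> real" where "bs = (0, 1)"
definition bl :: "'y \<times> real" where "bl = (bi, 0)"
definition bm :: "'y \<times> real" where "bm = (bj, 0)"

lemma dird_linear_part: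
  "dird (0, v) A (0, 0) - dird (0, v) C (0, 0) = 2 * (v \<bullet> bi) / m" "dird (0, v) B (0, 0) = (v \<bullet> bj) / m"
proof -
  have l: "((\<lambda>\<sigma>. f (0, \<sigma> *\<^sub>R v)) has_real_derivative dird (0, v) f (0, 0)) (at 0)" if "smooth_on W f" for f :: "(real \<times> real) \<times> 'y \<Rightarrow> real"
    using line_has_derivative[of f "(0, 0)" 0 "(0, v)"] smooth_on_differentiable[OF that zero_W] by simp
  have "open ((\<lambda>\<sigma>. \<sigma> *\<^sub>R v) -` ball 0 \<delta>)" by (intro open_vimage continuous_intros open_ball)
  then have ev: "\<forall>\<^sub>F \<sigma> in nhds 0. \<sigma> *\<^sub>R v \<in> ball 0 \<delta>"
    using eventually_nhds_in_open[of "(\<lambda>\<sigma>. \<sigma> *\<^sub>R v) -` ball 0 \<delta>" 0] \<delta> by simp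
  have "((\<lambda>\<sigma>. 2 * (\<sigma> * (v \<bullet> bi)) / m) has_real_derivative 2 * (v \<bullet> bi) / m) (at 0)"
    using m by (auto intro!: derivative_eq_intros)
  moreover have "((\<lambda>\<sigma>. 2 * (\<sigma> * (v \<bullet> bi)) / m) has_real_derivative dird (0, v) A (0, 0) - dird (0, v) C (0, 0)) (at 0)"
    by (rule DERIV_transfer[OF DERIV_diff[OF l[OF smooth_ABC(1)] l[OF smooth_ABC(3)]]])
      (use ev in eventually_elim, simp only: linear_part inner_scaleR_left)
  ultimately show "dird (0, v) A (0, 0) - dird (0, v) C (0, 0) = 2 * (v \<bullet> bi) / m" by (rule DERIV_unique[symmetric])
  have "((\<lambda>\<sigma>. \<sigma> * (v \<bullet> bj) / m) has_real_derivative (v \<bullet> bj) / m) (at 0)"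
    using m by (auto intro!: derivative_eq_intros)
  moreover have "((\<lambda>\<sigma>. \<sigma> * (v \<bullet> bj) / m) has_real_derivative dird (0, v) B (0, 0)) (at 0)"
    by (rule DERIV_transfer[OF l[OF smooth_ABC(2)]])
      (use ev in eventually_elim, simp only: linear_part inner_scaleR_left)
  ultimately show "dird (0, v) B (0, 0) = (v \<bullet> bj) / m" by (rule DERIV_unique[symmetric])
qed

text \<open>The variation of the polar radius is a cubic form in \<open>(cos t, sin t)\<close> for the direction \<open>s\<close> and a
  quadratic one for \<open>\<lambda>\<close> and \<open>\<mu>\<close>. The operator \<open>p \<mapsto> p'' + p\<close> kills the first harmonics, and so leaves of the cubic
  only its third harmonic, which is a multiple of \<open>c - b\<close> because \<open>x\<^sup>3\<close> and \<open>x y\<^sup>2\<close> have equal coefficients.\<close>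

lemma V_principal_part:
  "dird (bs, 0) V (0, t) = - (c - b) * cos (3 * t)" "dird (bl, 0) V (0, t) = - sin (2 * t)" "dird (bm, 0) V (0, t) = cos (2 * t)"
proof -
  have ij: "bi \<bullet> bi = 1" "bj \<bullet> bj = 1" "bi \<bullet> bj = 0" "bj \<bullet> bi = 0" using basis_ij by (simp_all add: inner_Basis)
  have sc: "(sin t)\<^sup>2 = 1 - (cos t)\<^sup>2" for t :: real by (simp add: sin_squared_eq)
  let ?e = "c - b"
  let ?p = "\<lambda>t. - (a * cos t + b * sin t + ?e * sin t ^ 3) / (2 * m)"
  let ?p1 = "\<lambda>t. - (- a * sin t + b * cos t + ?e * (3 * (sin t)\<^sup>2 * cos t)) / (2 * m)"
  let ?p2 = "\<lambda>t. - (- a * cos t - b * sin t + ?e * (6 * sin t * (cos t)\<^sup>2 - 3 * sin t ^ 3)) / (2 * m)"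
  let ?p3 = "\<lambda>t. - (a * sin t - b * cos t + ?e * (6 * cos t ^ 3 - 21 * (sin t)\<^sup>2 * cos t)) / (2 * m)"
  have "dird (bs, 0) V (0, t) = m / 3 * (?p3 t + ?p1 t)"
  proof (rule dird_V_0)
    show "dird (bs, 0) P (0, t) = ?p t" for t
    proof -
      have "a * cos t ^ 3 + b * (cos t)\<^sup>2 * sin t + a * cos t * (sin t)\<^sup>2 + c * sin t ^ 3
          = (a * cos t + b * sin t) * ((sin t)\<^sup>2 + (cos t)\<^sup>2) + ?e * sin t ^ 3" by algebra
      then have eq: "a * cos t ^ 3 + b * (cos t)\<^sup>2 * sin t + a * cos t * (sin t)\<^sup>2 + c * sin t ^ 3
          = a * cos t + b * sin t + ?e * sin t ^ 3" by simp
      have "- (X / m) / 2 = - X / (2 * m)" for X by simp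
      then show ?thesis unfolding bs_def dird_P_0 mult_1 cubic[of "cos t" "sin t"] eq .
    qed
    show "(?p has_real_derivative ?p1 t) (at t)" "(?p1 has_real_derivative ?p2 t) (at t)" "(?p2 has_real_derivative ?p3 t) (at t)" for t
      using m by (auto intro!: derivative_eq_intros simp: field_simps power2_eq_square power3_eq_cube)
  qed
  also have "?p3 t + ?p1 t = - (3 * ?e * (cos t ^ 3 - 3 * (sin t)\<^sup>2 * cos t)) / m"
    using m by (simp add: field_simps)
  also have "m / 3 * \<dots> = - ?e * (cos t ^ 3 - 3 * (sin t)\<^sup>2 * cos t)" using m by (simp add: field_simps)
  also have "cos t ^ 3 - 3 * (sin t)\<^sup>2 * cos t = cos (3 * t)"
    unfolding cos_treble_cos sc by (simp add: algebra_simps power2_eq_square power3_eq_cube)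
  finally show "dird (bs, 0) V (0, t) = - (c - b) * cos (3 * t)" .
  have split: "\<alpha> * (cos t)\<^sup>2 + 2 * \<beta> * cos t * sin t + \<gamma> * (sin t)\<^sup>2 = (\<alpha> + \<gamma>) / 2 + (\<alpha> - \<gamma>) / 2 * cos (2 * t) + \<beta> * sin (2 * t)"
    for \<alpha> \<beta> \<gamma> t :: real
    unfolding sin_double cos_double sc by (simp add: field_simps)
  have Pv: "dird ((v, 0), 0) P (0, t) = - ((dird (0, v) A (0, 0) + dird (0, v) C (0, 0)) / 2 + (v \<bullet> bi) / m * cos (2 * t) + (v \<bullet> bj) / m * sin (2 * t)) / 2" for v t
    unfolding dird_P_0 mult_zero_left zero_prod_def[symmetric] split dird_linear_part[unfolded zero_prod_def[symmetric]] by simp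
  let ?k = "\<lambda>v. (dird (0, v) A (0, 0) + dird (0, v) C (0, 0)) / 2"
  have "dird (bl, 0) V (0, t) = m / 3 * (- 4 * sin (2 * t) / m + sin (2 * t) / m)"
  proof (rule dird_V_0)
    show "dird (bl, 0) P (0, t) = - (?k bi + cos (2 * t) / m) / 2" for t
      unfolding bl_def Pv ij by simp
    show "((\<lambda>t. - (?k bi + cos (2 * t) / m) / 2) has_real_derivative sin (2 * t) / m) (at t)"
      "((\<lambda>t. sin (2 * t) / m) has_real_derivative 2 * cos (2 * t) / m) (at t)"
      "((\<lambda>t. 2 * cos (2 * t) / m) has_real_derivative - 4 * sin (2 * t) / m) (at t)" for t
      using m by (auto intro!: derivative_eq_intros)
  qed
  then show "dird (bl, 0) V (0, t) = - sin (2 * t)" using m by (simp add: field_simps)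
  have "dird (bm, 0) V (0, t) = m / 3 * (4 * cos (2 * t) / m + - cos (2 * t) / m)"
  proof (rule dird_V_0)
    show "dird (bm, 0) P (0, t) = - (?k bj + sin (2 * t) / m) / 2" for t
      unfolding bm_def Pv ij by simp
    show "((\<lambda>t. - (?k bj + sin (2 * t) / m) / 2) has_real_derivative - cos (2 * t) / m) (at t)"
      "((\<lambda>t. - cos (2 * t) / m) has_real_derivative 2 * sin (2 * t) / m) (at t)"
      "((\<lambda>t. 2 * sin (2 * t) / m) has_real_derivative 4 * cos (2 * t) / m) (at t)" for t
      using m by (auto intro!: derivative_eq_intros)
  qed
  then show "dird (bm, 0) V (0, t) = cos (2 * t)" using m by (simp add: field_simps)
qed

text \<open>Since \<open>V\<close> vanishes on \<open>s = \<lambda> = \<mu> = 0\<close>, Hadamard's lemma divides it by these three coordinates.\<close>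

lemma ex_vertex_family: "\<exists>a0 a1 a2. vertex_family V a0 a1 a2 (c - b) r bs bl bm"
proof -
  let ?T = "{(bs, 0), (bl, 0), (bm, 0)} :: (('y \<times> real) \<times> real) set"
  have Basis: "bs \<in> Basis" "bl \<in> Basis" "bm \<in> Basis"
    using basis_ij by (auto simp: bs_def bl_def bm_def Basis_prod_def)
  have ne: "bs \<noteq> bl" "bs \<noteq> bm" "bl \<noteq> bm" using basis_ij by (auto simp: bs_def bl_def bm_def)
  have T: "?T \<subseteq> Basis" using Basis by (auto simp: Basis_prod_def)
  have sum3: "(\<Sum>b\<in>?T. f b) = f (bs, 0) + f (bl, 0) + f (bm, 0)" for f :: "_ \<Rightarrow> 'z::ab_group_add"
    using ne by (simp add: add.assoc)
  have ij: "bi \<bullet> bi = 1" "bj \<bullet> bj = 1" "bi \<bullet> bj = 0" "bj \<bullet> bi = 0" using basis_ij by (simp_all add: inner_Basis)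
  have star: "x - t *\<^sub>R (\<Sum>b\<in>?T. (x \<bullet> b) *\<^sub>R b) \<in> \<Omega>r" if x: "x \<in> \<Omega>r" and t: "0 \<le> t" "t \<le> 1" for x t
  proof -
    obtain y s \<theta> where xeq: "x = ((y, s), \<theta>)" by (metis prod.exhaust)
    let ?y' = "y - t *\<^sub>R ((y \<bullet> bi) *\<^sub>R bi + (y \<bullet> bj) *\<^sub>R bj)" and ?s' = "s - t * s"
    have eq: "x - t *\<^sub>R (\<Sum>b\<in>?T. (x \<bullet> b) *\<^sub>R b) = ((?y', ?s'), \<theta>)"
      unfolding sum3 by (simp add: xeq bs_def bl_def bm_def inner_prod_def algebra_simps)
    have "?y' \<bullet> ?y' = y \<bullet> y - (2 * t - t\<^sup>2) * ((y \<bullet> bi)\<^sup>2 + (y \<bullet> bj)\<^sup>2)"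
      using ij by (simp add: inner_diff_left inner_diff_right inner_add_left inner_add_right inner_commute algebra_simps power2_eq_square)
    moreover have "0 \<le> 2 * t - t\<^sup>2" using mult_right_mono[OF t(2,1)] t unfolding power2_eq_square by linarith
    ultimately have "?y' \<bullet> ?y' \<le> y \<bullet> y" by simp
    then have "norm ?y' \<le> norm y" by (simp only: norm_le)
    moreover have "\<bar>?s'\<bar> \<le> \<bar>s\<bar>"
    proof -
      have "?s' = (1 - t) * s" by (simp add: algebra_simps)
      then show ?thesis using t by (simp add: abs_mult mult_left_le_one_le)
    qed
    ultimately have "norm (?y', ?s') \<le> norm (y, s)"
      unfolding norm_Pair real_norm_def by (intro real_sqrt_le_mono add_mono power_mono) auto
    then show ?thesis unfolding eq using x xeq by simp
  qed
  have zero: "V x = 0" if x: "x \<in> \<Omega>r" and 0: "\<And>b. b \<in> ?T \<Longrightarrow> x \<bullet> b = 0" for x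
  proof -
    have "snd (fst x) = 0" "fst (fst x) \<bullet> bi = 0" "fst (fst x) \<bullet> bj = 0"
      using 0[of "(bs, 0)"] 0[of "(bl, 0)"] 0[of "(bm, 0)"] by (simp_all add: bs_def bl_def bm_def inner_prod_def)
    then show ?thesis using V_zero[of "fst x" "snd x"] x by (simp add: mem_Times_iff)
  qed
  have fin: "finite ?T" by simp
  obtain Fb where Fb: "\<And>b. b \<in> ?T \<Longrightarrow> smooth_on \<Omega>r (Fb b)" "\<And>x. x \<in> \<Omega>r \<Longrightarrow> V x = (\<Sum>b\<in>?T. (x \<bullet> b) * Fb b x)"
    "\<And>x b. x \<in> \<Omega>r \<Longrightarrow> b \<in> ?T \<Longrightarrow> (\<And>b. b \<in> ?T \<Longrightarrow> x \<bullet> b = 0) \<Longrightarrow> Fb b x = dird b V x"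
    using hadamard[OF open_\<Omega>r smooth_V fin T star zero] by blast
  have "vertex_family V (Fb (bs, 0)) (Fb (bl, 0)) (Fb (bm, 0)) (c - b) r bs bl bm"
  proof
    show "c - b \<noteq> 0" "r > 0" using bc r by simp_all
    show "V (x, t) = (x \<bullet> bs) * Fb (bs, 0) (x, t) + (x \<bullet> bl) * Fb (bl, 0) (x, t) + (x \<bullet> bm) * Fb (bm, 0) (x, t)" if "x \<in> ball 0 r" for x t
      using Fb(2)[of "(x, t)"] that unfolding sum3 by simp
    have 0: "Fb b (0, t) = dird b V (0, t)" if "b \<in> ?T" for b t
      by (rule Fb(3)[OF zero_\<Omega>r(1) that]) auto
    show "Fb (bs, 0) (0, t) = - (c - b) * cos (3 * t)" "Fb (bl, 0) (0, t) = - sin (2 * t)" "Fb (bm, 0) (0, t) = cos (2 * t)" for t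
      using 0[of "(bs, 0)" t] 0[of "(bl, 0)" t] 0[of "(bm, 0)" t] V_principal_part by simp_all
    show "V (x, t + pi) = V (x - (2 * (x \<bullet> bs)) *\<^sub>R bs, t)" if "x \<in> ball 0 r" for x t
    proof -
      have "x - (2 * (x \<bullet> bs)) *\<^sub>R bs = (fst x, - snd x)" by (simp add: bs_def inner_prod_def prod_eq_iff)
      then show ?thesis using V_flip[OF that] by simp
    qed
  qed (use Basis ne Fb(1) in auto)
  then show ?thesis by blast
qed

end

section \<open>Degenerate vertices of the level curves\<close>

context umbilic_family
begin

lemma h_nonneg:
  assumes "p \<in> ball 0 \<delta>" "y \<in> ball 0 \<delta>"
  shows "h (p, y) \<ge> 0" "h (p, y) = 0 \<longleftrightarrow> p = 0"
proof -
  have "h (p, y) > 0" if p: "p \<noteq> 0"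
  proof -
    obtain r t where rt: "r > 0" "p = polar (r, t)" using polar_exists[OF p] by blast
    have "(p, y) \<in> W" using assms by simp
    from G_bound(1)[OF this, of t] rt show ?thesis unfolding rt(2) h_polar by simp
  qed
  moreover have "h (0, y) = 0" unfolding h_def by simp
  ultimately show "h (p, y) \<ge> 0" "h (p, y) = 0 \<longleftrightarrow> p = 0" by (cases "p = 0"; force)+
qed

text \<open>For nonpositive values of \<open>h\<close> the level is empty or a point, which contains no regular curve.\<close>

lemma no_degenerate_vertex:
  assumes "\<delta>' \<le> \<delta>" "y \<in> ball 0 \<delta>" "k \<le> 0"
  shows "\<not> degenerate_vertex {p \<in> ball 0 \<delta>'. h (p, y) = k} p"
proof
  let ?M = "{p \<in> ball 0 \<delta>'. h (p, y) = k}"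
  have M: "?M \<subseteq> {0}"
  proof
    fix p assume p: "p \<in> ?M"
    then have "p \<in> ball 0 \<delta>" using assms(1) by simp
    from h_nonneg[OF this assms(2)] p assms(3) show "p \<in> {0}" by auto
  qed
  assume "degenerate_vertex ?M p"
  then obtain \<gamma> where \<gamma>: "regular_param ?M p \<gamma>"
    unfolding degenerate_vertex_def vertex_def tangency_at_least_def by blast
  then obtain e where e: "e > 0" "\<gamma> ` {-e<..<e} \<subseteq> ?M" "vector_derivative \<gamma> (at 0) \<noteq> 0"
    unfolding regular_param_def by blast
  have "((\<lambda>t. 0) has_vector_derivative 0) (at (0::real))" by simp
  then have "(\<gamma> has_vector_derivative 0) (at 0)"
    by (rule has_vector_derivative_transform_within_open[of _ _ _ "{-e<..<e}"]) (use e(1,2) M in force)+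
  then show False using e(3) vector_derivative_at by blast
qed

end

context umbilic_vertex
begin

lemma deriv_angle:
  assumes "smooth_on (X \<times> UNIV) f" "x \<in> X"
  shows "deriv (\<lambda>t. f (x, t)) = (\<lambda>t. D f (x, t))"
proof
  fix t show "deriv (\<lambda>t. f (x, t)) t = D f (x, t)"
    using angle_has_derivative[OF assms, of t] by (rule DERIV_imp_deriv)
qed

lemma polar_curve_level:
  assumes x: "(y, s) \<in> ball 0 r" "s > 0" and d: "4 * s < \<delta>'" "\<delta>' \<le> \<delta>"
  shows "polar_curve {p \<in> ball 0 \<delta>'. h (p, y) = s\<^sup>2} s (\<lambda>t. P ((y, s), t))"
proof
  have x': "(y, s) \<in> ball 0 \<epsilon>" using x r by auto
  note Pb = P_bounds[OF x']
  have "norm y \<le> norm (y, s)" by (rule norm_fst_le)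
  then have y: "y \<in> ball 0 \<delta>" using x' \<epsilon>(2) \<delta> by simp
  have line: "smooth_on UNIV (\<lambda>t. f ((y, s), t))" if "smooth_on \<Omega> f" for f :: "('y \<times> real) \<times> real \<Rightarrow> real"
    by (rule smooth_on_compose[OF that open_UNIV open_\<Omega>]) (use x' in \<open>auto intro!: smooth_intros\<close>)
  show "s > 0" by (rule x)
  show "smooth_on UNIV (\<lambda>t. P ((y, s), t))" by (rule line[OF smooth_P])
  show "P ((y, s), t) > 0" for t using Pb(1)[of t] by simp
  have small: "\<bar>s * P ((y, s), t)\<bar> < \<delta>'" for t
  proof -
    have "s * P ((y, s), t) < s * 4" using Pb(2)[of t] x(2) by (intro mult_strict_left_mono) auto
    moreover have "0 < s * P ((y, s), t)" using x(2) Pb(1)[of t] by simp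
    ultimately show ?thesis using d(1) by linarith
  qed
  have hP: "h (polar (s * P ((y, s), t), t), y) = s\<^sup>2" for t
  proof -
    have "h (polar (s * P ((y, s), t), t), y) = s\<^sup>2 * F ((y, s), (cos t, sin t), P ((y, s), t))"
      unfolding h_polar F_polar by (simp add: power_mult_distrib)
    then show ?thesis unfolding Pb(3) by simp
  qed
  let ?M = "{p \<in> ball 0 \<delta>'. h (p, y) = s\<^sup>2}"
  show on: "polar (s * P ((y, s), t), t) \<in> ?M" for t using hP small by (simp add: norm_polar)
  show "\<rho> = s * P ((y, s), t)" if \<rho>: "\<rho> > 0" "polar (\<rho>, t) \<in> ?M" for \<rho> t
  proof -
    have W: "(polar (\<rho>, t), y) \<in> W" using \<rho>(2) y d(2) by auto
    let ?q = "\<rho> / s"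
    have sq: "s * ?q = \<rho>" using x(2) by simp
    have "\<rho>\<^sup>2 * G (polar (\<rho>, t), y) t = s\<^sup>2" using \<rho>(2) h_polar by simp
    then have q: "?q\<^sup>2 * G (polar (\<rho>, t), y) t = 1" using x(2) by (simp add: power_divide)
    have q0: "?q > 0" using \<rho> x by simp
    have "?q\<^sup>2 * (1 / 2) < 1" "1 < ?q\<^sup>2 * (3 / 2)"
      using mult_strict_left_mono[OF G_bound(1)[OF W, of t], of "?q\<^sup>2"] mult_strict_left_mono[OF G_bound(2)[OF W, of t], of "?q\<^sup>2"] q q0
      by (simp_all only: zero_less_power)
    then have "(1 / 4)\<^sup>2 < ?q\<^sup>2" "?q\<^sup>2 < 4\<^sup>2" by (simp_all add: power2_eq_square)
    then have "1 / 4 < ?q" "?q < 4" using q0 power_less_imp_less_base[of "1 / 4" 2 ?q] power_less_imp_less_base[of ?q 2 4] by linarith+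
    moreover have "F ((y, s), (cos t, sin t), ?q) = 1" unfolding F_polar sq using q .
    ultimately have "?q = P ((y, s), t)" using P_iff[OF x'] by blast
    then show ?thesis using sq by simp
  qed
  show "smooth_submanifold_at 1 ?M (polar (s * P ((y, s), t), t))" for t
  proof -
    let ?p = "polar (s * P ((y, s), t), t)" and ?w = "s *\<^sub>R polar (1, t)"
    define H where "H p = h (p, y) - s\<^sup>2" for p
    have S: "smooth_on (ball 0 \<delta>') H"
    proof -
      have c: "smooth_on (ball 0 \<delta>') (\<lambda>p. f (p, y))" if "smooth_on W f" for f :: "(real \<times> real) \<times> 'y \<Rightarrow> real"
        by (rule smooth_on_compose[OF that open_ball open_W smooth_on_Pair[OF open_ball smooth_on_id smooth_on_const]])
          (use d(2) y in auto)
      have H: "H = (\<lambda>p. A (p, y) * (fst p)\<^sup>2 + 2 * B (p, y) * fst p * snd p + C (p, y) * (snd p)\<^sup>2 - s\<^sup>2)"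
        unfolding H_def h_def by simp
      note f = smooth_on_fst[OF open_ball smooth_on_id] smooth_on_snd[OF open_ball smooth_on_id]
      show ?thesis unfolding H power2_eq_square
        by (intro smooth_on_diff smooth_on_add smooth_on_mult smooth_on_const f c[OF smooth_ABC(1)] c[OF smooth_ABC(2)] c[OF smooth_ABC(3)] open_ball)
    qed
    have pS: "?p \<in> ball 0 \<delta>'" using on[of t] by simp
    let ?q = "P ((y, s), t)"
    have f\<Omega>: "((y, s), (cos t, sin t), ?q) \<in> \<Omega>F"
      using in_\<Omega>F[of y s "(cos t, sin t)" ?q] y Pb[of t] x(2) norm_snd_le[of s y] x' \<epsilon>(2) by simp
    have "((\<lambda>\<sigma>. F ((y, s), (cos t, sin t), ?q + \<sigma>)) has_real_derivative dird (0, 0, 1) F ((y, s), (cos t, sin t), ?q)) (at 0)"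
      using line_has_derivative[of F "((y, s), (cos t, sin t), ?q)" 0 "(0, 0, 1)"] smooth_on_differentiable[OF smooth_F f\<Omega>] by simp
    then have dF: "((\<lambda>\<sigma>. s\<^sup>2 * F ((y, s), (cos t, sin t), ?q + \<sigma>) - s\<^sup>2) has_real_derivative s\<^sup>2 * dird (0, 0, 1) F ((y, s), (cos t, sin t), ?q)) (at 0)"
      by (auto intro!: derivative_eq_intros)
    have "H (?p + \<sigma> *\<^sub>R ?w) = s\<^sup>2 * F ((y, s), (cos t, sin t), ?q + \<sigma>) - s\<^sup>2" for \<sigma>
    proof -
      have "?p + \<sigma> *\<^sub>R ?w = polar (s * (?q + \<sigma>), t)" by (simp add: polar_def algebra_simps)
      then show ?thesis unfolding H_def F_polar by (simp add: h_polar power_mult_distrib)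
    qed
    then have "dird ?w H ?p = s\<^sup>2 * dird (0, 0, 1) F ((y, s), (cos t, sin t), ?q)"
      using dF by (intro dird_line[OF smooth_on_differentiable[OF S pS]]) simp
    then have "dird ?w H ?p \<noteq> 0" using F_pos[OF x' Pb(1,2)] x(2) by (simp add: less_imp_neq[symmetric])
    moreover have "H ?p = 0" unfolding H_def hP by simp
    ultimately have "smooth_submanifold_at (DIM(real \<times> real) - 1) {p \<in> ball 0 \<delta>'. H p = 0} ?p"
      by (intro regular_level_set open_ball S pS)
    then show ?thesis by (simp add: H_def)
  qed
  show "deriv (deriv (\<lambda>t. inverse (P ((y, s), t)))) t + inverse (P ((y, s), t)) \<noteq> 0" for t
  proof -
    have "deriv (deriv (\<lambda>t. u ((y, s), t))) t + u ((y, s), t) = den ((y, s), t)"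
      unfolding deriv_angle[OF smooth_u x'] deriv_angle[OF smooth_on_dird[OF smooth_u] x'] den_def ..
    then show ?thesis using den_pos[OF x(1), of t] unfolding u_def by simp
  qed
qed

theorem degenerate_vertex_level_iff:
  assumes x: "(y, s) \<in> ball 0 r" "s > 0" and d: "4 * s < \<delta>'" "\<delta>' \<le> \<delta>"
  shows "(\<exists>p. degenerate_vertex {p \<in> ball 0 \<delta>'. h (p, y) = s\<^sup>2} p) \<longleftrightarrow> (\<exists>t. V ((y, s), t) = 0 \<and> D V ((y, s), t) = 0)"
proof -
  let ?M = "{p \<in> ball 0 \<delta>'. h (p, y) = s\<^sup>2}"
  have "polar_curve ?M s (\<lambda>t. P ((y, s), t))" using x d by (rule polar_curve_level)
  then interpret curve: polar_curve ?M s "\<lambda>t. P ((y, s), t)" .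
  have x': "(y, s) \<in> ball 0 \<epsilon>" using x r by auto
  have cQ: "curve.Q = (\<lambda>t. Q ((y, s), t))"
  proof
    fix t
    have "curve.Q t = num ((y, s), t) / den ((y, s), t)"
      unfolding curve.Q_def num_def den_def u_def[symmetric]
      unfolding deriv_angle[OF smooth_u x'] deriv_angle[OF smooth_on_dird[OF smooth_u] x']
        deriv_angle[OF smooth_P x'] deriv_angle[OF smooth_on_dird[OF smooth_P] x'] ..
    then show "curve.Q t = Q ((y, s), t)" unfolding Q_def .
  qed
  have Q1: "deriv curve.Q = (\<lambda>t. D Q ((y, s), t))" unfolding cQ by (rule deriv_angle[OF smooth_Q x(1)])
  have Q2: "deriv (deriv curve.Q) = (\<lambda>t. D (D Q) ((y, s), t))" unfolding Q1 by (rule deriv_angle[OF smooth_on_dird[OF smooth_Q] x(1)])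
  have DV: "D V ((y, s), t) = m / 6 * D (D Q) ((y, s), t)" for t
    unfolding V_def[abs_def]
    by (rule dirdI) (intro has_derivative_mult_right smooth_on_has_derivative[OF smooth_on_dird[OF smooth_Q]], use x in simp)
  have iff: "degenerate_vertex ?M (curve.c t) \<longleftrightarrow> V ((y, s), t) = 0 \<and> D V ((y, s), t) = 0" for t
    unfolding curve.degenerate_vertex_iff Q2 unfolding Q1 DV unfolding V_def using m by simp
  show ?thesis
  proof
    assume "\<exists>p. degenerate_vertex ?M p"
    then obtain p where p: "degenerate_vertex ?M p" by blast
    then have pM: "p \<in> ?M" unfolding degenerate_vertex_def vertex_def smooth_submanifold_at_def by blast
    have "p \<noteq> 0" using pM x(2) by (auto simp: h_def)
    then obtain \<rho> t where \<rho>: "\<rho> > 0" "p = polar (\<rho>, t)" using polar_exists by metis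
    then have "p = curve.c t" unfolding curve.c_def using curve.only_M[of \<rho> t] pM by simp
    then show "\<exists>t. V ((y, s), t) = 0 \<and> D V ((y, s), t) = 0" using p iff by blast
  next
    assume "\<exists>t. V ((y, s), t) = 0 \<and> D V ((y, s), t) = 0"
    then show "\<exists>p. degenerate_vertex ?M p" using iff by blast
  qed
qed

end

theorem (in umbilic_family) ex_vertex_function:
  "\<exists>V a0 a1 a2 r. vertex_family V a0 a1 a2 (c - b) r (0, 1) (bi, 0) (bj, 0) \<and> r \<le> \<delta> \<and>
    (\<forall>y s \<delta>'. (y, s) \<in> ball 0 r \<longrightarrow> s > 0 \<longrightarrow> 4 * s < \<delta>' \<longrightarrow> \<delta>' \<le> \<delta> \<longrightarrow>
      ((\<exists>p. degenerate_vertex {p \<in> ball 0 \<delta>'. h (p, y) = s\<^sup>2} p) \<longleftrightarrow>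
       (\<exists>t. V ((y, s), t) = 0 \<and> dird (0, 1) V ((y, s), t) = 0)))"
proof -
  obtain P \<epsilon> where P: "\<epsilon> > 0" "\<epsilon> \<le> \<delta> / 8" "smooth_on (ball 0 \<epsilon> \<times> UNIV) P"
    "\<And>x t q. x \<in> ball 0 \<epsilon> \<Longrightarrow> (1 / 4 < q \<and> q < 4 \<and> F (x, (cos t, sin t), q) = 1) \<longleftrightarrow> q = P (x, t)"
    "\<And>x t q. x \<in> ball 0 \<epsilon> \<Longrightarrow> 1 / 4 < q \<Longrightarrow> q < 4 \<Longrightarrow> dird (0, 0, 1) F (x, (cos t, sin t), q) > 0"
    by (rule ex_polar_radius) (rule that; assumption)
  interpret p: umbilic_polar A B C m a b c \<delta> bi bj P \<epsilon>
    by (unfold_locales) (use P in blast)+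
  obtain r where r: "r > 0" "r \<le> \<epsilon>" "\<forall>x\<in>ball 0 r. \<forall>t. p.den (x, t) > 0" using p.ex_den_pos by blast
  interpret v: umbilic_vertex A B C m a b c \<delta> bi bj P \<epsilon> r
    by (unfold_locales) (use r in blast)+
  obtain a0 a1 a2 where "vertex_family v.V a0 a1 a2 (c - b) r (0, 1) (bi, 0) (bj, 0)"
    using v.ex_vertex_family unfolding v.bs_def v.bl_def v.bm_def by blast
  moreover have "r \<le> \<delta>" using r P(2) \<delta> by linarith
  ultimately show ?thesis using v.degenerate_vertex_level_iff by blast
qed

section \<open>Straightening three sheets\<close>

text \<open>Each \<open>c\<^sub>k\<close> describes a sheet \<open>y = w + s c\<^sub>k (w, s)\<close>, where \<open>w\<close> runs through the orthogonal complement of \<open>bi\<close> and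
  \<open>bj\<close>. For fixed \<open>w\<close> these are three curves in a plane with different tangents at their common point.\<close>

locale three_sheets =
  fixes bi bj :: "'y::euclidean_space" and c1 c2 c3 :: "'y \<times> real \<Rightarrow> 'y" and \<rho> :: real
  assumes basis: "bi \<in> Basis" "bj \<in> Basis" "bi \<noteq> bj"
    and \<rho>: "\<rho> > 0"
    and smooth: "smooth_on (ball 0 \<rho>) c1" "smooth_on (ball 0 \<rho>) c2" "smooth_on (ball 0 \<rho>) c3"
    and plane: "\<And>x. c1 x = (c1 x \<bullet> bi) *\<^sub>R bi + (c1 x \<bullet> bj) *\<^sub>R bj"
      "\<And>x. c2 x = (c2 x \<bullet> bi) *\<^sub>R bi + (c2 x \<bullet> bj) *\<^sub>R bj"
      "\<And>x. c3 x = (c3 x \<bullet> bi) *\<^sub>R bi + (c3 x \<bullet> bj) *\<^sub>R bj"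
    and independent: "\<And>\<alpha> \<beta>. \<alpha> *\<^sub>R c1 0 + \<beta> *\<^sub>R c2 0 = 0 \<Longrightarrow> \<alpha> = 0 \<and> \<beta> = 0"
      "\<And>\<alpha>. c3 0 \<noteq> \<alpha> *\<^sub>R c1 0" "\<And>\<alpha>. c3 0 \<noteq> \<alpha> *\<^sub>R c2 0"
begin

definition \<nu> :: "'y \<Rightarrow> 'y" where
  "\<nu> y = y - (y \<bullet> bi) *\<^sub>R bi - (y \<bullet> bj) *\<^sub>R bj"

lemma inner_basis [simp]: "bi \<bullet> bi = 1" "bj \<bullet> bj = 1" "bi \<bullet> bj = 0" "bj \<bullet> bi = 0"
  using basis by (auto simp: inner_Basis)

lemma nu_inner [simp]: "\<nu> y \<bullet> bi = 0" "\<nu> y \<bullet> bj = 0"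
  unfolding \<nu>_def by (simp_all add: inner_diff_left)

lemma nu_add: "\<nu> (x + y) = \<nu> x + \<nu> y" and nu_scaleR: "\<nu> (r *\<^sub>R x) = r *\<^sub>R \<nu> x"
  and nu_basis [simp]: "\<nu> bi = 0" "\<nu> bj = 0" and nu_nu [simp]: "\<nu> (\<nu> x) = \<nu> x" and nu_0 [simp]: "\<nu> 0 = 0"
  unfolding \<nu>_def by (simp_all add: inner_add_left inner_diff_left algebra_simps)

lemma nu_decompose: "y = \<nu> y + (y \<bullet> bi) *\<^sub>R bi + (y \<bullet> bj) *\<^sub>R bj"
  unfolding \<nu>_def by simp

lemma nu_c [simp]: "\<nu> (c1 x) = 0" "\<nu> (c2 x) = 0" "\<nu> (c3 x) = 0"
  by (subst plane, simp add: nu_add nu_scaleR)+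

lemma bounded_linear_nu: "bounded_linear \<nu>"
proof -
  have "bounded_linear (\<lambda>y. y - (y \<bullet> bi) *\<^sub>R bi - (y \<bullet> bj) *\<^sub>R bj)" by (intro bounded_linear_intros)
  then show ?thesis unfolding \<nu>_def[abs_def] .
qed

lemma norm_nu: "norm (\<nu> y) \<le> norm y"
proof -
  have "y \<bullet> y = \<nu> y \<bullet> \<nu> y + (y \<bullet> bi)\<^sup>2 + (y \<bullet> bj)\<^sup>2"
    unfolding \<nu>_def by (simp add: inner_diff_left inner_diff_right power2_eq_square inner_commute algebra_simps)
  then have "\<nu> y \<bullet> \<nu> y \<le> y \<bullet> y" by simp
  then show ?thesis by (simp add: norm_le)
qed

definition sheet :: "('y \<times> real \<Rightarrow> 'y) \<Rightarrow> 'y \<times> real \<Rightarrow> 'y" where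
  "sheet c x = fst x + snd x *\<^sub>R c x"

text \<open>The coordinate axes of the plane go to the first two curves.\<close>

definition K :: "'y \<Rightarrow> 'y" where
  "K z = \<nu> z + (z \<bullet> bi) *\<^sub>R c1 (\<nu> z, z \<bullet> bi) + (z \<bullet> bj) *\<^sub>R c2 (\<nu> z, z \<bullet> bj)"

abbreviation \<gamma> :: "'y \<Rightarrow> 'y \<Rightarrow> 'y \<times> real" where "\<gamma> b z \<equiv> (\<nu> z, z \<bullet> b)"

lemma bounded_linear_gamma: "bounded_linear (\<gamma> b)"
  by (intro bounded_linear_Pair bounded_linear_nu bounded_linear_inner_left)

lemma open_gamma: "open U \<Longrightarrow> open {z. \<gamma> b z \<in> U}"
  using open_vimage[OF _ linear_continuous_on[OF bounded_linear_gamma], of U b] by (simp add: vimage_def)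

lemma smooth_gamma: "open U \<Longrightarrow> smooth_on U f \<Longrightarrow> S \<subseteq> {z. \<gamma> b z \<in> U} \<Longrightarrow> open S \<Longrightarrow> smooth_on S (\<lambda>z. f (\<gamma> b z))"
  by (rule smooth_on_compose[OF _ _ _ smooth_on_bounded_linear[OF bounded_linear_gamma]]) auto

lemma nu_K [simp]: "\<nu> (K z) = \<nu> z"
  unfolding K_def by (simp add: nu_add nu_scaleR)

lemma K_differentiable:
  fixes S defines "S \<equiv> {z. \<gamma> bi z \<in> ball 0 \<rho>} \<inter> {z. \<gamma> bj z \<in> ball 0 \<rho>}"
  shows "open S" "0 \<in> S" "smooth_on S K" "dird v K 0 = \<nu> v + (v \<bullet> bi) *\<^sub>R c1 0 + (v \<bullet> bj) *\<^sub>R c2 0"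
proof -
  show S: "open S" unfolding S_def by (intro open_Int open_gamma open_ball)
  show "0 \<in> S" using \<rho> by (simp add: S_def zero_prod_def[symmetric])
  have "smooth_on S (\<lambda>z. c1 (\<gamma> bi z))" "smooth_on S (\<lambda>z. c2 (\<gamma> bj z))"
    using smooth_gamma[OF open_ball smooth(1) _ S] smooth_gamma[OF open_ball smooth(2) _ S] by (auto simp: S_def)
  then show "smooth_on S K" unfolding K_def[abs_def]
    by (intro smooth_on_add[OF S] smooth_on_scaleR[OF S] smooth_on_inner[OF S] smooth_on_id smooth_on_const
        smooth_on_bounded_linear[OF bounded_linear_nu])
  have cont: "isCont (\<lambda>z. c (\<gamma> b z)) 0" if "smooth_on (ball 0 \<rho>) c" for c :: "'y \<times> real \<Rightarrow> 'y" and b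
  proof (rule smooth_on_isCont)
    show "smooth_on {z. \<gamma> b z \<in> ball 0 \<rho>} (\<lambda>z. c (\<gamma> b z))"
      by (rule smooth_gamma[OF open_ball that order_refl open_gamma[OF open_ball]])
    show "open {z. \<gamma> b z \<in> ball 0 \<rho>}" by (rule open_gamma[OF open_ball])
  qed (use \<rho> in \<open>simp add: zero_prod_def[symmetric]\<close>)
  have prod: "((\<lambda>z. (z \<bullet> b) *\<^sub>R c (\<gamma> b z)) has_derivative (\<lambda>h. (h \<bullet> b) *\<^sub>R c 0)) (at 0)"
    if "smooth_on (ball 0 \<rho>) c" for c :: "'y \<times> real \<Rightarrow> 'y" and b
    using has_derivative_scaleR_vanishing[OF has_derivative_inner_left[OF has_derivative_ident] _ cont[OF that, of b], of b]
    by (simp add: zero_prod_def)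
  show "dird v K 0 = \<nu> v + (v \<bullet> bi) *\<^sub>R c1 0 + (v \<bullet> bj) *\<^sub>R c2 0"
    unfolding K_def[abs_def]
    by (rule dirdI) (intro has_derivative_add bounded_linear_imp_has_derivative[OF bounded_linear_nu] prod smooth)
qed

lemma K_inverse:
  obtains N N' L where "0 \<in> N" "diffeo N N' K L"
proof -
  have "v = 0" if "dird v K 0 = 0" for v
  proof -
    have "\<nu> (dird v K 0) = \<nu> v" unfolding K_differentiable(4) by (simp add: nu_add nu_scaleR)
    then have n: "\<nu> v = 0" using that by simp
    with that K_differentiable(4) have "(v \<bullet> bi) *\<^sub>R c1 0 + (v \<bullet> bj) *\<^sub>R c2 0 = 0" by simp
    from independent(1)[OF this] n show ?thesis using nu_decompose[of v] by simp
  qed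
  from smooth_inverse_function[OF K_differentiable(1,3,2) this] show ?thesis using that by metis
qed

text \<open>Undoing \<open>K\<close> turns the first two sheets into coordinate planes and the third one into a graph over each of them.
  Its two coordinate functions of \<open>s\<close>, applied separately in the two coordinates, preserve the planes and carry the diagonal to
  the third sheet; the inverse of this change of coordinates straightens all three.\<close>

theorem ex_straightening:
  assumes "\<eta>0 > 0"
  obtains N N' \<Phi> \<Psi> \<eta> where "0 < \<eta>" "\<eta> \<le> \<eta>0" "diffeo N N' \<Phi> \<Psi>" "0 \<in> N" "N \<subseteq> ball 0 \<eta>" "\<Phi> 0 = 0"
    "\<And>y. y \<in> N \<Longrightarrow> (\<exists>s. \<bar>s\<bar> < \<eta> \<and> y \<in> {sheet c1 (\<nu> y, s), sheet c2 (\<nu> y, s), sheet c3 (\<nu> y, s)}) \<longleftrightarrow>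
      \<Phi> y \<bullet> bj = 0 \<or> \<Phi> y \<bullet> bi = 0 \<or> \<Phi> y \<bullet> bi = \<Phi> y \<bullet> bj"
proof -
  obtain N1 N1' L where K: "0 \<in> N1" "diffeo N1 N1' K L" by (rule K_inverse)
  note K = K(1) diffeoD[OF K(2)] K(2)
  have K_plane: "K w = w" if "w \<bullet> bi = 0" "w \<bullet> bj = 0" for w
    unfolding K_def using that nu_decompose[of w] by simp
  have nu_L: "\<nu> (L y) = \<nu> y" if "y \<in> N1'" for y
    using nu_K[of "L y"] K(9)[OF that] by simp
  have K0: "K 0 = 0" by (rule K_plane) simp_all
  have L0: "0 \<in> N1'" "L 0 = 0" using K(10)[OF K(1)] K(8)[OF K(1)] K0 by simp_all
  \<comment> \<open>the condition on the first component makes \<open>L\<close> the identity on the common part of the sheets\<close>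
  define W where "W = (ball 0 \<rho> \<inter> sheet c3 -` N1') \<inter> fst -` N1"
  have smooth_sheet: "smooth_on (ball 0 \<rho>) (sheet c3)"
    unfolding sheet_def[abs_def] by (intro smooth_intros smooth open_ball)
  have W: "open W" unfolding W_def
    by (intro open_Int continuous_open_preimage[OF smooth_on_continuous[OF smooth_sheet] open_ball K(3)]
        open_vimage_fst K(2))
  have W0: "0 \<in> W" unfolding W_def using \<rho> L0 K(1) by (simp add: sheet_def)
  define U where "U b x = L (sheet c3 x) \<bullet> b" for b x
  have smooth_U: "smooth_on W (U b)" for b
    unfolding U_def[abs_def]
    by (intro smooth_on_inner[OF W] smooth_on_const smooth_on_compose[OF K(5) W K(3)] smooth_on_subset[OF smooth_sheet])
      (auto simp: W_def)
  have U0: "U b (w, 0) = 0" if "b \<in> {bi, bj}" "w \<bullet> bi = 0" "w \<bullet> bj = 0" "(w, 0) \<in> W" for b w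
  proof -
    have "w \<in> N1" using that(4) by (simp add: W_def)
    from K(8)[OF this] K_plane[OF that(2,3)] have "L w = w" by simp
    then show ?thesis using that by (auto simp: U_def sheet_def)
  qed
  have L_sheet: "L (sheet c3 x) = fst x + U bi x *\<^sub>R bi + U bj x *\<^sub>R bj" if "x \<in> W" "\<nu> (fst x) = fst x" for x
  proof -
    have "\<nu> (L (sheet c3 x)) = fst x"
      using nu_L[of "sheet c3 x"] that by (simp add: W_def sheet_def nu_add nu_scaleR)
    then show ?thesis using nu_decompose[of "L (sheet c3 x)"] by (simp add: U_def)
  qed
  have dU: "dird (0, 1) (U b) 0 \<noteq> 0" if "b \<in> {bi, bj}" for b
  proof -
    let ?u = "dird (c3 0) L 0"
    have "((\<lambda>x. fst x + snd x *\<^sub>R c3 x) has_derivative (\<lambda>h. fst h + snd h *\<^sub>R c3 0)) (at 0)"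
      using has_derivative_scaleR_vanishing[OF has_derivative_snd[OF has_derivative_ident] _ smooth_on_isCont[OF smooth(3) open_ball]] \<rho>
      by (intro has_derivative_add has_derivative_fst has_derivative_ident) simp
    then have d: "dird (0, 1) (sheet c3) 0 = c3 0" unfolding sheet_def[abs_def] using dirdI by fastforce
    have s0: "sheet c3 0 = 0" by (simp add: sheet_def)
    have dS: "sheet c3 differentiable (at 0)" using smooth_on_differentiable[OF smooth_sheet] \<rho> by simp
    have dL: "L differentiable (at (sheet c3 0))" unfolding s0 by (rule smooth_on_differentiable[OF K(5) L0(1)])
    have "((\<lambda>x. L (sheet c3 x)) has_derivative (\<lambda>v. dird v (\<lambda>x. L (sheet c3 x)) 0)) (at 0)"
      using differentiable_chain_at[OF dS dL] by (intro dird_has_derivative) (simp add: o_def)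
    from dirdI[OF has_derivative_inner_left[OF this]] dird_compose[OF dS dL] d s0
    have U': "dird (0, 1) (U b) 0 = ?u \<bullet> b" unfolding U_def[abs_def] by simp
    have "dird ?u K 0 = c3 0"
      using diffeo_dird[OF diffeo_sym[OF K(12)] L0(1)] L0(2) by simp
    then have c3: "c3 0 = \<nu> ?u + (?u \<bullet> bi) *\<^sub>R c1 0 + (?u \<bullet> bj) *\<^sub>R c2 0" unfolding K_differentiable(4) by simp
    have "\<nu> ?u = 0" using arg_cong[OF c3, of \<nu>] by (simp add: nu_add nu_scaleR)
    then have "c3 0 = (?u \<bullet> bi) *\<^sub>R c1 0 + (?u \<bullet> bj) *\<^sub>R c2 0" using c3 by simp
    then show ?thesis unfolding U' using that independent(2,3) by auto
  qed
  \<comment> \<open>the coordinates \<open>U bi\<close> and \<open>U bj\<close> of the third sheet, used as changes of the two coordinates of the plane\<close>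
  define K2 where "K2 z = \<nu> z + U bi (\<gamma> bi z) *\<^sub>R bi + U bj (\<gamma> bj z) *\<^sub>R bj" for z
  define S where "S = {z. \<gamma> bi z \<in> W} \<inter> {z. \<gamma> bj z \<in> W}"
  have S: "open S" unfolding S_def by (intro open_Int open_gamma W)
  have S0: "0 \<in> S" unfolding S_def using W0 by (simp add: zero_prod_def)
  have sU: "smooth_on S (\<lambda>z. U b (\<gamma> b z))" if "b \<in> {bi, bj}" for b
    by (rule smooth_gamma[OF W smooth_U _ S]) (use that in \<open>auto simp: S_def\<close>)
  have smooth_K2: "smooth_on S K2" unfolding K2_def[abs_def]
    by (intro smooth_on_add[OF S] smooth_on_scaleR[OF S] sU smooth_on_const smooth_on_bounded_linear[OF bounded_linear_nu]) auto
  have K2_inj: "v = 0" if v: "dird v K2 0 = 0" for v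
  proof -
    have dU': "dird v (\<lambda>z. U b (\<gamma> b z)) 0 = dird (\<gamma> b v) (U b) 0" for b
    proof -
      have "(\<gamma> b has_derivative \<gamma> b) (at 0)" by (rule bounded_linear_imp_has_derivative[OF bounded_linear_gamma])
      moreover have "U b differentiable (at (\<gamma> b 0))"
        using smooth_on_differentiable[OF smooth_U W0] by (simp add: zero_prod_def)
      ultimately show ?thesis using dird_compose[of "\<gamma> b" 0 "U b" v] dirdI[of "\<gamma> b" "\<gamma> b" 0 v] differentiableI
        by (fastforce simp: zero_prod_def)
    qed
    have "(K2 has_derivative (\<lambda>v. \<nu> v + dird v (\<lambda>z. U bi (\<gamma> bi z)) 0 *\<^sub>R bi + dird v (\<lambda>z. U bj (\<gamma> bj z)) 0 *\<^sub>R bj)) (at 0)"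
      unfolding K2_def[abs_def]
      by (intro has_derivative_add has_derivative_scaleR_left bounded_linear_imp_has_derivative[OF bounded_linear_nu]
          smooth_on_has_derivative[OF sU S0]) auto
    from dirdI[OF this, of v] v dU' have e: "\<nu> v + dird (\<gamma> bi v) (U bi) 0 *\<^sub>R bi + dird (\<gamma> bj v) (U bj) 0 *\<^sub>R bj = 0" by simp
    have n: "\<nu> v = 0" using arg_cong[OF e, of \<nu>] by (simp add: nu_add nu_scaleR)
    have "dird (0, v \<bullet> b) (U b) 0 = 0" if "b \<in> {bi, bj}" for b
      using that arg_cong[OF e, of "\<lambda>x. x \<bullet> b"] n by (auto simp: inner_add_left)
    moreover have "dird (0, v \<bullet> b) (U b) 0 = (v \<bullet> b) * dird (0, 1) (U b) 0" for b
      using linear_scale[OF dird_linear[OF smooth_on_differentiable[OF smooth_U W0, of b]], of "v \<bullet> b" "(0, 1)"] by simp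
    ultimately have "v \<bullet> bi = 0" "v \<bullet> bj = 0" using dU by auto
    then show ?thesis using n nu_decompose[of v] by simp
  qed
  obtain N2 N2' L2 where N2: "0 \<in> N2" "N2 \<subseteq> S" "diffeo N2 N2' K2 L2"
    by (rule smooth_inverse_function[OF S smooth_K2 S0 K2_inj])
  note L2 = diffeoD[OF N2(3)]
  obtain r1 where r1: "r1 > 0" "ball 0 r1 \<subseteq> N1" using K(1,2) open_contains_ball by blast
  obtain r2 where r2: "r2 > 0" "ball 0 r2 \<subseteq> N2" using N2(1) L2(1) open_contains_ball by blast
  define \<eta> where "\<eta> = min \<eta>0 (min (r1 / 2) (r2 / 3))"
  have \<eta>: "\<eta> > 0" "\<eta> \<le> \<eta>0" "2 * \<eta> \<le> r1" "3 * \<eta> \<le> r2" unfolding \<eta>_def using assms r1 r2 by auto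
  define N0 where "N0 = N1' \<inter> L -` N2'"
  have D: "diffeo N0 (N2 \<inter> K2 -` N1) (\<lambda>y. L2 (L y)) (\<lambda>z. K (K2 z))"
    using diffeo_compose[OF diffeo_sym[OF diffeo_restrict[OF K(12) L2(2)]], of _ L2 K2]
      diffeo_restrict[OF diffeo_sym[OF N2(3)] K(2)] unfolding N0_def by (simp add: Int_commute)
  have N0: "open N0" by (rule diffeoD(1)[OF D])
  have cont: "continuous_on N0 L" "continuous_on N0 (\<lambda>y. L2 (L y))"
    using smooth_on_continuous[OF smooth_on_subset[OF K(5)]] smooth_on_continuous[OF diffeoD(3)[OF D]] by (auto simp: N0_def)
  define G where "G = ball 0 \<eta> \<inter> (N0 \<inter> L -` ball 0 \<eta>) \<inter> (N0 \<inter> (\<lambda>y. L2 (L y)) -` ball 0 \<eta>)"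
  have G: "open G" unfolding G_def
    by (intro open_Int open_ball continuous_open_preimage[OF cont(1) N0] continuous_open_preimage[OF cont(2) N0])
  have K20: "K2 0 = 0" unfolding K2_def using U0[of bi 0] U0[of bj 0] W0 by (simp add: zero_prod_def)
  have L20: "0 \<in> N2'" "L2 0 = 0" using L2(7,9)[OF N2(1)] K20 by simp_all
  have G0: "0 \<in> G" unfolding G_def N0_def using L0 L20 \<eta>(1) by simp
  have main: "(\<exists>s. \<bar>s\<bar> < \<eta> \<and> y = sheet c1 (\<nu> y, s)) \<longleftrightarrow> L2 (L y) \<bullet> bj = 0"
    "(\<exists>s. \<bar>s\<bar> < \<eta> \<and> y = sheet c2 (\<nu> y, s)) \<longleftrightarrow> L2 (L y) \<bullet> bi = 0"
    "(\<exists>s. \<bar>s\<bar> < \<eta> \<and> y = sheet c3 (\<nu> y, s)) \<longleftrightarrow> L2 (L y) \<bullet> bi = L2 (L y) \<bullet> bj"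
    if "y \<in> G" for y
  proof -
    define z where "z = L2 (L y)"
    have y: "y \<in> N1'" "L y \<in> N2'" "norm y < \<eta>" "norm (L y) < \<eta>" "norm z < \<eta>"
      using that by (auto simp: G_def N0_def z_def)
    have z: "z \<in> N2" "K2 z = L y" "K (L y) = y"
      unfolding z_def using y L2 K by blast+
    have "\<nu> (K2 z) = \<nu> z" unfolding K2_def by (simp add: nu_add nu_scaleR)
    then have nz: "\<nu> z = \<nu> y" using nu_L[OF y(1)] z(2) by simp
    have Ui: "L y \<bullet> bi = U bi (\<gamma> bi z)" and Uj: "L y \<bullet> bj = U bj (\<gamma> bj z)"
      unfolding z(2)[symmetric] K2_def by (simp_all add: inner_add_left)
    have K1: "K (\<nu> y + s *\<^sub>R bi) = sheet c1 (\<nu> y, s)" "K (\<nu> y + s *\<^sub>R bj) = sheet c2 (\<nu> y, s)" for s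
      unfolding K_def sheet_def by (simp_all add: nu_add nu_scaleR inner_add_left)
    have ny: "norm (\<nu> y) < \<eta>" using norm_nu[of y] y(3) by simp
    have in_N1: "\<nu> y + s *\<^sub>R b \<in> N1" if "\<bar>s\<bar> < \<eta>" "b \<in> Basis" for s b
      using r1(2) norm_triangle_ineq[of "\<nu> y" "s *\<^sub>R b"] that ny \<eta>(3) by (auto simp: subset_iff)
    have zb: "z - (z \<bullet> b) *\<^sub>R b \<in> N2" if "b \<in> Basis" for b
      using r2(2) norm_triangle_ineq4[of z "(z \<bullet> b) *\<^sub>R b"] Basis_le_norm[OF that, of z] that y(5) \<eta>(1,4)
      by (auto simp: subset_iff)
    have nzb: "\<nu> (z - (z \<bullet> b) *\<^sub>R b) = \<nu> z" if "b \<in> {bi, bj}" for b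
      using nu_add[of z "- ((z \<bullet> b) *\<^sub>R b)"] nu_scaleR[of "- (z \<bullet> b)" b] that by auto
    have W1: "(\<nu> z, 0) \<in> W"
      using zb[OF basis(1)] N2(2) nzb[of bi] unfolding S_def by (auto simp: inner_diff_left)
    note U0 = U0[OF _ nu_inner W1]
    show "(\<exists>s. \<bar>s\<bar> < \<eta> \<and> y = sheet c1 (\<nu> y, s)) \<longleftrightarrow> L2 (L y) \<bullet> bj = 0"
    proof
      assume "\<exists>s. \<bar>s\<bar> < \<eta> \<and> y = sheet c1 (\<nu> y, s)"
      then obtain s where s: "\<bar>s\<bar> < \<eta>" "y = sheet c1 (\<nu> y, s)" by blast
      have "L y = \<nu> y + s *\<^sub>R bi" using K(8)[OF in_N1[OF s(1) basis(1)]] unfolding K1 s(2)[symmetric] .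
      then have "U bj (\<gamma> bj z) = 0" unfolding Uj[symmetric] by (simp add: inner_add_left)
      then have "K2 (z - (z \<bullet> bj) *\<^sub>R bj) = K2 z"
        unfolding K2_def using nzb[of bj] U0[of bj] by (simp add: inner_diff_left)
      then have "z - (z \<bullet> bj) *\<^sub>R bj = z" using L2(7)[OF zb[OF basis(2)]] L2(7)[OF z(1)] by simp
      then show "L2 (L y) \<bullet> bj = 0" using basis nonzero_Basis unfolding z_def[symmetric] by auto
    next
      assume "L2 (L y) \<bullet> bj = 0"
      then have "U bj (\<gamma> bj z) = 0" using U0[of bj] by (simp add: z_def)
      then have "L y = \<nu> y + (L y \<bullet> bi) *\<^sub>R bi" unfolding Ui unfolding z(2)[symmetric] K2_def nz by simp
      then have "y = sheet c1 (\<nu> y, L y \<bullet> bi)" using z(3) K1 by metis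
      then show "\<exists>s. \<bar>s\<bar> < \<eta> \<and> y = sheet c1 (\<nu> y, s)"
        using Basis_le_norm[OF basis(1), of "L y"] y(4)
          by (intro exI[of _ "L y \<bullet> bi"] conjI) (linarith, assumption)
    qed
    show "(\<exists>s. \<bar>s\<bar> < \<eta> \<and> y = sheet c2 (\<nu> y, s)) \<longleftrightarrow> L2 (L y) \<bullet> bi = 0"
    proof
      assume "\<exists>s. \<bar>s\<bar> < \<eta> \<and> y = sheet c2 (\<nu> y, s)"
      then obtain s where s: "\<bar>s\<bar> < \<eta>" "y = sheet c2 (\<nu> y, s)" by blast
      have "L y = \<nu> y + s *\<^sub>R bj" using K(8)[OF in_N1[OF s(1) basis(2)]] unfolding K1 s(2)[symmetric] .
      then have "U bi (\<gamma> bi z) = 0" unfolding Ui[symmetric] by (simp add: inner_add_left)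
      then have "K2 (z - (z \<bullet> bi) *\<^sub>R bi) = K2 z"
        unfolding K2_def using nzb[of bi] U0[of bi] by (simp add: inner_diff_left)
      then have "z - (z \<bullet> bi) *\<^sub>R bi = z" using L2(7)[OF zb[OF basis(1)]] L2(7)[OF z(1)] by simp
      then show "L2 (L y) \<bullet> bi = 0" using basis nonzero_Basis unfolding z_def[symmetric] by auto
    next
      assume "L2 (L y) \<bullet> bi = 0"
      then have "U bi (\<gamma> bi z) = 0" using U0[of bi] by (simp add: z_def)
      then have "L y = \<nu> y + (L y \<bullet> bj) *\<^sub>R bj" unfolding Uj unfolding z(2)[symmetric] K2_def nz by simp
      then have "y = sheet c2 (\<nu> y, L y \<bullet> bj)" using z(3) K1 by metis
      then show "\<exists>s. \<bar>s\<bar> < \<eta> \<and> y = sheet c2 (\<nu> y, s)"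
        using Basis_le_norm[OF basis(2), of "L y"] y(4)
          by (intro exI[of _ "L y \<bullet> bj"] conjI) (linarith, assumption)
    qed
    show "(\<exists>s. \<bar>s\<bar> < \<eta> \<and> y = sheet c3 (\<nu> y, s)) \<longleftrightarrow> L2 (L y) \<bullet> bi = L2 (L y) \<bullet> bj"
    proof
      assume "\<exists>s. \<bar>s\<bar> < \<eta> \<and> y = sheet c3 (\<nu> y, s)"
      then obtain s where s: "\<bar>s\<bar> < \<eta>" "y = sheet c3 (\<nu> y, s)" by blast
      let ?z = "\<nu> y + s *\<^sub>R bi + s *\<^sub>R bj"
      have "norm ?z \<le> norm (\<nu> y) + norm (s *\<^sub>R bi) + norm (s *\<^sub>R bj)"
        by (intro norm_triangle_le add_right_mono norm_triangle_ineq)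
      then have z': "?z \<in> N2" using r2(2) ny s(1) \<eta>(4) basis by (auto simp: subset_iff)
      have g: "\<gamma> bi ?z = (\<nu> y, s)" "\<gamma> bj ?z = (\<nu> y, s)" by (simp_all add: nu_add nu_scaleR inner_add_left)
      have "(\<nu> y, s) \<in> W" using z' N2(2) g unfolding S_def by auto
      from L_sheet[OF this] s(2) have "L y = \<nu> y + U bi (\<nu> y, s) *\<^sub>R bi + U bj (\<nu> y, s) *\<^sub>R bj" by simp
      also have "\<dots> = K2 ?z" unfolding K2_def g by (simp add: nu_add nu_scaleR)
      finally have "?z = z" using L2(7)[OF z'] L2(7)[OF z(1)] z(2) by simp
      then have "z = ?z" by simp
      then show "L2 (L y) \<bullet> bi = L2 (L y) \<bullet> bj" unfolding z_def[symmetric] by (simp add: inner_add_left)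
    next
      assume "L2 (L y) \<bullet> bi = L2 (L y) \<bullet> bj"
      then have e: "z \<bullet> bj = z \<bullet> bi" by (simp add: z_def)
      have w: "(\<nu> y, z \<bullet> bi) \<in> W" using z(1) N2(2) nz unfolding S_def by auto
      have "L (sheet c3 (\<nu> y, z \<bullet> bi)) = K2 z" using L_sheet[OF w] unfolding K2_def nz e by simp
      then have "y = sheet c3 (\<nu> y, z \<bullet> bi)" using z(2,3) w K(9)[of "sheet c3 (\<nu> y, z \<bullet> bi)"] by (simp add: W_def)
      then show "\<exists>s. \<bar>s\<bar> < \<eta> \<and> y = sheet c3 (\<nu> y, s)"
        using Basis_le_norm[OF basis(1), of z] y(5)
          by (intro exI[of _ "z \<bullet> bi"] conjI) (linarith, assumption)
    qed
  qed
  show ?thesis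
  proof (rule that)
    show "0 < \<eta>" "\<eta> \<le> \<eta>0" by (rule \<eta>)+
    show "diffeo (N0 \<inter> G) ((N2 \<inter> K2 -` N1) \<inter> (\<lambda>z. K (K2 z)) -` G) (\<lambda>y. L2 (L y)) (\<lambda>z. K (K2 z))"
      by (rule diffeo_restrict[OF D G])
    show "0 \<in> N0 \<inter> G" using G0 unfolding G_def by simp
    show "N0 \<inter> G \<subseteq> ball 0 \<eta>" unfolding G_def by blast
    show "L2 (L 0) = 0" using L0 L20 by simp
    show "(\<exists>s. \<bar>s\<bar> < \<eta> \<and> y \<in> {sheet c1 (\<nu> y, s), sheet c2 (\<nu> y, s), sheet c3 (\<nu> y, s)}) \<longleftrightarrow>
      L2 (L y) \<bullet> bj = 0 \<or> L2 (L y) \<bullet> bi = 0 \<or> L2 (L y) \<bullet> bi = L2 (L y) \<bullet> bj" if "y \<in> N0 \<inter> G" for y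
      using main[of y] that by blast
  qed
qed

end

section \<open>From the deformation to an umbilic family\<close>

text \<open>Iterated directional derivatives are derivatives along a line, where the product rule applies to \<open>t\<^sup>2 \<psi>\<close>.\<close>

lemma line_quadratic:
  fixes F \<psi> :: "'a::real_normed_vector \<Rightarrow> real"
  assumes "\<delta> > 0" "smooth_on (ball 0 \<delta>) F" "smooth_on (ball 0 \<delta>) \<psi>"
    and F: "\<And>t. t *\<^sub>R v \<in> ball 0 \<delta> \<Longrightarrow> F (t *\<^sub>R v) = t\<^sup>2 * \<psi> (t *\<^sub>R v)"
  shows "dird v (dird v F) 0 = 2 * \<psi> 0" "dird v (dird v (dird v F)) 0 = 6 * dird v \<psi> 0"
proof -
  define I where "I = {t. t *\<^sub>R v \<in> ball 0 \<delta>}"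
  have I: "open I" unfolding I_def
    using open_vimage[OF open_ball, of "\<lambda>t. t *\<^sub>R v" 0 \<delta>] by (simp add: vimage_def continuous_intros)
  have line: "((\<lambda>t. f (t *\<^sub>R v)) has_real_derivative dird v f (t *\<^sub>R v)) (at t)" if "smooth_on (ball 0 \<delta>) f" "t \<in> I" for f t
    using line_has_derivative[of f 0 t v] smooth_on_differentiable[OF that(1), of "t *\<^sub>R v"] that(2) by (simp add: I_def)
  have step: "dird v f (t *\<^sub>R v) = g' t"
    if "smooth_on (ball 0 \<delta>) f" "t \<in> I" "\<And>t. t \<in> I \<Longrightarrow> f (t *\<^sub>R v) = g t" "(g has_real_derivative g' t) (at t)"
    for f t and g g' :: "real \<Rightarrow> real"
  proof -
    have "\<forall>\<^sub>F t in nhds t. g t = f (t *\<^sub>R v)"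
      using eventually_nhds_in_open[OF I that(2)] by eventually_elim (simp add: that(3))
    from DERIV_transfer[OF that(4) this] line[OF that(1,2)] show ?thesis by (rule DERIV_unique[rotated])
  qed
  note s = smooth_on_dird[of "ball 0 \<delta>" _ v]
  note F = assms(2) s[OF assms(2)] s[OF s[OF assms(2)]]
  note \<psi> = assms(3) s[OF assms(3)] s[OF s[OF assms(3)]]
  let ?\<psi>1 = "dird v \<psi>" and ?\<psi>2 = "dird v (dird v \<psi>)" and ?\<psi>3 = "dird v (dird v (dird v \<psi>))"
  have 1: "dird v F (t *\<^sub>R v) = 2 * t * \<psi> (t *\<^sub>R v) + t\<^sup>2 * ?\<psi>1 (t *\<^sub>R v)" if "t \<in> I" for t
    by (rule step[OF F(1) that, of "\<lambda>t. t\<^sup>2 * \<psi> (t *\<^sub>R v)"])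
      (use that assms(4) in \<open>auto simp: I_def intro!: derivative_eq_intros line[OF \<psi>(1)]\<close>)
  have 2: "dird v (dird v F) (t *\<^sub>R v) = 2 * \<psi> (t *\<^sub>R v) + 4 * t * ?\<psi>1 (t *\<^sub>R v) + t\<^sup>2 * ?\<psi>2 (t *\<^sub>R v)" if "t \<in> I" for t
    by (rule step[OF F(2) that 1])
      (use that in \<open>auto intro!: derivative_eq_intros line[OF \<psi>(1)] line[OF \<psi>(2)] simp: algebra_simps\<close>)
  have 3: "dird v (dird v (dird v F)) (t *\<^sub>R v) = 6 * ?\<psi>1 (t *\<^sub>R v) + 6 * t * ?\<psi>2 (t *\<^sub>R v) + t\<^sup>2 * ?\<psi>3 (t *\<^sub>R v)" if "t \<in> I" for t
    by (rule step[OF F(3) that 2])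
      (use that in \<open>auto intro!: derivative_eq_intros line[OF \<psi>(1)] line[OF \<psi>(2)] line[OF \<psi>(3)] simp: algebra_simps\<close>)
  have "0 \<in> I" using \<open>\<delta> > 0\<close> by (simp add: I_def)
  from 2[OF this] 3[OF this] show "dird v (dird v F) 0 = 2 * \<psi> 0" "dird v (dird v (dird v F)) 0 = 6 * dird v \<psi> 0" by simp_all
qed

lemma taylor_part_quadratic_form:
  fixes F p q s :: "real \<times> real \<Rightarrow> real"
  assumes "\<delta> > 0" "smooth_on (ball 0 \<delta>) F" and pqs: "smooth_on (ball 0 \<delta>) p" "smooth_on (ball 0 \<delta>) q" "smooth_on (ball 0 \<delta>) s"
    and F: "\<And>x y. (x, y) \<in> ball 0 \<delta> \<Longrightarrow> F (x, y) = p (x, y) * x\<^sup>2 + 2 * q (x, y) * x * y + s (x, y) * y\<^sup>2"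
  shows "taylor_part 2 F (v, w) = p 0 * v\<^sup>2 + 2 * q 0 * v * w + s 0 * w\<^sup>2"
    "taylor_part 3 F (v, w) = dird (v, w) p 0 * v\<^sup>2 + 2 * dird (v, w) q 0 * v * w + dird (v, w) s 0 * w\<^sup>2"
proof -
  let ?v = "(v, w)"
  define \<psi> where "\<psi> x = p x * v\<^sup>2 + q x * (2 * v * w) + s x * w\<^sup>2" for x
  have \<psi>: "smooth_on (ball 0 \<delta>) \<psi>"
    unfolding \<psi>_def[abs_def] by (intro smooth_intros pqs open_ball)
  have 0: "(0::real \<times> real) \<in> ball 0 \<delta>" using \<open>\<delta> > 0\<close> by simp
  have lq: "F (t *\<^sub>R ?v) = t\<^sup>2 * \<psi> (t *\<^sub>R ?v)" if "t *\<^sub>R ?v \<in> ball 0 \<delta>" for t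
    using F[of "t * v" "t * w"] that by (simp add: \<psi>_def power_mult_distrib algebra_simps power2_eq_square)
  have L: "dird ?v (dird ?v F) 0 = 2 * \<psi> 0" "dird ?v (dird ?v (dird ?v F)) 0 = 6 * dird ?v \<psi> 0"
    by (rule line_quadratic[OF assms(1,2) \<psi>], erule lq)+
  have "(\<psi> has_derivative (\<lambda>x. dird x p 0 * v\<^sup>2 + dird x q 0 * (2 * v * w) + dird x s 0 * w\<^sup>2)) (at 0)"
    unfolding \<psi>_def[abs_def]
    by (intro has_derivative_add has_derivative_mult_left smooth_on_has_derivative[OF pqs(1) 0]
        smooth_on_has_derivative[OF pqs(2) 0] smooth_on_has_derivative[OF pqs(3) 0])
  then have "dird ?v \<psi> 0 = dird ?v p 0 * v\<^sup>2 + dird ?v q 0 * (2 * v * w) + dird ?v s 0 * w\<^sup>2" by (rule dirdI)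
  then have d: "dird ?v \<psi> 0 = dird ?v p 0 * v\<^sup>2 + 2 * dird ?v q 0 * v * w + dird ?v s 0 * w\<^sup>2" by simp
  have \<psi>0: "\<psi> 0 = p 0 * v\<^sup>2 + 2 * q 0 * v * w + s 0 * w\<^sup>2" by (simp add: \<psi>_def)
  have E: "(\<lambda>g x. frechet_derivative g (at x) ?v) = dird ?v" by (simp add: dird_def fun_eq_iff)
  have iter: "(h ^^ 2) F = h (h F)" "(h ^^ 3) F = h (h (h F))" for h :: "(real \<times> real \<Rightarrow> real) \<Rightarrow> real \<times> real \<Rightarrow> real"
    by (simp_all add: numeral_2_eq_2 numeral_3_eq_3)
  show "taylor_part 2 F ?v = p 0 * v\<^sup>2 + 2 * q 0 * v * w + s 0 * w\<^sup>2"
    "taylor_part 3 F ?v = dird ?v p 0 * v\<^sup>2 + 2 * dird ?v q 0 * v * w + dird ?v s 0 * w\<^sup>2"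
    unfolding taylor_part_def E d[symmetric] \<psi>0[symmetric] iter L by (simp_all add: fact_numeral)
qed

text \<open>Hadamard's lemma applied to \<open>f\<close> and again to the coefficients, which vanish on the axis like the first
  derivatives of \<open>f\<close>.\<close>

lemma hadamard_quadratic:
  fixes f :: "(real \<times> real) \<times> 'c::euclidean_space \<Rightarrow> real"
  assumes f: "smooth_on (ball 0 \<delta> \<times> ball 0 \<delta>) f"
    and zero: "\<And>y. y \<in> ball 0 \<delta> \<Longrightarrow> f (0, y) = 0" "\<And>y v. y \<in> ball 0 \<delta> \<Longrightarrow> dird (v, 0) f (0, y) = 0"
  obtains A B C where "smooth_on (ball 0 \<delta> \<times> ball 0 \<delta>) A" "smooth_on (ball 0 \<delta> \<times> ball 0 \<delta>) B" "smooth_on (ball 0 \<delta> \<times> ball 0 \<delta>) C"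
    "\<And>x1 x2 y. (x1, x2) \<in> ball 0 \<delta> \<Longrightarrow> y \<in> ball 0 \<delta> \<Longrightarrow>
      f ((x1, x2), y) = A ((x1, x2), y) * x1\<^sup>2 + 2 * B ((x1, x2), y) * x1 * x2 + C ((x1, x2), y) * x2\<^sup>2"
proof -
  let ?S = "ball 0 \<delta> \<times> ball 0 \<delta> :: ((real \<times> real) \<times> 'c) set"
  let ?b1 = "((1, 0), 0) :: (real \<times> real) \<times> 'c" and ?b2 = "((0, 1), 0) :: (real \<times> real) \<times> 'c"
  define T where "T = {?b1, ?b2}"
  have b12: "?b1 \<in> T" "?b2 \<in> T" by (simp_all add: T_def)
  have S: "open ?S" by (intro open_Times open_ball)
  have T: "finite T" "T \<subseteq> Basis" by (auto simp: T_def Basis_prod_def)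
  have in1: "z \<bullet> ?b1 = fst (fst z)" and in2: "z \<bullet> ?b2 = snd (fst z)" for z by (simp_all add: inner_prod_def)
  have sm: "(\<Sum>b\<in>T. (z \<bullet> b) *\<^sub>R b) = (fst z, 0)" for z by (simp add: in1 in2 T_def)
  have star: "z - t *\<^sub>R (\<Sum>b\<in>T. (z \<bullet> b) *\<^sub>R b) \<in> ?S" if "z \<in> ?S" "0 \<le> t" "t \<le> 1" for z t
  proof -
    have "norm ((1 - t) *\<^sub>R fst z) \<le> norm (fst z)" using that by (simp add: mult_left_le_one_le)
    then have "norm ((1 - t) *\<^sub>R fst z) < \<delta>" using that(1) by (auto simp: mem_Times_iff)
    then show ?thesis unfolding sm using that(1) by (cases z) (auto simp: algebra_simps)
  qed
  have p0: "z = (0, snd z)" if "\<And>b. b \<in> T \<Longrightarrow> z \<bullet> b = 0" for z :: "(real \<times> real) \<times> 'c"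
    using that[OF b12(1)] that[OF b12(2)] unfolding in1 in2 by (simp add: prod_eq_iff)
  have zf: "f z = 0" if "z \<in> ?S" "\<And>b. b \<in> T \<Longrightarrow> z \<bullet> b = 0" for z
    using p0[OF that(2)] zero(1)[of "snd z"] that(1) by (metis mem_Times_iff)
  have "\<exists>F. (\<forall>b\<in>T. smooth_on ?S (F b)) \<and> (\<forall>z\<in>?S. f z = (\<Sum>b\<in>T. (z \<bullet> b) * F b z)) \<and>
      (\<forall>z\<in>?S. (\<forall>b\<in>T. z \<bullet> b = 0) \<longrightarrow> (\<forall>b\<in>T. F b z = dird b f z))" (is "\<exists>F. ?H F")
  proof (rule hadamard[OF S f T])
    show "z - t *\<^sub>R (\<Sum>b\<in>T. (z \<bullet> b) *\<^sub>R b) \<in> ?S" if "z \<in> ?S" "0 \<le> t" "t \<le> 1" for z t using that by (rule star)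
    show "f z = 0" if "z \<in> ?S" "\<And>b. b \<in> T \<Longrightarrow> z \<bullet> b = 0" for z using that by (rule zf)
    fix F assume "\<And>b. b \<in> T \<Longrightarrow> smooth_on ?S (F b)" "\<And>z. z \<in> ?S \<Longrightarrow> f z = (\<Sum>b\<in>T. (z \<bullet> b) * F b z)"
      "\<And>z b. z \<in> ?S \<Longrightarrow> b \<in> T \<Longrightarrow> (\<And>b. b \<in> T \<Longrightarrow> z \<bullet> b = 0) \<Longrightarrow> F b z = dird b f z"
    then show "\<exists>F. ?H F" by (intro exI[of _ F]) simp
  qed
  then obtain F where "?H F" ..
  then have F: "\<And>b. b \<in> T \<Longrightarrow> smooth_on ?S (F b)" "\<And>z. z \<in> ?S \<Longrightarrow> f z = (\<Sum>b\<in>T. (z \<bullet> b) * F b z)"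
    "\<And>z b. z \<in> ?S \<Longrightarrow> b \<in> T \<Longrightarrow> (\<forall>b\<in>T. z \<bullet> b = 0) \<Longrightarrow> F b z = dird b f z"
    by blast+
  have zF: "F b z = 0" if b: "b \<in> T" and "z \<in> ?S" "\<And>b. b \<in> T \<Longrightarrow> z \<bullet> b = 0" for b z
  proof -
    have "F b z = dird b f z" using F(3)[OF that(2,1)] that(3) by simp
    also have "\<dots> = 0"
    proof -
      have "b = (fst b, 0)" using b by (auto simp: T_def)
      moreover have "z = (0, snd z)" using that(3) by (rule p0)
      moreover have "snd z \<in> ball 0 \<delta>" using that(2) by (simp add: mem_Times_iff)
      ultimately show ?thesis using zero(2)[of "snd z" "fst b"] by metis
    qed
    finally show ?thesis .
  qed
  have "\<exists>G. (\<forall>b'\<in>T. smooth_on ?S (G b')) \<and> (\<forall>z\<in>?S. F b z = (\<Sum>b'\<in>T. (z \<bullet> b') * G b' z))" if b: "b \<in> T" for b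
  proof (rule hadamard[OF S F(1)[OF b] T])
    show "z - t *\<^sub>R (\<Sum>b\<in>T. (z \<bullet> b) *\<^sub>R b) \<in> ?S" if "z \<in> ?S" "0 \<le> t" "t \<le> 1" for z t using that by (rule star)
    show "F b z = 0" if "z \<in> ?S" "\<And>b. b \<in> T \<Longrightarrow> z \<bullet> b = 0" for z using b that by (rule zF)
    fix G assume "\<And>b. b \<in> T \<Longrightarrow> smooth_on ?S (G b)" "\<And>z. z \<in> ?S \<Longrightarrow> F b z = (\<Sum>b\<in>T. (z \<bullet> b) * G b z)"
    then show "\<exists>G. (\<forall>b'\<in>T. smooth_on ?S (G b')) \<and> (\<forall>z\<in>?S. F b z = (\<Sum>b'\<in>T. (z \<bullet> b') * G b' z))"
      by (intro exI[of _ G]) simp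
  qed
  then have "\<forall>b\<in>T. \<exists>G. (\<forall>b'\<in>T. smooth_on ?S (G b')) \<and> (\<forall>z\<in>?S. F b z = (\<Sum>b'\<in>T. (z \<bullet> b') * G b' z))" ..
  from bchoice[OF this] obtain G where
    "\<forall>b\<in>T. (\<forall>b'\<in>T. smooth_on ?S (G b b')) \<and> (\<forall>z\<in>?S. F b z = (\<Sum>b'\<in>T. (z \<bullet> b') * G b b' z))" ..
  then have G: "\<And>b b'. b \<in> T \<Longrightarrow> b' \<in> T \<Longrightarrow> smooth_on ?S (G b b')"
    "\<And>b z. b \<in> T \<Longrightarrow> z \<in> ?S \<Longrightarrow> F b z = (\<Sum>b'\<in>T. (z \<bullet> b') * G b b' z)" by blast+
  show ?thesis
  proof (rule that[of "G ?b1 ?b1" "\<lambda>z. (G ?b1 ?b2 z + G ?b2 ?b1 z) * (1 / 2)" "G ?b2 ?b2"])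
    show "smooth_on ?S (G ?b1 ?b1)" "smooth_on ?S (G ?b2 ?b2)" using G(1) b12 by blast+
    have "smooth_on ?S (G ?b1 ?b2)" "smooth_on ?S (G ?b2 ?b1)" using G(1) b12 by blast+
    then show "smooth_on ?S (\<lambda>z. (G ?b1 ?b2 z + G ?b2 ?b1 z) * (1 / 2))"
      by (intro smooth_on_mult[OF S] smooth_on_add[OF S] smooth_on_const)
    fix x1 x2 :: real and y :: 'c assume "(x1, x2) \<in> ball 0 \<delta>" "y \<in> ball (0::'c) \<delta>"
    then have z: "((x1, x2), y) \<in> ?S" by simp
    show "f ((x1, x2), y) = G ?b1 ?b1 ((x1, x2), y) * x1\<^sup>2
      + 2 * ((G ?b1 ?b2 ((x1, x2), y) + G ?b2 ?b1 ((x1, x2), y)) * (1 / 2)) * x1 * x2 + G ?b2 ?b2 ((x1, x2), y) * x2\<^sup>2"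
      using F(2)[OF z] G(2)[OF b12(1) z] G(2)[OF b12(2) z] by (simp add: T_def in1 in2 algebra_simps power2_eq_square)
  qed
qed

text \<open>If all minors vanished, a nonzero linear form would vanish on the range.\<close>

lemma independent_columns:
  fixes T :: "real ^ 'n::finite \<Rightarrow> real \<times> real"
  assumes "linear T" "dim (range T) = 2"
  obtains i j where "fst (T (axis i 1)) * snd (T (axis j 1)) \<noteq> fst (T (axis j 1)) * snd (T (axis i 1))"
proof (rule ccontr)
  assume *: "\<not> thesis"
  have minor: "fst (T (axis i 1)) * snd (T (axis j 1)) = fst (T (axis j 1)) * snd (T (axis i 1))" for i j
    using * that by blast
  have UNIV: "range T = UNIV"
  proof (rule subspace_dim_equal)
    show "subspace (range T)" using assms(1) by (simp add: linear_subspace_image)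
  qed (simp_all add: assms(2))
  have rep: "T v = (\<Sum>k\<in>UNIV. v $ k *\<^sub>R T (axis k 1))" for v
    using linear_sum[OF assms(1), of "\<lambda>k. v $ k *\<^sub>R axis k 1" UNIV] linear_scale[OF assms(1)]
    by (simp add: scalar_mult_eq_scaleR[symmetric] basis_expansion)
  have "\<exists>k. T (axis k 1) \<noteq> 0"
  proof (rule ccontr)
    assume "\<nexists>k. T (axis k 1) \<noteq> 0"
    then have "T v = 0" for v using rep[of v] by simp
    then have "range T = {0}" by auto
    then show False using assms(2) by simp
  qed
  then obtain k where k: "T (axis k 1) \<noteq> 0" by blast
  let ?p = "fst (T (axis k 1))" and ?q = "snd (T (axis k 1))"
  have "?p * snd (T v) = fst (T v) * ?q" for v
    unfolding rep[of v] using minor[of k]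
    by (simp add: fst_sum snd_sum sum_distrib_left sum_distrib_right mult.assoc) (intro sum.cong refl, simp add: algebra_simps)
  moreover obtain v where "T v = (- ?q, ?p)" using UNIV by (metis rangeE UNIV_I)
  ultimately have "?p * ?p = - ?q * ?q" by (metis fst_conv snd_conv)
  then have "?p * ?p + ?q * ?q = 0" by simp
  then have "?p = 0 \<and> ?q = 0" by (simp add: sum_squares_eq_zero_iff)
  then show False using k by (simp add: prod_eq_iff)
qed

lemma ball_times_ball_subset:
  assumes "open S" "(0, 0) \<in> S"
  obtains \<delta> where "\<delta> > 0" "ball 0 \<delta> \<times> ball 0 \<delta> \<subseteq> S"
proof -
  obtain P Q where PQ: "open P" "open Q" "(0, 0) \<in> P \<times> Q" "P \<times> Q \<subseteq> S" using open_prod_elim[OF assms] by metis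
  obtain d1 d2 where d: "d1 > 0" "ball 0 d1 \<subseteq> P" "d2 > 0" "ball 0 d2 \<subseteq> Q"
    using PQ open_contains_ball by (metis mem_Sigma_iff)
  show thesis by (rule that[of "min d1 d2"]) (use d PQ(4) in \<open>auto simp: subset_iff\<close>)
qed

lemma smooth_slice:
  fixes f :: "'a::euclidean_space \<times> 'b::euclidean_space \<Rightarrow> 'c::real_normed_vector"
  assumes "smooth_on (S \<times> T) f" "open S" "open T"
  shows "y \<in> T \<Longrightarrow> smooth_on S (\<lambda>x. f (x, y))" "x \<in> S \<Longrightarrow> smooth_on T (\<lambda>y. f (x, y))"
proof -
  have ST: "open (S \<times> T)" by (intro open_Times assms)
  show "smooth_on S (\<lambda>x. f (x, y))" if "y \<in> T"
    by (rule smooth_on_compose[OF assms(1,2) ST smooth_on_Pair[OF assms(2) smooth_on_id smooth_on_const]]) (use that in simp)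
  show "smooth_on T (\<lambda>y. f (x, y))" if "x \<in> S"
    by (rule smooth_on_compose[OF assms(1,3) ST smooth_on_Pair[OF assms(3) smooth_on_const smooth_on_id]]) (use that in simp)
qed

lemma dird_slice:
  fixes f :: "'a::real_normed_vector \<times> 'b::real_normed_vector \<Rightarrow> 'c::real_normed_vector"
  assumes "f differentiable (at (x, y))"
  shows "dird v (\<lambda>x. f (x, y)) x = dird (v, 0) f (x, y)"
proof -
  have d: "((\<lambda>x. (x, y)) has_derivative (\<lambda>v. (v, 0))) (at x)" by (auto intro!: derivative_eq_intros)
  then have "(\<lambda>x. (x, y)) differentiable (at x)" by (rule differentiableI)
  from dird_compose[OF this assms] show ?thesis by (simp add: dirdI[OF d])
qed

lemma dird_cmult:
  fixes g :: "'a::real_normed_vector \<Rightarrow> real"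
  shows "g differentiable (at x) \<Longrightarrow> dird v (\<lambda>x. k * g x) x = k * dird v g x"
proof -
  assume "g differentiable (at x)"
  from dird_has_derivative[OF this] have "((\<lambda>x. k * g x) has_derivative (\<lambda>v. k * dird v g x)) (at x)"
    by (rule has_derivative_mult_right)
  then show ?thesis by (rule dirdI)
qed

text \<open>The new parameters are the old ones with the coordinates of index \<open>i\<close> and \<open>j\<close> replaced by \<open>\<lambda>\<close> and \<open>\<mu>\<close>, where \<open>i\<close> and
  \<open>j\<close> select an invertible minor of the derivative; \<open>\<Xi>\<close> is the inverse change.\<close>

theorem ex_umbilic_family:
  fixes f0 :: "real \<times> real \<Rightarrow> real"
    and R :: "(real \<times> real) \<times> (real ^ 'n::finite) \<Rightarrow> real"
  assumes "surface_germ f0" "generic_umbilic f0"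
    and cubic: "\<forall>x y. taylor_part 3 f0 (x, y) = a * x^3 + b * x^2 * y + a * x * y^2 + c * y^3"
    and "deformation_term R" and rank: "deformation_rank (deformed f0 R) = 2"
  obtains i j A B C m \<delta> N N' \<Theta> \<Xi> where "i \<noteq> j"
    "umbilic_family A B C m a b c \<delta> (axis i 1 :: real ^ 'n) (axis j 1)"
    "diffeo N N' \<Theta> \<Xi>" "0 \<in> N" "\<Theta> 0 = 0" "ball 0 \<delta> \<subseteq> N'"
    "\<And>p y. p \<in> ball 0 \<delta> \<Longrightarrow> y \<in> ball 0 \<delta> \<Longrightarrow> deformed f0 R (p, \<Xi> y) = m * umbilic_family.h A B C (p, y)"
proof -
  let ?f = "deformed f0 R"
  obtain U where U: "open U" "0 \<in> U" "smooth_on U f0" and f0: "f0 0 = 0" "\<And>v. taylor_part 1 f0 v = 0"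
    using assms(1) unfolding surface_germ_def by blast
  obtain W where W: "open W" "(0, 0) \<in> W" "smooth_on W R" "\<And>p. (p, 0) \<in> W \<Longrightarrow> R (p, 0) = 0"
    "\<And>\<tau>. (0, \<tau>) \<in> W \<Longrightarrow> R (0, \<tau>) = 0" "\<And>\<tau> v. (0, \<tau>) \<in> W \<Longrightarrow> taylor_part 1 (\<lambda>p. R (p, \<tau>)) v = 0"
    using assms(4) unfolding deformation_term_def by blast
  obtain m where m: "m \<noteq> 0" "\<And>x y. taylor_part 2 f0 (x, y) = m * (x^2 + y^2)"
    and gen: "\<not> quadratic_divides_cubic (taylor_part 2 f0) (taylor_part 3 f0)"
    using assms(2) unfolding generic_umbilic_def by blast
  have bc: "b \<noteq> c" using normalized_umbilic_generic_iff[OF m, of "taylor_part 3 f0" a b c] cubic gen by simp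
  have "open (W \<inter> fst -` U)" "(0, 0) \<in> W \<inter> fst -` U" using W(1,2) U(1,2) by (auto intro: open_vimage_fst)
  then obtain \<delta>1 where \<delta>1: "\<delta>1 > 0" "ball 0 \<delta>1 \<times> ball 0 \<delta>1 \<subseteq> W \<inter> fst -` U" by (rule ball_times_ball_subset)
  let ?S = "ball 0 \<delta>1 \<times> ball 0 \<delta>1 :: ((real \<times> real) \<times> (real ^ 'n)) set"
  have S: "open ?S" by (intro open_Times open_ball)
  have b0: "(0::real \<times> real) \<in> ball 0 \<delta>1" and b0': "(0::real ^ 'n) \<in> ball 0 \<delta>1" using \<delta>1(1) by simp_all
  have f_eq: "?f = (\<lambda>z. f0 (fst z) + R z)" unfolding deformed_def by (auto simp: fun_eq_iff)
  have ball_U: "p \<in> U" if "p \<in> ball 0 \<delta>1" for p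
    using subsetD[OF \<delta>1(2), of "(p, 0)"] that b0' by simp
  have ball_W: "(p, \<tau>) \<in> W" if "p \<in> ball 0 \<delta>1" "\<tau> \<in> ball 0 \<delta>1" for p \<tau>
    using subsetD[OF \<delta>1(2), of "(p, \<tau>)"] that by simp
  have SW: "?S \<subseteq> W" using \<delta>1(2) by simp
  have smooth_R: "smooth_on ?S R" by (rule smooth_on_subset[OF W(3) SW])
  have smooth_f: "smooth_on ?S ?f"
    unfolding f_eq
  proof (rule smooth_on_add[OF S])
    show "smooth_on ?S (\<lambda>z. f0 (fst z))"
      by (rule smooth_on_compose[OF U(3) S U(1) smooth_on_fst[OF S smooth_on_id]]) (simp add: mem_Times_iff ball_U del: mem_ball)
    show "smooth_on ?S R" by (rule smooth_R)
  qed
  have taylor1: "taylor_part 1 g v = dird v g 0" for g :: "real \<times> real \<Rightarrow> real" and v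
    by (simp add: taylor_part_def dird_def)
  have f_0: "?f (0, \<tau>) = 0" if "\<tau> \<in> ball 0 \<delta>1" for \<tau>
    unfolding f_eq using f0(1) W(5) ball_W[OF b0 that] by simp
  have df_0: "dird (v, 0) ?f (0, \<tau>) = 0" if \<tau>: "\<tau> \<in> ball 0 \<delta>1" for \<tau> v
  proof -
    have "?f differentiable (at (0, \<tau>))" by (rule smooth_on_differentiable[OF smooth_f]) (use \<tau> b0 in auto)
    from dird_slice[OF this] have "dird (v, 0) ?f (0, \<tau>) = dird v (\<lambda>p. f0 p + R (p, \<tau>)) 0" unfolding f_eq by simp
    also have "\<dots> = dird v f0 0 + dird v (\<lambda>p. R (p, \<tau>)) 0"
    proof -
      have d0: "f0 differentiable (at 0)" by (rule smooth_on_differentiable[OF U(3,2)])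
      from smooth_on_differentiable[OF smooth_slice(1)[OF smooth_R open_ball open_ball \<tau>] b0]
      have "(\<lambda>p. R (p, \<tau>)) differentiable (at 0)" .
      from dirdI[OF has_derivative_add[OF dird_has_derivative[OF d0] dird_has_derivative[OF this]]] show ?thesis .
    qed
    also have "\<dots> = 0" using f0(2) W(6)[OF ball_W[OF b0 \<tau>]] unfolding taylor1 by simp
    finally show ?thesis .
  qed
  obtain A B C where smooth_ABC: "smooth_on ?S A" "smooth_on ?S B" "smooth_on ?S C"
    and f: "\<And>x1 x2 y. (x1, x2) \<in> ball 0 \<delta>1 \<Longrightarrow> y \<in> ball 0 \<delta>1 \<Longrightarrow>
      ?f ((x1, x2), y) = A ((x1, x2), y) * x1\<^sup>2 + 2 * B ((x1, x2), y) * x1 * x2 + C ((x1, x2), y) * x2\<^sup>2"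
  proof (rule hadamard_quadratic[OF smooth_f])
    show "?f (0, y) = 0" if "y \<in> ball 0 \<delta>1" for y using that by (rule f_0)
    show "dird (v, 0) ?f (0, y) = 0" if "y \<in> ball 0 \<delta>1" for y v using that by (rule df_0)
  qed (rule that; assumption)
  note slice1 = smooth_slice(1)[OF _ open_ball open_ball]
  define lam where "lam \<tau> = (A (0, \<tau>) - C (0, \<tau>)) * (1 / 2)" for \<tau>
  define mu where "mu \<tau> = B (0, \<tau>)" for \<tau>
  have T: "T_projection ?f \<tau> = (lam \<tau>, mu \<tau>)" if \<tau>: "\<tau> \<in> ball 0 \<delta>1" for \<tau>
  proof -
    have "taylor_part 2 (\<lambda>p. ?f (p, \<tau>)) (v, w) = A (0, \<tau>) * v\<^sup>2 + 2 * B (0, \<tau>) * v * w + C (0, \<tau>) * w\<^sup>2" for v w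
      by (rule taylor_part_quadratic_form(1)[OF \<delta>1(1) slice1[OF smooth_f \<tau>] slice1[OF smooth_ABC(1) \<tau>]
            slice1[OF smooth_ABC(2) \<tau>] slice1[OF smooth_ABC(3) \<tau>]]) (rule f[OF _ \<tau>])
    then show ?thesis unfolding T_projection_def T_coords_def lam_def mu_def by simp
  qed
  have f0_form: "f0 (x, y) = A ((x, y), 0) * x\<^sup>2 + 2 * B ((x, y), 0) * x * y + C ((x, y), 0) * y\<^sup>2"
    if p: "(x, y) \<in> ball 0 \<delta>1" for x y
    using f[OF p b0'] W(4)[OF ball_W[OF p b0']] unfolding f_eq by simp
  have smooth_f0: "smooth_on (ball 0 \<delta>1) f0" by (rule smooth_on_subset[OF U(3)]) (use ball_U in blast)
  note taylor = taylor_part_quadratic_form[OF \<delta>1(1) smooth_f0 slice1[OF smooth_ABC(1) b0'] slice1[OF smooth_ABC(2) b0']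
    slice1[OF smooth_ABC(3) b0'] f0_form]
  have A0: "A (0, 0) = m" "C (0, 0) = m" "B (0, 0) = 0"
    using taylor(1)[of 1 0] taylor(1)[of 0 1] taylor(1)[of 1 1] unfolding m(2) by simp_all
  have smooth_T: "smooth_on (ball 0 \<delta>1) lam" "smooth_on (ball 0 \<delta>1) mu"
    unfolding lam_def[abs_def] mu_def[abs_def]
    by (intro smooth_on_mult smooth_on_diff smooth_on_const open_ball smooth_slice(2)[OF _ open_ball open_ball b0] smooth_ABC)+
  have T0: "lam 0 = 0" "mu 0 = 0" unfolding lam_def mu_def A0 by simp_all
  let ?T = "\<lambda>v. (dird v lam 0, dird v mu 0)"
  have dT: "((\<lambda>\<tau>. (lam \<tau>, mu \<tau>)) has_derivative ?T) (at 0)"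
    by (intro has_derivative_Pair smooth_on_has_derivative[OF smooth_T(1) b0'] smooth_on_has_derivative[OF smooth_T(2) b0'])
  have lin: "linear ?T" using dT by (rule has_derivative_linear)
  have "frechet_derivative (T_projection ?f) (at 0) v = ?T v" for v
  proof -
    have "dird v (T_projection ?f) 0 = dird v (\<lambda>\<tau>. (lam \<tau>, mu \<tau>)) 0"
      by (rule dird_cong[OF open_ball b0']) (rule T)
    also have "\<dots> = ?T v" using dT by (rule dirdI)
    finally show ?thesis unfolding dird_def .
  qed
  then have "dim (range ?T) = 2" using rank unfolding deformation_rank_def by simp
  from independent_columns[OF lin this] obtain i j where
    ij: "dird (axis i 1) lam 0 * dird (axis j 1) mu 0 \<noteq> dird (axis j 1) lam 0 * dird (axis i 1) mu 0" by auto
  then have "i \<noteq> j" by auto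
  let ?bi = "axis i 1 :: real ^ 'n" and ?bj = "axis j 1 :: real ^ 'n"
  have basis: "?bi \<in> Basis" "?bj \<in> Basis" "?bi \<noteq> ?bj"
    using \<open>i \<noteq> j\<close> by (auto simp: axis_eq_axis Basis_vec_def)
  have inner: "?bi \<bullet> ?bi = 1" "?bj \<bullet> ?bj = 1" "?bi \<bullet> ?bj = 0" "?bj \<bullet> ?bi = 0"
    using basis by (auto simp: inner_Basis)
  define \<Theta> where "\<Theta> \<tau> = \<tau> + (lam \<tau> - \<tau> \<bullet> ?bi) *\<^sub>R ?bi + (mu \<tau> - \<tau> \<bullet> ?bj) *\<^sub>R ?bj" for \<tau>
  have \<Theta>_inner: "\<Theta> \<tau> \<bullet> ?bi = lam \<tau>" "\<Theta> \<tau> \<bullet> ?bj = mu \<tau>" for \<tau>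
    unfolding \<Theta>_def by (simp_all add: inner_add_left inner)
  have \<Theta>0: "\<Theta> 0 = 0" unfolding \<Theta>_def by (simp add: T0)
  have smooth_\<Theta>: "smooth_on (ball 0 \<delta>1) \<Theta>"
    unfolding \<Theta>_def[abs_def] by (intro smooth_intros smooth_T open_ball)
  have inj: "v = 0" if v: "dird v \<Theta> 0 = 0" for v
  proof -
    have "(\<Theta> has_derivative (\<lambda>v. v + (dird v lam 0 - v \<bullet> ?bi) *\<^sub>R ?bi + (dird v mu 0 - v \<bullet> ?bj) *\<^sub>R ?bj)) (at 0)"
      unfolding \<Theta>_def[abs_def]
      by (intro has_derivative_add has_derivative_ident has_derivative_scaleR_left has_derivative_diff has_derivative_inner_left
          smooth_on_has_derivative[OF smooth_T(1) b0'] smooth_on_has_derivative[OF smooth_T(2) b0'])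
    from dirdI[OF this, where v = v] v have e: "v + (dird v lam 0 - v \<bullet> ?bi) *\<^sub>R ?bi + (dird v mu 0 - v \<bullet> ?bj) *\<^sub>R ?bj = 0" by simp
    from arg_cong[OF e, of "\<lambda>x. x \<bullet> ?bi"] arg_cong[OF e, of "\<lambda>x. x \<bullet> ?bj"]
    have d: "dird v lam 0 = 0" "dird v mu 0 = 0" by (simp_all add: inner_add_left inner_diff_left inner)
    then have v': "v = (v \<bullet> ?bi) *\<^sub>R ?bi + (v \<bullet> ?bj) *\<^sub>R ?bj" using e by (simp add: algebra_simps)
    have "?T v = ?T ((v \<bullet> ?bi) *\<^sub>R ?bi + (v \<bullet> ?bj) *\<^sub>R ?bj)" by (rule arg_cong[OF v'])
    also have "\<dots> = (v \<bullet> ?bi) *\<^sub>R ?T ?bi + (v \<bullet> ?bj) *\<^sub>R ?T ?bj"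
      using linear_add[OF lin, of "(v \<bullet> ?bi) *\<^sub>R ?bi" "(v \<bullet> ?bj) *\<^sub>R ?bj"]
        linear_scale[OF lin, of "v \<bullet> ?bi" ?bi] linear_scale[OF lin, of "v \<bullet> ?bj" ?bj] by simp
    finally have e1: "(v \<bullet> ?bi) * dird ?bi lam 0 + (v \<bullet> ?bj) * dird ?bj lam 0 = 0"
      and e2: "(v \<bullet> ?bi) * dird ?bi mu 0 + (v \<bullet> ?bj) * dird ?bj mu 0 = 0" using d by simp_all
    have "(v \<bullet> ?bi) * (dird ?bi lam 0 * dird ?bj mu 0 - dird ?bj lam 0 * dird ?bi mu 0) = 0"
      "(v \<bullet> ?bj) * (dird ?bi lam 0 * dird ?bj mu 0 - dird ?bj lam 0 * dird ?bi mu 0) = 0"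
      using e1 e2 by algebra+
    then have "v \<bullet> ?bi = 0" "v \<bullet> ?bj = 0" using ij by auto
    then show ?thesis using v' by simp
  qed
  obtain N N' \<Xi> where N: "0 \<in> N" "N \<subseteq> ball 0 \<delta>1" "diffeo N N' \<Theta> \<Xi>"
    by (rule smooth_inverse_function[OF open_ball smooth_\<Theta> b0' inj])
  note ND = diffeoD[OF N(3)]
  have N'0: "0 \<in> N'" "\<Xi> 0 = 0" using ND(9)[OF N(1)] ND(7)[OF N(1)] \<Theta>0 by simp_all
  let ?S' = "ball 0 \<delta>1 \<times> N' :: ((real \<times> real) \<times> (real ^ 'n)) set"
  have S': "open ?S'" by (intro open_Times open_ball ND(2))
  define pull where "pull g z = inverse m * g (fst z, \<Xi> (snd z))"
    for g :: "(real \<times> real) \<times> (real ^ 'n) \<Rightarrow> real" and z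
  have smooth_pull: "smooth_on ?S' (pull g)" if "smooth_on ?S g" for g
    unfolding pull_def[abs_def]
  proof (rule smooth_on_mult[OF S' smooth_on_const], rule smooth_on_compose[OF that S' S])
    have "smooth_on ?S' (\<lambda>z. \<Xi> (snd z))"
      by (rule smooth_on_compose[OF ND(4) S' ND(2) smooth_on_snd[OF S' smooth_on_id]]) (simp add: mem_Times_iff)
    then show "smooth_on ?S' (\<lambda>z. (fst z, \<Xi> (snd z)))" by (intro smooth_on_Pair smooth_on_fst smooth_on_id S')
    show "(fst z, \<Xi> (snd z)) \<in> ?S" if "z \<in> ?S'" for z
      using that ND(10)[of "snd z"] N(2) by (auto simp: mem_Times_iff)
  qed
  have pull_0: "pull g (0, 0) = inverse m * g (0, 0)" for g unfolding pull_def by (simp add: N'0)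
  have dird_pull: "dird (v, 0) (pull g) (0, 0) = inverse m * dird v (\<lambda>p. g (p, 0)) 0" if g: "smooth_on ?S g" for g v
  proof -
    have "pull g differentiable (at (0, 0))" by (rule smooth_on_differentiable[OF smooth_pull[OF g]]) (use b0 N'0 in simp)
    from dird_slice[OF this, of v] have "dird (v, 0) (pull g) (0, 0) = dird v (\<lambda>p. inverse m * g (p, 0)) 0"
      unfolding pull_def by (simp add: N'0)
    then show ?thesis using dird_cmult[OF smooth_on_differentiable[OF slice1[OF g b0'] b0], of v "inverse m"] by simp
  qed
  have small: "\<forall>\<^sub>F z in nhds (0, 0). \<bar>pull g z - pull g (0, 0)\<bar> < k" if "smooth_on ?S g" "k > 0" for g k
  proof -
    have "isCont (pull g) (0, 0)" by (rule smooth_on_isCont[OF smooth_pull[OF that(1)] S']) (use b0 N'0 in simp)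
    then have "(pull g \<longlongrightarrow> pull g (0, 0)) (nhds (0, 0))" unfolding isCont_def by (rule tendsto_at_iff_tendsto_nhds[THEN iffD1])
    from tendstoD[OF this that(2)] show ?thesis by (simp add: dist_real_def)
  qed
  have "\<forall>\<^sub>F z in nhds (0, 0). z \<in> ?S'" by (rule eventually_nhds_in_open[OF S']) (use b0 N'0 in simp)
  with small[OF smooth_ABC(1), of "1 / 4"] small[OF smooth_ABC(2), of "1 / 8"] small[OF smooth_ABC(3), of "1 / 4"]
  have "\<forall>\<^sub>F z in nhds (0, 0). z \<in> ?S' \<and> \<bar>pull A z - 1\<bar> < 1 / 4 \<and> \<bar>pull B z\<bar> < 1 / 8 \<and> \<bar>pull C z - 1\<bar> < 1 / 4"
    by (auto simp: pull_0 A0 m(1) eventually_conj_iff)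
  then obtain G where G: "open G" "(0, 0) \<in> G"
    "\<And>z. z \<in> G \<Longrightarrow> z \<in> ?S' \<and> \<bar>pull A z - 1\<bar> < 1 / 4 \<and> \<bar>pull B z\<bar> < 1 / 8 \<and> \<bar>pull C z - 1\<bar> < 1 / 4"
    unfolding eventually_nhds by metis
  obtain \<delta> where \<delta>: "\<delta> > 0" "ball 0 \<delta> \<times> ball 0 \<delta> \<subseteq> G" by (rule ball_times_ball_subset[OF G(1,2)])
  have inO: "(p, y) \<in> ?S'" "\<bar>pull A (p, y) - 1\<bar> < 1 / 4" "\<bar>pull B (p, y)\<bar> < 1 / 8" "\<bar>pull C (p, y) - 1\<bar> < 1 / 4"
    if "p \<in> ball 0 \<delta>" "y \<in> ball 0 \<delta>" for p y
    using G(3)[OF subsetD[OF \<delta>(2)], of "(p, y)"] that by simp_all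
  have y_N': "y \<in> N'" if "y \<in> ball 0 \<delta>" for y using inO(1)[of 0 y] that \<delta>(1) by simp
  have \<delta>S': "ball 0 \<delta> \<times> ball 0 \<delta> \<subseteq> ?S'" using inO(1) by (intro subsetI) (metis mem_Sigma_iff prod.collapse)
  have \<Xi>_inner: "lam (\<Xi> y) = y \<bullet> ?bi" "mu (\<Xi> y) = y \<bullet> ?bj" if "y \<in> N'" for y
    using \<Theta>_inner[of "\<Xi> y"] ND(8)[OF that] by simp_all
  have umb: "umbilic_family (pull A) (pull B) (pull C) m a b c \<delta> ?bi ?bj"
  proof
    show "\<delta> > 0" "m \<noteq> 0" "b \<noteq> c" by (rule \<delta> m bc)+
    show "smooth_on (ball 0 \<delta> \<times> ball 0 \<delta>) (pull A)" "smooth_on (ball 0 \<delta> \<times> ball 0 \<delta>) (pull B)"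
      "smooth_on (ball 0 \<delta> \<times> ball 0 \<delta>) (pull C)"
      using smooth_on_subset[OF smooth_pull \<delta>S'] smooth_ABC by blast+
    show "?bi \<in> Basis" "?bj \<in> Basis" "?bi \<noteq> ?bj" by (rule basis)+
    show "\<bar>pull A (p, y) - 1\<bar> < 1 / 4 \<and> \<bar>pull B (p, y)\<bar> < 1 / 8 \<and> \<bar>pull C (p, y) - 1\<bar> < 1 / 4"
      if "p \<in> ball 0 \<delta>" "y \<in> ball 0 \<delta>" for p y using inO[OF that] by blast
    show "pull A (0, y) - pull C (0, y) = 2 * (y \<bullet> ?bi) / m" if "y \<in> ball 0 \<delta>" for y
      unfolding \<Xi>_inner(1)[OF y_N'[OF that], symmetric] lam_def pull_def by (simp add: field_simps m(1))
    show "pull B (0, y) = (y \<bullet> ?bj) / m" if "y \<in> ball 0 \<delta>" for y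
      unfolding \<Xi>_inner(2)[OF y_N'[OF that], symmetric] mu_def pull_def by (simp add: field_simps m(1))
    show "pull A (0, 0) = 1" by (simp add: pull_0 A0 m(1))
    fix v w
    show "dird ((v, w), 0) (pull A) (0, 0) * v\<^sup>2 + 2 * dird ((v, w), 0) (pull B) (0, 0) * v * w
        + dird ((v, w), 0) (pull C) (0, 0) * w\<^sup>2 = (a * v ^ 3 + b * v\<^sup>2 * w + a * v * w\<^sup>2 + c * w ^ 3) / m"
      using taylor(2)[of v w] cubic unfolding dird_pull[OF smooth_ABC(1)] dird_pull[OF smooth_ABC(2)] dird_pull[OF smooth_ABC(3)]
      by (simp add: field_simps m(1))
  qed
  interpret u: umbilic_family "pull A" "pull B" "pull C" m a b c \<delta> ?bi ?bj by (rule umb)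
  have "?f (p, \<Xi> y) = m * u.h (p, y)" if "p \<in> ball 0 \<delta>" "y \<in> ball 0 \<delta>" for p y
  proof -
    have "fst p = fst p \<and> (fst p, snd p) \<in> ball 0 \<delta>1" "\<Xi> y \<in> ball 0 \<delta>1"
      using inO(1)[OF that] ND(10)[OF y_N'[OF that(2)]] N(2) by auto
    with f[of "fst p" "snd p" "\<Xi> y"] show ?thesis unfolding u.h_def pull_def by (simp add: field_simps m(1))
  qed
  moreover have "ball 0 \<delta> \<subseteq> N'" using y_N' by blast
  ultimately show ?thesis using that[OF \<open>i \<noteq> j\<close> umb N(3,1) \<Theta>0] by blast
qed

section \<open>The singular locus of the bifurcation diagram\<close>

lemma Ck_on_sqrt: "Ck_on k {0<..} sqrt"
proof (induction k)
  case 0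
  then show ?case by (simp add: continuous_intros)
next
  case (Suc k)
  have d: "(sqrt has_derivative (\<lambda>v. (v / 2) * inverse (sqrt x))) (at x)" if "x > 0" for x
    using that by (auto intro!: derivative_eq_intros simp: field_simps)
  have "Ck_on k {0<..} (\<lambda>x. inverse (sqrt x))"
    by (rule Ck_on_compose[OF _ _ Suc Ck_on_inverse]) auto
  then have "Ck_on k {0<..} (\<lambda>x. (v / 2) * inverse (sqrt x))" for v :: real
    by (intro Ck_on_bilinear[OF _ bounded_bilinear_mult] Ck_on_const) auto
  moreover have "Ck_on k {0<..} (dird v sqrt) \<longleftrightarrow> Ck_on k {0<..} (\<lambda>x. (v / 2) * inverse (sqrt x))" for v
    by (rule Ck_on_cong) (use dirdI[OF d] in auto)
  ultimately have "Ck_on k {0<..} (dird v sqrt)" for v by blast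
  then show ?case unfolding Ck_on_Suc_dird using d differentiable_def by (metis greaterThan_iff)
qed

lemma smooth_on_sqrt [smooth_intros]:
  fixes f :: "'a::real_normed_vector \<Rightarrow> real"
  shows "open S \<Longrightarrow> smooth_on S f \<Longrightarrow> (\<And>x. x \<in> S \<Longrightarrow> f x > 0) \<Longrightarrow> smooth_on S (\<lambda>x. sqrt (f x))"
  by (rule smooth_on_compose[of "{0<..}" sqrt]) (auto intro: smooth_onI Ck_on_sqrt)

lemma closure_transfer:
  fixes f :: "'a::metric_space \<Rightarrow> 'b::metric_space"
  assumes "open W" "z \<in> W" "isCont f z" "\<And>w. w \<in> W \<Longrightarrow> w \<in> S \<Longrightarrow> f w \<in> T" "z \<in> closure S"
  shows "f z \<in> closure T"
proof (rule ccontr)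
  assume "f z \<notin> closure T"
  then have "\<forall>\<^sub>F w in nhds (f z). w \<in> - closure T" by (intro eventually_nhds_in_open) auto
  moreover have "filterlim f (nhds (f z)) (nhds z)" using assms(3) unfolding isCont_def by (rule tendsto_at_iff_tendsto_nhds[THEN iffD1])
  ultimately have "\<forall>\<^sub>F w in nhds z. f w \<in> - closure T" by (auto simp: filterlim_iff)
  then obtain U where U: "open U" "z \<in> U" "\<And>w. w \<in> U \<Longrightarrow> f w \<notin> closure T" unfolding eventually_nhds by auto
  have "(U \<inter> W) \<inter> S = {}"
    using U(3) assms(4) closure_subset[of T] by (blast dest: subsetD)
  then have "(U \<inter> W) \<inter> closure S = {}" using open_Int_closure_eq_empty[of "U \<inter> W" S] U(1) assms(1) by blast
  then show False using U(2) assms(2,5) by blast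
qed

text \<open>Uniqueness of the double zero turns the two pointwise criteria into an equivalence.\<close>

lemma (in vertex_family) smooth_iff_no_triple_zero:
  assumes "good \<rho>" "x \<in> E \<rho>"
  shows "smooth_submanifold_at (DIM('x) - 1) (E \<rho>) x \<longleftrightarrow> (\<nexists>t. Z3 x t)"
proof -
  have x: "x \<in> ball 0 \<rho>" "x \<bullet> bs \<noteq> 0" using assms(2) unfolding E_def by auto
  have xr: "x \<in> ball 0 r" using assms(1) x(1) unfolding good_def by auto
  obtain t where "Z2 x t" using assms(2) unfolding E_def by blast
  from Z2_reduce[OF xr this] obtain t0 where t0: "0 \<le> t0" "t0 \<le> 2 * pi" "Z2 x t0" by (metis less_imp_le)
  have "Z3 x t0" if "Z3 x t" for t
  proof -
    have "Z2 x t" using that unfolding Z3_def by blast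
    from Z2_unique[OF assms(1) x t0(3) this] obtain k :: int where "t = t0 + 2 * pi * of_int k" by blast
    then show ?thesis using that Z_2pi_int(2)[OF xr] by simp
  qed
  then have "(\<exists>t. Z3 x t) \<longleftrightarrow> D (D V) (x, t0) = 0" using t0(3) unfolding Z3_def by blast
  then show ?thesis
    using smooth_at_double_zero[OF assms t0(3,1,2)] not_smooth_at_triple_zero[OF assms _ t0(1,2)] t0(3)
    unfolding Z3_def by blast
qed

lemma (in vertex_family) good_mono: "good \<rho> \<Longrightarrow> 0 < \<rho>' \<Longrightarrow> \<rho>' \<le> \<rho> \<Longrightarrow> good \<rho>'"
  unfolding good_def by auto

text \<open>Degenerate vertices of the level curves, described through double zeros of \<open>V\<close> in the coordinates \<open>y = \<Theta> \<tau>\<close>,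
  \<open>s\<^sup>2 = k / m\<close>. The condition \<open>4 * s < \<delta>'\<close> ensures that the whole closed level curve lies in the disc of radius \<open>\<delta>'\<close>.\<close>

locale unfolded_diagram =
  vertex_family V a0 a1 a2 e r "(0, 1)" "(bi, 0)" "(bj, 0)"
  for V a0 a1 a2 :: "('y::euclidean_space \<times> real) \<times> real \<Rightarrow> real" and e r :: real and bi bj :: 'y +
  fixes f :: "(real \<times> real) \<times> 'y \<Rightarrow> real" and m \<delta> :: real and N N' :: "'y set" and \<Theta> \<Xi> :: "'y \<Rightarrow> 'y"
  assumes m: "m \<noteq> 0" and \<delta>: "\<delta> > 0" and r\<delta>: "r \<le> \<delta>"
    and \<Theta>: "diffeo N N' \<Theta> \<Xi>" "0 \<in> N" "\<Theta> 0 = 0" "ball 0 \<delta> \<subseteq> N'"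
    and no_vertex: "\<And>y k \<delta>' p. y \<in> ball 0 \<delta> \<Longrightarrow> \<delta>' \<le> \<delta> \<Longrightarrow> k \<le> 0 \<Longrightarrow> \<not> degenerate_vertex (level_curve f \<delta>' (\<Xi> y) (m * k)) p"
    and vertex_iff: "\<And>y s \<delta>'. (y, s) \<in> ball 0 r \<Longrightarrow> s > 0 \<Longrightarrow> 4 * s < \<delta>' \<Longrightarrow> \<delta>' \<le> \<delta> \<Longrightarrow>
      (\<exists>p. degenerate_vertex (level_curve f \<delta>' (\<Xi> y) (m * s\<^sup>2)) p) \<longleftrightarrow> (\<exists>t. V ((y, s), t) = 0 \<and> dird (0, 1) V ((y, s), t) = 0)"
begin

lemmas \<Theta>D = diffeoD[OF \<Theta>(1)]

text \<open>The real square root is an odd function here, so that this is a homeomorphism also across \<open>k = 0\<close>.\<close>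

definition to_xs :: "'y \<times> real \<Rightarrow> 'y \<times> real" where
  "to_xs z = (\<Theta> (fst z), sqrt (snd z / m))"

definition of_xs :: "'y \<times> real \<Rightarrow> 'y \<times> real" where
  "of_xs x = (\<Xi> (fst x), m * (sgn (snd x) * (snd x)\<^sup>2))"

definition region :: "real \<Rightarrow> ('y \<times> real) set" where
  "region \<rho> = {z. fst z \<in> N \<and> to_xs z \<in> ball 0 \<rho>}"

abbreviation diagram :: "real \<Rightarrow> ('y \<times> real) set" where
  "diagram \<delta>' \<equiv> bifurcation_diagram f \<delta>'"

lemma to_xs_of_xs: "fst x \<in> N' \<Longrightarrow> to_xs (of_xs x) = x"
proof -
  have "sqrt (sgn s * s\<^sup>2) = s" for s :: real
    by (cases "s < 0") (auto simp: sgn_if real_sqrt_minus)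
  then show "fst x \<in> N' \<Longrightarrow> to_xs (of_xs x) = x" using m by (simp add: to_xs_def of_xs_def \<Theta>D)
qed

lemma of_xs_to_xs: "fst z \<in> N \<Longrightarrow> of_xs (to_xs z) = z"
proof -
  have "sgn (sqrt s) * (sqrt s)\<^sup>2 = s" for s :: real
    by (cases "s < 0") (auto simp: sgn_if real_sqrt_power[symmetric] power2_eq_square)
  then show "fst z \<in> N \<Longrightarrow> of_xs (to_xs z) = z" using m by (simp add: to_xs_def of_xs_def \<Theta>D)
qed

lemma of_xs_in_region:
  assumes "x \<in> ball 0 \<rho>" "\<rho> \<le> \<delta>"
  shows "fst x \<in> N'" "of_xs x \<in> region \<rho>"
proof -
  have "norm (fst x) \<le> norm x" by (metis norm_fst_le prod.collapse)
  then have "fst x \<in> ball 0 \<delta>" using assms by simp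
  then show "fst x \<in> N'" using \<Theta>(4) by blast
  then show "of_xs x \<in> region \<rho>" unfolding region_def using to_xs_of_xs[of x] assms(1) \<Theta>D(10) by (simp add: of_xs_def)
qed

lemma continuous_to_xs: "continuous_on (N \<times> UNIV) to_xs"
  unfolding to_xs_def[abs_def] using m
  by (intro continuous_intros continuous_on_compose2[OF smooth_on_continuous[OF \<Theta>D(3)]]) auto

lemma isCont_of_xs:
  assumes "fst x \<in> N'"
  shows "isCont of_xs x"
proof -
  have "sgn s * s\<^sup>2 = s * \<bar>s\<bar>" for s :: real by (simp add: sgn_if power2_eq_square)
  then have e: "of_xs = (\<lambda>x. (\<Xi> (fst x), m * (snd x * \<bar>snd x\<bar>)))" unfolding of_xs_def[abs_def] by simp
  have "continuous_on (N' \<times> UNIV) of_xs"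
    unfolding e by (intro continuous_intros continuous_on_compose2[OF smooth_on_continuous[OF \<Theta>D(4)]]) auto
  moreover have "open (N' \<times> (UNIV :: real set))" by (intro open_Times \<Theta>D(2) open_UNIV)
  ultimately show ?thesis using assms by (cases x) (simp add: continuous_on_eq_continuous_at)
qed

lemma open_region: "open (region \<rho>)"
proof -
  have "region \<rho> = (N \<times> UNIV) \<inter> to_xs -` ball 0 \<rho>" unfolding region_def by (auto simp: mem_Times_iff)
  then show ?thesis using continuous_open_preimage[OF continuous_to_xs _ open_ball] \<Theta>D(1) by (simp add: open_Times)
qed

lemma isCont_to_xs: "fst z \<in> N \<Longrightarrow> isCont to_xs z"
  using continuous_to_xs \<Theta>D(1) by (cases z) (simp add: continuous_on_eq_continuous_at open_Times)

lemma degenerate_iff: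
  assumes \<rho>: "good \<rho>" "4 * \<rho> \<le> \<delta>'" "\<delta>' \<le> \<delta>" and z: "z \<in> region \<rho>"
  shows "(\<exists>p. degenerate_vertex (level_curve f \<delta>' (fst z) (snd z)) p) \<longleftrightarrow> to_xs z \<in> E \<rho>"
proof -
  obtain \<tau> k where zk: "z = (\<tau>, k)" by (cases z)
  let ?s = "sqrt (k / m)"
  have \<tau>: "\<tau> \<in> N" "\<Xi> (\<Theta> \<tau>) = \<tau>" and x: "(\<Theta> \<tau>, ?s) \<in> ball 0 \<rho>"
    using z \<Theta>D(7) unfolding region_def to_xs_def zk by auto
  have xr: "(\<Theta> \<tau>, ?s) \<in> ball 0 r" using x \<rho>(1) unfolding good_def by auto
  have "norm (\<Theta> \<tau>) \<le> norm (\<Theta> \<tau>, ?s)" by (rule norm_fst_le)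
  then have y: "\<Theta> \<tau> \<in> ball 0 \<delta>" using xr r\<delta> by simp
  show ?thesis
  proof (cases "k / m \<le> 0")
    case True
    have "m * (k / m) = k" using m by simp
    then have "\<not> degenerate_vertex (level_curve f \<delta>' \<tau> k) p" for p
      using no_vertex[OF y \<rho>(3) True, of p] \<tau>(2) by simp
    moreover have "to_xs z \<notin> E \<rho>" using True unfolding to_xs_def E_def zk by (auto simp: real_sqrt_le_0_iff not_less)
    ultimately show ?thesis unfolding zk by simp
  next
    case False
    then have s: "?s > 0" "m * ?s\<^sup>2 = k" using m by (simp_all del: real_sqrt_divide add: real_sqrt_pow2)
    have "?s \<le> norm (\<Theta> \<tau>, ?s)" using norm_snd_le[of ?s "\<Theta> \<tau>"] by simp
    then have "4 * ?s < \<delta>'" using x \<rho>(2) by (simp del: real_sqrt_divide)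
    from vertex_iff[OF xr s(1) this \<rho>(3)] show ?thesis
      using s x \<tau>(2) unfolding to_xs_def E_def zk Z2_def by (simp del: real_sqrt_divide)
  qed
qed

text \<open>The change of coordinates is only a homeomorphism at \<open>s = 0\<close>, which is enough to transport closures.\<close>

lemma diagram_iff:
  assumes \<rho>: "good \<rho>" "4 * \<rho> \<le> \<delta>'" "\<delta>' \<le> \<delta>" and z: "z \<in> region \<rho>"
  shows "z \<in> diagram \<delta>' \<longleftrightarrow> to_xs z \<in> closure (E \<rho>)"
proof -
  let ?S = "{(\<tau>, k). \<exists>p. degenerate_vertex (level_curve f \<delta>' \<tau> k) p}"
  have S: "w \<in> ?S \<longleftrightarrow> to_xs w \<in> E \<rho>" if "w \<in> region \<rho>" for w
    using degenerate_iff[OF \<rho> that] by (cases w) simp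
  have \<rho>': "\<rho> \<le> \<delta>" "to_xs z \<in> ball 0 \<rho>" using \<rho>(1) r\<delta> z unfolding good_def region_def by auto
  have zN: "fst z \<in> N" using z unfolding region_def by blast
  show ?thesis
  proof
    assume "z \<in> diagram \<delta>'"
    then have "z \<in> closure ?S" unfolding bifurcation_diagram_def .
    with open_region z isCont_to_xs[OF zN] S show "to_xs z \<in> closure (E \<rho>)"
      by (intro closure_transfer[of "region \<rho>" z to_xs ?S]) blast+
  next
    assume z': "to_xs z \<in> closure (E \<rho>)"
    have "of_xs (to_xs z) \<in> closure ?S"
    proof (rule closure_transfer[OF open_ball \<rho>'(2) isCont_of_xs _ z'])
      show "fst (to_xs z) \<in> N'" by (rule of_xs_in_region[OF \<rho>'(2,1)])
      show "of_xs w \<in> ?S" if "w \<in> ball 0 \<rho>" "w \<in> E \<rho>" for w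
        using S[OF of_xs_in_region(2)[OF that(1) \<rho>'(1)]] to_xs_of_xs[OF of_xs_in_region(1)[OF that(1) \<rho>'(1)]] that(2) by simp
    qed
    then show "z \<in> diagram \<delta>'" unfolding bifurcation_diagram_def of_xs_to_xs[OF zN] .
  qed
qed

lemma E_eq_closure:
  assumes "good \<rho>" "x \<in> ball 0 \<rho>" "snd x > 0"
  shows "x \<in> closure (E \<rho>) \<longleftrightarrow> x \<in> E \<rho>"
proof
  assume "x \<in> closure (E \<rho>)"
  from closure_E[OF assms(1,2) this] show "x \<in> E \<rho>" using assms(2,3) unfolding E_def by (simp add: inner_prod_def)
qed (rule subsetD[OF closure_subset])

text \<open>The double zeros stay in a cone around the \<open>s\<close>-axis, which meets \<open>s = 0\<close> in \<open>\<lambda> = \<mu> = 0\<close> only.\<close>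

lemma closure_E_boundary:
  assumes "good \<rho>" "x \<in> ball 0 \<rho>" "x \<in> closure (E \<rho>)"
  shows "snd x \<ge> 0" "snd x = 0 \<Longrightarrow> fst x \<bullet> bi = 0 \<and> fst x \<bullet> bj = 0"
proof -
  have "closed {x :: 'y \<times> real. snd x \<ge> 0}" by (intro closed_Collect_le continuous_intros)
  moreover have "E \<rho> \<subseteq> {x. snd x \<ge> 0}" unfolding E_def by (auto simp: inner_prod_def)
  ultimately have "closure (E \<rho>) \<subseteq> {x. snd x \<ge> 0}" by (rule closure_minimal[rotated])
  then show "snd x \<ge> 0" using assms(3) by blast
  show "snd x = 0 \<Longrightarrow> fst x \<bullet> bi = 0 \<and> fst x \<bullet> bj = 0"
    using closure_E[OF assms] Z2_bound[OF assms(1,2)] by (auto simp: inner_prod_def)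
qed

text \<open>For \<open>s > 0\<close> the change of coordinates is a diffeomorphism and preserves smooth points.\<close>

lemma singular_iff:
  assumes \<rho>: "good \<rho>" "4 * \<rho> \<le> \<delta>'" "\<delta>' \<le> \<delta>" and z: "z \<in> region \<rho>" "snd (to_xs z) > 0"
  shows "z \<in> singular_locus (diagram \<delta>') \<longleftrightarrow> (\<exists>t. Z3 (to_xs z) t)"
proof -
  define P where "P = region \<rho> \<inter> {z. snd z / m > 0}"
  define Q where "Q = ball (0 :: 'y \<times> real) \<rho> \<inter> {x. snd x > 0}"
  have "open {z :: 'y \<times> real. snd z / m > 0}" using m by (intro open_Collect_less continuous_intros) auto
  then have P: "open P" unfolding P_def by (intro open_Int open_region)
  have "open {x :: 'y \<times> real. snd x > 0}" by (intro open_Collect_less continuous_intros)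
  then have Q: "open Q" unfolding Q_def by (intro open_Int open_ball)
  have \<rho>': "\<rho> \<le> \<delta>" using \<rho>(1) r\<delta> unfolding good_def by auto
  have PN: "fst w \<in> N" if "w \<in> P" for w using that unfolding P_def region_def by blast
  have QN: "fst x \<in> N'" if "x \<in> Q" for x using that of_xs_in_region(1)[OF _ \<rho>'] unfolding Q_def by blast
  have D: "diffeo P Q to_xs of_xs"
  proof (rule diffeoI[OF P Q])
    have "smooth_on P (\<lambda>z. \<Theta> (fst z))"
      by (rule smooth_on_compose[OF \<Theta>D(3) P \<Theta>D(1) smooth_on_fst[OF P smooth_on_id] PN])
    moreover have "smooth_on P (\<lambda>z. sqrt (snd z / m))"
      using m by (intro smooth_intros P) (auto simp: P_def)
    ultimately show "smooth_on P to_xs" unfolding to_xs_def[abs_def] by (rule smooth_on_Pair[OF P])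
    have "smooth_on Q (\<lambda>x. \<Xi> (fst x))"
      by (rule smooth_on_compose[OF \<Theta>D(4) Q \<Theta>D(2) smooth_on_fst[OF Q smooth_on_id] QN])
    moreover have "smooth_on Q (\<lambda>x. m * (snd x)\<^sup>2)" by (intro smooth_intros Q)
    ultimately have "smooth_on Q (\<lambda>x. (\<Xi> (fst x), m * (snd x)\<^sup>2))" by (rule smooth_on_Pair[OF Q])
    then show "smooth_on Q of_xs" by (rule smooth_on_cong[OF Q, rotated]) (simp add: of_xs_def Q_def)
    show "of_xs (to_xs z) = z" if "z \<in> P" for z using of_xs_to_xs[OF PN[OF that]] .
    show "to_xs (of_xs x) = x" if "x \<in> Q" for x using to_xs_of_xs[OF QN[OF that]] .
    show "to_xs z \<in> Q" if "z \<in> P" for z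
      using that unfolding P_def Q_def region_def to_xs_def by (auto simp del: real_sqrt_divide)
    show "of_xs x \<in> P" if "x \<in> Q" for x
      using that of_xs_in_region(2)[OF _ \<rho>', of x] m unfolding P_def Q_def by (auto simp: of_xs_def)
  qed
  note DD = diffeoD[OF D]
  have mem: "w \<in> diagram \<delta>' \<longleftrightarrow> to_xs w \<in> E \<rho>" if "w \<in> P" for w
    using diagram_iff[OF \<rho>, of w] E_eq_closure[OF \<rho>(1), of "to_xs w"] DD(9)[OF that] that
    unfolding P_def Q_def by blast
  have EQ: "E \<rho> \<subseteq> Q" unfolding E_def Q_def by (auto simp: inner_prod_def)
  have im: "to_xs ` (diagram \<delta>' \<inter> P) = E \<rho>" "of_xs ` (E \<rho> \<inter> Q) = diagram \<delta>' \<inter> P"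
  proof -
    show "to_xs ` (diagram \<delta>' \<inter> P) = E \<rho>"
    proof
      show "to_xs ` (diagram \<delta>' \<inter> P) \<subseteq> E \<rho>" using mem by blast
      show "E \<rho> \<subseteq> to_xs ` (diagram \<delta>' \<inter> P)"
      proof
        fix x assume x: "x \<in> E \<rho>"
        then have "x \<in> Q" using EQ by blast
        then have "of_xs x \<in> P" "to_xs (of_xs x) = x" using DD(8,10) by blast+
        then show "x \<in> to_xs ` (diagram \<delta>' \<inter> P)" using mem[of "of_xs x"] x by (metis IntI imageI)
      qed
    qed
    then have "of_xs ` (E \<rho> \<inter> Q) = (\<lambda>w. of_xs (to_xs w)) ` (diagram \<delta>' \<inter> P)"
      using EQ by (simp add: Int_absorb2 image_image[symmetric])
    also have "\<dots> = (\<lambda>w. w) ` (diagram \<delta>' \<inter> P)" by (rule image_cong) (simp_all add: DD(7))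
    finally show "of_xs ` (E \<rho> \<inter> Q) = diagram \<delta>' \<inter> P" by simp
  qed
  have zP: "z \<in> P"
    using z unfolding P_def to_xs_def by (simp del: real_sqrt_divide)
  have "smooth_submanifold_at (DIM('y \<times> real) - 1) (diagram \<delta>') z \<longleftrightarrow> smooth_submanifold_at (DIM('y \<times> real) - 1) (E \<rho>) (to_xs z)"
  proof
    assume "smooth_submanifold_at (DIM('y \<times> real) - 1) (diagram \<delta>') z"
    from smooth_submanifold_at_diffeo[OF this D zP]
    show "smooth_submanifold_at (DIM('y \<times> real) - 1) (E \<rho>) (to_xs z)" unfolding im(1) .
  next
    assume "smooth_submanifold_at (DIM('y \<times> real) - 1) (E \<rho>) (to_xs z)"
    from smooth_submanifold_at_diffeo[OF this diffeo_sym[OF D] DD(9)[OF zP]]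
    have "smooth_submanifold_at (DIM('y \<times> real) - 1) (diagram \<delta>' \<inter> P) z" unfolding im(2) DD(7)[OF zP] .
    then show "smooth_submanifold_at (DIM('y \<times> real) - 1) (diagram \<delta>') z"
      by (rule smooth_submanifold_at_cong[OF P zP, rotated]) blast
  qed
  then have "z \<in> singular_locus (diagram \<delta>') \<longleftrightarrow> to_xs z \<in> E \<rho> \<and> (\<exists>t. Z3 (to_xs z) t)"
    unfolding singular_locus_def using mem[OF zP] smooth_iff_no_triple_zero[OF \<rho>(1)] by blast
  moreover have "to_xs z \<in> E \<rho>" if "Z3 (to_xs z) t" for t
    using that z unfolding E_def Z3_def region_def by (auto simp: inner_prod_def)
  ultimately show ?thesis by blast
qed

end

section \<open>The discriminant\<close>

lemma hypo_cusps:
  "hypo1 e (pi / 6) = 3 / 4 * e" "hypo2 e (pi / 6) = 3 / 4 * sqrt 3 * e"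
  "hypo1 e (pi / 2) = 3 / 2 * e" "hypo2 e (pi / 2) = 0"
  "hypo1 e (5 * pi / 6) = 3 / 4 * e" "hypo2 e (5 * pi / 6) = - (3 / 4 * sqrt 3 * e)"
proof -
  have a: "3 * (pi / 6) = pi / 2" "2 * (pi / 6) = pi / 3" "3 * (pi / 2) = pi / 2 + pi" "2 * (pi / 2) = pi"
    "3 * (5 * pi / 6) = pi / 2 + 2 * pi" "2 * (5 * pi / 6) = 2 * pi - pi / 3" by simp_all
  note t = sin_periodic cos_periodic sin_periodic_pi cos_periodic_pi sin_2pi_minus cos_2pi_minus
    sin_pi_half cos_pi_half sin_pi cos_pi sin_60 cos_60
  show "hypo1 e (pi / 6) = 3 / 4 * e" "hypo2 e (pi / 6) = 3 / 4 * sqrt 3 * e"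
    "hypo1 e (pi / 2) = 3 / 2 * e" "hypo2 e (pi / 2) = 0"
    "hypo1 e (5 * pi / 6) = 3 / 4 * e" "hypo2 e (5 * pi / 6) = - (3 / 4 * sqrt 3 * e)"
    unfolding hypo1_def hypo2_def a t by simp_all
qed

context unfolded_diagram
begin

lemma basis_y: "bi \<in> Basis" "bj \<in> Basis" "bi \<noteq> bj"
  using basis unfolding Basis_prod_def by (auto simp: nonzero_Basis)

text \<open>The initial directions of the three sheets are the cusps of the hypocycloid at the angles \<open>\<pi>/6\<close>, \<open>\<pi>/2\<close> and
  \<open>5\<pi>/6\<close>; no two of them are proportional, and the other three cusps are opposite to these.\<close>

lemma ex_sheets:
  obtains \<rho> c1 c2 c3 where "three_sheets bi bj c1 c2 c3 \<rho>"
    "\<And>y s. (y, s) \<in> ball 0 \<rho> \<Longrightarrow> s \<noteq> 0 \<Longrightarrow> (\<exists>t. Z3 (y, s) t) \<longleftrightarrow>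
      (\<exists>\<sigma>\<in>{s, -s}. \<exists>c\<in>{c1, c2, c3}. y = three_sheets.sheet c (three_sheets.\<nu> bi bj y, \<sigma>))"
proof (rule Z3_param)
  fix \<rho> :: real and P1 P2
  assume P: "\<rho> > 0"
    "\<And>t. t \<in> {pi / 6, pi / 2, 5 * pi / 6} \<Longrightarrow> smooth_on (ball 0 \<rho>) (P1 t) \<and> smooth_on (ball 0 \<rho>) (P2 t) \<and>
       P1 t 0 = hypo1 e t \<and> P2 t 0 = hypo2 e t"
    and Z3: "\<And>x. x \<in> ball 0 \<rho> \<Longrightarrow> x \<bullet> (0, 1) \<noteq> 0 \<Longrightarrow> (\<exists>t. Z3 x t) \<longleftrightarrow>
       (\<exists>t\<in>{pi / 6, pi / 2, 5 * pi / 6}. on_edge (P1 t) (P2 t) x \<or> on_edge (P1 t) (P2 t) (flip x))"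
  define c where "c t x = P1 t x *\<^sub>R bi + P2 t x *\<^sub>R bj" for t x
  have inner: "bi \<bullet> bi = 1" "bj \<bullet> bj = 1" "bi \<bullet> bj = 0" "bj \<bullet> bi = 0"
    using basis_y by (auto simp: inner_Basis)
  have c_inner: "c t x \<bullet> bi = P1 t x" "c t x \<bullet> bj = P2 t x" for t x
    unfolding c_def by (simp_all add: inner inner_add_left)
  let ?c1 = "c (pi / 6)" and ?c2 = "c (pi / 2)" and ?c3 = "c (5 * pi / 6)"
  have c0: "?c1 0 \<bullet> bi = 3 / 4 * e" "?c1 0 \<bullet> bj = 3 / 4 * sqrt 3 * e" "?c2 0 \<bullet> bi = 3 / 2 * e" "?c2 0 \<bullet> bj = 0"
    "?c3 0 \<bullet> bi = 3 / 4 * e" "?c3 0 \<bullet> bj = - (3 / 4 * sqrt 3 * e)"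
    unfolding c_inner using P(2) hypo_cusps by simp_all
  have three: "three_sheets bi bj ?c1 ?c2 ?c3 \<rho>"
  proof
    show "bi \<in> Basis" "bj \<in> Basis" "bi \<noteq> bj" by (rule basis_y)+
    show "\<rho> > 0" by (rule P)
    have "smooth_on (ball 0 \<rho>) (c t)" if "t \<in> {pi / 6, pi / 2, 5 * pi / 6}" for t
      unfolding c_def[abs_def] using P(2)[OF that] by (intro smooth_intros) auto
    then show "smooth_on (ball 0 \<rho>) ?c1" "smooth_on (ball 0 \<rho>) ?c2" "smooth_on (ball 0 \<rho>) ?c3" by blast+
    show "c t x = (c t x \<bullet> bi) *\<^sub>R bi + (c t x \<bullet> bj) *\<^sub>R bj" for t x unfolding c_inner by (simp add: c_def)
    show "c t x = (c t x \<bullet> bi) *\<^sub>R bi + (c t x \<bullet> bj) *\<^sub>R bj" for t x unfolding c_inner by (simp add: c_def)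
    show "c t x = (c t x \<bullet> bi) *\<^sub>R bi + (c t x \<bullet> bj) *\<^sub>R bj" for t x unfolding c_inner by (simp add: c_def)
    show "\<alpha> = 0 \<and> \<beta> = 0" if "\<alpha> *\<^sub>R ?c1 0 + \<beta> *\<^sub>R ?c2 0 = 0" for \<alpha> \<beta>
    proof -
      from arg_cong[OF that, of "\<lambda>v. v \<bullet> bj"] have "\<alpha> = 0" using e by (simp add: inner_add_left c0)
      with arg_cong[OF that, of "\<lambda>v. v \<bullet> bi"] show ?thesis using e by (simp add: inner_add_left c0)
    qed
    show "?c3 0 \<noteq> \<alpha> *\<^sub>R ?c1 0" for \<alpha>
    proof
      assume "?c3 0 = \<alpha> *\<^sub>R ?c1 0"
      from arg_cong[OF this, of "\<lambda>v. v \<bullet> bi"] arg_cong[OF this, of "\<lambda>v. v \<bullet> bj"] e show False by (simp add: c0)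
    qed
    show "?c3 0 \<noteq> \<alpha> *\<^sub>R ?c2 0" for \<alpha>
    proof
      assume "?c3 0 = \<alpha> *\<^sub>R ?c2 0"
      from arg_cong[OF this, of "\<lambda>v. v \<bullet> bj"] e show False by (simp add: c0)
    qed
  qed
  interpret sh: three_sheets bi bj ?c1 ?c2 ?c3 \<rho> by (rule three)
  have edge: "on_edge (P1 t) (P2 t) (y, s) \<longleftrightarrow> y = sh.sheet (c t) (sh.\<nu> y, s)" for t y s
  proof -
    have st: "strip (y, s) = (sh.\<nu> y, s)"
      unfolding strip_def sh.\<nu>_def by (simp add: prod_eq_iff)
    have "y = sh.sheet (c t) (sh.\<nu> y, s) \<longleftrightarrow> y \<bullet> bi = s * P1 t (sh.\<nu> y, s) \<and> y \<bullet> bj = s * P2 t (sh.\<nu> y, s)"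
    proof
      assume "y = sh.sheet (c t) (sh.\<nu> y, s)"
      from arg_cong[OF this, of "\<lambda>v. v \<bullet> bi"] arg_cong[OF this, of "\<lambda>v. v \<bullet> bj"]
      show "y \<bullet> bi = s * P1 t (sh.\<nu> y, s) \<and> y \<bullet> bj = s * P2 t (sh.\<nu> y, s)"
        unfolding sh.sheet_def by (simp add: inner_add_left c_inner)
    next
      assume "y \<bullet> bi = s * P1 t (sh.\<nu> y, s) \<and> y \<bullet> bj = s * P2 t (sh.\<nu> y, s)"
      then have "sh.sheet (c t) (sh.\<nu> y, s) = sh.\<nu> y + (y \<bullet> bi) *\<^sub>R bi + (y \<bullet> bj) *\<^sub>R bj"
        unfolding sh.sheet_def by (simp add: c_def scaleR_add_right add.assoc)
      then show "y = sh.sheet (c t) (sh.\<nu> y, s)" using sh.nu_decompose[of y] by metis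
    qed
    then show ?thesis unfolding on_edge_def st by (simp add: inner_prod_def)
  qed
  show thesis
  proof (rule that[OF three])
    fix y :: 'y and s :: real assume ys: "(y, s) \<in> ball 0 \<rho>" "s \<noteq> 0"
    have "flip (y, s) = (y, - s)" unfolding flip_def by simp
    then show "(\<exists>t. Z3 (y, s) t) \<longleftrightarrow>
      (\<exists>\<sigma>\<in>{s, -s}. \<exists>c\<in>{?c1, ?c2, ?c3}. y = sh.sheet c (sh.\<nu> y, \<sigma>))"
      using Z3[OF ys(1)] ys(2) edge by (auto simp: inner_prod_def)
  qed
qed

text \<open>For a parameter on a sheet, the value \<open>s\<close> is bounded by a multiple of the distance from the origin, since the
  sheets have nonzero initial direction. Hence the singular points over small parameters are themselves small, and the germ of
  the projection depends neither on \<open>\<delta>\<close> nor on \<open>\<epsilon>\<close>.\<close>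

theorem ex_discriminant:
  obtains D N'' M'' \<eta> \<omega> where "discriminant_germ f D" "diffeo N'' M'' \<eta> \<omega>" "0 \<in> N''" "\<eta> 0 = 0"
    "\<And>\<tau>. \<tau> \<in> N'' \<Longrightarrow> \<tau> \<in> D \<longleftrightarrow> \<eta> \<tau> \<bullet> bj = 0 \<or> \<eta> \<tau> \<bullet> bi = 0 \<or> \<eta> \<tau> \<bullet> bi = \<eta> \<tau> \<bullet> bj"
proof (rule ex_sheets)
  fix \<rho>1 c1 c2 c3
  assume three: "three_sheets bi bj c1 c2 c3 \<rho>1"
    and Z3: "\<And>y s. (y, s) \<in> ball 0 \<rho>1 \<Longrightarrow> s \<noteq> 0 \<Longrightarrow> (\<exists>t. Z3 (y, s) t) \<longleftrightarrow>
      (\<exists>\<sigma>\<in>{s, -s}. \<exists>c\<in>{c1, c2, c3}. y = three_sheets.sheet c (three_sheets.\<nu> bi bj y, \<sigma>))"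
  interpret sh: three_sheets bi bj c1 c2 c3 \<rho>1 by (rule three)
  let ?C = "{c1, c2, c3}"
  have c0: "c 0 \<noteq> 0" if "c \<in> ?C" for c
    using that sh.independent(1)[of 1 0] sh.independent(1)[of 0 1] sh.independent(2)[of 0] by auto
  have smooth_c: "smooth_on (ball 0 \<rho>1) c" if "c \<in> ?C" for c using that sh.smooth by blast
  define \<kappa> where "\<kappa> = min (norm (c1 0)) (min (norm (c2 0)) (norm (c3 0))) / 2"
  have \<kappa>: "\<kappa> > 0" unfolding \<kappa>_def using c0 by simp
  have \<kappa>_less: "\<kappa> < norm (c 0)" if "c \<in> ?C" for c
  proof -
    have "2 * \<kappa> \<le> norm (c 0)" using that unfolding \<kappa>_def by auto
    then show ?thesis using \<kappa> by simp
  qed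
  have "\<forall>\<^sub>F x in nhds 0. norm (c x) > \<kappa>" if "c \<in> ?C" for c
  proof -
    have "isCont (\<lambda>x. norm (c x)) 0"
      using smooth_on_isCont[OF smooth_c[OF that] open_ball] sh.\<rho> by (intro isCont_norm) simp
    then have "((\<lambda>x. norm (c x)) \<longlongrightarrow> norm (c 0)) (nhds 0)" unfolding isCont_def by (rule tendsto_at_iff_tendsto_nhds[THEN iffD1])
    then show ?thesis by (rule order_tendstoD(1)) (rule \<kappa>_less[OF that])
  qed
  then have "\<forall>\<^sub>F x in nhds 0. norm (c1 x) > \<kappa> \<and> norm (c2 x) > \<kappa> \<and> norm (c3 x) > \<kappa>" by (simp add: eventually_conj_iff)
  then obtain \<eta>1 where \<eta>1: "\<eta>1 > 0" "\<And>x c. x \<in> ball 0 \<eta>1 \<Longrightarrow> c \<in> ?C \<Longrightarrow> norm (c x) > \<kappa>"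
    unfolding eventually_nhds_metric by (auto simp: dist_commute)
  have "\<eta>1 / 2 > 0" using \<eta>1(1) by simp
  then show thesis
  proof (rule sh.ex_straightening)
    fix M M' \<Phi> \<Psi> \<eta>
    assume \<eta>: "0 < \<eta>" "\<eta> \<le> \<eta>1 / 2" and \<Phi>: "diffeo M M' \<Phi> \<Psi>" "0 \<in> M" "M \<subseteq> ball 0 \<eta>" "\<Phi> 0 = 0"
      and planes: "\<And>y. y \<in> M \<Longrightarrow>
        (\<exists>s. \<bar>s\<bar> < \<eta> \<and> y \<in> {sh.sheet c1 (sh.\<nu> y, s), sh.sheet c2 (sh.\<nu> y, s), sh.sheet c3 (sh.\<nu> y, s)}) \<longleftrightarrow>
          \<Phi> y \<bullet> bj = 0 \<or> \<Phi> y \<bullet> bi = 0 \<or> \<Phi> y \<bullet> bi = \<Phi> y \<bullet> bj"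
    define on where "on y s \<longleftrightarrow> (\<exists>c\<in>?C. y = sh.sheet c (sh.\<nu> y, s))" for y s
    have on_0: "on y 0 \<longleftrightarrow> y \<bullet> bi = 0 \<and> y \<bullet> bj = 0" for y
    proof -
      have "on y 0 \<longleftrightarrow> y = sh.\<nu> y" unfolding on_def sh.sheet_def by auto
      also have "\<dots> \<longleftrightarrow> y \<bullet> bi = 0 \<and> y \<bullet> bj = 0"
        using sh.nu_inner[of y] by (metis add.right_neutral scale_zero_left sh.nu_decompose)
      finally show ?thesis .
    qed
    have on_bound: "\<bar>s\<bar> * \<kappa> \<le> 2 * norm y" if ys: "y \<in> M" "\<bar>s\<bar> < \<eta>" "on y s" for y s
    proof -
      obtain c where c: "c \<in> ?C" "y = sh.sheet c (sh.\<nu> y, s)" using ys(3) unfolding on_def by blast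
      have "norm y < \<eta>" using ys(1) \<Phi>(3) by auto
      then have "norm (sh.\<nu> y, s) < \<eta>1"
        using norm_Pair_le[of "sh.\<nu> y" s] sh.norm_nu[of y] ys(2) \<eta>(2) by simp
      then have "\<kappa> \<le> norm (c (sh.\<nu> y, s))" using \<eta>1(2)[OF _ c(1), of "(sh.\<nu> y, s)"] by simp
      then have "\<bar>s\<bar> * \<kappa> \<le> norm (s *\<^sub>R c (sh.\<nu> y, s))" by (simp add: mult_left_mono)
      also have "s *\<^sub>R c (sh.\<nu> y, s) = y - sh.\<nu> y"
        using c(2) unfolding sh.sheet_def by (simp add: algebra_simps)
      also have "norm (y - sh.\<nu> y) \<le> norm y + norm (sh.\<nu> y)" by (rule norm_triangle_ineq4)
      also have "\<dots> \<le> 2 * norm y" using sh.norm_nu[of y] by simp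
      finally show ?thesis .
    qed
    \<comment> \<open>the sheets are taken with both signs of \<open>s\<close>, since a cusp point at \<open>s\<close> may lie on a sheet at \<open>- s\<close>\<close>
    define D where "D = {\<tau> \<in> N. \<Theta> \<tau> \<in> M \<and> (\<exists>s. \<bar>s\<bar> < \<eta> \<and> on (\<Theta> \<tau>) s)}"
    define N'' where "N'' = N \<inter> \<Theta> -` M"
    have "diffeo N'' (M' \<inter> \<Psi> -` N') (\<lambda>\<tau>. \<Phi> (\<Theta> \<tau>)) (\<lambda>z. \<Xi> (\<Psi> z))"
    proof -
      have "diffeo N'' (N' \<inter> M) \<Theta> \<Xi>"
        using diffeo_sym[OF diffeo_restrict[OF diffeo_sym[OF \<Theta>(1)] diffeoD(1)[OF \<Phi>(1)]]] unfolding N''_def .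
      moreover have "diffeo (N' \<inter> M) (M' \<inter> \<Psi> -` N') \<Phi> \<Psi>"
        using diffeo_restrict[OF \<Phi>(1) \<Theta>D(2)] by (simp add: Int_commute)
      ultimately show ?thesis by (rule diffeo_compose)
    qed
    moreover have "0 \<in> N''" unfolding N''_def using \<Theta>(2,3) \<Phi>(2) by simp
    moreover have "\<Phi> (\<Theta> 0) = 0" using \<Theta>(3) \<Phi>(4) by simp
    moreover have "\<tau> \<in> D \<longleftrightarrow> \<Phi> (\<Theta> \<tau>) \<bullet> bj = 0 \<or> \<Phi> (\<Theta> \<tau>) \<bullet> bi = 0 \<or> \<Phi> (\<Theta> \<tau>) \<bullet> bi = \<Phi> (\<Theta> \<tau>) \<bullet> bj" if "\<tau> \<in> N''" for \<tau>
      using that planes[of "\<Theta> \<tau>"] unfolding D_def N''_def on_def by auto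
    moreover have "discriminant_germ f D"
    proof -
      obtain \<rho>0 where \<rho>0: "good \<rho>0" using ex_good by blast
      have germ: "germ_eq_at 0 D (fst ` (singular_locus (diagram \<delta>') \<inter> ball (0, 0) \<epsilon>))"
        if \<delta>': "0 < \<delta>'" "\<delta>' < \<delta>" and \<rho>: "\<rho> = min (min \<rho>0 (\<delta>' / 4)) (min \<rho>1 \<eta>)"
          and \<epsilon>: "\<epsilon> > 0" "ball (0, 0) \<epsilon> \<subseteq> region \<rho>" for \<delta>' \<rho> \<epsilon>
      proof -
        have \<rho>_pos: "\<rho> > 0" using \<rho> \<delta>' \<eta>(1) sh.\<rho> \<rho>0 unfolding good_def by auto
        have \<rho>_le: "\<rho> \<le> \<rho>0" "4 * \<rho> \<le> \<delta>'" "\<rho> \<le> \<rho>1" "\<rho> \<le> \<eta>" "\<delta>' \<le> \<delta>" using \<rho> \<delta>' by auto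
        have good: "good \<rho>" using good_mono[OF \<rho>0 \<rho>_pos \<rho>_le(1)] .
        have \<rho>\<delta>: "\<rho> \<le> \<delta>" using \<rho>_le(2,5) \<rho>_pos by simp
        note sing = singular_iff[OF good \<rho>_le(2,5)]
        have triple: "of_xs (y, s) \<in> singular_locus (diagram \<delta>')"
          if x: "(y, s) \<in> ball 0 \<rho>" "s > 0" and on: "on y s \<or> on y (- s)" for y s
        proof -
          have "(y, s) \<in> ball 0 \<rho>1" using x(1) \<rho>_le(3) by auto
          from Z3[OF this] x(2) on have "\<exists>t. Z3 (y, s) t" unfolding on_def by auto
          moreover note of_xs_in_region[OF x(1) \<rho>\<delta>]
          ultimately show ?thesis using sing[of "of_xs (y, s)"] to_xs_of_xs[of "(y, s)"] x(2) by simp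
        qed
        \<comment> \<open>points of the first sheet with \<open>s\<close> tending to \<open>0\<close> from the right are cusp points converging to this one\<close>
        have limit: "of_xs (y, 0) \<in> singular_locus (diagram \<delta>')"
          if x: "(y, 0 :: real) \<in> ball 0 \<rho>" and on: "on y 0" for y
        proof -
          have ny: "sh.\<nu> y = y" using on unfolding on_def sh.sheet_def by auto
          define x where "x s = (sh.sheet c1 (y, s), s)" for s
          have on_x: "on (fst (x s)) s" for s
            unfolding on_def x_def by (auto simp: sh.sheet_def sh.nu_add sh.nu_scaleR ny)
          have x0: "x 0 = (y, 0)" unfolding x_def sh.sheet_def by simp
          have "isCont c1 (y, 0)"
            using smooth_on_isCont[OF sh.smooth(1) open_ball] subsetD[OF subset_ball[OF \<rho>_le(3)] x(1)] by blast
          then have "isCont (\<lambda>s. c1 (y, s)) 0"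
            by (intro isCont_o2[where f = "\<lambda>s. (y, s)" and g = c1]) (auto intro!: continuous_intros)
          then have contx: "isCont x 0" unfolding x_def[abs_def] sh.sheet_def by (auto intro!: continuous_intros)
          have "isCont of_xs (y, 0)" using isCont_of_xs[OF of_xs_in_region(1)[OF x(1) \<rho>\<delta>]] .
          then have "isCont of_xs (x 0)" unfolding x0 .
          from isContD[OF isCont_o2[OF contx this]] have "((\<lambda>s. of_xs (x s)) \<longlongrightarrow> of_xs (y, 0)) (at 0)" unfolding x0 .
          then have lim: "((\<lambda>s. of_xs (x s)) \<longlongrightarrow> of_xs (y, 0)) (at_right 0)"
            by (rule tendsto_mono[OF at_le[OF subset_UNIV]])
          have "(x \<longlongrightarrow> (y, 0)) (at 0)" using isContD[OF contx] unfolding x0 .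
          then have "(x \<longlongrightarrow> (y, 0)) (at_right 0)" by (rule tendsto_mono[OF at_le[OF subset_UNIV]])
          from topological_tendstoD[OF this open_ball x(1)]
          have "\<forall>\<^sub>F s in at_right 0. x s \<in> ball 0 \<rho>" .
          moreover have "\<forall>\<^sub>F s in at_right (0::real). s > 0" by (rule eventually_at_right_less)
          ultimately have ev: "\<forall>\<^sub>F s in at_right 0. of_xs (x s) \<in> singular_locus (diagram \<delta>')"
          proof eventually_elim
            case (elim s)
            have "x s = (fst (x s), s)" unfolding x_def by simp
            then have "(fst (x s), s) \<in> ball 0 \<rho>" using elim(1) by argo
            from triple[OF this elim(2)] on_x[of s] \<open>x s = (fst (x s), s)\<close> show ?case by argo
          qed
          then have "\<forall>\<^sub>F s in at_right 0. of_xs (x s) \<in> diagram \<delta>'"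
            by eventually_elim (simp add: singular_locus_def)
          moreover have "closed (diagram \<delta>')" unfolding bifurcation_diagram_def by (rule closed_closure)
          ultimately have "of_xs (y, 0) \<in> diagram \<delta>'"
            using Lim_in_closed_set[OF _ _ trivial_limit_at_right_real lim] by blast
          moreover have False if smooth: "smooth_submanifold_at (DIM('y \<times> real) - 1) (diagram \<delta>') (of_xs (y, 0))"
          proof -
            obtain U where U: "open U" "of_xs (y, 0) \<in> U"
              "\<And>q. q \<in> diagram \<delta>' \<inter> U \<Longrightarrow> smooth_submanifold_at (DIM('y \<times> real) - 1) (diagram \<delta>') q"
              using smooth_submanifold_at_nearby[OF smooth] by metis
            have "\<forall>\<^sub>F s in at_right 0. of_xs (x s) \<in> U" by (rule topological_tendstoD[OF lim U(1,2)])
            with ev have "\<forall>\<^sub>F s in at_right (0::real). False"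
              by eventually_elim (use U(3) in \<open>unfold singular_locus_def, blast\<close>)
            then show False by (simp add: trivial_limit_at_right_real)
          qed
          ultimately show ?thesis unfolding singular_locus_def by blast
        qed
        have project: "\<tau> \<in> D" if z: "(\<tau>, k) \<in> singular_locus (diagram \<delta>')" "(\<tau>, k) \<in> ball (0, 0) \<epsilon>" and \<tau>: "\<tau> \<in> N''" for \<tau> k
        proof -
          let ?z = "(\<tau>, k)"
          obtain y s where ys: "to_xs ?z = (y, s)" by (cases "to_xs ?z")
          have y: "y = \<Theta> \<tau>" using ys unfolding to_xs_def by simp
          have zr: "?z \<in> region \<rho>" using z(2) \<epsilon>(2) by blast
          then have x: "(y, s) \<in> ball 0 \<rho>" using ys unfolding region_def by simp
          then have "\<bar>s\<bar> < \<rho>" using norm_snd_le[of s y] by simp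
          then have s: "\<bar>s\<bar> < \<eta>" using \<rho>_le(4) by simp
          have cl: "(y, s) \<in> closure (E \<rho>)"
            using z(1) diagram_iff[OF good \<rho>_le(2,5) zr] ys unfolding singular_locus_def by simp
          have "\<exists>\<sigma>\<in>{s, - s}. on y \<sigma>"
          proof (cases "s = 0")
            case True
            then show ?thesis using closure_E_boundary(2)[OF good x cl] on_0 by simp
          next
            case False
            then have s0: "s > 0" using closure_E_boundary(1)[OF good x cl] by simp
            have "\<exists>t. Z3 (y, s) t" using sing[OF zr] z(1) ys s0 by simp
            moreover have "(y, s) \<in> ball 0 \<rho>1" using x \<rho>_le(3) by auto
            ultimately show ?thesis using Z3[of y s] False unfolding on_def by blast
          qed
          then obtain \<sigma> where \<sigma>: "\<sigma> \<in> {s, - s}" "on y \<sigma>" by blast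
          then have "\<bar>\<sigma>\<bar> < \<eta>" using s by auto
          then show ?thesis using \<sigma>(2) \<tau> unfolding D_def N''_def y by blast
        qed
        have lifts: "\<tau> \<in> fst ` (singular_locus (diagram \<delta>') \<inter> ball (0, 0) \<epsilon>)"
          if \<tau>: "\<tau> \<in> D" and small: "norm \<tau> < \<epsilon> / 2" "norm (\<Theta> \<tau>) * (1 + 2 / \<kappa>) < \<rho>" "\<bar>m\<bar> * (2 / \<kappa> * norm (\<Theta> \<tau>))\<^sup>2 < \<epsilon> / 2" for \<tau>
        proof -
          let ?y = "\<Theta> \<tau>"
          obtain s where s: "\<bar>s\<bar> < \<eta>" "on ?y s" and \<tau>N: "\<tau> \<in> N" "?y \<in> M" using \<tau> unfolding D_def by blast
          have sb: "\<bar>s\<bar> \<le> 2 / \<kappa> * norm ?y" using on_bound[OF \<tau>N(2) s] \<kappa> by (simp add: field_simps)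
          have "norm (?y, \<bar>s\<bar>) \<le> norm ?y + \<bar>s\<bar>" using norm_Pair_le[of ?y "\<bar>s\<bar>"] by simp
          also have "\<dots> \<le> norm ?y * (1 + 2 / \<kappa>)" using sb by (simp add: algebra_simps)
          finally have x: "(?y, \<bar>s\<bar>) \<in> ball 0 \<rho>" using small(2) by simp
          have "of_xs (?y, \<bar>s\<bar>) \<in> singular_locus (diagram \<delta>')"
          proof (cases "s = 0")
            case True
            then show ?thesis using limit[of ?y] x s(2) by simp
          next
            case False
            then show ?thesis using triple[OF x] s(2) by (cases "s > 0") simp_all
          qed
          moreover have o: "of_xs (?y, \<bar>s\<bar>) = (\<tau>, m * s\<^sup>2)" using \<tau>N \<Theta>D(7) by (simp add: of_xs_def sgn_if)
          moreover have "(\<tau>, m * s\<^sup>2) \<in> ball (0, 0) \<epsilon>"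
          proof -
            have "s\<^sup>2 \<le> (2 / \<kappa> * norm ?y)\<^sup>2" using sb by (metis abs_ge_zero power2_abs power_mono)
            then have "\<bar>m\<bar> * s\<^sup>2 \<le> \<bar>m\<bar> * (2 / \<kappa> * norm ?y)\<^sup>2" by (intro mult_left_mono) auto
            then have "norm (m * s\<^sup>2) < \<epsilon> / 2" using small(3) by (simp add: abs_mult)
            then have "norm (\<tau>, m * s\<^sup>2) < \<epsilon>" using norm_Pair_le[of \<tau> "m * s\<^sup>2"] small(1) by simp
            then show ?thesis by (simp add: zero_prod_def[symmetric])
          qed
          ultimately show ?thesis by force
        qed
        have ct: "isCont \<Theta> 0" by (rule smooth_on_isCont[OF \<Theta>D(3,1) \<Theta>(2)])
        have ev: "\<forall>\<^sub>F \<tau> in nhds 0. g \<tau> < q" if "isCont g 0" "g 0 < (q::real)" for g :: "'y \<Rightarrow> real" and q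
          using that order_tendstoD(2)[OF tendsto_at_iff_tendsto_nhds[THEN iffD1], of g 0 q] by (simp add: isCont_def)
        have "\<forall>\<^sub>F \<tau> in nhds (0 :: 'y). norm \<tau> < \<epsilon> / 2"
          by (rule ev) (use \<epsilon> in auto)
        moreover have "\<forall>\<^sub>F \<tau> in nhds 0. norm (\<Theta> \<tau>) * (1 + 2 / \<kappa>) < \<rho>"
          by (rule ev) (use ct \<kappa> \<rho>_pos \<Theta>(3) in \<open>auto intro!: continuous_intros\<close>)
        moreover have "\<forall>\<^sub>F \<tau> in nhds 0. \<bar>m\<bar> * (2 / \<kappa> * norm (\<Theta> \<tau>))\<^sup>2 < \<epsilon> / 2"
          by (rule ev) (use ct \<kappa> \<epsilon>(1) \<Theta>(3) in \<open>auto intro!: continuous_intros\<close>)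
        moreover have "open N''" unfolding N''_def
          by (rule continuous_open_preimage[OF smooth_on_continuous[OF \<Theta>D(3)] \<Theta>D(1) diffeoD(1)[OF \<Phi>(1)]])
        then have "\<forall>\<^sub>F \<tau> in nhds 0. \<tau> \<in> N''"
          using \<Theta>(2,3) \<Phi>(2) by (intro eventually_nhds_in_open) (auto simp: N''_def)
        ultimately show ?thesis unfolding germ_eq_at_def
          by eventually_elim (use project lifts in force)
      qed
      have "\<forall>\<^sub>F \<epsilon> in at_right 0. germ_eq_at 0 D (fst ` (singular_locus (diagram \<delta>') \<inter> ball (0, 0) \<epsilon>))"
        if \<delta>': "0 < \<delta>'" "\<delta>' < \<delta>" for \<delta>'
      proof -
        let ?\<rho> = "min (min \<rho>0 (\<delta>' / 4)) (min \<rho>1 \<eta>)"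
        have "?\<rho> > 0" using \<delta>' \<eta>(1) sh.\<rho> \<rho>0 unfolding good_def by auto
        then have "(0, 0) \<in> region ?\<rho>" unfolding region_def to_xs_def using \<Theta>(2,3) by (simp add: zero_prod_def[symmetric])
        then obtain \<epsilon>0 where \<epsilon>0: "\<epsilon>0 > 0" "ball (0, 0) \<epsilon>0 \<subseteq> region ?\<rho>" using open_region[of ?\<rho>] open_contains_ball by blast
        show ?thesis
        proof (rule eventually_at_rightI[OF _ \<epsilon>0(1)])
          fix \<epsilon> assume "\<epsilon> \<in> {0<..<\<epsilon>0}"
          moreover from this have "ball (0, 0) \<epsilon> \<subseteq> region ?\<rho>" using \<epsilon>0(2) by (meson greaterThanLessThan_iff less_imp_le order_trans subset_ball)
          ultimately show "germ_eq_at 0 D (fst ` (singular_locus (diagram \<delta>') \<inter> ball (0, 0) \<epsilon>))"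
            by (intro germ[OF \<delta>' refl]) auto
        qed
      qed
      note small = this
      show ?thesis unfolding discriminant_germ_def
      proof (rule eventually_at_rightI[OF _ \<delta>])
        fix \<delta>' assume "\<delta>' \<in> {0<..<\<delta>}"
        then have "0 < \<delta>'" "\<delta>' < \<delta>" by simp_all
        then show "\<forall>\<^sub>F \<epsilon> in at_right 0. germ_eq_at 0 D (fst ` (singular_locus (diagram \<delta>') \<inter> ball (0, 0) \<epsilon>))"
          by (rule small)
      qed
    qed
    ultimately show thesis using that[of D N'' "M' \<inter> \<Psi> -` N'" "\<lambda>\<tau>. \<Phi> (\<Theta> \<tau>)" "\<lambda>z. \<Xi> (\<Psi> z)"] by blast
  qed
qed

end

section \<open>Three lines and the theorem\<close>

text \<open>A smooth curve inside a line through the origin has its velocity in the line, by linearity of the equation.\<close>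

lemma plane_line:
  fixes p q :: real
  assumes "(p, q) \<noteq> (0, 0)"
  defines "S \<equiv> {(l, m). m * p = q * l}"
  shows "smooth_submanifold_at 1 S (0, 0)" "tangent_space S (0, 0) = S"
proof -
  have S: "S = span {(p, q)}"
  proof
    show "S \<subseteq> span {(p, q)}"
    proof
      fix z assume "z \<in> S"
      then obtain l m where z: "z = (l, m)" "m * p = q * l" by (auto simp: S_def)
      have "z = (if p = 0 then m / q else l / p) *\<^sub>R (p, q)"
        using z assms(1) by (auto simp: field_simps)
      then show "z \<in> span {(p, q)}" by (metis span_base span_scale insertI1)
    qed
    show "span {(p, q)} \<subseteq> S" by (rule span_minimal) (auto simp: S_def subspace_def zero_prod_def algebra_simps)
  qed
  have sub: "subspace S" unfolding S by simp
  have dim: "dim S = 1" unfolding S using assms(1) by (simp add: dim_insert zero_prod_def)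
  show "smooth_submanifold_at 1 S (0, 0)"
  proof (rule smooth_submanifold_atI)
    show "diffeo UNIV UNIV (\<lambda>x. x) (\<lambda>x :: real \<times> real. x)" by (rule diffeoI) (auto intro: smooth_intros)
  qed (use sub dim in \<open>auto simp: S_def\<close>)
  show "tangent_space S (0, 0) = S"
  proof
    show "tangent_space S (0, 0) \<subseteq> S"
    proof
      fix v assume "v \<in> tangent_space S (0, 0)"
      then obtain \<gamma> e where \<gamma>: "e > 0" "\<gamma> ` {-e<..<e} \<subseteq> S" "(\<gamma> has_vector_derivative v) (at (0 :: real))"
        unfolding tangent_space_def by blast
      let ?L = "\<lambda>z :: real \<times> real. snd z * p - q * fst z"
      have bl: "bounded_linear ?L" by (intro bounded_linear_intros)
      have "((\<lambda>t. ?L (\<gamma> t)) has_vector_derivative ?L v) (at 0)"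
        by (rule bounded_linear.has_vector_derivative[OF bl \<gamma>(3)])
      moreover have "((\<lambda>t. ?L (\<gamma> t)) has_vector_derivative 0) (at 0)"
        by (rule has_vector_derivative_transform_within_open[of "\<lambda>t. 0" _ _ "{-e<..<e}"]) (use \<gamma>(1,2) in \<open>force simp: S_def\<close>)+
      ultimately have "?L v = 0" by (rule vector_derivative_unique_at)
      then show "v \<in> S" by (auto simp: S_def case_prod_beta)
    qed
    show "S \<subseteq> tangent_space S (0, 0)"
    proof
      fix v assume v: "v \<in> S"
      have "smooth_on {- 1<..<1} (\<lambda>t :: real. t *\<^sub>R v)" by (intro smooth_intros) auto
      moreover have "(\<lambda>t :: real. t *\<^sub>R v) ` {- 1<..<1} \<subseteq> S" using v sub by (auto intro: subspace_scale)
      moreover have "((\<lambda>t :: real. t *\<^sub>R v) has_vector_derivative v) (at 0)"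
        by (auto intro!: derivative_eq_intros)
      ultimately show "v \<in> tangent_space S (0, 0)" unfolding tangent_space_def
        by (intro CollectI exI[of _ "\<lambda>t. t *\<^sub>R v"] exI[of _ 1]) (simp add: zero_prod_def)
    qed
  qed
qed

lemma plane_lines_transverse:
  fixes p q p' q' :: real
  assumes "p * q' \<noteq> p' * q"
  shows "transverse_at {(l, m). m * p = q * l} {(l, m). m * p' = q' * l} (0, 0)"
proof -
  have nz: "(p, q) \<noteq> (0, 0)" "(p', q') \<noteq> (0, 0)" using assms by auto
  have "\<exists>u v. (l, m) = u + v \<and> u \<in> {(l, m). m * p = q * l} \<and> v \<in> {(l, m). m * p' = q' * l}" for l m
  proof (intro exI conjI)
    let ?d = "p * q' - p' * q"
    have d: "?d \<noteq> 0" using assms by simp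
    show "(l, m) = ((l * q' - m * p') / ?d) *\<^sub>R (p, q) + ((m * p - l * q) / ?d) *\<^sub>R (p', q')"
      using d by (simp add: divide_simps) algebra
  qed (auto simp: algebra_simps)
  then show ?thesis unfolding transverse_at_def plane_line(2)[OF nz(1)] plane_line(2)[OF nz(2)] by (force simp: set_eq_iff)
qed

text \<open>This linear map sends \<open>z\<^sub>j = 0\<close>, \<open>z\<^sub>i = 0\<close> and \<open>z\<^sub>i = z\<^sub>j\<close> to the lines \<open>\<mu> = 0\<close>, \<open>\<mu> = \<surd>3 \<lambda>\<close> and
  \<open>\<mu> = - \<surd>3 \<lambda>\<close>.\<close>

lemma diffeo_to_lines:
  fixes bi bj :: "'y::euclidean_space"
  assumes "bi \<in> Basis" "bj \<in> Basis" "bi \<noteq> bj"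
  obtains T T' where "diffeo UNIV UNIV T T'" "T 0 = 0"
    "\<And>z. T z \<bullet> bi = z \<bullet> bj - 2 * (z \<bullet> bi)" "\<And>z. T z \<bullet> bj = sqrt 3 * (z \<bullet> bj)"
proof -
  have inner: "bi \<bullet> bi = 1" "bj \<bullet> bj = 1" "bi \<bullet> bj = 0" "bj \<bullet> bi = 0" using assms by (auto simp: inner_Basis)
  \<comment> \<open>\<open>put w l m\<close> is \<open>w\<close> with its coordinates along \<open>bi\<close> and \<open>bj\<close> replaced by \<open>l\<close> and \<open>m\<close>\<close>
  define put where "put w l m = w + (l - w \<bullet> bi) *\<^sub>R bi + (m - w \<bullet> bj) *\<^sub>R bj" for w l m
  have put: "put w l m \<bullet> bi = l" "put w l m \<bullet> bj = m" "put (put w l m) l' m' = put w l' m'"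
    "put w (w \<bullet> bi) (w \<bullet> bj) = w" for w l m l' m'
    unfolding put_def by (simp_all add: inner_add_left inner algebra_simps)
  define T where "T z = put z (z \<bullet> bj - 2 * (z \<bullet> bi)) (sqrt 3 * (z \<bullet> bj))" for z
  define T' where "T' w = put w ((w \<bullet> bj / sqrt 3 - w \<bullet> bi) / 2) (w \<bullet> bj / sqrt 3)" for w
  have "diffeo UNIV UNIV T T'"
  proof (rule diffeoI)
    show "smooth_on UNIV T" "smooth_on UNIV T'"
      unfolding T_def[abs_def] T'_def[abs_def] put_def by (intro smooth_intros open_UNIV; simp)+
    show "T' (T z) = z" for z unfolding T'_def T_def put by (simp add: put)
    have "w \<bullet> bj / sqrt 3 - 2 * ((w \<bullet> bj / sqrt 3 - w \<bullet> bi) / 2) = w \<bullet> bi" for w by (simp add: field_simps)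
    then show "T (T' w) = w" for w unfolding T'_def T_def put by (simp add: put)
  qed auto
  then show ?thesis by (rule that) (simp_all add: T_def put(1,2), simp add: put_def)
qed

theorem theorem2:
  fixes f0 :: "real \<times> real \<Rightarrow> real"
    and R :: "(real \<times> real) \<times> (real ^ 'n::finite) \<Rightarrow> real"
    and a b c :: real
  assumes "surface_germ f0"
    and "generic_umbilic f0"
    and "\<forall>x y. taylor_part 3 f0 (x, y) = a * x^3 + b * x^2 * y + a * x * y^2 + c * y^3"
    and "CARD('n) \<ge> 2"
    and "deformation_term R"
    and "deformation_rank (deformed f0 R) = 2"
  shows "\<exists>D. discriminant_germ (deformed f0 R) D \<and>
    (\<exists>(i::'n) j S1 S2 S3. i \<noteq> j \<and>
       smooth_submanifold_at 1 S1 (0, 0) \<and>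
       smooth_submanifold_at 1 S2 (0, 0) \<and>
       smooth_submanifold_at 1 S3 (0, 0) \<and>
       tangent_space S1 (0, 0) = {(l, m). m = 0} \<and>
       tangent_space S2 (0, 0) = {(l, m). m = sqrt 3 * l} \<and>
       tangent_space S3 (0, 0) = {(l, m). m = - sqrt 3 * l} \<and>
       transverse_at S1 S2 (0, 0) \<and> transverse_at S1 S3 (0, 0) \<and> transverse_at S2 S3 (0, 0) \<and>
       germ_diffeomorphic_at_0 D (cylinder i j (S1 \<union> S2 \<union> S3)))"
proof (rule ex_umbilic_family[OF assms(1,2,3,5,6)])
  let ?f = "deformed f0 R"
  fix i j :: 'n and A B C m \<delta> N N' \<Theta> \<Xi>
  assume "i \<noteq> j" and umb: "umbilic_family A B C m a b c \<delta> (axis i 1 :: real ^ 'n) (axis j 1)"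
    and \<Theta>: "diffeo N N' \<Theta> \<Xi>" "0 \<in> N" "\<Theta> 0 = 0" "ball 0 \<delta> \<subseteq> N'"
    and f: "\<And>p y. p \<in> ball 0 \<delta> \<Longrightarrow> y \<in> ball 0 \<delta> \<Longrightarrow> ?f (p, \<Xi> y) = m * umbilic_family.h A B C (p, y)"
  let ?bi = "axis i 1 :: real ^ 'n" and ?bj = "axis j 1 :: real ^ 'n"
  interpret u: umbilic_family A B C m a b c \<delta> ?bi ?bj by (rule umb)
  have level: "level_curve ?f \<delta>' (\<Xi> y) (m * k) = {p \<in> ball 0 \<delta>'. u.h (p, y) = k}"
    if "y \<in> ball 0 \<delta>" "\<delta>' \<le> \<delta>" for y k \<delta>'
    unfolding level_curve_def using f that u.m by auto
  obtain V a0 a1 a2 r where V: "vertex_family V a0 a1 a2 (c - b) r (0, 1) (?bi, 0) (?bj, 0)" "r \<le> \<delta>"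
    and iff: "\<And>y s \<delta>'. (y, s) \<in> ball 0 r \<Longrightarrow> s > 0 \<Longrightarrow> 4 * s < \<delta>' \<Longrightarrow> \<delta>' \<le> \<delta> \<Longrightarrow>
      (\<exists>p. degenerate_vertex {p \<in> ball 0 \<delta>'. u.h (p, y) = s\<^sup>2} p) \<longleftrightarrow> (\<exists>t. V ((y, s), t) = 0 \<and> dird (0, 1) V ((y, s), t) = 0)"
    using u.ex_vertex_function by blast
  interpret d: unfolded_diagram V a0 a1 a2 "c - b" r ?bi ?bj ?f m \<delta> N N' \<Theta> \<Xi>
  proof (intro unfolded_diagram.intro V(1), unfold_locales)
    show "m \<noteq> 0" "\<delta> > 0" "r \<le> \<delta>" by (rule u.m u.\<delta> V(2))+
    show "diffeo N N' \<Theta> \<Xi>" "0 \<in> N" "\<Theta> 0 = 0" "ball 0 \<delta> \<subseteq> N'" by (rule \<Theta>)+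
    show "\<not> degenerate_vertex (level_curve ?f \<delta>' (\<Xi> y) (m * k)) p"
      if "y \<in> ball 0 \<delta>" "\<delta>' \<le> \<delta>" "k \<le> 0" for y k \<delta>' p
      unfolding level[OF that(1,2)] by (rule u.no_degenerate_vertex[OF that(2,1,3)])
    show "(\<exists>p. degenerate_vertex (level_curve ?f \<delta>' (\<Xi> y) (m * s\<^sup>2)) p) \<longleftrightarrow> (\<exists>t. V ((y, s), t) = 0 \<and> dird (0, 1) V ((y, s), t) = 0)"
      if s: "(y, s) \<in> ball 0 r" "s > 0" "4 * s < \<delta>'" "\<delta>' \<le> \<delta>" for y s \<delta>'
    proof -
      have "norm y \<le> norm (y, s)" by (rule norm_fst_le)
      then have y: "y \<in> ball 0 \<delta>" using s(1) V(2) by simp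
      show ?thesis unfolding level[OF y s(4)] by (rule iff[OF s])
    qed
  qed
  \<comment> \<open>straight lines suffice, because the diffeomorphism of parameters already straightens the sheets\<close>
  define S1 S2 S3 :: "(real \<times> real) set"
    where "S1 = {(l, m). m = 0}" and "S2 = {(l, m). m = sqrt 3 * l}" and "S3 = {(l, m). m = - sqrt 3 * l}"
  note S_def = S1_def S2_def S3_def
  have S: "S1 = {(l, m). m * 1 = 0 * l}" "S2 = {(l, m). m * 1 = sqrt 3 * l}" "S3 = {(l, m). m * 1 = - sqrt 3 * l}"
    unfolding S_def by simp_all
  have lines: "smooth_submanifold_at 1 S1 (0, 0)" "smooth_submanifold_at 1 S2 (0, 0)" "smooth_submanifold_at 1 S3 (0, 0)"
    "tangent_space S1 (0, 0) = S1" "tangent_space S2 (0, 0) = S2" "tangent_space S3 (0, 0) = S3"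
    unfolding S by (intro plane_line; simp)+
  have transverse: "transverse_at S1 S2 (0, 0)" "transverse_at S1 S3 (0, 0)" "transverse_at S2 S3 (0, 0)"
    unfolding S by (intro plane_lines_transverse; simp)+
  show ?thesis
  proof (rule d.ex_discriminant)
    fix D N'' M'' \<eta> \<omega>
    assume D: "discriminant_germ ?f D" and \<eta>: "diffeo N'' M'' \<eta> \<omega>" "0 \<in> N''" "\<eta> 0 = 0"
      and D_iff: "\<And>\<tau>. \<tau> \<in> N'' \<Longrightarrow> \<tau> \<in> D \<longleftrightarrow> \<eta> \<tau> \<bullet> ?bj = 0 \<or> \<eta> \<tau> \<bullet> ?bi = 0 \<or> \<eta> \<tau> \<bullet> ?bi = \<eta> \<tau> \<bullet> ?bj"
    obtain T T' where T: "diffeo UNIV UNIV T T'" "T 0 = 0"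
      "\<And>z. T z \<bullet> ?bi = z \<bullet> ?bj - 2 * (z \<bullet> ?bi)" "\<And>z. T z \<bullet> ?bj = sqrt 3 * (z \<bullet> ?bj)"
      using diffeo_to_lines[OF u.basis_ij] by blast
    have "diffeo M'' (T' -` M'') T T'" using diffeo_restrict[OF T(1) diffeoD(2)[OF \<eta>(1)]] by simp
    from diffeo_compose[OF \<eta>(1) this]
    have "diffeo N'' (T' -` M'') (\<lambda>\<tau>. T (\<eta> \<tau>)) (\<lambda>z. \<omega> (T' z))" .
    note E = this diffeoD[OF this]
    have "T z \<in> cylinder i j (S1 \<union> S2 \<union> S3) \<longleftrightarrow> z \<bullet> ?bj = 0 \<or> z \<bullet> ?bi = 0 \<or> z \<bullet> ?bi = z \<bullet> ?bj" for z
    proof -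
      have "T z \<in> cylinder i j (S1 \<union> S2 \<union> S3) \<longleftrightarrow>
        T z \<bullet> ?bj = 0 \<or> T z \<bullet> ?bj = sqrt 3 * (T z \<bullet> ?bi) \<or> T z \<bullet> ?bj = - sqrt 3 * (T z \<bullet> ?bi)"
        unfolding cylinder_def S_def by (auto simp: inner_axis)
      also have "\<dots> \<longleftrightarrow> sqrt 3 * (z \<bullet> ?bj) = 0 \<or> sqrt 3 * (z \<bullet> ?bj) = sqrt 3 * (z \<bullet> ?bj - 2 * (z \<bullet> ?bi)) \<or>
        sqrt 3 * (z \<bullet> ?bj) = sqrt 3 * (2 * (z \<bullet> ?bi) - z \<bullet> ?bj)"
        unfolding T(3,4) by (simp add: algebra_simps)
      also have "\<dots> \<longleftrightarrow> z \<bullet> ?bj = 0 \<or> z \<bullet> ?bi = 0 \<or> z \<bullet> ?bi = z \<bullet> ?bj"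
        unfolding mult_cancel_left by auto
      finally show ?thesis .
    qed
    then have "(\<lambda>\<tau>. T (\<eta> \<tau>)) ` (D \<inter> N'') = cylinder i j (S1 \<union> S2 \<union> S3) \<inter> (T' -` M'')"
      using D_iff E(6,8-11) by (auto simp: image_iff) (metis IntI)+
    then have "germ_diffeomorphic_at_0 D (cylinder i j (S1 \<union> S2 \<union> S3))"
      unfolding germ_diffeomorphic_at_0_def using E(1) \<eta>(2,3) T(2) by (metis (no_types, lifting))
    with D lines transverse \<open>i \<noteq> j\<close> show ?thesis unfolding S_def[symmetric] by blast
  qed
qed

end
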